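(* Fix $p\in(0,1/2]$. For integers $n,d\ge 2$ let $X_1,\dots,X_n$ be i.i.d. uniformly distributed on the unit sphere $\mathbb S^{d-1}\subset\mathbb R^d$, let $t_p=t_{p,d}$ be the threshold with $\mathbb P(\langle X_1,X_2\rangle\ge t_p)=p$, and let $$\mathcal E=\mathcal E(n,d,p)=\{\langle X_i,X_j\rangle\ge t_p\ \text{for all } 1\le i\ne j\le n\}$$ be the event that the spherical random geometric graph on $n$ vertices with edge probability $p$ is the complete graph. (1) (Lower bound) There exists a constant $C>0$ such that for all $n,d\ge2$, $$\mathbb P(\mathcal E)\ge\exp\left(-C\min\left(n^2,\,n\sqrt{d\log n},\,nd\right)\right).$$ (2) (Upper bound) There exist a constant $c>0$ and a sequence $\varepsilon_n\to0$ (as $n\to\infty$) such that for all $n,d\ge2$, $$\mathbb P(\mathcal E)\le\exp\left(-c\min\left(n^2,\,n\sqrt{d\log\left(\max\left(\frac{n^{1-\varepsilon_n}}{d^{3/4}},\,e\right)\right)},\,nd\right)\right).$$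
   Context: The spherical random geometric graph with parameters $n,p$ in dimension $d$ has vertex set $\{1,\dots,n\}$, and $i\neq j$ are joined by an edge iff $\langle X_i,X_j\rangle\ge t_p$, where $X_1,\dots,X_n$ are i.i.d. uniform on $\mathbb S^{d-1}$. Constants may depend on $p$ but not on $n$ and $d$; $\log$ is the natural logarithm. *)

theory Defs
  imports "HOL-Probability.Probability"
begin

text \<open>
  The dimension \<open>d\<close> is quantified inside the theorem (its constants must not depend on it), so
  \<open>\<real>\<^sup>d\<close> is modelled by the functions \<open>nat \<Rightarrow> real\<close> that are extensional on \<open>{..<d}\<close>, with
  Lebesgue measure \<open>\<Pi>\<^sub>M i\<in>{..<d}. lborel\<close> and Euclidean norm \<open>L2_set x {..<d}\<close>.
\<close>

definition vec_inner :: "nat \<Rightarrow> (nat \<Rightarrow> real) \<Rightarrow> (nat \<Rightarrow> real) \<Rightarrow> real" where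
  "vec_inner d x y = (\<Sum>k<d. x k * y k)"

definition vec_ball :: "nat \<Rightarrow> (nat \<Rightarrow> real) set" where
  "vec_ball d = {x \<in> {..<d} \<rightarrow>\<^sub>E UNIV. L2_set x {..<d} \<le> 1}"

definition vec_normalize :: "nat \<Rightarrow> (nat \<Rightarrow> real) \<Rightarrow> (nat \<Rightarrow> real)" where
  "vec_normalize d x = (\<lambda>k\<in>{..<d}. x k / L2_set x {..<d})"

text \<open>
  The uniform distribution on the unit sphere of \<open>\<real>\<^sup>d\<close>, as the normalised cone measure
  \<open>A \<mapsto> vol {r x | x \<in> A, 0 < r \<le> 1} / vol B\<close> (which is the normalised surface measure): the law
  of \<open>x / norm x\<close> for \<open>x\<close> uniform in the unit ball \<open>B\<close>.  It is a Borel measure on all of \<open>\<real>\<^sup>d\<close>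
  concentrated on the sphere; the origin, where the normalisation is meaningless, is a null set.
\<close>

definition uniform_sphere :: "nat \<Rightarrow> (nat \<Rightarrow> real) measure" where
  "uniform_sphere d =
     distr (uniform_measure (\<Pi>\<^sub>M k\<in>{..<d}. lborel) (vec_ball d))
           (\<Pi>\<^sub>M k\<in>{..<d}. borel) (vec_normalize d)"

text \<open>For \<open>d \<ge> 2\<close> and \<open>0 < p < 1\<close> there is exactly one such \<open>t\<close>.\<close>

definition is_threshold :: "nat \<Rightarrow> real \<Rightarrow> real \<Rightarrow> bool" where
  "is_threshold d p t \<longleftrightarrow>
     measure (uniform_sphere d \<Otimes>\<^sub>M uniform_sphere d)
       {(x, y) \<in> space (uniform_sphere d \<Otimes>\<^sub>M uniform_sphere d). vec_inner d x y \<ge> t} = p"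

text \<open>
  The i.i.d. points \<open>X\<^sub>1, \<dots>, X\<^sub>n\<close> are the coordinates of the product space.
\<close>

definition sphere_sample :: "nat \<Rightarrow> nat \<Rightarrow> (nat \<Rightarrow> nat \<Rightarrow> real) measure" where
  "sphere_sample n d = (\<Pi>\<^sub>M i\<in>{1..n}. uniform_sphere d)"

definition complete_event :: "nat \<Rightarrow> nat \<Rightarrow> real \<Rightarrow> (nat \<Rightarrow> nat \<Rightarrow> real) set" where
  "complete_event n d t =
     {X \<in> space (sphere_sample n d).
        \<forall>i\<in>{1..n}. \<forall>j\<in>{1..n}. i \<noteq> j \<longrightarrow> vec_inner d (X i) (X j) \<ge> t}"

lemma space_uniform_sphere: "space (uniform_sphere d) = {..<d} \<rightarrow>\<^sub>E UNIV"
  by (simp add: uniform_sphere_def space_PiM)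

lemma sets_uniform_sphere [measurable_cong]:
  "sets (uniform_sphere d) = sets (\<Pi>\<^sub>M k\<in>{..<d}. borel)"
  by (simp add: uniform_sphere_def)

lemma vec_inner_measurable [measurable]:
  assumes f: "f \<in> M \<rightarrow>\<^sub>M uniform_sphere d" and g: "g \<in> M \<rightarrow>\<^sub>M uniform_sphere d"
  shows "(\<lambda>w. vec_inner d (f w) (g w)) \<in> borel_measurable M"
proof -
  have "(\<lambda>w. f w k) \<in> borel_measurable M" "(\<lambda>w. g w k) \<in> borel_measurable M" if "k < d" for k
    using f g that measurable_component_singleton[of k "{..<d}" "\<lambda>_. borel"]
    by (auto intro!: measurable_compose[of _ M "\<Pi>\<^sub>M k\<in>{..<d}. borel" "\<lambda>x. x k"]
             simp: measurable_cong_sets[OF refl sets_uniform_sphere])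
  then show ?thesis
    unfolding vec_inner_def by (auto intro!: borel_measurable_sum borel_measurable_times)
qed

lemma sets_PiM_lborel: "sets (\<Pi>\<^sub>M k\<in>I. lborel) = sets (\<Pi>\<^sub>M k\<in>I. (borel :: real measure))"
  by (rule sets_PiM_cong) auto

lemma L2_set_measurable [measurable]:
  "(\<lambda>x. L2_set x {..<d}) \<in> borel_measurable (\<Pi>\<^sub>M k\<in>{..<d}. (lborel :: real measure))"
  unfolding L2_set_def by measurable

lemma vec_ball_sets [measurable]: "vec_ball d \<in> sets (\<Pi>\<^sub>M k\<in>{..<d}. lborel)"
proof -
  have "vec_ball d = {x \<in> space (\<Pi>\<^sub>M k\<in>{..<d}. lborel). L2_set x {..<d} \<le> 1}"
    by (auto simp: vec_ball_def space_PiM)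
  also have "\<dots> \<in> sets (\<Pi>\<^sub>M k\<in>{..<d}. lborel)" by measurable
  finally show ?thesis .
qed

lemma vec_normalize_measurable [measurable]:
  "vec_normalize d \<in> (\<Pi>\<^sub>M k\<in>{..<d}. lborel) \<rightarrow>\<^sub>M (\<Pi>\<^sub>M k\<in>{..<d}. borel)"
  unfolding vec_normalize_def[abs_def] by measurable

lemma prob_space_uniform_sphere:
  assumes "d \<ge> 1"
  shows "prob_space (uniform_sphere d)"
proof -
  let ?L = "\<Pi>\<^sub>M k\<in>{..<d}. (lborel :: real measure)"
  interpret product_sigma_finite "\<lambda>_::nat. lborel :: real measure"
    by unfold_locales
  let ?big = "{..<d} \<rightarrow>\<^sub>E {-1..1::real}" and ?small = "{..<d} \<rightarrow>\<^sub>E {0..1 / real d}"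
  have "vec_ball d \<subseteq> ?big"
  proof
    fix x assume x: "x \<in> vec_ball d"
    have *: "\<bar>x k\<bar> \<le> 1" if "k < d" for k
    proof -
      have "\<bar>x k\<bar> \<le> L2_set (\<lambda>k. \<bar>x k\<bar>) {..<d}" using that by (intro member_le_L2_set) auto
      also have "\<dots> \<le> 1" using x by (simp add: vec_ball_def L2_set_def)
      finally show ?thesis .
    qed
    have "-1 \<le> x k \<and> x k \<le> 1" if "k < d" for k using *[OF that] by linarith
    then show "x \<in> ?big" using x by (simp add: vec_ball_def PiE_iff)
  qed
  then have "emeasure ?L (vec_ball d) \<le> emeasure ?L ?big"
    by (intro emeasure_mono sets_PiM_I_finite) auto
  also have "\<dots> < \<infinity>" by (subst emeasure_PiM) (auto simp: power_less_top_ennreal)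
  finally have fin: "emeasure ?L (vec_ball d) \<noteq> \<infinity>" by simp
  have "?small \<subseteq> vec_ball d"
  proof
    fix x assume x: "x \<in> ?small"
    have b: "0 \<le> x k" "x k \<le> 1 / real d" if "k \<in> {..<d}" for k
      using PiE_mem[OF x that] unfolding atLeastAtMost_iff by blast+
    have "L2_set x {..<d} \<le> (\<Sum>k<d. x k)" using b(1) by (rule L2_set_le_sum)
    also have "\<dots> \<le> (\<Sum>k<d. 1 / real d)" using b(2) by (rule sum_mono)
    also have "\<dots> = 1" using assms by simp
    finally show "x \<in> vec_ball d"
      using x unfolding vec_ball_def PiE_iff by blast
  qed
  then have "emeasure ?L ?small \<le> emeasure ?L (vec_ball d)"
    by (intro emeasure_mono) auto
  moreover have "emeasure ?L ?small > 0"
    using assms by (subst emeasure_PiM) (auto simp: ennreal_power)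
  ultimately have pos: "emeasure ?L (vec_ball d) \<noteq> 0" by auto
  show ?thesis unfolding uniform_sphere_def
    by (intro prob_space.prob_space_distr prob_space_uniform_measure pos fin) simp
qed

lemma AE_uniform_sphere:
  assumes "d \<ge> 1"
  shows "AE x in uniform_sphere d. L2_set x {..<d} = 1"
proof -
  let ?L = "\<Pi>\<^sub>M k\<in>{..<d}. (lborel :: real measure)"
  interpret product_sigma_finite "\<lambda>_::nat. lborel :: real measure"
    by unfold_locales
  have zero: "emeasure ?L ({..<d} \<rightarrow>\<^sub>E {0}) = 0"
    using assms by (subst emeasure_PiM) auto
  have "({..<d} \<rightarrow>\<^sub>E {0}) \<in> sets ?L" by (intro sets_PiM_I_finite) auto
  with zero have "AE x in ?L. x \<notin> {..<d} \<rightarrow>\<^sub>E {0}"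
    by (intro AE_not_in null_setsI)
  then have *: "AE x in ?L. L2_set (vec_normalize d x) {..<d} = 1"
  proof (rule AE_mp, intro AE_I2 impI)
    fix x :: "nat \<Rightarrow> real" assume x: "x \<in> space ?L" "x \<notin> {..<d} \<rightarrow>\<^sub>E {0}"
    have "L2_set x {..<d} \<noteq> 0"
    proof
      assume "L2_set x {..<d} = 0"
      then have "\<forall>k<d. x k = 0" by (simp add: L2_set_eq_0_iff)
      then have "x \<in> {..<d} \<rightarrow>\<^sub>E {0}"
        using x(1) by (intro PiE_I) (auto simp: space_PiM PiE_def extensional_def)
      with x(2) show False by contradiction
    qed
    then have pos: "L2_set x {..<d} > 0" using L2_set_nonneg[of x "{..<d}"] by linarith
    have "L2_set (vec_normalize d x) {..<d} = L2_set (\<lambda>k. (1 / L2_set x {..<d}) * x k) {..<d}"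
      by (intro L2_set_cong) (auto simp: vec_normalize_def)
    also have "\<dots> = (1 / L2_set x {..<d}) * L2_set x {..<d}"
      using pos by (subst L2_set_right_distrib) auto
    finally show "L2_set (vec_normalize d x) {..<d} = 1" using pos by simp
  qed
  have "AE x in uniform_measure ?L (vec_ball d). L2_set (vec_normalize d x) {..<d} = 1"
    by (rule AE_uniform_measureI) (use * in auto)
  moreover have "{x \<in> space (\<Pi>\<^sub>M k\<in>{..<d}. borel). L2_set x {..<d} = 1}
      \<in> sets (\<Pi>\<^sub>M k\<in>{..<d}. (borel :: real measure))"
    unfolding L2_set_def by measurable
  ultimately show ?thesis
    unfolding uniform_sphere_def by (subst AE_distr_iff) auto
qed

text \<open>
  Any i.i.d. uniform points on any probability space give the same probability as
  \<open>sphere_sample\<close>, so fixing the canonical space loses no generality.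
\<close>

lemma complete_event_prob_iid:
  fixes X :: "nat \<Rightarrow> 'a \<Rightarrow> nat \<Rightarrow> real"
  assumes M: "prob_space M" and n: "n \<ge> 1"
    and indep: "prob_space.indep_vars M (\<lambda>_. uniform_sphere d) X {1..n}"
    and law: "\<And>i. i \<in> {1..n} \<Longrightarrow> distr M (uniform_sphere d) (X i) = uniform_sphere d"
  shows "measure M {w \<in> space M. \<forall>i\<in>{1..n}. \<forall>j\<in>{1..n}. i \<noteq> j \<longrightarrow> vec_inner d (X i w) (X j w) \<ge> t}
       = measure (sphere_sample n d) (complete_event n d t)"
proof -
  interpret prob_space M by fact
  have rv: "X i \<in> M \<rightarrow>\<^sub>M uniform_sphere d" if "i \<in> {1..n}" for i
    using indep that by (auto simp: indep_vars_def)
  have "distr M (\<Pi>\<^sub>M i\<in>{1..n}. uniform_sphere d) (\<lambda>w. \<lambda>i\<in>{1..n}. X i w)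
      = (\<Pi>\<^sub>M i\<in>{1..n}. distr M (uniform_sphere d) (X i))"
    using indep_vars_iff_distr_eq_PiM'[of "{1..n}" X "\<lambda>_. uniform_sphere d"] indep rv n by auto
  also have "\<dots> = sphere_sample n d"
    unfolding sphere_sample_def by (intro PiM_cong law refl)
  finally have eq: "sphere_sample n d
      = distr M (\<Pi>\<^sub>M i\<in>{1..n}. uniform_sphere d) (\<lambda>w. \<lambda>i\<in>{1..n}. X i w)" ..
  have meas: "(\<lambda>w. \<lambda>i\<in>{1..n}. X i w) \<in> M \<rightarrow>\<^sub>M (\<Pi>\<^sub>M i\<in>{1..n}. uniform_sphere d)"
    using rv by (intro measurable_restrict)
  have ev: "complete_event n d t \<in> sets (\<Pi>\<^sub>M i\<in>{1..n}. uniform_sphere d)"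
    unfolding complete_event_def sphere_sample_def by measurable
  show ?thesis
    by (subst eq, subst measure_distr[OF meas ev], rule arg_cong[where f = "measure M"])
       (use measurable_space[OF meas] in \<open>auto simp: complete_event_def sphere_sample_def\<close>)
qed

end

theory Submission imports Defs begin

text \<open>
  The points are replaced by independent standard Gaussian vectors, normalised at the end.

  Upper bound. Since \<open>p \<le> 1/2\<close>, up to a null event one may take \<open>t \<ge> 0\<close>, so that all inner products are nonnegative; split the points into
  two halves \<open>X\<^sub>i\<close>, \<open>Y\<^sub>j\<close>. Put on each pair \<open>(i, j)\<close> the density of a Gaussian pair with correlation \<open>-\<rho>\<close> relative to
  an independent pair. Typically the weighted sum of the inner products \<open>\<langle>X\<^sub>i, Y\<^sub>j\<rangle>\<close> is about
  \<open>- k\<^sup>2 \<rho> d\<close>, where \<open>k\<close> is the size of the halves, while the weights have row and column sums of order \<open>k\<close>. A configuration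
  with nonnegative inner products is therefore at Euclidean distance at least some \<open>s\<close> from the typical set, and
  Gaussian concentration bounds its probability by \<open>2 exp (- s\<^sup>2 / 4)\<close>. The bound follows with \<open>\<rho> = 1 / sqrt d\<close> or
  \<open>\<rho>\<^sup>2\<close> of order \<open>min 1 (ln n / d)\<close>; the sequence \<open>\<epsilon>\<close> can be taken to be \<open>0\<close>.

  Lower bound. The points are chosen one after another. Moving a symmetric event by \<open>m\<close> costs at most a factor
  \<open>exp (- \<bar>m\<bar>\<^sup>2 / 2)\<close>, and thresholds are at most of order \<open>1 / sqrt d\<close> and bounded away from \<open>1\<close>. A shift of
  squared length of order \<open>d\<close> along an axis gives \<open>n d\<close>, one of order \<open>sqrt (d ln n)\<close> gives
  \<open>n sqrt (d ln n)\<close>, and for \<open>n\<^sup>2\<close> one shifts along an axis by squared length of order \<open>sqrt d\<close> if \<open>n\<close> exceeds a multiple of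
  \<open>sqrt d\<close>, and along the sum of the previous points otherwise.
\<close>

section \<open>A transport inequality for Gaussian products\<close>

text \<open>The plain sum of the inner products is centred, so its sign says little; the weights
  must depend on the pair. A Mehler weight has conditional mean 1 given either vector and tilts the
  mean of the inner product to \<open>- \<rho> * d\<close>. What limits \<rho> is its fourth moment,
  at most \<open>exp (14 * \<rho>\<^sup>2 * d)\<close>, which has to stay below a fixed fraction of
  \<open>k\<close>. So \<open>\<rho>\<^sup>2 * d\<close> can reach order \<open>ln n\<close>: this
  is the logarithm of the bound. With \<open>E = exp (7 * \<rho>\<^sup>2 * d)\<close> the squared
  distance reached is of order the smaller of \<open>k \<rho> d\<close> and
  \<open>(k \<rho> d)^2 / (d E + k \<rho>^2 d)\<close>. The second is no smaller in order once
  \<open>E\<close> is at most of order \<open>k \<rho>\<close>, which the logarithmic choice meets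
  if \<open>n\<close> is at least \<open>d powr (3/4)\<close>. There the full \<open>ln n\<close>
  results, and for smaller \<open>n\<close> the logarithm of the claim is 1; hence \<epsilon> = 0 is
  possible. For the term \<open>n^2\<close> of the lower bound a new point must meet up to
  \<open>n\<close> constraints with probability \<open>exp (- O(n))\<close>; the slab estimate pays
  a constant factor per constraint, as Sidak's inequality would.\<close>

lemma nn_integral_layer_cake:
  fixes f :: "'a \<Rightarrow> real"
  assumes "sigma_finite_measure M" and f [measurable]: "f \<in> borel_measurable M"
  shows "(\<integral>\<^sup>+x. ennreal (f x) \<partial>M) = (\<integral>\<^sup>+t. emeasure M {x \<in> space M. t < f x} * indicator {0..} t \<partial>lborel)"
proof -
  interpret M: sigma_finite_measure M by fact
  interpret P: pair_sigma_finite M lborel by unfold_locales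
  have e: "ennreal (f x) = (\<integral>\<^sup>+t. indicator {0..<f x} t \<partial>lborel)" for x
    by (cases "0 \<le> f x") (auto simp: ennreal_neg)
  have "(\<integral>\<^sup>+x. ennreal (f x) \<partial>M) = (\<integral>\<^sup>+x. (\<integral>\<^sup>+t. indicator {0..<f x} t \<partial>lborel) \<partial>M)"
    by (simp only: e)
  also have "\<dots> = (\<integral>\<^sup>+t. (\<integral>\<^sup>+x. indicator {0..<f x} t \<partial>M) \<partial>lborel)"
    by (rule P.Fubini'[symmetric]) (simp add: indicator_def, measurable)
  also have "\<dots> = (\<integral>\<^sup>+t. emeasure M {x \<in> space M. t < f x} * indicator {0..} t \<partial>lborel)"
  proof (rule nn_integral_cong)
    fix t :: real
    have "(\<integral>\<^sup>+x. indicator {0..<f x} t \<partial>M) = (\<integral>\<^sup>+x. indicator {x \<in> space M. t < f x} x * indicator {0..} t \<partial>M)"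
      by (rule nn_integral_cong) (auto simp: indicator_def)
    also have "\<dots> = emeasure M {x \<in> space M. t < f x} * indicator {0..} t"
      by (subst nn_integral_multc) auto
    finally show "(\<integral>\<^sup>+x. indicator {0..<f x} t \<partial>M) = emeasure M {x \<in> space M. t < f x} * indicator {0..} t" .
  qed
  finally show ?thesis .
qed

text \<open>This is Maurey's property (tau), written with nonnegative functions instead of
  exponentials of a function and of its infimal convolution. Costs add up under products without
  loss, so the resulting concentration does not depend on the dimension.\<close>

definition transport_property :: "'a measure \<Rightarrow> ('a \<Rightarrow> 'a \<Rightarrow> real) \<Rightarrow> bool" where
  "transport_property M c \<longleftrightarrow>
     (\<forall>u \<in> borel_measurable M. \<forall>v \<in> borel_measurable M.
        (\<forall>x \<in> space M. \<forall>y \<in> space M. u x * v y \<le> ennreal (exp (c x y))) \<longrightarrow>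
        (\<integral>\<^sup>+x. u x \<partial>M) * (\<integral>\<^sup>+x. v x \<partial>M) \<le> 1)"

lemma transport_propertyD:
  assumes "transport_property M c" "u \<in> borel_measurable M" "v \<in> borel_measurable M"
    "\<And>x y. x \<in> space M \<Longrightarrow> y \<in> space M \<Longrightarrow> u x * v y \<le> ennreal (exp (c x y))"
  shows "(\<integral>\<^sup>+x. u x \<partial>M) * (\<integral>\<^sup>+x. v x \<partial>M) \<le> 1"
  using assms unfolding transport_property_def by blast

text \<open>Homogeneity in \<open>u\<close>. In the product lemmas \<open>e\<close> is the cost of
  the coordinates that are held fixed.\<close>

lemma transport_property_scaled:
  assumes "transport_property M c" "u \<in> borel_measurable M" "v \<in> borel_measurable M"
    "\<And>x y. x \<in> space M \<Longrightarrow> y \<in> space M \<Longrightarrow> u x * v y \<le> ennreal (exp (c x y + e))"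
  shows "(\<integral>\<^sup>+x. u x \<partial>M) * (\<integral>\<^sup>+x. v x \<partial>M) \<le> ennreal (exp e)"
proof -
  note [measurable] = assms(2,3)
  have m: "(\<lambda>x. ennreal (exp (-e)) * u x) \<in> borel_measurable M" by measurable
  have *: "(\<integral>\<^sup>+x. ennreal (exp (-e)) * u x \<partial>M) * (\<integral>\<^sup>+x. v x \<partial>M) \<le> 1"
  proof (rule transport_propertyD[OF assms(1) m assms(3)])
    fix x y assume "x \<in> space M" "y \<in> space M"
    then have "u x * v y \<le> ennreal (exp (c x y + e))" by (rule assms(4))
    then have "ennreal (exp (-e)) * (u x * v y) \<le> ennreal (exp (-e)) * ennreal (exp (c x y + e))"
      by (rule mult_left_mono) simp
    also have "\<dots> = ennreal (exp (c x y))"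
      by (subst ennreal_mult[symmetric]) (auto simp: exp_add[symmetric])
    finally show "ennreal (exp (-e)) * u x * v y \<le> ennreal (exp (c x y))" by (simp add: mult.assoc)
  qed
  have "(\<integral>\<^sup>+x. u x \<partial>M) * (\<integral>\<^sup>+x. v x \<partial>M)
      = ennreal (exp e) * ((ennreal (exp (-e)) * (\<integral>\<^sup>+x. u x \<partial>M)) * (\<integral>\<^sup>+x. v x \<partial>M))"
    by (simp add: mult.assoc[symmetric] ennreal_mult[symmetric] exp_add[symmetric])
  also have "\<dots> = ennreal (exp e) * ((\<integral>\<^sup>+x. ennreal (exp (-e)) * u x \<partial>M) * (\<integral>\<^sup>+x. v x \<partial>M))"
    by (subst nn_integral_cmult) auto
  also have "\<dots> \<le> ennreal (exp e) * 1" by (rule mult_left_mono[OF *]) simp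
  finally show ?thesis by simp
qed

text \<open>For fixed first coordinates the inner integrals satisfy the hypothesis for
  \<open>c\<close>, because the property of \<open>N\<close> absorbs the cost \<open>e\<close>; then
  the property of \<open>M\<close> finishes.\<close>

lemma transport_property_pair:
  assumes "prob_space M" "prob_space N" and M: "transport_property M c" and N: "transport_property N e"
  shows "transport_property (M \<Otimes>\<^sub>M N) (\<lambda>x y. c (fst x) (fst y) + e (snd x) (snd y))"
  unfolding transport_property_def
proof (intro ballI impI)
  interpret M: prob_space M by fact
  interpret N: prob_space N by fact
  fix u v assume [measurable]: "u \<in> borel_measurable (M \<Otimes>\<^sub>M N)" "v \<in> borel_measurable (M \<Otimes>\<^sub>M N)"
    and uv: "\<forall>x\<in>space (M \<Otimes>\<^sub>M N). \<forall>y\<in>space (M \<Otimes>\<^sub>M N).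
      u x * v y \<le> ennreal (exp (c (fst x) (fst y) + e (snd x) (snd y)))"
  have "(\<integral>\<^sup>+x. (\<integral>\<^sup>+y. u (x, y) \<partial>N) \<partial>M) * (\<integral>\<^sup>+x. (\<integral>\<^sup>+y. v (x, y) \<partial>N) \<partial>M) \<le> 1"
  proof (rule transport_propertyD[OF M])
    fix x x' assume x: "x \<in> space M" "x' \<in> space M"
    show "(\<integral>\<^sup>+y. u (x, y) \<partial>N) * (\<integral>\<^sup>+y. v (x', y) \<partial>N) \<le> ennreal (exp (c x x'))"
    proof (rule transport_property_scaled[OF N])
      fix y y' assume "y \<in> space N" "y' \<in> space N"
      then show "u (x, y) * v (x', y') \<le> ennreal (exp (e y y' + c x x'))"
        using uv[rule_format, of "(x, y)" "(x', y')"] x by (simp add: space_pair_measure add.commute)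
    qed (use x in measurable)
  qed measurable
  then show "(\<integral>\<^sup>+x. u x \<partial>(M \<Otimes>\<^sub>M N)) * (\<integral>\<^sup>+x. v x \<partial>(M \<Otimes>\<^sub>M N)) \<le> 1"
    by (simp add: N.nn_integral_fst)
qed

lemma transport_property_PiM:
  assumes "prob_space M" and M: "transport_property M c" and "finite I"
  shows "transport_property (\<Pi>\<^sub>M i\<in>I. M) (\<lambda>x y. \<Sum>i\<in>I. c (x i) (y i))"
  using \<open>finite I\<close>
proof induction
  interpret M: prob_space M by fact
  case empty
  show ?case unfolding transport_property_def
    by (auto simp: PiM_empty nn_integral_count_space_finite)
next
  case (insert i I)
  interpret M: prob_space M by fact
  interpret product_sigma_finite "\<lambda>_. M" by unfold_locales
  note upd [measurable] = measurable_fun_upd[of "insert i I" I i]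
  show ?case unfolding transport_property_def
  proof (intro ballI impI)
    let ?P = "\<Pi>\<^sub>M i\<in>insert i I. M"
    fix u v assume u [measurable]: "u \<in> borel_measurable ?P" and v [measurable]: "v \<in> borel_measurable ?P"
      and uv: "\<forall>x\<in>space ?P. \<forall>y\<in>space ?P. u x * v y \<le> ennreal (exp (\<Sum>i\<in>insert i I. c (x i) (y i)))"
    have sp: "x(i := y) \<in> space ?P" if "x \<in> space (\<Pi>\<^sub>M i\<in>I. M)" "y \<in> space M" for x y
      using that by (auto simp: space_PiM PiE_def extensional_def)
    have "(\<integral>\<^sup>+x. (\<integral>\<^sup>+y. u (x(i := y)) \<partial>M) \<partial>(\<Pi>\<^sub>M i\<in>I. M)) * (\<integral>\<^sup>+x. (\<integral>\<^sup>+y. v (x(i := y)) \<partial>M) \<partial>(\<Pi>\<^sub>M i\<in>I. M)) \<le> 1"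
    proof (rule transport_propertyD[OF insert.IH])
      fix x x' assume x: "x \<in> space (\<Pi>\<^sub>M i\<in>I. M)" "x' \<in> space (\<Pi>\<^sub>M i\<in>I. M)"
      show "(\<integral>\<^sup>+y. u (x(i := y)) \<partial>M) * (\<integral>\<^sup>+y. v (x'(i := y)) \<partial>M) \<le> ennreal (exp (\<Sum>i\<in>I. c (x i) (x' i)))"
      proof (rule transport_property_scaled[OF M])
        fix y y' assume y: "y \<in> space M" "y' \<in> space M"
        have "(\<Sum>j\<in>I. c ((x(i := y)) j) ((x'(i := y')) j)) = (\<Sum>j\<in>I. c (x j) (x' j))"
          using insert by (intro sum.cong) auto
        then show "u (x(i := y)) * v (x'(i := y')) \<le> ennreal (exp (c y y' + (\<Sum>i\<in>I. c (x i) (x' i))))"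
          using uv[rule_format, OF sp[OF x(1) y(1)] sp[OF x(2) y(2)]] insert by simp
      qed (use x in measurable)
    qed measurable
    then show "(\<integral>\<^sup>+x. u x \<partial>?P) * (\<integral>\<^sup>+x. v x \<partial>?P) \<le> 1"
      using insert by (simp add: product_nn_integral_insert)
  qed
qed

text \<open>Indicators serve as \<open>u\<close> and \<open>v\<close>: their product vanishes off
  \<open>A \<times> B\<close>, and there \<open>c x y - s\<close> is nonnegative.\<close>

lemma transport_property_sets:
  assumes "prob_space M" "transport_property M c" and A: "A \<in> sets M" and B: "B \<in> sets M"
    and s: "\<And>x y. x \<in> A \<Longrightarrow> y \<in> B \<Longrightarrow> s \<le> c x y"
  shows "measure M A * measure M B \<le> exp (- s)"
proof -
  interpret prob_space M by fact
  have "(\<integral>\<^sup>+x. indicator A x \<partial>M) * (\<integral>\<^sup>+x. indicator B x \<partial>M) \<le> ennreal (exp (-s))"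
  proof (rule transport_property_scaled[OF assms(2)])
    fix x y show "(indicator A x * indicator B y :: ennreal) \<le> ennreal (exp (c x y + - s))"
      using s[of x y] by (auto simp: indicator_def)
  qed (use A B in auto)
  then show ?thesis
    using A B by (simp add: emeasure_eq_measure ennreal_mult[symmetric])
qed

text \<open>The one-dimensional Brunn-Minkowski inequality in the only case required, where the set
  of sums lies in a centred interval. Each set may be replaced by the interval between its infimum
  and supremum, and these endpoints add.\<close>

lemma set_sum_lengths:
  fixes A B :: "real set"
  assumes A: "A \<in> sets borel" "A \<noteq> {}" and B: "B \<in> sets borel" "B \<noteq> {}" and r: "0 \<le> r"
    and AB: "\<And>x y. x \<in> A \<Longrightarrow> y \<in> B \<Longrightarrow> \<bar>x + y\<bar> \<le> 2 * r"
  shows "emeasure lborel A + emeasure lborel B \<le> ennreal (4 * r)"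
proof -
  obtain a b where ab: "a \<in> A" "b \<in> B" using A B by auto
  have x1: "x \<le> 2 * r - b" "- 2 * r - b \<le> x" if "x \<in> A" for x using AB[OF that ab(2)] by auto
  have x2: "x \<le> 2 * r - a" "- 2 * r - a \<le> x" if "x \<in> B" for x using AB[OF ab(1) that] by auto
  have bA: "bdd_above A" "bdd_below A" using x1 unfolding bdd_above_def bdd_below_def by blast+
  have bB: "bdd_above B" "bdd_below B" using x2 unfolding bdd_above_def bdd_below_def by blast+
  have sup: "Sup A + Sup B \<le> 2 * r"
  proof -
    have "Sup A \<le> 2 * r - y" if "y \<in> B" for y
      using AB[OF _ that] by (intro cSup_least A) fastforce
    then have "Sup B \<le> 2 * r - Sup A" by (intro cSup_least B) fastforce
    then show ?thesis by simp
  qed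
  have inf: "Inf A + Inf B \<ge> - 2 * r"
  proof -
    have "Inf A \<ge> - 2 * r - y" if "y \<in> B" for y
      using AB[OF _ that] by (intro cInf_greatest A) fastforce
    then have "Inf B \<ge> - 2 * r - Inf A" by (intro cInf_greatest B) fastforce
    then show ?thesis by simp
  qed
  have le: "Inf A \<le> Sup A" "Inf B \<le> Sup B" using bA bB A B by (auto intro: cInf_le_cSup)
  have "emeasure lborel A \<le> emeasure lborel {Inf A..Sup A}"
    using bA by (intro emeasure_mono) (auto intro: cInf_lower cSup_upper)
  moreover have "emeasure lborel B \<le> emeasure lborel {Inf B..Sup B}"
    using bB by (intro emeasure_mono) (auto intro: cInf_lower cSup_upper)
  ultimately have "emeasure lborel A + emeasure lborel B \<le> ennreal (Sup A - Inf A) + ennreal (Sup B - Inf B)"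
    using le by (auto intro: add_mono)
  also have "\<dots> = ennreal (Sup A - Inf A + (Sup B - Inf B))" using le by simp
  also have "\<dots> \<le> ennreal (4 * r)" using sup inf by (intro ennreal_leI) simp
  finally show ?thesis .
qed

lemma std_normal_level_set:
  assumes t: "0 < t" and ne: "{x. t < std_normal_density x} \<noteq> {}"
  obtains r where "0 \<le> r" "\<And>x. t < std_normal_density x \<longleftrightarrow> \<bar>x\<bar> < r"
    "emeasure lborel {x. t < std_normal_density x} = ennreal (2 * r)"
proof -
  define z where "z = - 2 * ln (t * sqrt (2 * pi))"
  have pos: "0 < t * sqrt (2 * pi)" using t by simp
  have eq: "t < std_normal_density x \<longleftrightarrow> x\<^sup>2 < z" for x
  proof -
    have "t < std_normal_density x \<longleftrightarrow> t * sqrt (2 * pi) < exp (- x\<^sup>2 / 2)"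
      by (simp add: std_normal_density_def field_simps)
    also have "\<dots> \<longleftrightarrow> ln (t * sqrt (2 * pi)) < - x\<^sup>2 / 2"
      using pos by (metis exp_gt_zero ln_exp ln_less_cancel_iff)
    also have "\<dots> \<longleftrightarrow> x\<^sup>2 < z" by (auto simp: z_def)
    finally show ?thesis .
  qed
  obtain x where "t < std_normal_density x" using ne by auto
  then have z: "0 < z" using eq[of x] by (smt (verit) zero_le_power2)
  have eq2: "t < std_normal_density x \<longleftrightarrow> \<bar>x\<bar> < sqrt z" for x
  proof -
    have "x\<^sup>2 < z \<longleftrightarrow> \<bar>x\<bar> < sqrt z"
      using z by (metis real_sqrt_abs real_sqrt_less_iff)
    then show ?thesis using eq by simp
  qed
  have "{x. t < std_normal_density x} = {- sqrt z <..< sqrt z}"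
    unfolding eq2 by (auto simp: abs_less_iff)
  then have "emeasure lborel {x. t < std_normal_density x} = ennreal (2 * sqrt z)" using z by simp
  with eq2 z show ?thesis by (intro that[of "sqrt z"]) auto
qed

text \<open>The parallelogram identity in the exponent. It explains the factor 1/4 of the cost: with
  it, the hypothesis on \<open>u\<close> and \<open>v\<close> becomes a Prekopa-Leindler hypothesis
  for the midpoint.\<close>

lemma std_normal_density_midpoint:
  "std_normal_density x * std_normal_density y * exp ((x - y)\<^sup>2 / 4) = (std_normal_density ((x + y) / 2))\<^sup>2"
proof -
  have "exp (- x\<^sup>2 / 2) * exp (- y\<^sup>2 / 2) * exp ((x - y)\<^sup>2 / 4) = exp (- ((x + y) / 2)\<^sup>2 / 2 + - ((x + y) / 2)\<^sup>2 / 2)"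
    unfolding exp_add[symmetric]
    by (intro arg_cong[where f = exp]) (simp add: power2_eq_square field_simps)
  then have e: "exp (- x\<^sup>2 / 2) * exp (- y\<^sup>2 / 2) * exp ((x - y)\<^sup>2 / 4) = exp (- ((x + y) / 2)\<^sup>2 / 2) * exp (- ((x + y) / 2)\<^sup>2 / 2)"
    by (simp only: exp_add)
  have "std_normal_density x * std_normal_density y * exp ((x - y)\<^sup>2 / 4)
      = (1 / sqrt (2 * pi)) * (1 / sqrt (2 * pi)) * (exp (- x\<^sup>2 / 2) * exp (- y\<^sup>2 / 2) * exp ((x - y)\<^sup>2 / 4))"
    unfolding std_normal_density_def by (simp only: ac_simps)
  then show ?thesis
    unfolding e std_normal_density_def by (simp only: power2_eq_square[of "_ * _"] ac_simps)
qed

text \<open>The one-dimensional case is a Prekopa-Leindler argument: when the two functions have been scaled to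
  have supremum 1, all their superlevel sets below level 1 are nonempty, so the sum of their lengths is at
  most the length of the Minkowski sum.\<close>

lemma transport_property_std_normal:
  "transport_property std_normal_distribution (\<lambda>x y. (x - y)\<^sup>2 / 4)"
  unfolding transport_property_def
proof (intro ballI impI)
  let ?\<phi> = std_normal_density
  fix u v :: "real \<Rightarrow> ennreal"
  assume "u \<in> borel_measurable std_normal_distribution" "v \<in> borel_measurable std_normal_distribution"
  then have [measurable]: "u \<in> borel_measurable borel" "v \<in> borel_measurable borel"
    by simp_all
  assume uv: "\<forall>x\<in>space std_normal_distribution. \<forall>y\<in>space std_normal_distribution.
     u x * v y \<le> ennreal (exp ((x - y)\<^sup>2 / 4))"
  define F where "F x = ennreal (?\<phi> x) * u x" for x
  define G where "G x = ennreal (?\<phi> x) * v x" for x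
  have [measurable]: "F \<in> borel_measurable borel" "G \<in> borel_measurable borel"
    by (simp_all add: F_def[abs_def] G_def[abs_def])
  have iF: "(\<integral>\<^sup>+x. u x \<partial>std_normal_distribution) = (\<integral>\<^sup>+x. F x \<partial>lborel)"
    by (subst nn_integral_density) (simp_all add: F_def[abs_def])
  have iG: "(\<integral>\<^sup>+x. v x \<partial>std_normal_distribution) = (\<integral>\<^sup>+x. G x \<partial>lborel)"
    by (subst nn_integral_density) (simp_all add: G_def[abs_def])
  have FG: "F x * G y \<le> ennreal ((?\<phi> ((x + y) / 2))\<^sup>2)" for x y
  proof -
    have "F x * G y = ennreal (?\<phi> x * ?\<phi> y) * (u x * v y)"
      by (simp only: F_def G_def ennreal_mult[OF normal_density_nonneg normal_density_nonneg] ac_simps)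
    also have "\<dots> \<le> ennreal (?\<phi> x * ?\<phi> y) * ennreal (exp ((x - y)\<^sup>2 / 4))"
      using uv by (intro mult_left_mono) auto
    also have "\<dots> = ennreal (?\<phi> x * ?\<phi> y * exp ((x - y)\<^sup>2 / 4))" by (simp add: ennreal_mult)
    also have "?\<phi> x * ?\<phi> y * exp ((x - y)\<^sup>2 / 4) = (?\<phi> ((x + y) / 2))\<^sup>2"
      by (rule std_normal_density_midpoint)
    finally show ?thesis .
  qed
  show "(\<integral>\<^sup>+x. u x \<partial>std_normal_distribution) * (\<integral>\<^sup>+x. v x \<partial>std_normal_distribution) \<le> 1"
  proof (cases "(\<exists>x. F x \<noteq> 0) \<and> (\<exists>y. G y \<noteq> 0)")
    case False
    then have "F = (\<lambda>_. 0) \<or> G = (\<lambda>_. 0)" by auto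
    then show ?thesis unfolding iF iG by auto
  next
    case True
    then obtain x0 y0 where x0: "F x0 \<noteq> 0" and y0: "G y0 \<noteq> 0" by auto
    have le1: "?\<phi> x \<le> 1" for x
    proof -
      have "1 \<le> sqrt (2 * pi)" using pi_gt3 by (intro real_le_rsqrt) simp
      then have "1 / sqrt (2 * pi) \<le> 1" by simp
      moreover have "exp (- x\<^sup>2 / 2) \<le> 1" by simp
      ultimately show ?thesis unfolding std_normal_density_def by (intro mult_le_one) simp_all
    qed
    \<comment> \<open>This bound makes both suprema finite: each is nonzero and their product is at
      most 1.\<close>
    have FG1: "F x * G y \<le> 1" for x y
    proof -
      have "ennreal ((?\<phi> ((x + y) / 2))\<^sup>2) \<le> ennreal 1"
        using le1[of "(x + y) / 2"] by (intro ennreal_leI power_le_one) auto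
      then show ?thesis using FG[of x y] by (simp add: order_trans)
    qed
    define a where "a = (SUP x. F x)"
    define b where "b = (SUP x. G x)"
    have aG: "a * G y \<le> 1" for y
      unfolding a_def by (subst SUP_mult_right_ennreal) (auto intro: SUP_least FG1)
    have ab1: "a * b \<le> 1"
      unfolding b_def by (subst SUP_mult_left_ennreal) (auto intro: SUP_least aG)
    have Fa: "F x \<le> a" and Gb: "G x \<le> b" for x unfolding a_def b_def by (auto intro: SUP_upper)
    have ab0: "a \<noteq> 0" "b \<noteq> 0" using x0 y0 Fa[of x0] Gb[of y0] by auto
    have abinf: "a \<noteq> \<infinity>" "b \<noteq> \<infinity>"
      using ab1 ab0 by (auto simp: ennreal_mult_top ennreal_top_mult top_unique)
    define \<alpha> where "\<alpha> = enn2real a"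
    define \<beta> where "\<beta> = enn2real b"
    have lt: "0 < a" "a < top" "0 < b" "b < top"
      using ab0 abinf by (simp_all add: zero_less_iff_neq_zero less_top)
    have a: "a = ennreal \<alpha>" "0 < \<alpha>"
      unfolding \<alpha>_def using lt by (simp_all add: enn2real_positive_iff)
    have b: "b = ennreal \<beta>" "0 < \<beta>"
      unfolding \<beta>_def using lt by (simp_all add: enn2real_positive_iff)
    define f where "f x = enn2real (F x) / \<alpha>" for x
    define g where "g x = enn2real (G x) / \<beta>" for x
    have [measurable]: "f \<in> borel_measurable borel" "g \<in> borel_measurable borel"
      unfolding f_def[abs_def] g_def[abs_def] by measurable
    have Ff: "F x = ennreal (\<alpha> * f x)" and Gg: "G x = ennreal (\<beta> * g x)" for x
      using Fa[of x] Gb[of x] a b by (auto simp: f_def g_def ennreal_enn2real_if top_unique)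
    have f1: "0 \<le> f x" "f x \<le> 1" and g1: "0 \<le> g x" "g x \<le> 1" for x
    proof -
      show "0 \<le> f x" "0 \<le> g x" using a b by (auto simp: f_def g_def)
      then show "f x \<le> 1" "g x \<le> 1" using Fa[of x] Gb[of x] a b by (auto simp: Ff Gg)
    qed
    have exf: "\<exists>x. t < f x" and exg: "\<exists>x. t < g x" if "t < 1" "0 \<le> t" for t
    proof -
      have "ennreal (\<alpha> * t) < a" "ennreal (\<beta> * t) < b" using that a b by (auto simp: ennreal_less_iff)
      then obtain x y where "ennreal (\<alpha> * t) < F x" "ennreal (\<beta> * t) < G y"
        unfolding a_def b_def less_SUP_iff by auto
      then have "t < f x" "t < g y" using a b that by (auto simp: Ff Gg ennreal_less_iff)
      then show "\<exists>x. t < f x" "\<exists>x. t < g x" by auto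
    qed
    \<comment> \<open>The geometric mean of the suprema: since the product of \<open>F\<close> and
      \<open>G\<close> is bounded by a square, \<open>t < f x\<close> and \<open>t < g y\<close>
      force the density at the midpoint above \<open>c * t\<close>.\<close>
    define c where "c = sqrt (\<alpha> * \<beta>)"
    have c: "0 < c" "c\<^sup>2 = \<alpha> * \<beta>" using a b by (auto simp: c_def)
    have level: "emeasure lborel {x. t < f x} + emeasure lborel {x. t < g x}
        \<le> 2 * emeasure lborel {x. t < ?\<phi> x / c}" if t: "0 \<le> t" for t
    \<comment> \<open>At \<open>t = 0\<close> the right side is infinite, and from
      \<open>t = 1\<close> on the left side vanishes. Only in between are all level sets nonempty,
      as \<open>set_sum_lengths\<close> demands.\<close>
    proof (cases "t = 0 \<or> 1 \<le> t")
      case True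
      then show ?thesis
      proof
        assume "t = 0"
        moreover have "{x. 0 < ?\<phi> x / c} = UNIV" using c by (auto simp: normal_density_pos)
        ultimately have "emeasure lborel {x. t < ?\<phi> x / c} = \<infinity>" by simp
        then show ?thesis by (simp add: ennreal_mult_top)
      next
        assume "1 \<le> t"
        then have "f x \<le> t" "g x \<le> t" for x using f1(2)[of x] g1(2)[of x] by linarith+
        then have "{x. t < f x} = {}" "{x. t < g x} = {}" by (auto simp: not_less)
        then show ?thesis by simp
      qed
    next
      case False
      have prod: "c * t < ?\<phi> ((x + y) / 2)" if "t < f x" "t < g y" for x y
      proof -
        have "ennreal (\<alpha> * f x) * ennreal (\<beta> * g y) \<le> ennreal ((?\<phi> ((x + y) / 2))\<^sup>2)"
          using FG[of x y] by (simp add: Ff Gg)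
        then have "(\<alpha> * f x) * (\<beta> * g y) \<le> (?\<phi> ((x + y) / 2))\<^sup>2"
          using a b f1 g1 by (simp add: ennreal_mult[symmetric])
        moreover have "t * t < f x * g y" using that t by (intro mult_strict_mono') auto
        then have "(c * t)\<^sup>2 < (\<alpha> * f x) * (\<beta> * g y)"
        proof -
          have "(c * t)\<^sup>2 = (\<alpha> * \<beta>) * (t * t)" using c by (simp add: power_mult_distrib power2_eq_square[of t])
          also have "\<dots> < (\<alpha> * \<beta>) * (f x * g y)"
            using \<open>t * t < f x * g y\<close> a b by (intro mult_strict_left_mono) auto
          finally show ?thesis by (simp only: ac_simps)
        qed
        ultimately have "(c * t)\<^sup>2 < (?\<phi> ((x + y) / 2))\<^sup>2" by simp
        then show ?thesis by (rule power2_less_imp_less) simp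
      qed
      obtain x1 y1 where xy1: "t < f x1" "t < g y1" using exf exg False t by (meson not_le)
      have ct: "0 < c * t" using c False t by simp
      have ne: "{x. c * t < ?\<phi> x} \<noteq> {}" using prod[OF xy1] by auto
      obtain r where r: "0 \<le> r" "\<And>x. c * t < ?\<phi> x \<longleftrightarrow> \<bar>x\<bar> < r"
        "emeasure lborel {x. c * t < ?\<phi> x} = ennreal (2 * r)"
        using std_normal_level_set[OF ct ne] by metis
      have "emeasure lborel {x. t < f x} + emeasure lborel {x. t < g x} \<le> ennreal (4 * r)"
      proof (rule set_sum_lengths)
        fix x y assume "x \<in> {x. t < f x}" "y \<in> {x. t < g x}"
        then show "\<bar>x + y\<bar> \<le> 2 * r" using prod[of x y] r(2)[of "(x + y) / 2"] by auto
      qed (use r xy1 in auto)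
      also have "ennreal (4 * r) = 2 * ennreal (2 * r)"
        using ennreal_mult[of 2 "2 * r"] r(1) by simp
      also have "ennreal (2 * r) = emeasure lborel {x. t < ?\<phi> x / c}"
        using c unfolding r(3)[symmetric] by (simp add: field_simps)
      finally show ?thesis .
    qed
    have sf: "sigma_finite_measure (lborel :: real measure)" by (rule sigma_finite_lborel)
    have "(\<integral>\<^sup>+x. ennreal (f x) \<partial>lborel) + (\<integral>\<^sup>+x. ennreal (g x) \<partial>lborel)
        = (\<integral>\<^sup>+t. (emeasure lborel {x. t < f x} + emeasure lborel {x. t < g x}) * indicator {0..} t \<partial>lborel)"
    proof -
      have m: "(\<lambda>t. emeasure lborel {x \<in> space lborel. t < h x}) \<in> borel_measurable lborel"
        if [measurable]: "h \<in> borel_measurable borel" for h :: "real \<Rightarrow> real"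
        by measurable
      show ?thesis
        using m[of f] m[of g]
        by (simp add: nn_integral_layer_cake[OF sf] distrib_right nn_integral_add)
    qed
    also have "\<dots> \<le> (\<integral>\<^sup>+t. 2 * (emeasure lborel {x. t < ?\<phi> x / c} * indicator {0..} t) \<partial>lborel)"
    proof (rule nn_integral_mono)
      fix t :: real
      show "(emeasure lborel {x. t < f x} + emeasure lborel {x. t < g x}) * indicator {0..} t
         \<le> 2 * (emeasure lborel {x. t < ?\<phi> x / c} * indicator {0..} t)"
        using level[of t] by (auto simp: indicator_def)
    qed
    also have "\<dots> = 2 * (\<integral>\<^sup>+t. emeasure lborel {x. t < ?\<phi> x / c} * indicator {0..} t \<partial>lborel)"
    proof -
      have m: "(\<lambda>t. emeasure lborel {x \<in> space lborel. t < ?\<phi> x / c}) \<in> borel_measurable lborel"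
        by measurable
      then show ?thesis by (subst nn_integral_cmult) auto
    qed
    also have "(\<integral>\<^sup>+t. emeasure lborel {x. t < ?\<phi> x / c} * indicator {0..} t \<partial>lborel) = (\<integral>\<^sup>+x. ennreal (?\<phi> x / c) \<partial>lborel)"
      by (subst nn_integral_layer_cake[OF sf]) auto
    also have "\<dots> = ennreal (1 / c)"
      using c by (subst nn_integral_eq_integral) auto
    finally have sum: "(\<integral>\<^sup>+x. ennreal (f x) \<partial>lborel) + (\<integral>\<^sup>+x. ennreal (g x) \<partial>lborel) \<le> 2 * ennreal (1 / c)" .
    define P where "P = enn2real (\<integral>\<^sup>+x. ennreal (f x) \<partial>lborel)"
    define Q where "Q = enn2real (\<integral>\<^sup>+x. ennreal (g x) \<partial>lborel)"
    have "2 * ennreal (1 / c) < \<infinity>" by (simp add: ennreal_mult_less_top)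
    then have fin: "(\<integral>\<^sup>+x. ennreal (f x) \<partial>lborel) + (\<integral>\<^sup>+x. ennreal (g x) \<partial>lborel) < \<infinity>"
      using sum by (rule order_le_less_trans[rotated])
    then have PQ: "(\<integral>\<^sup>+x. ennreal (f x) \<partial>lborel) = ennreal P" "(\<integral>\<^sup>+x. ennreal (g x) \<partial>lborel) = ennreal Q"
      "0 \<le> P" "0 \<le> Q"
      by (auto simp: P_def Q_def ennreal_enn2real_if)
    have "2 * ennreal (1 / c) = ennreal (2 / c)"
      using ennreal_mult[of 2 "1 / c"] c by simp
    then have "P + Q \<le> 2 / c" using sum PQ c by (simp flip: ennreal_plus)
    then have "c * (P + Q) \<le> 2" using c by (simp add: field_simps)
    then have "(c * (P + Q))\<^sup>2 \<le> 2\<^sup>2" using c PQ by (intro power_mono) auto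
    \<comment> \<open>The arithmetic-geometric mean inequality turns the bound on
      \<open>P + Q\<close> into one on \<open>P * Q\<close>; as
      \<open>c\<^sup>2 = \<alpha> * \<beta>\<close>, this is the claim before normalisation.\<close>
    moreover have "4 * (c\<^sup>2 * (P * Q)) \<le> (c * (P + Q))\<^sup>2"
      using c sum_squares_ge_zero[of "c * (P - Q)" 0] by (simp add: power2_eq_square algebra_simps)
    ultimately have "c\<^sup>2 * (P * Q) \<le> 1" by simp
    moreover have "(\<integral>\<^sup>+x. F x \<partial>lborel) = ennreal (\<alpha> * P)" "(\<integral>\<^sup>+x. G x \<partial>lborel) = ennreal (\<beta> * Q)"
      using a b f1 g1 PQ by (simp_all add: Ff Gg ennreal_mult nn_integral_cmult)
    ultimately show ?thesis
      unfolding iF iG using a b PQ c by (simp add: ennreal_mult[symmetric] ac_simps)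
  qed
qed

section \<open>Moments\<close>

lemma nn_integral_has_bochner_integral:
  fixes f :: "'a \<Rightarrow> real"
  assumes "has_bochner_integral M f c" "\<And>x. 0 \<le> f x"
  shows "(\<integral>\<^sup>+x. ennreal (f x) \<partial>M) = ennreal c"
  using assms by (subst nn_integral_eq_integral) (auto simp: has_bochner_integral_iff)

lemma (in finite_measure) integrable_power_mono:
  fixes f :: "'a \<Rightarrow> real"
  assumes [measurable]: "f \<in> borel_measurable M" and i: "integrable M (\<lambda>x. f x ^ k)"
    and k: "even k" "j \<le> k"
  shows "integrable M (\<lambda>x. f x ^ j)"
proof (rule Bochner_Integration.integrable_bound)
  show "integrable M (\<lambda>x. 1 + f x ^ k)" using i by simp
  have "\<bar>f x ^ j\<bar> \<le> 1 + f x ^ k" for x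
  proof (cases "\<bar>f x\<bar> \<le> 1")
    case True
    then have "\<bar>f x ^ j\<bar> \<le> 1" by (simp add: power_abs power_le_one)
    moreover have "0 \<le> f x ^ k" using zero_le_even_power[OF k(1)] by blast
    ultimately show ?thesis by linarith
  next
    case False
    then have "\<bar>f x\<bar> ^ j \<le> \<bar>f x\<bar> ^ k" using k by (intro power_increasing) auto
    then show ?thesis using k by (simp add: power_abs power_even_abs)
  qed
  then show "AE x in M. norm (f x ^ j) \<le> norm (1 + f x ^ k)"
    using k by (intro AE_I2) (auto intro: order_trans[OF _ abs_ge_self])
qed measurable

lemma (in prob_space) integral_PiM_component:
  fixes f :: "'a \<Rightarrow> real"
  assumes "finite I" "i \<in> I" and [measurable]: "f \<in> borel_measurable M"
  shows "(\<integral>x. f (x i) \<partial>(\<Pi>\<^sub>M i\<in>I. M)) = (\<integral>x. f x \<partial>M)"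
    and "integrable M f \<Longrightarrow> integrable (\<Pi>\<^sub>M i\<in>I. M) (\<lambda>x. f (x i))"
proof -
  interpret P: product_prob_space "\<lambda>_. M" by unfold_locales
  have [measurable]: "(\<lambda>x. x i) \<in> (\<Pi>\<^sub>M i\<in>I. M) \<rightarrow>\<^sub>M M" using assms by measurable
  have d: "distr (\<Pi>\<^sub>M i\<in>I. M) M (\<lambda>x. x i) = M" using P.PiM_component[OF assms(2)] by simp
  show "(\<integral>x. f (x i) \<partial>(\<Pi>\<^sub>M i\<in>I. M)) = (\<integral>x. f x \<partial>M)"
    by (subst (2) d[symmetric], subst integral_distr) auto
  assume "integrable M f"
  then have "integrable (distr (\<Pi>\<^sub>M i\<in>I. M) M (\<lambda>x. x i)) f" by (simp add: d)
  then show "integrable (\<Pi>\<^sub>M i\<in>I. M) (\<lambda>x. f (x i))"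
    by (subst (asm) integrable_distr_eq) auto
qed

lemma (in prob_space) nn_integral_PiM_component:
  assumes "finite I" "i \<in> I" and [measurable]: "f \<in> borel_measurable M"
  shows "(\<integral>\<^sup>+x. f (x i) \<partial>(\<Pi>\<^sub>M i\<in>I. M)) = (\<integral>\<^sup>+x. f x \<partial>M)"
proof -
  interpret P: product_prob_space "\<lambda>_. M" by unfold_locales
  have [measurable]: "(\<lambda>x. x i) \<in> (\<Pi>\<^sub>M i\<in>I. M) \<rightarrow>\<^sub>M M" using assms by measurable
  have d: "distr (\<Pi>\<^sub>M i\<in>I. M) M (\<lambda>x. x i) = M" using P.PiM_component[OF assms(2)] by simp
  show ?thesis by (subst (2) d[symmetric], subst nn_integral_distr) auto
qed

text \<open>Variances of independent centred terms add; in the induction the cross term integrates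
  to 0. With \<open>nn_integral\<close> on the left no integrability of the sum has to be carried
  along.\<close>

lemma (in prob_space) nn_integral_PiM_sum_square:
  fixes f :: "'i \<Rightarrow> 'a \<Rightarrow> real"
  assumes "finite I" and m: "\<And>i. i \<in> I \<Longrightarrow> f i \<in> borel_measurable M"
    and i2: "\<And>i. i \<in> I \<Longrightarrow> integrable M (\<lambda>x. (f i x)\<^sup>2)" and z: "\<And>i. i \<in> I \<Longrightarrow> (\<integral>x. f i x \<partial>M) = 0"
  shows "(\<integral>\<^sup>+x. ennreal ((\<Sum>i\<in>I. f i (x i))\<^sup>2) \<partial>(\<Pi>\<^sub>M i\<in>I. M)) = ennreal (\<Sum>i\<in>I. \<integral>x. (f i x)\<^sup>2 \<partial>M)"
  using assms
proof induction
  case empty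
  then show ?case by (simp add: PiM_empty nn_integral_count_space_finite)
next
  case (insert i I)
  interpret product_sigma_finite "\<lambda>_. M" by unfold_locales
  interpret P: product_prob_space "\<lambda>_. M" by unfold_locales
  interpret PI: prob_space "\<Pi>\<^sub>M i\<in>I. M" by (rule prob_space_PiM) unfold_locales
  have [measurable]: "f j \<in> borel_measurable M" if "j \<in> insert i I" for j using insert.prems that by auto
  have ins: "finite I" "i \<notin> I" using insert by auto
  let ?S = "\<lambda>x. \<Sum>j\<in>I. f j (x j)"
  have i1: "integrable M (f i)"
    using integrable_power_mono[of "f i" 2 1] insert.prems(2)[of i] by auto
  have inner: "(\<integral>\<^sup>+y. ennreal ((s + f i y)\<^sup>2) \<partial>M) = ennreal (s\<^sup>2) + ennreal (\<integral>x. (f i x)\<^sup>2 \<partial>M)" for s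
  proof -
    have e: "s\<^sup>2 + 2 * s * f i y + (f i y)\<^sup>2 = (s + f i y)\<^sup>2" for y
      by (simp add: power2_sum)
    have "has_bochner_integral M (\<lambda>y. s\<^sup>2 + (2 * s) * f i y + (f i y)\<^sup>2) (s\<^sup>2 + (2 * s) * 0 + (\<integral>x. (f i x)\<^sup>2 \<partial>M))"
      using i1 insert.prems(2)[of i] insert.prems(3)[of i]
      by (intro has_bochner_integral_add has_bochner_integral_mult_right)
         (auto simp: has_bochner_integral_iff prob_space)
    then have "(\<integral>\<^sup>+y. ennreal (s\<^sup>2 + (2 * s) * f i y + (f i y)\<^sup>2) \<partial>M) = ennreal (s\<^sup>2 + (2 * s) * 0 + (\<integral>x. (f i x)\<^sup>2 \<partial>M))"
      by (rule nn_integral_has_bochner_integral) (simp add: e)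
    then show ?thesis by (simp add: e ennreal_plus)
  qed
  have "(\<integral>\<^sup>+x. ennreal ((\<Sum>j\<in>insert i I. f j (x j))\<^sup>2) \<partial>(\<Pi>\<^sub>M j\<in>insert i I. M))
      = (\<integral>\<^sup>+x. (\<integral>\<^sup>+y. ennreal ((\<Sum>j\<in>insert i I. f j ((x(i := y)) j))\<^sup>2) \<partial>M) \<partial>(\<Pi>\<^sub>M j\<in>I. M))"
    using ins by (intro product_nn_integral_insert) measurable
  also have "\<dots> = (\<integral>\<^sup>+x. (\<integral>\<^sup>+y. ennreal ((?S x + f i y)\<^sup>2) \<partial>M) \<partial>(\<Pi>\<^sub>M j\<in>I. M))"
  proof (intro nn_integral_cong arg_cong[where f = ennreal] arg_cong[where f = "\<lambda>x. x\<^sup>2"])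
    fix x y
    have "(\<Sum>j\<in>I. f j ((x(i := y)) j)) = ?S x" using ins by (intro sum.cong) auto
    then show "(\<Sum>j\<in>insert i I. f j ((x(i := y)) j)) = ?S x + f i y" using ins by simp
  qed
  also have "\<dots> = (\<integral>\<^sup>+x. ennreal ((?S x)\<^sup>2) + ennreal (\<integral>x. (f i x)\<^sup>2 \<partial>M) \<partial>(\<Pi>\<^sub>M j\<in>I. M))"
    by (simp only: inner)
  also have "\<dots> = (\<integral>\<^sup>+x. ennreal ((?S x)\<^sup>2) \<partial>(\<Pi>\<^sub>M j\<in>I. M)) + ennreal (\<integral>x. (f i x)\<^sup>2 \<partial>M)"
    by (subst nn_integral_add) (auto simp: PI.emeasure_space_1)
  also have "(\<integral>\<^sup>+x. ennreal ((?S x)\<^sup>2) \<partial>(\<Pi>\<^sub>M j\<in>I. M)) = ennreal (\<Sum>i\<in>I. \<integral>x. (f i x)\<^sup>2 \<partial>M)"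
    using insert by auto
  also have "\<dots> + ennreal (\<integral>x. (f i x)\<^sup>2 \<partial>M) = ennreal (\<Sum>i\<in>insert i I. \<integral>x. (f i x)\<^sup>2 \<partial>M)"
    using ins by (simp add: ennreal_plus[symmetric] sum_nonneg add.commute del: ennreal_plus)
  finally show ?case .
qed

text \<open>Expanding \<open>(S + f i y)^4\<close>, the terms linear in \<open>f i y\<close> or in
  \<open>S\<close> integrate to 0. The rest is at most \<open>3 C^2 + 6 C c + c^2\<close> for
  \<open>C\<close> the sum of the earlier bounds \<open>c\<close>, which is below
  \<open>3 (C + c)^2\<close>.\<close>

lemma (in prob_space) nn_integral_PiM_sum_power4:
  fixes f :: "'i \<Rightarrow> 'a \<Rightarrow> real"
  assumes "finite I" and m: "\<And>i. i \<in> I \<Longrightarrow> f i \<in> borel_measurable M"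
    and i4: "\<And>i. i \<in> I \<Longrightarrow> integrable M (\<lambda>x. (f i x)^4)" and z: "\<And>i. i \<in> I \<Longrightarrow> (\<integral>x. f i x \<partial>M) = 0"
    and c: "\<And>i. i \<in> I \<Longrightarrow> (\<integral>x. (f i x)^4 \<partial>M) \<le> (c i)\<^sup>2" "\<And>i. i \<in> I \<Longrightarrow> 0 \<le> c i"
  shows "(\<integral>\<^sup>+x. ennreal ((\<Sum>i\<in>I. f i (x i))^4) \<partial>(\<Pi>\<^sub>M i\<in>I. M)) \<le> ennreal (3 * (\<Sum>i\<in>I. c i)\<^sup>2)"
  using assms
proof induction
  case empty
  then show ?case by (simp add: PiM_empty nn_integral_count_space_finite)
next
  case (insert i I)
  interpret product_sigma_finite "\<lambda>_. M" by unfold_locales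
  interpret P: product_prob_space "\<lambda>_. M" by unfold_locales
  interpret PI: prob_space "\<Pi>\<^sub>M i\<in>I. M" by (rule prob_space_PiM) unfold_locales
  have fm [measurable]: "f j \<in> borel_measurable M" if "j \<in> insert i I" for j using insert.prems that by auto
  have ins: "finite I" "i \<notin> I" using insert by auto
  let ?S = "\<lambda>x. \<Sum>j\<in>I. f j (x j)"
  let ?P = "\<Pi>\<^sub>M j\<in>I. M"
  have int: "integrable M (\<lambda>x. (f j x)^a)" if "j \<in> insert i I" "a \<le> 4" for j a
    using integrable_power_mono[of "f j" 4 a] insert.prems(2)[of j] that by auto
  define m where "m a = (\<integral>x. (f i x)^a \<partial>M)" for a :: nat
  have m1: "m 1 = 0" using insert.prems(3)[of i] by (simp add: m_def)
  \<comment> \<open>The variance of \<open>(f j)^2\<close> is nonnegative, so the squared second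
    moment is at most the fourth moment.\<close>
  have m2le: "(\<integral>x. (f j x)^2 \<partial>M) \<le> c j" if "j \<in> insert i I" for j
  proof -
    have "0 \<le> (\<integral>x. ((f j x)^2 - (\<integral>x. (f j x)^2 \<partial>M))\<^sup>2 \<partial>M)" by simp
    also have "\<dots> = (\<integral>x. (f j x)^4 - 2 * (\<integral>x. (f j x)^2 \<partial>M) * (f j x)^2 + (\<integral>x. (f j x)^2 \<partial>M)\<^sup>2 \<partial>M)"
      by (intro Bochner_Integration.integral_cong) (auto simp: power2_eq_square power4_eq_xxxx algebra_simps)
    also have "\<dots> = (\<integral>x. (f j x)^4 \<partial>M) - (\<integral>x. (f j x)^2 \<partial>M)\<^sup>2"
      using int[OF that, of 2] int[OF that, of 4] by (simp add: prob_space power2_eq_square)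
    finally have "(\<integral>x. (f j x)^2 \<partial>M)\<^sup>2 \<le> (c j)\<^sup>2" using insert.prems(4)[OF that] by simp
    then show ?thesis using insert.prems(5)[OF that] by (rule power2_le_imp_le)
  qed
  have inner: "(\<integral>\<^sup>+y. ennreal ((s + f i y)^4) \<partial>M) = ennreal (s^4 + 6 * m 2 * s^2 + 4 * m 3 * s + m 4)" for s
  proof -
    have e: "s^4 + 4 * s^3 * f i y + 6 * s\<^sup>2 * (f i y)^2 + 4 * s * (f i y)^3 + (f i y)^4 = (s + f i y)^4" for y
      by (simp add: power4_eq_xxxx power3_eq_cube power2_eq_square algebra_simps)
    have "has_bochner_integral M (\<lambda>y. s^4 + (4 * s^3) * f i y + (6 * s\<^sup>2) * (f i y)^2 + (4 * s) * (f i y)^3 + (f i y)^4)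
       (s^4 + (4 * s^3) * m 1 + (6 * s\<^sup>2) * m 2 + (4 * s) * m 3 + m 4)"
      using int[of i 1] int[of i 2] int[of i 3] int[of i 4]
      by (intro has_bochner_integral_add has_bochner_integral_mult_right)
         (auto simp: has_bochner_integral_iff prob_space m_def)
    then have "has_bochner_integral M (\<lambda>y. (s + f i y)^4) (s^4 + 6 * m 2 * s^2 + 4 * m 3 * s + m 4)"
      unfolding e m1 by (simp add: ac_simps)
    then show ?thesis by (rule nn_integral_has_bochner_integral) simp
  qed
  have IH: "(\<integral>\<^sup>+x. ennreal ((?S x)^4) \<partial>?P) \<le> ennreal (3 * (\<Sum>i\<in>I. c i)\<^sup>2)"
    using insert by auto
  have S4: "integrable ?P (\<lambda>x. (?S x)^4)"
  proof (rule integrableI_nonneg)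
    show "(\<integral>\<^sup>+x. ennreal ((?S x)^4) \<partial>?P) < \<infinity>" using IH by (rule order_le_less_trans) simp
  qed auto
  have S4le: "(\<integral>x. (?S x)^4 \<partial>?P) \<le> 3 * (\<Sum>i\<in>I. c i)\<^sup>2"
  proof -
    have "ennreal (\<integral>x. (?S x)^4 \<partial>?P) = (\<integral>\<^sup>+x. ennreal ((?S x)^4) \<partial>?P)"
      using S4 by (subst nn_integral_eq_integral) auto
    then have "ennreal (\<integral>x. (?S x)^4 \<partial>?P) \<le> ennreal (3 * (\<Sum>i\<in>I. c i)\<^sup>2)" using IH by simp
    then show ?thesis by (subst (asm) ennreal_le_iff) auto
  qed
  have S2: "integrable ?P (\<lambda>x. (?S x)^2)" "integrable ?P ?S"
    using PI.integrable_power_mono[of ?S 4 2] PI.integrable_power_mono[of ?S 4 1] S4 by auto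
  have S0: "(\<integral>x. ?S x \<partial>?P) = 0"
    using insert.prems ins int[of _ 1]
    by (subst Bochner_Integration.integral_sum) (auto simp: integral_PiM_component)
  have S2le: "(\<integral>x. (?S x)^2 \<partial>?P) \<le> (\<Sum>i\<in>I. c i)"
  proof -
    have "ennreal (\<integral>x. (?S x)^2 \<partial>?P) = (\<integral>\<^sup>+x. ennreal ((?S x)^2) \<partial>?P)"
      using S2 by (subst nn_integral_eq_integral) auto
    also have "\<dots> = ennreal (\<Sum>i\<in>I. \<integral>x. (f i x)\<^sup>2 \<partial>M)"
      using ins insert.prems int[of _ 2] by (intro nn_integral_PiM_sum_square) auto
    finally have "(\<integral>x. (?S x)^2 \<partial>?P) = (\<Sum>i\<in>I. \<integral>x. (f i x)\<^sup>2 \<partial>M)"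
      by (subst (asm) ennreal_inj) (auto intro: sum_nonneg)
    also have "\<dots> \<le> (\<Sum>i\<in>I. c i)" using m2le by (intro sum_mono) auto
    finally show ?thesis .
  qed
  \<comment> \<open>The polynomial is the mean of \<open>(s + f i y)^4\<close>; its sign is needed
    to return from \<open>nn_integral\<close> to a Bochner integral.\<close>
  have nn: "0 \<le> s^4 + 6 * m 2 * s^2 + 4 * m 3 * s + m 4" for s
  proof -
    have e: "s^4 + 4 * s^3 * f i y + 6 * s\<^sup>2 * (f i y)^2 + 4 * s * (f i y)^3 + (f i y)^4 = (s + f i y)^4" for y
      by (simp add: power4_eq_xxxx power3_eq_cube power2_eq_square algebra_simps)
    have "has_bochner_integral M (\<lambda>y. s^4 + (4 * s^3) * f i y + (6 * s\<^sup>2) * (f i y)^2 + (4 * s) * (f i y)^3 + (f i y)^4)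
       (s^4 + (4 * s^3) * m 1 + (6 * s\<^sup>2) * m 2 + (4 * s) * m 3 + m 4)"
      using int[of i 1] int[of i 2] int[of i 3] int[of i 4]
      by (intro has_bochner_integral_add has_bochner_integral_mult_right)
         (auto simp: has_bochner_integral_iff prob_space m_def)
    then have "(\<integral>y. (s + f i y)^4 \<partial>M) = s^4 + 6 * m 2 * s^2 + 4 * m 3 * s + m 4"
      unfolding e m1 by (simp add: has_bochner_integral_iff ac_simps)
    then show ?thesis by (metis Bochner_Integration.integral_nonneg zero_le_even_power even_numeral)
  qed
  have "(\<integral>\<^sup>+x. ennreal ((\<Sum>j\<in>insert i I. f j (x j))^4) \<partial>(\<Pi>\<^sub>M j\<in>insert i I. M))
      = (\<integral>\<^sup>+x. (\<integral>\<^sup>+y. ennreal ((\<Sum>j\<in>insert i I. f j ((x(i := y)) j))^4) \<partial>M) \<partial>?P)"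
    using ins by (intro product_nn_integral_insert) measurable
  also have "\<dots> = (\<integral>\<^sup>+x. (\<integral>\<^sup>+y. ennreal ((?S x + f i y)^4) \<partial>M) \<partial>?P)"
  proof (intro nn_integral_cong arg_cong[where f = ennreal] arg_cong[where f = "\<lambda>x. x^4"])
    fix x y
    have "(\<Sum>j\<in>I. f j ((x(i := y)) j)) = ?S x" using ins by (intro sum.cong) auto
    then show "(\<Sum>j\<in>insert i I. f j ((x(i := y)) j)) = ?S x + f i y" using ins by simp
  qed
  also have "\<dots> = (\<integral>\<^sup>+x. ennreal ((?S x)^4 + 6 * m 2 * (?S x)^2 + 4 * m 3 * ?S x + m 4) \<partial>?P)"
    by (simp only: inner)
  also have "\<dots> = ennreal ((\<integral>x. (?S x)^4 \<partial>?P) + 6 * m 2 * (\<integral>x. (?S x)^2 \<partial>?P) + 4 * m 3 * 0 + m 4)"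
  proof (rule nn_integral_has_bochner_integral)
    show "has_bochner_integral ?P (\<lambda>x. (?S x)^4 + 6 * m 2 * (?S x)^2 + 4 * m 3 * ?S x + m 4)
      ((\<integral>x. (?S x)^4 \<partial>?P) + 6 * m 2 * (\<integral>x. (?S x)^2 \<partial>?P) + 4 * m 3 * 0 + m 4)"
      using S4 S2 S0
      by (intro has_bochner_integral_add has_bochner_integral_mult_right)
         (auto simp: has_bochner_integral_iff PI.prob_space)
  qed (use nn in auto)
  also have "\<dots> \<le> ennreal (3 * (\<Sum>i\<in>insert i I. c i)\<^sup>2)"
  proof (rule ennreal_leI)
    have "m 2 * (\<integral>x. (?S x)^2 \<partial>?P) \<le> c i * (\<Sum>i\<in>I. c i)"
      using m2le[of i] S2le insert.prems(5)[of i] by (intro mult_mono) (auto simp: m_def)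
    moreover have "m 4 \<le> (c i)\<^sup>2" using insert.prems(4)[of i] by (simp add: m_def)
    moreover have "3 * (\<Sum>i\<in>insert i I. c i)\<^sup>2 = 3 * (\<Sum>i\<in>I. c i)\<^sup>2 + 6 * (c i * (\<Sum>i\<in>I. c i)) + 3 * (c i)\<^sup>2"
      using ins by (simp add: power2_sum algebra_simps)
    moreover have "0 \<le> (c i)\<^sup>2" by simp
    ultimately show "(\<integral>x. (?S x)^4 \<partial>?P) + 6 * m 2 * (\<integral>x. (?S x)^2 \<partial>?P) + 4 * m 3 * 0 + m 4 \<le> 3 * (\<Sum>i\<in>insert i I. c i)\<^sup>2"
      using S4le by linarith
  qed
  finally show ?case .
qed

section \<open>Gaussian integrals and moments of Gaussian vectors\<close>

lemma has_bochner_integral_std_normal_iff: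
  fixes f :: "real \<Rightarrow> real"
  assumes [measurable]: "f \<in> borel_measurable borel"
  shows "has_bochner_integral std_normal_distribution f c \<longleftrightarrow>
    has_bochner_integral lborel (\<lambda>x. std_normal_density x * f x) c"
  by (simp add: has_bochner_integral_iff integral_density integrable_density)

text \<open>Completing the square: the integrand times the standard density is the constant
  \<open>C\<close> times a normal density of variance \<open>1 / (1 + 2 * a)\<close>.\<close>

lemma nn_integral_std_normal_exp_quadratic:
  fixes a b :: real
  assumes a: "0 < 1 + 2 * a"
  shows "(\<integral>\<^sup>+y. ennreal (exp (b * y - a * y\<^sup>2)) \<partial>std_normal_distribution)
    = ennreal (exp (b\<^sup>2 / (2 * (1 + 2 * a))) / sqrt (1 + 2 * a))"
proof -
  let ?s = "1 / sqrt (1 + 2 * a)" and ?m = "b / (1 + 2 * a)"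
  define C where "C = exp (b\<^sup>2 / (2 * (1 + 2 * a))) / sqrt (1 + 2 * a)"
  have eq: "std_normal_density y * exp (b * y - a * y\<^sup>2) = C * normal_density ?m ?s y" for y
  proof -
    have s2: "?s\<^sup>2 = 1 / (1 + 2 * a)" using a by (simp add: power_divide)
    define v where "v = 1 + 2 * a"
    have v: "0 < v" "a = (v - 1) / 2" using a by (simp_all add: v_def)
    have "- (y - 0)\<^sup>2 / (2 * 1\<^sup>2) + (b * y - a * y\<^sup>2) = b\<^sup>2 / (2 * v) + - (y - b / v)\<^sup>2 / (2 * (1 / v))"
      unfolding v(2) using v(1) by (simp add: field_simps power2_eq_square)
    then have "exp (- (y - 0)\<^sup>2 / (2 * 1\<^sup>2)) * exp (b * y - a * y\<^sup>2) = exp (b\<^sup>2 / (2 * (1 + 2 * a))) * exp (- (y - ?m)\<^sup>2 / (2 * ?s\<^sup>2))"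
      unfolding exp_add[symmetric] s2 v_def by (rule arg_cong)
    moreover have "sqrt (2 * pi * ?s\<^sup>2) = sqrt (2 * pi) / sqrt (1 + 2 * a)"
      using a by (simp add: s2 real_sqrt_divide)
    ultimately show ?thesis
      unfolding normal_density_def C_def using a by (simp add: field_simps)
  qed
  have "(\<integral>\<^sup>+y. ennreal (exp (b * y - a * y\<^sup>2)) \<partial>std_normal_distribution)
    = (\<integral>\<^sup>+y. ennreal (C * normal_density ?m ?s y) \<partial>lborel)"
    by (subst nn_integral_density) (auto simp: ennreal_mult[symmetric] eq)
  also have "\<dots> = ennreal C"
    using a by (subst nn_integral_eq_integral) (auto simp: C_def)
  finally show ?thesis by (simp add: C_def)
qed

abbreviation gauss :: "nat \<Rightarrow> (nat \<Rightarrow> real) measure" where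
  "gauss d \<equiv> (\<Pi>\<^sub>M k\<in>{..<d}. std_normal_distribution)"

lemma prob_space_gauss: "prob_space (gauss d)"
  by (intro prob_space_PiM prob_space_normal_density) simp

lemma measurable_gauss_component:
  assumes "f \<in> M \<rightarrow>\<^sub>M gauss d" "k < d"
  shows "(\<lambda>w. f w k) \<in> borel_measurable M"
proof -
  have "(\<lambda>w. f w k) \<in> M \<rightarrow>\<^sub>M std_normal_distribution"
    using measurable_compose[OF assms(1) measurable_component_singleton[of k "{..<d}"]] assms(2) by simp
  then show ?thesis by simp
qed

lemma vec_inner_gauss_measurable [measurable]:
  assumes "f \<in> M \<rightarrow>\<^sub>M gauss d" "g \<in> M \<rightarrow>\<^sub>M gauss d"
  shows "(\<lambda>w. vec_inner d (f w) (g w)) \<in> borel_measurable M"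
  unfolding vec_inner_def
  using measurable_gauss_component[OF assms(1)] measurable_gauss_component[OF assms(2)]
  by (intro borel_measurable_sum borel_measurable_times) auto

lemma vec_inner_gauss_measurable' [measurable]:
  assumes "f \<in> M \<rightarrow>\<^sub>M gauss d"
  shows "(\<lambda>w. vec_inner d x (f w)) \<in> borel_measurable M"
  unfolding vec_inner_def
  using measurable_gauss_component[OF assms(1)]
  by (intro borel_measurable_sum borel_measurable_times) auto

interpretation std_normal: prob_space std_normal_distribution
  by (rule prob_space_normal_density) simp

lemma std_normal_moment2: "(\<integral>x. x\<^sup>2 \<partial>std_normal_distribution) = 1"
  using std_normal_distribution_even_moments(1)[of 1] by simp

lemma std_normal_moment4: "(\<integral>x. x^4 \<partial>std_normal_distribution) = 3"
  using std_normal_distribution_even_moments(1)[of 2] by (simp add: fact_numeral)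

lemma std_normal_moment1: "(\<integral>x. x \<partial>std_normal_distribution) = 0"
  using integral_std_normal_distribution_moment_odd[of 1] by simp

lemma nn_integral_gauss_inner_square:
  "(\<integral>\<^sup>+y. ennreal ((vec_inner d x y)\<^sup>2) \<partial>gauss d) = ennreal (vec_inner d x x)"
proof -
  have "(\<integral>\<^sup>+y. ennreal ((\<Sum>k<d. x k * y k)\<^sup>2) \<partial>gauss d) = ennreal (\<Sum>k<d. \<integral>y. (x k * y)\<^sup>2 \<partial>std_normal_distribution)"
    using integrable_std_normal_distribution_moment[of 2]
    by (intro std_normal.nn_integral_PiM_sum_square) (auto simp: power_mult_distrib std_normal_moment1)
  also have "(\<Sum>k<d. \<integral>y. (x k * y)\<^sup>2 \<partial>std_normal_distribution) = (\<Sum>k<d. (x k)\<^sup>2)"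
    by (simp add: power_mult_distrib std_normal_moment2)
  finally show ?thesis by (simp add: vec_inner_def power2_eq_square)
qed

lemma nn_integral_gauss_inner_power4:
  "(\<integral>\<^sup>+y. ennreal ((vec_inner d x y)^4) \<partial>gauss d) \<le> ennreal (9 * (vec_inner d x x)\<^sup>2)"
proof -
  \<comment> \<open>The standard normal has fourth moment 3, so
    \<open>sqrt 3 * (x k)\<^sup>2\<close> is an admissible bound for each term; the factor 9 is 3
    times the square of \<open>sqrt 3\<close>.\<close>
  have "(\<integral>\<^sup>+y. ennreal ((\<Sum>k<d. x k * y k)^4) \<partial>gauss d) \<le> ennreal (3 * (\<Sum>k<d. sqrt 3 * (x k)\<^sup>2)\<^sup>2)"
    using integrable_std_normal_distribution_moment[of 4]
    by (intro std_normal.nn_integral_PiM_sum_power4) (auto simp: power_mult_distrib std_normal_moment1 std_normal_moment4)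
  also have "3 * (\<Sum>k<d. sqrt 3 * (x k)\<^sup>2)\<^sup>2 = 9 * (vec_inner d x x)\<^sup>2"
    by (simp add: vec_inner_def sum_distrib_left[symmetric] power_mult_distrib power2_eq_square)
  finally show ?thesis by (simp add: vec_inner_def)
qed

lemma nn_integral_gauss_norm_square:
  "(\<integral>\<^sup>+y. ennreal (vec_inner d y y) \<partial>gauss d) = ennreal d"
proof -
  have "(\<integral>\<^sup>+y. ennreal (vec_inner d y y) \<partial>gauss d) = (\<integral>\<^sup>+y. (\<Sum>k<d. ennreal ((y k)\<^sup>2)) \<partial>gauss d)"
    by (simp add: vec_inner_def power2_eq_square)
  also have "\<dots> = (\<Sum>k<d. \<integral>\<^sup>+y. ennreal ((y k)\<^sup>2) \<partial>gauss d)"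
    by (rule nn_integral_sum) measurable
  also have "\<dots> = (\<Sum>k<d. \<integral>\<^sup>+y. ennreal (y\<^sup>2) \<partial>std_normal_distribution)"
    by (intro sum.cong refl std_normal.nn_integral_PiM_component) auto
  also have "(\<integral>\<^sup>+y. ennreal (y\<^sup>2) \<partial>std_normal_distribution) = ennreal 1"
    using integrable_std_normal_distribution_moment[of 2]
    by (subst nn_integral_eq_integral) (auto simp: std_normal_moment2)
  finally show ?thesis by (simp add: ennreal_of_nat_eq_real_of_nat)
qed

text \<open>Cauchy-Schwarz replaces the squared sum of squares by \<open>d\<close> times the sum of
  fourth powers, each of mean 3.\<close>

lemma nn_integral_gauss_norm_power4:
  "(\<integral>\<^sup>+y. ennreal ((vec_inner d y y)\<^sup>2) \<partial>gauss d) \<le> ennreal (3 * (real d)\<^sup>2)"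
proof -
  have le: "(vec_inner d y y)\<^sup>2 \<le> real d * (\<Sum>k<d. (y k)^4)" for y
    using Cauchy_Schwarz_ineq_sum[of "\<lambda>_. 1" "\<lambda>k. (y k)\<^sup>2" "{..<d}"]
    by (simp add: vec_inner_def power2_eq_square power4_eq_xxxx mult.assoc)
  have "(\<integral>\<^sup>+y. ennreal ((vec_inner d y y)\<^sup>2) \<partial>gauss d) \<le> (\<integral>\<^sup>+y. ennreal d * (\<Sum>k<d. ennreal ((y k)^4)) \<partial>gauss d)"
  proof (rule nn_integral_mono)
    fix y show "ennreal ((vec_inner d y y)\<^sup>2) \<le> ennreal d * (\<Sum>k<d. ennreal ((y k)^4))"
      using ennreal_leI[OF le[of y]] by (simp add: ennreal_mult sum_nonneg sum_ennreal)
  qed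
  also have "\<dots> = ennreal d * (\<integral>\<^sup>+y. (\<Sum>k<d. ennreal ((y k)^4)) \<partial>gauss d)"
    by (rule nn_integral_cmult) measurable
  also have "(\<integral>\<^sup>+y. (\<Sum>k<d. ennreal ((y k)^4)) \<partial>gauss d) = (\<Sum>k<d. \<integral>\<^sup>+y. ennreal ((y k)^4) \<partial>gauss d)"
    by (rule nn_integral_sum) measurable
  also have "\<dots> = (\<Sum>k<d. \<integral>\<^sup>+y. ennreal (y^4) \<partial>std_normal_distribution)"
    by (intro sum.cong refl std_normal.nn_integral_PiM_component) auto
  also have "(\<integral>\<^sup>+y. ennreal (y^4) \<partial>std_normal_distribution) = ennreal 3"
    using integrable_std_normal_distribution_moment[of 4]
    by (subst nn_integral_eq_integral) (auto simp: std_normal_moment4)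
  also have "ennreal d * (\<Sum>k<d. ennreal 3) = ennreal (3 * (real d)\<^sup>2)"
    by (simp add: ennreal_of_nat_eq_real_of_nat ennreal_mult[symmetric] power2_eq_square ac_simps del: ennreal_numeral)
  finally show ?thesis .
qed

section \<open>Mehler weights\<close>

text \<open>The closed form of the Mehler kernel at parameter \<open>- \<rho>\<close>.\<close>

definition mehler1 :: "real \<Rightarrow> real \<Rightarrow> real \<Rightarrow> real" where
  "mehler1 \<rho> x y = exp (- (\<rho>\<^sup>2 * (x\<^sup>2 + y\<^sup>2) + 2 * \<rho> * x * y) / (2 * (1 - \<rho>\<^sup>2))) / sqrt (1 - \<rho>\<^sup>2)"

text \<open>The density of the law of a correlated Gaussian pair, with correlation \<open>-\<rho>\<close>, with respect to
  that of an independent pair.\<close>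

definition mehler :: "nat \<Rightarrow> real \<Rightarrow> (nat \<Rightarrow> real) \<Rightarrow> (nat \<Rightarrow> real) \<Rightarrow> real" where
  "mehler d \<rho> x y = (\<Prod>l<d. mehler1 \<rho> (x l) (y l))"

lemma mehler1_nonneg: "0 \<le> mehler1 \<rho> x y" if "\<rho>\<^sup>2 < 1"
  using that by (simp add: mehler1_def)

lemma mehler1_commute: "mehler1 \<rho> x y = mehler1 \<rho> y x"
  by (simp add: mehler1_def ac_simps)

lemma mehler1_measurable [measurable]:
  "f \<in> borel_measurable M \<Longrightarrow> g \<in> borel_measurable M \<Longrightarrow> (\<lambda>w. mehler1 \<rho> (f w) (g w)) \<in> borel_measurable M"
  unfolding mehler1_def by simp

text \<open>The conditional law of \<open>y\<close> given \<open>x\<close> for a standard pair of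
  correlation \<open>- \<rho>\<close>. Mass and mean of the weight are read off the normal density
  on the right.\<close>

lemma mehler1_density:
  assumes "\<rho>\<^sup>2 < 1"
  shows "std_normal_density y * mehler1 \<rho> x y = normal_density (- \<rho> * x) (sqrt (1 - \<rho>\<^sup>2)) y"
proof -
  let ?s = "1 - \<rho>\<^sup>2"
  have s: "0 < ?s" using assms by simp
  have "exp (- (y - 0)\<^sup>2 / (2 * 1\<^sup>2)) * exp (- (\<rho>\<^sup>2 * (x\<^sup>2 + y\<^sup>2) + 2 * \<rho> * x * y) / (2 * ?s))
      = exp (- (y - - \<rho> * x)\<^sup>2 / (2 * (sqrt ?s)\<^sup>2))"
    unfolding exp_add[symmetric] using s
    by (intro arg_cong[where f = exp]) (simp add: field_simps, simp add: power2_eq_square power4_eq_xxxx algebra_simps)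
  moreover have "sqrt (2 * pi * (sqrt ?s)\<^sup>2) = sqrt (2 * pi) * sqrt ?s"
    using s by (simp add: real_sqrt_mult)
  ultimately show ?thesis
    unfolding normal_density_def mehler1_def using s by (simp add: field_simps)
qed

lemma has_bochner_integral_mehler1:
  assumes "\<rho>\<^sup>2 < 1"
  shows "has_bochner_integral std_normal_distribution (mehler1 \<rho> x) 1"
    "has_bochner_integral std_normal_distribution (\<lambda>y. mehler1 \<rho> x y * y) (- \<rho> * x)"
proof -
  have s: "0 < sqrt (1 - \<rho>\<^sup>2)" using assms by simp
  show "has_bochner_integral std_normal_distribution (mehler1 \<rho> x) 1"
    using s by (subst has_bochner_integral_std_normal_iff)
      (auto simp: mehler1_density[OF assms] has_bochner_integral_iff)
  show "has_bochner_integral std_normal_distribution (\<lambda>y. mehler1 \<rho> x y * y) (- \<rho> * x)"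
    using normal_moment_nz_1[OF s, of "- \<rho> * x"]
    by (subst has_bochner_integral_std_normal_iff) (auto simp: mult.assoc[symmetric] mehler1_density[OF assms])
qed

text \<open>The fourth power is again the exponential of a quadratic in \<open>y\<close>, namely
  \<open>C * exp (b * y - a * y\<^sup>2)\<close>. The integral grows like a Gaussian exponential in
  \<open>x\<close>, so that integrating over \<open>x\<close> as well restricts \<rho>.\<close>

lemma nn_integral_mehler1_power4:
  assumes \<rho>: "\<rho>\<^sup>2 < 1"
  shows "(\<integral>\<^sup>+y. ennreal (mehler1 \<rho> x y ^ 4) \<partial>std_normal_distribution)
    = ennreal (exp (6 * \<rho>\<^sup>2 / (1 + 3 * \<rho>\<^sup>2) * x\<^sup>2) * (1 / ((1 - \<rho>\<^sup>2)\<^sup>2 * sqrt ((1 + 3 * \<rho>\<^sup>2) / (1 - \<rho>\<^sup>2)))))"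
proof -
  define s where "s = 1 - \<rho>\<^sup>2"
  have s: "0 < s" "\<rho>\<^sup>2 = 1 - s" "s \<le> 1" using assms by (auto simp: s_def)
  define a where "a = 2 * \<rho>\<^sup>2 / s"
  define b where "b = - 4 * \<rho> * x / s"
  have a1: "1 + 2 * a = (1 + 3 * \<rho>\<^sup>2) / s" using s by (simp add: a_def field_simps)
  have apos: "0 < 1 + 2 * a" unfolding a1 using s by (simp add: add_pos_nonneg)
  define C where "C = exp (- 2 * \<rho>\<^sup>2 * x\<^sup>2 / s) / s\<^sup>2"
  have "mehler1 \<rho> x y ^ 4 = C * exp (b * y - a * y\<^sup>2)" for y
  proof -
    have "mehler1 \<rho> x y ^ 4 = exp (4 * (- (\<rho>\<^sup>2 * (x\<^sup>2 + y\<^sup>2) + 2 * \<rho> * x * y) / (2 * s))) / s\<^sup>2"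
    proof -
      have "exp e ^ 4 = exp (4 * e)" for e :: real by (simp add: exp_of_nat_mult[symmetric])
      moreover have "sqrt s ^ 4 = s\<^sup>2"
        using s power_mult[of "sqrt s" 2 2] by simp
      ultimately show ?thesis
        unfolding mehler1_def s_def[symmetric] power_divide by simp
    qed
    also have "4 * (- (\<rho>\<^sup>2 * (x\<^sup>2 + y\<^sup>2) + 2 * \<rho> * x * y) / (2 * s)) = - 2 * \<rho>\<^sup>2 * x\<^sup>2 / s + (b * y - a * y\<^sup>2)"
      using s by (simp add: a_def b_def field_simps)
    finally show ?thesis by (simp only: exp_add C_def) simp
  qed
  then have "(\<integral>\<^sup>+y. ennreal (mehler1 \<rho> x y ^ 4) \<partial>std_normal_distribution)
    = (\<integral>\<^sup>+y. ennreal C * ennreal (exp (b * y - a * y\<^sup>2)) \<partial>std_normal_distribution)"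
    by (simp add: C_def ennreal_mult[symmetric])
  also have "\<dots> = ennreal C * ennreal (exp (b\<^sup>2 / (2 * (1 + 2 * a))) / sqrt (1 + 2 * a))"
    by (subst nn_integral_cmult) (auto simp: nn_integral_std_normal_exp_quadratic[OF apos])
  also have "\<dots> = ennreal (C * (exp (b\<^sup>2 / (2 * (1 + 2 * a))) / sqrt (1 + 2 * a)))"
    using apos by (intro ennreal_mult[symmetric]) (auto simp: C_def)
  also have "C * (exp (b\<^sup>2 / (2 * (1 + 2 * a))) / sqrt (1 + 2 * a))
     = exp (- 2 * \<rho>\<^sup>2 * x\<^sup>2 / s + b\<^sup>2 / (2 * (1 + 2 * a))) * (1 / (s\<^sup>2 * sqrt (1 + 2 * a)))"
    unfolding exp_add C_def by simp
  also have "- 2 * \<rho>\<^sup>2 * x\<^sup>2 / s + b\<^sup>2 / (2 * (1 + 2 * a)) = 6 * \<rho>\<^sup>2 / (1 + 3 * \<rho>\<^sup>2) * x\<^sup>2"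
  proof -
    have p: "1 + 3 * \<rho>\<^sup>2 \<noteq> 0" by (smt (verit) zero_le_power2)
    have "b\<^sup>2 / (2 * (1 + 2 * a)) = 8 * \<rho>\<^sup>2 * x\<^sup>2 / (s * (1 + 3 * \<rho>\<^sup>2))"
    proof -
      define q where "q = 1 + 3 * \<rho>\<^sup>2"
      have b2: "b\<^sup>2 = 16 * (\<rho>\<^sup>2 * x\<^sup>2) / (s * s)"
        by (simp add: b_def power_divide power_mult_distrib power2_eq_square[of s])
      show ?thesis unfolding a1 b2 q_def[symmetric] using s(1) p[folded q_def] by (simp add: field_simps)
    qed
    moreover have "- 2 * \<rho>\<^sup>2 * x\<^sup>2 / s = - 2 * \<rho>\<^sup>2 * x\<^sup>2 * (1 + 3 * \<rho>\<^sup>2) / (s * (1 + 3 * \<rho>\<^sup>2))"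
      using p by simp
    ultimately have "- 2 * \<rho>\<^sup>2 * x\<^sup>2 / s + b\<^sup>2 / (2 * (1 + 2 * a))
       = (8 * \<rho>\<^sup>2 * x\<^sup>2 - 2 * \<rho>\<^sup>2 * x\<^sup>2 * (1 + 3 * \<rho>\<^sup>2)) / (s * (1 + 3 * \<rho>\<^sup>2))"
      by (simp add: diff_divide_distrib)
    also have "8 * \<rho>\<^sup>2 * x\<^sup>2 - 2 * \<rho>\<^sup>2 * x\<^sup>2 * (1 + 3 * \<rho>\<^sup>2) = s * (6 * \<rho>\<^sup>2 * x\<^sup>2)"
      by (simp add: s_def algebra_simps)
    finally show ?thesis using s by simp
  qed
  finally show ?thesis unfolding a1 by (simp add: s_def)
qed

text \<open>The second integration converges only while \<open>9 * \<rho>\<^sup>2 < 1\<close>; the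
  bound 1/4 on \<rho> keeps a margin in which the result is \<open>exp\<close> of a multiple of
  \<open>\<rho>\<^sup>2\<close>.\<close>

lemma nn_integral_mehler1_power4_joint:
  assumes \<rho>: "\<bar>\<rho>\<bar> \<le> 1 / 4"
  shows "(\<integral>\<^sup>+x. (\<integral>\<^sup>+y. ennreal (mehler1 \<rho> x y ^ 4) \<partial>std_normal_distribution) \<partial>std_normal_distribution)
    \<le> ennreal (exp (14 * \<rho>\<^sup>2))"
proof -
  define r where "r = \<rho>\<^sup>2"
  have "\<bar>\<rho>\<bar>\<^sup>2 \<le> (1 / 4)\<^sup>2" using \<rho> by (intro power_mono) auto
  then have r: "0 \<le> r" "r \<le> 1 / 16" by (auto simp: r_def power2_eq_square)
  have r1: "\<rho>\<^sup>2 < 1" using r by (simp add: r_def)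
  define a where "a = - 6 * r / (1 + 3 * r)"
  have a1: "1 + 2 * a = (1 - 9 * r) / (1 + 3 * r)" using r by (simp add: a_def field_simps)
  have apos: "0 < 1 + 2 * a" unfolding a1 using r by simp
  define K where "K = 1 / ((1 - r)\<^sup>2 * sqrt ((1 + 3 * r) / (1 - r)))"
  have K: "0 \<le> K" using r by (simp add: K_def)
  have "(\<integral>\<^sup>+x. (\<integral>\<^sup>+y. ennreal (mehler1 \<rho> x y ^ 4) \<partial>std_normal_distribution) \<partial>std_normal_distribution)
     = (\<integral>\<^sup>+x. ennreal (exp (0 * x - a * x\<^sup>2)) * ennreal K \<partial>std_normal_distribution)"
    using K unfolding nn_integral_mehler1_power4[OF r1] r_def[symmetric] a_def K_def[symmetric]
    by (intro nn_integral_cong) (simp add: ennreal_mult)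
  also have "\<dots> = ennreal (1 / sqrt (1 + 2 * a)) * ennreal K"
    by (subst nn_integral_multc) (auto simp: nn_integral_std_normal_exp_quadratic[OF apos, of 0, simplified])
  also have "\<dots> = ennreal (1 / sqrt (1 + 2 * a) * K)"
    using K apos by (intro ennreal_mult[symmetric]) auto
  also have "\<dots> \<le> ennreal (exp (14 * r))"
  proof (rule ennreal_leI, rule power2_le_imp_le)
    have e1: "1 / (1 - z) \<le> exp (z / (1 - z))" if "z < 1" for z :: real
      using exp_ge_add_one_self[of "z / (1 - z)"] that by (simp add: field_simps)
    have "(1 / sqrt (1 + 2 * a) * K)\<^sup>2 = (1 / (1 - r)) ^ 3 * (1 / (1 - 9 * r))"
    proof -
      have eq: "(1 / sqrt (1 + 2 * a) * K)\<^sup>2 = 1 / (1 + 2 * a) * (1 / ((1 - r)^4 * ((1 + 3 * r) / (1 - r))))"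
        unfolding K_def power_mult_distrib power_divide power_one
        using r apos by (simp add: power_mult[symmetric])
      have gen: "1 / (u / v) * (1 / (w^4 * (v / w))) = (1 / w) ^ 3 * (1 / u)"
        if "0 < u" "0 < v" "0 < w" for u v w :: real
        using that by (simp add: power_divide power4_eq_xxxx power3_eq_cube)
      show ?thesis by (rule trans[OF eq[unfolded a1[symmetric]]], unfold a1, rule gen) (use r in auto)
    qed
    also have "\<dots> \<le> exp (r / (1 - r)) ^ 3 * exp (9 * r / (1 - 9 * r))"
      using r e1[of r] e1[of "9 * r"] by (intro mult_mono power_mono) auto
    also have "\<dots> = exp (3 * (r / (1 - r)) + 9 * r / (1 - 9 * r))"
      by (simp add: exp_add exp_of_nat_mult[symmetric])
    \<comment> \<open>For \<open>r\<close> up to 1/16 the exponents are at most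
      \<open>3 * 2 r\<close> and \<open>21 r\<close>, together below \<open>28 r\<close>. This
      bounds the square, so the lemma gets 14.\<close>
    also have "\<dots> \<le> exp (28 * r)"
    proof -
      have "r / (1 - r) \<le> 2 * r" "9 * r / (1 - 9 * r) \<le> 21 * r"
        using r mult_left_mono[of r "1/16" r] by (auto simp: divide_le_eq algebra_simps)
      then show ?thesis using r by simp
    qed
    also have "\<dots> = (exp (14 * r))\<^sup>2" by (simp add: exp_of_nat_mult[symmetric] power2_eq_square exp_add[symmetric])
    finally show "(1 / sqrt (1 + 2 * a) * K)\<^sup>2 \<le> (exp (14 * r))\<^sup>2" .
  qed simp
  finally show ?thesis by (simp add: r_def)
qed

lemma mehler_nonneg: "\<rho>\<^sup>2 < 1 \<Longrightarrow> 0 \<le> mehler d \<rho> x y"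
  unfolding mehler_def by (intro prod_nonneg) (auto intro: mehler1_nonneg)

lemma mehler_commute: "mehler d \<rho> x y = mehler d \<rho> y x"
  unfolding mehler_def by (simp add: mehler1_commute)

lemma mehler_measurable [measurable]:
  assumes "f \<in> M \<rightarrow>\<^sub>M gauss d" "g \<in> M \<rightarrow>\<^sub>M gauss d"
  shows "(\<lambda>w. mehler d \<rho> (f w) (g w)) \<in> borel_measurable M"
  unfolding mehler_def
  using measurable_gauss_component[OF assms(1)] measurable_gauss_component[OF assms(2)]
  by (intro borel_measurable_prod mehler1_measurable) auto

lemma mehler_measurable' [measurable]:
  assumes "f \<in> M \<rightarrow>\<^sub>M gauss d"
  shows "(\<lambda>w. mehler d \<rho> x (f w)) \<in> borel_measurable M"
  unfolding mehler_def
  using measurable_gauss_component[OF assms(1)]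
  by (intro borel_measurable_prod mehler1_measurable) auto

interpretation std_normal_product: product_sigma_finite "\<lambda>_::nat. std_normal_distribution"
  by unfold_locales

text \<open>Given \<open>x\<close>, the weight is a probability density under which \<open>y\<close>
  has mean \<open>- \<rho>\<close> times \<open>x\<close>. Mass 1 keeps row sums near their number
  of terms, and the mean supplies the negative bias.\<close>

lemma has_bochner_integral_mehler:
  assumes "\<rho>\<^sup>2 < 1"
  shows "has_bochner_integral (gauss d) (mehler d \<rho> x) 1"
    "l < d \<Longrightarrow> has_bochner_integral (gauss d) (\<lambda>y. mehler d \<rho> x y * y l) (- \<rho> * x l)"
proof -
  have gen: "has_bochner_integral (gauss d) (\<lambda>y. \<Prod>k<d. f k (y k)) (\<Prod>k<d. c k)"
    if "\<And>k. k < d \<Longrightarrow> has_bochner_integral std_normal_distribution (f k) (c k)"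
    for f :: "nat \<Rightarrow> real \<Rightarrow> real" and c
  proof -
    have "(\<integral>y. (\<Prod>k<d. f k (y k)) \<partial>gauss d) = (\<Prod>k<d. \<integral>y. f k y \<partial>std_normal_distribution)"
      using that by (intro std_normal_product.product_integral_prod) (auto simp: has_bochner_integral_iff)
    also have "\<dots> = (\<Prod>k<d. c k)"
      using that by (intro prod.cong) (auto simp: has_bochner_integral_iff)
    finally show ?thesis
      using that by (auto simp: has_bochner_integral_iff intro!: std_normal_product.product_integrable_prod)
  qed
  show "has_bochner_integral (gauss d) (mehler d \<rho> x) 1"
    using gen[of "\<lambda>k. mehler1 \<rho> (x k)" "\<lambda>_. 1"] has_bochner_integral_mehler1(1)[OF assms]
    by (simp add: mehler_def[abs_def])
  assume l: "l < d"
  have "has_bochner_integral (gauss d) (\<lambda>y. \<Prod>k<d. (if k = l then \<lambda>y. mehler1 \<rho> (x l) y * y else mehler1 \<rho> (x k)) (y k))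
     (\<Prod>k<d. if k = l then - \<rho> * x l else 1)"
    using has_bochner_integral_mehler1[OF assms] by (intro gen) auto
  moreover have "(\<Prod>k<d. (if k = l then \<lambda>y. mehler1 \<rho> (x l) y * y else mehler1 \<rho> (x k)) (y k)) = mehler d \<rho> x y * y l" for y :: "nat \<Rightarrow> real"
  proof -
    have "(\<Prod>k<d. (if k = l then \<lambda>y. mehler1 \<rho> (x l) y * y else mehler1 \<rho> (x k)) (y k))
      = (\<Prod>k<d. mehler1 \<rho> (x k) (y k) * (if k = l then y l else 1))"
      by (intro prod.cong) auto
    then show ?thesis using l by (simp add: mehler_def prod.distrib)
  qed
  ultimately show "has_bochner_integral (gauss d) (\<lambda>y. mehler d \<rho> x y * y l) (- \<rho> * x l)"
    using l by simp
qed

lemma integrable_mehler_power4: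
  assumes "\<rho>\<^sup>2 < 1"
  shows "integrable (gauss d) (\<lambda>y. mehler d \<rho> x y ^ 4)"
proof -
  have "integrable std_normal_distribution (\<lambda>y. mehler1 \<rho> t y ^ 4)" for t
    by (rule integrableI_nonneg) (auto simp: nn_integral_mehler1_power4[OF assms] ennreal_mult_less_top)
  then show ?thesis
    unfolding mehler_def prod_power_distrib
    by (intro std_normal_product.product_integrable_prod) auto
qed

lemma nn_integral_mehler_power4_joint:
  assumes "\<bar>\<rho>\<bar> \<le> 1 / 4"
  shows "(\<integral>\<^sup>+x. (\<integral>\<^sup>+y. ennreal (mehler d \<rho> x y ^ 4) \<partial>gauss d) \<partial>gauss d) \<le> ennreal (exp (14 * \<rho>\<^sup>2 * d))"
proof -
  have "\<bar>\<rho>\<bar>\<^sup>2 \<le> (1 / 4)\<^sup>2" using assms by (intro power_mono) auto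
  then have r1: "\<rho>\<^sup>2 < 1" by (auto simp: power2_eq_square)
  have nn: "0 \<le> mehler1 \<rho> x y" for x y using mehler1_nonneg[OF r1] .
  have "(\<integral>\<^sup>+x. (\<integral>\<^sup>+y. ennreal (mehler d \<rho> x y ^ 4) \<partial>gauss d) \<partial>gauss d)
    = (\<integral>\<^sup>+x. (\<Prod>l<d. \<integral>\<^sup>+y. ennreal (mehler1 \<rho> (x l) y ^ 4) \<partial>std_normal_distribution) \<partial>gauss d)"
  proof (rule nn_integral_cong)
    fix x
    have "(\<integral>\<^sup>+y. ennreal (mehler d \<rho> x y ^ 4) \<partial>gauss d) = (\<integral>\<^sup>+y. (\<Prod>l<d. ennreal (mehler1 \<rho> (x l) (y l) ^ 4)) \<partial>gauss d)"
      using nn by (simp add: mehler_def prod_power_distrib prod_ennreal)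
    also have "\<dots> = (\<Prod>l<d. \<integral>\<^sup>+y. ennreal (mehler1 \<rho> (x l) y ^ 4) \<partial>std_normal_distribution)"
      by (rule std_normal_product.product_nn_integral_prod) auto
    finally show "(\<integral>\<^sup>+y. ennreal (mehler d \<rho> x y ^ 4) \<partial>gauss d) = \<dots>" .
  qed
  also have "\<dots> = (\<Prod>l<d. \<integral>\<^sup>+x. (\<integral>\<^sup>+y. ennreal (mehler1 \<rho> x y ^ 4) \<partial>std_normal_distribution) \<partial>std_normal_distribution)"
    by (rule std_normal_product.product_nn_integral_prod) measurable
  also have "\<dots> \<le> (\<Prod>l<d. ennreal (exp (14 * \<rho>\<^sup>2)))"
    using nn_integral_mehler1_power4_joint[OF assms] unfolding prod_constant by (intro power_mono) auto
  also have "\<dots> = ennreal (exp (14 * \<rho>\<^sup>2 * d))"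
    by (simp add: ennreal_power exp_of_nat_mult[symmetric] mult.commute)
  finally show ?thesis .
qed

lemma integrable_gauss_component_power4:
  assumes "l < d" shows "integrable (gauss d) (\<lambda>y. (y l)^4)"
  using std_normal.integral_PiM_component(2)[of "{..<d}" l "\<lambda>y. y^4"] assms
    integrable_std_normal_distribution_moment[of 4] by simp

lemma integrable_gauss_inner_power4: "integrable (gauss d) (\<lambda>y. (vec_inner d x y)^4)"
proof (rule integrableI_nonneg)
  show "(\<integral>\<^sup>+y. ennreal ((vec_inner d x y)^4) \<partial>gauss d) < \<infinity>"
    by (rule order_le_less_trans[OF nn_integral_gauss_inner_power4]) simp
qed (auto, measurable)

lemma square_mult_le_powers4: "(a * b)\<^sup>2 \<le> (t * a^4 + b^4 / t) / 2" if "0 < t" for a b t :: real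
proof -
  have "0 \<le> (t * a\<^sup>2 - b\<^sup>2)\<^sup>2 / t" using that by simp
  also have "\<dots> = t * a^4 + b^4 / t - 2 * (a * b)\<^sup>2"
    using that by (simp add: power2_eq_square power4_eq_xxxx field_simps)
  finally show ?thesis by simp
qed

lemma integrable_mehler_mult_square:
  assumes "\<rho>\<^sup>2 < 1" "integrable (gauss d) (\<lambda>y. (f y)^4)" and [measurable]: "f \<in> borel_measurable (gauss d)"
  shows "integrable (gauss d) (\<lambda>y. (mehler d \<rho> x y * f y)\<^sup>2)"
proof (rule Bochner_Integration.integrable_bound)
  show "integrable (gauss d) (\<lambda>y. (1 * mehler d \<rho> x y ^ 4 + (f y)^4 / 1) / 2)"
    using integrable_mehler_power4[OF assms(1), of d x] assms(2) by auto
  show "AE y in gauss d. norm ((mehler d \<rho> x y * f y)\<^sup>2) \<le> norm ((1 * mehler d \<rho> x y ^ 4 + (f y)^4 / 1) / 2)"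
    using square_mult_le_powers4[of 1] by (intro AE_I2) simp
qed measurable

text \<open>Young's inequality against the fourth moment of the Mehler weight.\<close>

lemma nn_integral_mehler_mult_square:
  assumes \<rho>: "\<bar>\<rho>\<bar> \<le> 1 / 4" and t: "0 < t" and K: "0 \<le> K"
    and [measurable]: "case_prod f \<in> borel_measurable (gauss d \<Otimes>\<^sub>M gauss d)"
    and f4: "(\<integral>\<^sup>+x. (\<integral>\<^sup>+y. ennreal ((f x y)^4) \<partial>gauss d) \<partial>gauss d) \<le> ennreal K"
  shows "(\<integral>\<^sup>+x. (\<integral>\<^sup>+y. ennreal ((mehler d \<rho> x y * f x y)\<^sup>2) \<partial>gauss d) \<partial>gauss d)
    \<le> ennreal ((t * exp (14 * \<rho>\<^sup>2 * d) + K / t) / 2)"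
proof -
  interpret G: prob_space "gauss d" by (rule prob_space_gauss)
  interpret GG: pair_prob_space "gauss d" "gauss d" by unfold_locales
  have [measurable]: "(\<lambda>p. mehler d \<rho> (fst p) (snd p)) \<in> borel_measurable (gauss d \<Otimes>\<^sub>M gauss d)" by measurable
  have [measurable]: "(\<lambda>p. f (fst p) (snd p)) \<in> borel_measurable (gauss d \<Otimes>\<^sub>M gauss d)"
    using assms(3) by (simp add: case_prod_beta')
  let ?M = "gauss d \<Otimes>\<^sub>M gauss d"
  have "(\<integral>\<^sup>+x. (\<integral>\<^sup>+y. ennreal ((mehler d \<rho> x y * f x y)\<^sup>2) \<partial>gauss d) \<partial>gauss d)
     = (\<integral>\<^sup>+p. ennreal ((mehler d \<rho> (fst p) (snd p) * f (fst p) (snd p))\<^sup>2) \<partial>?M)"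
    by (subst G.nn_integral_fst[symmetric]) auto
  also have "\<dots> \<le> (\<integral>\<^sup>+p. ennreal (t / 2) * ennreal (mehler d \<rho> (fst p) (snd p) ^ 4)
       + ennreal (1 / (2 * t)) * ennreal ((f (fst p) (snd p))^4) \<partial>?M)"
  proof (rule nn_integral_mono)
    fix p
    have "(mehler d \<rho> (fst p) (snd p) * f (fst p) (snd p))\<^sup>2
      \<le> t / 2 * mehler d \<rho> (fst p) (snd p) ^ 4 + 1 / (2 * t) * (f (fst p) (snd p))^4"
      using square_mult_le_powers4[OF t, of "mehler d \<rho> (fst p) (snd p)" "f (fst p) (snd p)"]
      by (simp add: add_divide_distrib mult.commute[of t 2])
    then show "ennreal ((mehler d \<rho> (fst p) (snd p) * f (fst p) (snd p))\<^sup>2) \<le>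
      ennreal (t / 2) * ennreal (mehler d \<rho> (fst p) (snd p) ^ 4) + ennreal (1 / (2 * t)) * ennreal ((f (fst p) (snd p))^4)"
      using t by (simp add: ennreal_mult[symmetric] ennreal_plus[symmetric] ennreal_leI del: ennreal_plus)
  qed
  also have "\<dots> = ennreal (t / 2) * (\<integral>\<^sup>+p. ennreal (mehler d \<rho> (fst p) (snd p) ^ 4) \<partial>?M)
       + ennreal (1 / (2 * t)) * (\<integral>\<^sup>+p. ennreal ((f (fst p) (snd p))^4) \<partial>?M)"
    by (subst nn_integral_add) (auto simp: nn_integral_cmult)
  also have "(\<integral>\<^sup>+p. ennreal (mehler d \<rho> (fst p) (snd p) ^ 4) \<partial>?M)
      = (\<integral>\<^sup>+x. (\<integral>\<^sup>+y. ennreal (mehler d \<rho> x y ^ 4) \<partial>gauss d) \<partial>gauss d)"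
    by (subst G.nn_integral_fst[symmetric]) auto
  also have "(\<integral>\<^sup>+p. ennreal ((f (fst p) (snd p))^4) \<partial>?M)
      = (\<integral>\<^sup>+x. (\<integral>\<^sup>+y. ennreal ((f x y)^4) \<partial>gauss d) \<partial>gauss d)"
    by (subst G.nn_integral_fst[symmetric]) auto
  also have "ennreal (t / 2) * (\<integral>\<^sup>+x. (\<integral>\<^sup>+y. ennreal (mehler d \<rho> x y ^ 4) \<partial>gauss d) \<partial>gauss d)
       + ennreal (1 / (2 * t)) * (\<integral>\<^sup>+x. (\<integral>\<^sup>+y. ennreal ((f x y)^4) \<partial>gauss d) \<partial>gauss d)
     \<le> ennreal (t / 2) * ennreal (exp (14 * \<rho>\<^sup>2 * d)) + ennreal (1 / (2 * t)) * ennreal (K)"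
    using f4 nn_integral_mehler_power4_joint[OF \<rho>, of d]
    by (intro add_mono mult_left_mono) auto
  also have "\<dots> = ennreal (t / 2 * exp (14 * \<rho>\<^sup>2 * d) + 1 / (2 * t) * K)"
    using t K by (simp add: ennreal_mult[symmetric] ennreal_plus[symmetric] del: ennreal_plus)
  finally show ?thesis by (simp add: add_divide_distrib mult.commute[of t 2])
qed

section \<open>The bipartite event\<close>

lemma double_sum_Cauchy_Schwarz:
  fixes a u :: "'i \<Rightarrow> 'l \<Rightarrow> real"
  shows "\<bar>\<Sum>i\<in>I. \<Sum>l\<in>L. a i l * u i l\<bar> \<le> sqrt ((\<Sum>i\<in>I. \<Sum>l\<in>L. (a i l)\<^sup>2) * (\<Sum>i\<in>I. \<Sum>l\<in>L. (u i l)\<^sup>2))"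
proof -
  have "(\<Sum>p\<in>I \<times> L. a (fst p) (snd p) * u (fst p) (snd p))\<^sup>2
     \<le> (\<Sum>p\<in>I \<times> L. (a (fst p) (snd p))\<^sup>2) * (\<Sum>p\<in>I \<times> L. (u (fst p) (snd p))\<^sup>2)"
    by (rule Cauchy_Schwarz_ineq_sum)
  then have "(\<Sum>i\<in>I. \<Sum>l\<in>L. a i l * u i l)\<^sup>2 \<le> (\<Sum>i\<in>I. \<Sum>l\<in>L. (a i l)\<^sup>2) * (\<Sum>i\<in>I. \<Sum>l\<in>L. (u i l)\<^sup>2)"
    by (simp add: sum.cartesian_product case_prod_beta')
  then have "sqrt ((\<Sum>i\<in>I. \<Sum>l\<in>L. a i l * u i l)\<^sup>2) \<le> sqrt ((\<Sum>i\<in>I. \<Sum>l\<in>L. (a i l)\<^sup>2) * (\<Sum>i\<in>I. \<Sum>l\<in>L. (u i l)\<^sup>2))"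
    by (rule real_sqrt_le_mono)
  then show ?thesis by simp
qed

text \<open>Writing \<open>X' = X + a\<close> and \<open>Y' = Y + b\<close>, expand the nonnegative
  weighted sum at the primed points. The two terms linear in \<open>a\<close> or \<open>b\<close>
  are paired by Cauchy-Schwarz with the weighted row and column vectors, which gives
  \<open>Q\<close>. The bilinear term is bounded as in Schur's test by the row and column sums of
  \<open>W\<close>.\<close>

lemma weighted_bilinear_bound:
  fixes W :: "'i \<Rightarrow> 'j \<Rightarrow> real" and X X' :: "'i \<Rightarrow> nat \<Rightarrow> real" and Y Y' :: "'j \<Rightarrow> nat \<Rightarrow> real"
    and I :: "'i set" and J :: "'j set" and d :: nat
  defines "S \<equiv> (\<Sum>i\<in>I. \<Sum>l<d. (X i l - X' i l)\<^sup>2) + (\<Sum>j\<in>J. \<Sum>l<d. (Y j l - Y' j l)\<^sup>2)"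
  assumes fin: "finite I" "finite J" and W: "\<And>i j. 0 \<le> W i j"
    and row: "\<And>i. i \<in> I \<Longrightarrow> (\<Sum>j\<in>J. W i j) \<le> 2 * k" and col: "\<And>j. j \<in> J \<Longrightarrow> (\<Sum>i\<in>I. W i j) \<le> 2 * k"
    and U: "(\<Sum>i\<in>I. \<Sum>l<d. (\<Sum>j\<in>J. W i j * Y j l)\<^sup>2) \<le> Q"
    and V: "(\<Sum>j\<in>J. \<Sum>l<d. (\<Sum>i\<in>I. W i j * X i l)\<^sup>2) \<le> Q"
    and pos: "\<And>i j. i \<in> I \<Longrightarrow> j \<in> J \<Longrightarrow> 0 \<le> vec_inner d (X' i) (Y' j)"
  shows "- (\<Sum>i\<in>I. \<Sum>j\<in>J. W i j * vec_inner d (X i) (Y j)) \<le> 2 * sqrt (Q * S) + k * S"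
proof -
  define a where "a i l = X' i l - X i l" for i l
  define b where "b j l = Y' j l - Y j l" for j l
  define A where "A = (\<Sum>i\<in>I. \<Sum>l<d. (a i l)\<^sup>2)"
  define B where "B = (\<Sum>j\<in>J. \<Sum>l<d. (b j l)\<^sup>2)"
  have S: "S = A + B" by (simp add: S_def A_def B_def a_def b_def power2_commute)
  have AB: "0 \<le> A" "0 \<le> B" by (auto simp: A_def B_def intro!: sum_nonneg)
  have Q: "0 \<le> Q" using U by (rule order_trans[rotated]) (auto intro!: sum_nonneg)
  have "0 \<le> (\<Sum>i\<in>I. \<Sum>j\<in>J. W i j * vec_inner d (X' i) (Y' j))"
    using W pos by (intro sum_nonneg mult_nonneg_nonneg) auto
  also have "\<dots> = (\<Sum>i\<in>I. \<Sum>j\<in>J. W i j * vec_inner d (X i) (Y j))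
     + (\<Sum>i\<in>I. \<Sum>j\<in>J. \<Sum>l<d. W i j * (a i l * Y j l)) + (\<Sum>i\<in>I. \<Sum>j\<in>J. \<Sum>l<d. W i j * (X i l * b j l))
     + (\<Sum>i\<in>I. \<Sum>j\<in>J. \<Sum>l<d. W i j * (a i l * b j l))"
    unfolding sum.distrib[symmetric] vec_inner_def sum_distrib_left
    by (intro sum.cong refl) (simp add: a_def b_def algebra_simps)
  also have "(\<Sum>i\<in>I. \<Sum>j\<in>J. \<Sum>l<d. W i j * (a i l * Y j l)) = (\<Sum>i\<in>I. \<Sum>l<d. a i l * (\<Sum>j\<in>J. W i j * Y j l))"
    by (subst sum.swap[of _ _ J]) (simp add: sum_distrib_left ac_simps)
  also have "(\<Sum>i\<in>I. \<Sum>j\<in>J. \<Sum>l<d. W i j * (X i l * b j l)) = (\<Sum>j\<in>J. \<Sum>l<d. b j l * (\<Sum>i\<in>I. W i j * X i l))"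
    by (subst sum.swap[of _ J I], subst sum.swap[of _ _ I]) (simp add: sum_distrib_left ac_simps)
  finally have *: "- (\<Sum>i\<in>I. \<Sum>j\<in>J. W i j * vec_inner d (X i) (Y j)) \<le>
      (\<Sum>i\<in>I. \<Sum>l<d. a i l * (\<Sum>j\<in>J. W i j * Y j l)) + (\<Sum>j\<in>J. \<Sum>l<d. b j l * (\<Sum>i\<in>I. W i j * X i l))
     + (\<Sum>i\<in>I. \<Sum>j\<in>J. \<Sum>l<d. W i j * (a i l * b j l))" by linarith
  have 1: "(\<Sum>i\<in>I. \<Sum>l<d. a i l * (\<Sum>j\<in>J. W i j * Y j l)) \<le> sqrt (Q * S)"
  proof -
    have "(\<Sum>i\<in>I. \<Sum>l<d. a i l * (\<Sum>j\<in>J. W i j * Y j l)) \<le> sqrt (A * (\<Sum>i\<in>I. \<Sum>l<d. (\<Sum>j\<in>J. W i j * Y j l)\<^sup>2))"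
      unfolding A_def by (rule order_trans[OF abs_ge_self double_sum_Cauchy_Schwarz])
    also have "\<dots> \<le> sqrt (S * Q)"
      using U AB by (intro real_sqrt_le_mono mult_mono) (auto simp: S intro!: sum_nonneg)
    finally show ?thesis by (simp add: mult.commute)
  qed
  have 2: "(\<Sum>j\<in>J. \<Sum>l<d. b j l * (\<Sum>i\<in>I. W i j * X i l)) \<le> sqrt (Q * S)"
  proof -
    have "(\<Sum>j\<in>J. \<Sum>l<d. b j l * (\<Sum>i\<in>I. W i j * X i l)) \<le> sqrt (B * (\<Sum>j\<in>J. \<Sum>l<d. (\<Sum>i\<in>I. W i j * X i l)\<^sup>2))"
      unfolding B_def by (rule order_trans[OF abs_ge_self double_sum_Cauchy_Schwarz])
    also have "\<dots> \<le> sqrt (S * Q)"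
      using V AB by (intro real_sqrt_le_mono mult_mono) (auto simp: S intro!: sum_nonneg)
    finally show ?thesis by (simp add: mult.commute)
  qed
  have 3: "(\<Sum>i\<in>I. \<Sum>j\<in>J. \<Sum>l<d. W i j * (a i l * b j l)) \<le> k * S"
  proof -
    have "(\<Sum>i\<in>I. \<Sum>j\<in>J. \<Sum>l<d. W i j * (a i l * b j l))
       \<le> (\<Sum>i\<in>I. \<Sum>j\<in>J. \<Sum>l<d. W i j * ((a i l)\<^sup>2 / 2 + (b j l)\<^sup>2 / 2))"
    proof (intro sum_mono mult_left_mono W)
      fix i j l show "a i l * b j l \<le> (a i l)\<^sup>2 / 2 + (b j l)\<^sup>2 / 2"
        using sum_squares_bound[of "a i l" "b j l"] by simp
    qed
    also have "\<dots> = (\<Sum>i\<in>I. (\<Sum>j\<in>J. W i j) * (\<Sum>l<d. (a i l)\<^sup>2 / 2)) + (\<Sum>j\<in>J. (\<Sum>i\<in>I. W i j) * (\<Sum>l<d. (b j l)\<^sup>2 / 2))"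
    proof -
      have "(\<Sum>j\<in>J. (\<Sum>i\<in>I. W i j) * (\<Sum>l<d. (b j l)\<^sup>2 / 2)) = (\<Sum>i\<in>I. \<Sum>j\<in>J. \<Sum>l<d. W i j * ((b j l)\<^sup>2 / 2))"
        by (subst sum.swap[of _ J I]) (simp only: sum_product)
      moreover have "(\<Sum>i\<in>I. (\<Sum>j\<in>J. W i j) * (\<Sum>l<d. (a i l)\<^sup>2 / 2)) = (\<Sum>i\<in>I. \<Sum>j\<in>J. \<Sum>l<d. W i j * ((a i l)\<^sup>2 / 2))"
        by (simp only: sum_product)
      ultimately show ?thesis by (simp only: sum.distrib[symmetric] distrib_left)
    qed
    also have "\<dots> \<le> (\<Sum>i\<in>I. (2 * k) * (\<Sum>l<d. (a i l)\<^sup>2 / 2)) + (\<Sum>j\<in>J. (2 * k) * (\<Sum>l<d. (b j l)\<^sup>2 / 2))"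
      using row col by (intro add_mono sum_mono mult_right_mono sum_nonneg) auto
    also have "\<dots> = k * S"
      by (simp add: S A_def B_def sum_distrib_left[symmetric] sum_divide_distrib[symmetric] distrib_left)
    finally show ?thesis .
  qed
  from * 1 2 3 show ?thesis by linarith
qed

section \<open>Moments of weighted row and column sums\<close>

lemma (in prob_space) nn_integral_PiM_sum_centred_square:
  fixes f :: "'a \<Rightarrow> real" and \<mu> :: real
  assumes "finite J" and [measurable]: "f \<in> borel_measurable M" and i2: "integrable M (\<lambda>x. (f x)\<^sup>2)"
    and mu: "(\<integral>x. f x \<partial>M) = \<mu>"
  shows "(\<integral>\<^sup>+y. ennreal (((\<Sum>j\<in>J. f (y j)) - card J * \<mu>)\<^sup>2) \<partial>(\<Pi>\<^sub>M j\<in>J. M))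
     \<le> ennreal (card J) * (\<integral>\<^sup>+x. ennreal ((f x)\<^sup>2) \<partial>M)"
proof -
  have i1: "integrable M f" using integrable_power_mono[of f 2 1] i2 by auto
  have sq: "(f x - \<mu>)\<^sup>2 = (f x)\<^sup>2 - 2 * \<mu> * f x + \<mu>\<^sup>2" for x by (simp add: power2_diff)
  have "(\<integral>\<^sup>+y. ennreal ((\<Sum>j\<in>J. f (y j) - \<mu>)\<^sup>2) \<partial>(\<Pi>\<^sub>M j\<in>J. M)) = ennreal (\<Sum>j\<in>J. \<integral>x. (f x - \<mu>)\<^sup>2 \<partial>M)"
    using assms i1 by (intro nn_integral_PiM_sum_square) (auto simp: sq prob_space)
  also have "(\<integral>x. (f x - \<mu>)\<^sup>2 \<partial>M) = (\<integral>x. (f x)\<^sup>2 \<partial>M) - \<mu>\<^sup>2"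
    unfolding sq using i1 i2 by (simp add: mu prob_space power2_eq_square)
  also have "ennreal (\<Sum>j\<in>J. (\<integral>x. (f x)\<^sup>2 \<partial>M) - \<mu>\<^sup>2) \<le> ennreal (card J * (\<integral>x. (f x)\<^sup>2 \<partial>M))"
    by (intro ennreal_leI) (simp add: mult_left_mono)
  also have "\<dots> = ennreal (card J) * (\<integral>\<^sup>+x. ennreal ((f x)\<^sup>2) \<partial>M)"
    using i2 by (subst nn_integral_eq_integral) (auto simp: ennreal_mult)
  finally show ?thesis by (simp add: sum_subtractf)
qed

lemma (in prob_space) nn_integral_PiM_sum_square_le:
  fixes f :: "'a \<Rightarrow> real" and \<mu> :: real
  assumes "finite J" and [measurable]: "f \<in> borel_measurable M" and i2: "integrable M (\<lambda>x. (f x)\<^sup>2)"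
    and mu: "(\<integral>x. f x \<partial>M) = \<mu>"
  shows "(\<integral>\<^sup>+y. ennreal ((\<Sum>j\<in>J. f (y j))\<^sup>2) \<partial>(\<Pi>\<^sub>M j\<in>J. M))
     \<le> ennreal (2 * card J) * (\<integral>\<^sup>+x. ennreal ((f x)\<^sup>2) \<partial>M) + ennreal (2 * (card J)\<^sup>2 * \<mu>\<^sup>2)"
proof -
  interpret PJ: prob_space "\<Pi>\<^sub>M j\<in>J. M" by (rule prob_space_PiM) unfold_locales
  let ?g = "\<lambda>y. ((\<Sum>j\<in>J. f (y j)) - card J * \<mu>)\<^sup>2"
  have "(\<integral>\<^sup>+y. ennreal ((\<Sum>j\<in>J. f (y j))\<^sup>2) \<partial>(\<Pi>\<^sub>M j\<in>J. M))
     \<le> (\<integral>\<^sup>+y. 2 * ennreal (?g y) + ennreal (2 * (card J)\<^sup>2 * \<mu>\<^sup>2) \<partial>(\<Pi>\<^sub>M j\<in>J. M))"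
  proof (rule nn_integral_mono)
    fix y
    define s where "s = (\<Sum>j\<in>J. f (y j))"
    have "s\<^sup>2 \<le> 2 * (s - card J * \<mu>)\<^sup>2 + 2 * (card J * \<mu>)\<^sup>2"
      using zero_le_power2[of "s - 2 * (card J * \<mu>)"] by (simp add: power2_eq_square algebra_simps)
    then have "ennreal (s\<^sup>2) \<le> ennreal (2 * (s - card J * \<mu>)\<^sup>2 + 2 * (card J)\<^sup>2 * \<mu>\<^sup>2)"
      by (intro ennreal_leI) (simp add: power_mult_distrib)
    also have "\<dots> = 2 * ennreal ((s - card J * \<mu>)\<^sup>2) + ennreal (2 * (card J)\<^sup>2 * \<mu>\<^sup>2)"
      by (subst ennreal_plus) (auto simp: ennreal_mult)
    finally show "ennreal ((\<Sum>j\<in>J. f (y j))\<^sup>2) \<le> 2 * ennreal (?g y) + ennreal (2 * (card J)\<^sup>2 * \<mu>\<^sup>2)"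
      by (simp add: s_def)
  qed
  also have "\<dots> = 2 * (\<integral>\<^sup>+y. ennreal (?g y) \<partial>(\<Pi>\<^sub>M j\<in>J. M)) + ennreal (2 * (card J)\<^sup>2 * \<mu>\<^sup>2)"
    by (subst nn_integral_add) (auto simp: nn_integral_cmult PJ.emeasure_space_1)
  also have "\<dots> \<le> 2 * (ennreal (card J) * (\<integral>\<^sup>+x. ennreal ((f x)\<^sup>2) \<partial>M)) + ennreal (2 * (card J)\<^sup>2 * \<mu>\<^sup>2)"
    by (intro add_mono mult_left_mono nn_integral_PiM_sum_centred_square assms) auto
  finally show ?thesis by (simp add: ennreal_mult mult.assoc)
qed

text \<open>The factor 24 is 3, from the fourth moment of a sum of independent terms, times 8, from
  \<open>(f x - 1)^4 \<le> 8 * ((f x)^4 + 1)\<close>.\<close>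

lemma (in prob_space) nn_integral_PiM_sum_centred_power4:
  fixes f :: "'a \<Rightarrow> real"
  assumes "finite J" and [measurable]: "f \<in> borel_measurable M" and i4: "integrable M (\<lambda>x. (f x)^4)"
    and mu: "(\<integral>x. f x \<partial>M) = 1"
  shows "(\<integral>\<^sup>+y. ennreal (((\<Sum>j\<in>J. f (y j)) - card J)^4) \<partial>(\<Pi>\<^sub>M j\<in>J. M))
     \<le> ennreal (24 * (card J)\<^sup>2) * (\<integral>\<^sup>+x. ennreal ((f x)^4) + 1 \<partial>M)"
proof -
  have i1: "integrable M (\<lambda>x. f x ^ a)" if "a \<le> 4" for a using integrable_power_mono[of f 4 a] i4 that by auto
  have i1': "integrable M f" using i1[of 1] by simp
  have le: "(f x - 1)^4 \<le> 8 * ((f x)^4 + 1)" for x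
  proof -
    have "(f x - 1)\<^sup>2 \<le> 2 * ((f x)\<^sup>2 + 1)"
      using zero_le_power2[of "f x + 1"] by (simp add: power2_eq_square algebra_simps)
    then have "((f x - 1)\<^sup>2)\<^sup>2 \<le> (2 * ((f x)\<^sup>2 + 1))\<^sup>2" by (intro power_mono) auto
    also have "\<dots> \<le> 8 * ((f x)^4 + 1)"
      using zero_le_power2[of "(f x)\<^sup>2 - 1"] by (simp add: power2_eq_square power4_eq_xxxx algebra_simps)
    finally show ?thesis by (simp add: power_mult[symmetric])
  qed
  have i4': "integrable M (\<lambda>x. (f x - 1)^4)"
  proof (rule Bochner_Integration.integrable_bound)
    show "integrable M (\<lambda>x. 8 * ((f x)^4 + 1))" using i4 by simp
    show "AE x in M. norm ((f x - 1)^4) \<le> norm (8 * ((f x)^4 + 1))"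
      using le by (intro AE_I2) (auto intro: order_trans[OF _ abs_ge_self])
  qed measurable
  have "(\<integral>\<^sup>+y. ennreal ((\<Sum>j\<in>J. f (y j) - 1)^4) \<partial>(\<Pi>\<^sub>M j\<in>J. M))
     \<le> ennreal (3 * (\<Sum>j\<in>J. sqrt (\<integral>x. (f x - 1)^4 \<partial>M))\<^sup>2)"
    using assms i4' i1' by (intro nn_integral_PiM_sum_power4) (auto simp: prob_space)
  also have "3 * (\<Sum>j\<in>J. sqrt (\<integral>x. (f x - 1)^4 \<partial>M))\<^sup>2 = 3 * (card J)\<^sup>2 * (\<integral>x. (f x - 1)^4 \<partial>M)"
    by (simp add: power_mult_distrib)
  also have "ennreal (3 * (card J)\<^sup>2 * (\<integral>x. (f x - 1)^4 \<partial>M)) \<le> ennreal (3 * (card J)\<^sup>2 * (\<integral>x. 8 * ((f x)^4 + 1) \<partial>M))"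
    using i4 i4' le by (intro ennreal_leI mult_left_mono integral_mono) auto
  also have "3 * (card J)\<^sup>2 * (\<integral>x. 8 * ((f x)^4 + 1) \<partial>M) = 24 * (card J)\<^sup>2 * (\<integral>x. (f x)^4 + 1 \<partial>M)"
    by (subst Bochner_Integration.integral_mult_right_zero) simp
  also have "ennreal \<dots> = ennreal (24 * (card J)\<^sup>2) * (\<integral>\<^sup>+x. ennreal ((f x)^4 + 1) \<partial>M)"
    using i4 by (subst nn_integral_eq_integral) (auto simp: ennreal_mult)
  finally show ?thesis by (simp add: sum_subtractf)
qed

lemma (in prob_space) nn_integral_markov:
  fixes f :: "'a \<Rightarrow> real"
  assumes [measurable]: "f \<in> borel_measurable M" and b: "(\<integral>\<^sup>+x. ennreal (f x) \<partial>M) \<le> ennreal b" and "0 \<le> b" "0 < a"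
  shows "measure M {x \<in> space M. a < f x} \<le> b / a"
proof -
  have "emeasure M {x \<in> space M. a < f x} = (\<integral>\<^sup>+x. indicator {x \<in> space M. a < f x} x \<partial>M)" by simp
  also have "\<dots> \<le> (\<integral>\<^sup>+x. ennreal (1 / a) * ennreal (f x) \<partial>M)"
  proof (rule nn_integral_mono)
    fix x
    show "indicator {x \<in> space M. a < f x} x \<le> ennreal (1 / a) * ennreal (f x)"
      using assms by (cases "a < f x") (auto simp: ennreal_mult[symmetric] indicator_def)
  qed
  also have "\<dots> = ennreal (1 / a) * (\<integral>\<^sup>+x. ennreal (f x) \<partial>M)" by (rule nn_integral_cmult) measurable
  also have "\<dots> \<le> ennreal (1 / a) * ennreal b" by (intro mult_left_mono b) simp
  also have "\<dots> = ennreal (b / a)" using assms by (simp add: ennreal_mult[symmetric])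
  finally show ?thesis using assms by (simp add: emeasure_eq_measure)
qed

text \<open>Reduces the statistic of one row to a single vector against the whole second sample, the
  form in which the row estimates are proved.\<close>

lemma nn_integral_pair_fst_component:
  assumes "prob_space M" "prob_space N" "finite I" "i \<in> I" and [measurable]: "F \<in> borel_measurable (M \<Otimes>\<^sub>M N)"
  shows "(\<integral>\<^sup>+p. F (fst p i, snd p) \<partial>((\<Pi>\<^sub>M i\<in>I. M) \<Otimes>\<^sub>M N)) = (\<integral>\<^sup>+x. (\<integral>\<^sup>+y. F (x, y) \<partial>N) \<partial>M)"
proof -
  interpret M: prob_space M by fact
  interpret N: prob_space N by fact
  have [measurable]: "(\<lambda>x. x i) \<in> (\<Pi>\<^sub>M i\<in>I. M) \<rightarrow>\<^sub>M M" using assms by measurable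
  have "(\<integral>\<^sup>+p. F (fst p i, snd p) \<partial>((\<Pi>\<^sub>M i\<in>I. M) \<Otimes>\<^sub>M N)) = (\<integral>\<^sup>+X. (\<integral>\<^sup>+y. F (X i, y) \<partial>N) \<partial>(\<Pi>\<^sub>M i\<in>I. M))"
    by (subst N.nn_integral_fst[symmetric]) auto
  also have "\<dots> = (\<integral>\<^sup>+x. (\<integral>\<^sup>+y. F (x, y) \<partial>N) \<partial>M)"
    using assms by (intro M.nn_integral_PiM_component[of I i "\<lambda>x. \<integral>\<^sup>+y. F (x, y) \<partial>N"]) auto
  finally show ?thesis .
qed

text \<open>The counterpart for columns. The arguments of \<open>F\<close> are swapped so that, the
  weights being symmetric, the row estimates serve for columns too.\<close>

lemma nn_integral_pair_snd_component:
  assumes "prob_space M" "prob_space N" "finite J" "j \<in> J" and [measurable]: "F \<in> borel_measurable (M \<Otimes>\<^sub>M N)"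
  shows "(\<integral>\<^sup>+p. F (snd p j, fst p) \<partial>(N \<Otimes>\<^sub>M (\<Pi>\<^sub>M j\<in>J. M))) = (\<integral>\<^sup>+x. (\<integral>\<^sup>+y. F (x, y) \<partial>N) \<partial>M)"
proof -
  interpret M: prob_space M by fact
  interpret N: prob_space N by fact
  interpret PJ: prob_space "\<Pi>\<^sub>M j\<in>J. M" by (intro prob_space_PiM assms)
  interpret NP: pair_prob_space N "\<Pi>\<^sub>M j\<in>J. M" by unfold_locales
  have [measurable]: "(\<lambda>x. x j) \<in> (\<Pi>\<^sub>M j\<in>J. M) \<rightarrow>\<^sub>M M" using assms by measurable
  have "(\<integral>\<^sup>+p. F (snd p j, fst p) \<partial>(N \<Otimes>\<^sub>M (\<Pi>\<^sub>M j\<in>J. M))) = (\<integral>\<^sup>+Y. (\<integral>\<^sup>+y. F (Y j, y) \<partial>N) \<partial>(\<Pi>\<^sub>M j\<in>J. M))"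
    by (subst NP.nn_integral_snd[symmetric]) auto
  also have "\<dots> = (\<integral>\<^sup>+x. (\<integral>\<^sup>+y. F (x, y) \<partial>N) \<partial>M)"
    using assms by (intro M.nn_integral_PiM_component[of J j "\<lambda>x. \<integral>\<^sup>+y. F (x, y) \<partial>N"]) auto
  finally show ?thesis .
qed

text \<open>Given \<open>x\<close> the weights of a row are i.i.d. of mean 1. The fourth moment is
  taken because all \<open>k\<close> rows must be controlled at once: Markov at level
  \<open>k\<close> then loses a total of order \<open>1 / k\<close> times the exponential, whereas
  second moments would leave the exponential with no factor \<open>1 / k\<close>.\<close>

lemma mehler_row_weight:
  assumes J: "finite J" "card J = k" and \<rho>: "\<bar>\<rho>\<bar> \<le> 1 / 4"
  shows "(\<integral>\<^sup>+x. (\<integral>\<^sup>+Y. ennreal (((\<Sum>j\<in>J. mehler d \<rho> x (Y j)) - real k)^4) \<partial>(\<Pi>\<^sub>M j\<in>J. gauss d)) \<partial>gauss d)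
    \<le> ennreal (48 * real k ^ 2 * exp (14 * \<rho>\<^sup>2 * d))"
proof -
  interpret G: prob_space "gauss d" by (rule prob_space_gauss)
  have "\<bar>\<rho>\<bar>\<^sup>2 \<le> (1 / 4)\<^sup>2" using \<rho> by (intro power_mono) auto
  then have r1: "\<rho>\<^sup>2 < 1" by (auto simp: power2_eq_square)
  have "(\<integral>\<^sup>+x. (\<integral>\<^sup>+Y. ennreal (((\<Sum>j\<in>J. mehler d \<rho> x (Y j)) - real k)^4) \<partial>(\<Pi>\<^sub>M j\<in>J. gauss d)) \<partial>gauss d)
    \<le> (\<integral>\<^sup>+x. ennreal (24 * (real k)\<^sup>2) * (\<integral>\<^sup>+y. ennreal ((mehler d \<rho> x y)^4) + 1 \<partial>gauss d) \<partial>gauss d)"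
  proof (rule nn_integral_mono)
    fix x
    show "(\<integral>\<^sup>+Y. ennreal (((\<Sum>j\<in>J. mehler d \<rho> x (Y j)) - real k)^4) \<partial>(\<Pi>\<^sub>M j\<in>J. gauss d))
      \<le> ennreal (24 * (real k)\<^sup>2) * (\<integral>\<^sup>+y. ennreal ((mehler d \<rho> x y)^4) + 1 \<partial>gauss d)"
      using G.nn_integral_PiM_sum_centred_power4[OF J(1), of "mehler d \<rho> x"]
        integrable_mehler_power4[OF r1] has_bochner_integral_mehler(1)[OF r1] J
      by (simp add: has_bochner_integral_iff)
  qed
  also have "\<dots> = ennreal (24 * (real k)\<^sup>2) * ((\<integral>\<^sup>+x. (\<integral>\<^sup>+y. ennreal ((mehler d \<rho> x y)^4) \<partial>gauss d) \<partial>gauss d) + 1)"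
    by (simp add: nn_integral_cmult nn_integral_add G.emeasure_space_1)
  also have "\<dots> \<le> ennreal (24 * (real k)\<^sup>2) * (ennreal (exp (14 * \<rho>\<^sup>2 * d)) + ennreal (exp (14 * \<rho>\<^sup>2 * d)))"
    by (intro mult_left_mono add_mono nn_integral_mehler_power4_joint \<rho>) auto
  also have "\<dots> = ennreal (48 * real k ^ 2 * exp (14 * \<rho>\<^sup>2 * d))"
    by (simp add: ennreal_mult[symmetric] ennreal_plus[symmetric] del: ennreal_plus)
  finally show ?thesis .
qed

text \<open>The squared length of the weighted vector has a fluctuation part, linear in
  \<open>k\<close>, and a part from its conditional mean \<open>- k \<rho> x\<close>, quadratic in
  \<open>k\<close>.\<close>

lemma mehler_row_vector:
  assumes J: "finite J" "card J = k" and \<rho>: "\<bar>\<rho>\<bar> \<le> 1 / 4" and d: "0 < d"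
  shows "(\<integral>\<^sup>+x. (\<integral>\<^sup>+Y. ennreal (\<Sum>l<d. (\<Sum>j\<in>J. mehler d \<rho> x (Y j) * Y j l)\<^sup>2) \<partial>(\<Pi>\<^sub>M j\<in>J. gauss d)) \<partial>gauss d)
    \<le> ennreal (4 * real k * d * exp (7 * \<rho>\<^sup>2 * d) + 2 * (real k)\<^sup>2 * \<rho>\<^sup>2 * d)"
proof -
  interpret G: prob_space "gauss d" by (rule prob_space_gauss)
  have "\<bar>\<rho>\<bar>\<^sup>2 \<le> (1 / 4)\<^sup>2" using \<rho> by (intro power_mono) auto
  then have r1: "\<rho>\<^sup>2 < 1" by (auto simp: power2_eq_square)
  have [measurable]: "(\<lambda>w. f w l) \<in> borel_measurable M" if "f \<in> M \<rightarrow>\<^sub>M gauss d" "l < d" for f :: "_ \<Rightarrow> nat \<Rightarrow> real" and l M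
    using measurable_gauss_component[OF that] .
  have [measurable]: "(\<lambda>y. y l) \<in> borel_measurable (gauss d)" if "l < d" for l
    using measurable_gauss_component[of "\<lambda>y. y" "gauss d" d l] that by simp
  let ?D = "\<lambda>x y. sqrt (vec_inner d y y)"
  have nn: "0 \<le> vec_inner d y y" for y by (auto simp: vec_inner_def intro: sum_nonneg)
  have "(\<integral>\<^sup>+x. (\<integral>\<^sup>+Y. ennreal (\<Sum>l<d. (\<Sum>j\<in>J. mehler d \<rho> x (Y j) * Y j l)\<^sup>2) \<partial>(\<Pi>\<^sub>M j\<in>J. gauss d)) \<partial>gauss d)
    \<le> (\<integral>\<^sup>+x. ennreal (2 * real k) * (\<integral>\<^sup>+y. ennreal ((mehler d \<rho> x y * ?D x y)\<^sup>2) \<partial>gauss d)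
         + ennreal (2 * (real k)\<^sup>2 * \<rho>\<^sup>2) * ennreal (vec_inner d x x) \<partial>gauss d)"
  proof (rule nn_integral_mono)
    fix x
    have "(\<integral>\<^sup>+Y. ennreal (\<Sum>l<d. (\<Sum>j\<in>J. mehler d \<rho> x (Y j) * Y j l)\<^sup>2) \<partial>(\<Pi>\<^sub>M j\<in>J. gauss d))
      = (\<integral>\<^sup>+Y. (\<Sum>l<d. ennreal ((\<Sum>j\<in>J. mehler d \<rho> x (Y j) * Y j l)\<^sup>2)) \<partial>(\<Pi>\<^sub>M j\<in>J. gauss d))"
      by simp
    also have "\<dots> = (\<Sum>l<d. \<integral>\<^sup>+Y. ennreal ((\<Sum>j\<in>J. mehler d \<rho> x (Y j) * Y j l)\<^sup>2) \<partial>(\<Pi>\<^sub>M j\<in>J. gauss d))"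
      by (rule nn_integral_sum) measurable
    also have "\<dots> \<le> (\<Sum>l<d. ennreal (2 * real k) * (\<integral>\<^sup>+y. ennreal ((mehler d \<rho> x y * y l)\<^sup>2) \<partial>gauss d)
        + ennreal (2 * (real k)\<^sup>2 * (- \<rho> * x l)\<^sup>2))"
    proof (intro sum_mono)
      fix l assume "l \<in> {..<d}"
      then have l: "l < d" by simp
      show "(\<integral>\<^sup>+Y. ennreal ((\<Sum>j\<in>J. mehler d \<rho> x (Y j) * Y j l)\<^sup>2) \<partial>(\<Pi>\<^sub>M j\<in>J. gauss d))
        \<le> ennreal (2 * real k) * (\<integral>\<^sup>+y. ennreal ((mehler d \<rho> x y * y l)\<^sup>2) \<partial>gauss d) + ennreal (2 * (real k)\<^sup>2 * (- \<rho> * x l)\<^sup>2)"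
        using G.nn_integral_PiM_sum_square_le[OF J(1), of "\<lambda>y. mehler d \<rho> x y * y l" "- \<rho> * x l"] l J
          has_bochner_integral_mehler(2)[OF r1 l, of x]
          integrable_mehler_mult_square[OF r1 integrable_gauss_component_power4[OF l], of x]
        by (auto simp: has_bochner_integral_iff)
    qed
    also have "\<dots> = ennreal (2 * real k) * (\<integral>\<^sup>+y. (\<Sum>l<d. ennreal ((mehler d \<rho> x y * y l)\<^sup>2)) \<partial>gauss d)
        + ennreal (\<Sum>l<d. 2 * (real k)\<^sup>2 * (- \<rho> * x l)\<^sup>2)"
      by (subst nn_integral_sum) (auto simp: sum.distrib sum_distrib_left)
    also have "(\<Sum>l<d. 2 * (real k)\<^sup>2 * (- \<rho> * x l)\<^sup>2) = 2 * (real k)\<^sup>2 * \<rho>\<^sup>2 * vec_inner d x x"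
      by (simp add: vec_inner_def sum_distrib_left power_mult_distrib power2_eq_square ac_simps)
    also have "(\<integral>\<^sup>+y. (\<Sum>l<d. ennreal ((mehler d \<rho> x y * y l)\<^sup>2)) \<partial>gauss d) = (\<integral>\<^sup>+y. ennreal ((mehler d \<rho> x y * ?D x y)\<^sup>2) \<partial>gauss d)"
    proof (rule nn_integral_cong)
      fix y
      have "(\<Sum>l<d. (mehler d \<rho> x y * y l)\<^sup>2) = (mehler d \<rho> x y * ?D x y)\<^sup>2"
        using nn[of y] by (simp add: power_mult_distrib vec_inner_def sum_distrib_left power2_eq_square[of "y _"])
      then show "(\<Sum>l<d. ennreal ((mehler d \<rho> x y * y l)\<^sup>2)) = ennreal ((mehler d \<rho> x y * ?D x y)\<^sup>2)"
        by simp
    qed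
    finally show "(\<integral>\<^sup>+Y. ennreal (\<Sum>l<d. (\<Sum>j\<in>J. mehler d \<rho> x (Y j) * Y j l)\<^sup>2) \<partial>(\<Pi>\<^sub>M j\<in>J. gauss d))
      \<le> ennreal (2 * real k) * (\<integral>\<^sup>+y. ennreal ((mehler d \<rho> x y * ?D x y)\<^sup>2) \<partial>gauss d)
         + ennreal (2 * (real k)\<^sup>2 * \<rho>\<^sup>2) * ennreal (vec_inner d x x)"
      using nn[of x] by (simp add: ennreal_mult)
  qed
  also have "\<dots> = ennreal (2 * real k) * (\<integral>\<^sup>+x. (\<integral>\<^sup>+y. ennreal ((mehler d \<rho> x y * ?D x y)\<^sup>2) \<partial>gauss d) \<partial>gauss d)
         + ennreal (2 * (real k)\<^sup>2 * \<rho>\<^sup>2) * ennreal d"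
    by (simp add: nn_integral_add nn_integral_cmult nn_integral_gauss_norm_square)
  also have "\<dots> \<le> ennreal (2 * real k) * ennreal (2 * d * exp (7 * \<rho>\<^sup>2 * d)) + ennreal (2 * (real k)\<^sup>2 * \<rho>\<^sup>2) * ennreal d"
  proof (intro add_mono mult_left_mono)
    have *: "(\<integral>\<^sup>+x. (\<integral>\<^sup>+y. ennreal ((?D x y)^4) \<partial>gauss d) \<partial>gauss d) \<le> ennreal (3 * (real d)\<^sup>2)"
    proof -
      have "(?D x y)^4 = (vec_inner d y y)\<^sup>2" for x y :: "nat \<Rightarrow> real"
        using nn[of y] power_mult[of "sqrt (vec_inner d y y)" 2 2] by simp
      then show ?thesis using nn_integral_gauss_norm_power4[of d] by (simp add: G.emeasure_space_1)
    qed
    \<comment> \<open>This value balances the two terms in Young's inequality: up to constants both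
      become \<open>d * exp (7 * \<rho>\<^sup>2 * d)\<close>.\<close>
    let ?t = "d / exp (7 * \<rho>\<^sup>2 * d)"
    have "(\<integral>\<^sup>+x. (\<integral>\<^sup>+y. ennreal ((mehler d \<rho> x y * ?D x y)\<^sup>2) \<partial>gauss d) \<partial>gauss d)
      \<le> ennreal ((?t * exp (14 * \<rho>\<^sup>2 * d) + 3 * (real d)\<^sup>2 / ?t) / 2)"
      using d by (intro nn_integral_mehler_mult_square \<rho> *) auto
    also have "exp (14 * \<rho>\<^sup>2 * d) = exp (7 * \<rho>\<^sup>2 * d) * exp (7 * \<rho>\<^sup>2 * d)" by (simp add: exp_add[symmetric])
    also have "(?t * (exp (7 * \<rho>\<^sup>2 * d) * exp (7 * \<rho>\<^sup>2 * d)) + 3 * (real d)\<^sup>2 / ?t) / 2 = 2 * d * exp (7 * \<rho>\<^sup>2 * d)"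
      using d by (simp add: field_simps power2_eq_square)
    finally show "(\<integral>\<^sup>+x. (\<integral>\<^sup>+y. ennreal ((mehler d \<rho> x y * ?D x y)\<^sup>2) \<partial>gauss d) \<partial>gauss d) \<le> ennreal (2 * d * exp (7 * \<rho>\<^sup>2 * d))" .
  qed auto
  also have "\<dots> = ennreal (4 * real k * d * exp (7 * \<rho>\<^sup>2 * d) + 2 * (real k)\<^sup>2 * \<rho>\<^sup>2 * d)"
    by (simp add: ennreal_mult[symmetric] ennreal_plus[symmetric] mult.assoc del: ennreal_plus)
  finally show ?thesis .
qed

text \<open>The added term cancels the conditional mean given \<open>x\<close>, so only the
  fluctuation over the independent \<open>Y j\<close> is left. Summed over the rows, this locates
  the total weighted sum at \<open>- k \<rho>\<close> times the total squared length of the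
  \<open>X i\<close>.\<close>

lemma mehler_row_inner:
  assumes J: "finite J" "card J = k" and \<rho>: "\<bar>\<rho>\<bar> \<le> 1 / 4" and d: "0 < d"
  shows "(\<integral>\<^sup>+x. (\<integral>\<^sup>+Y. ennreal (((\<Sum>j\<in>J. mehler d \<rho> x (Y j) * vec_inner d x (Y j)) + real k * \<rho> * vec_inner d x x)\<^sup>2) \<partial>(\<Pi>\<^sub>M j\<in>J. gauss d)) \<partial>gauss d)
    \<le> ennreal (14 * real k * d * exp (7 * \<rho>\<^sup>2 * d))"
proof -
  interpret G: prob_space "gauss d" by (rule prob_space_gauss)
  have "\<bar>\<rho>\<bar>\<^sup>2 \<le> (1 / 4)\<^sup>2" using \<rho> by (intro power_mono) auto
  then have r1: "\<rho>\<^sup>2 < 1" by (auto simp: power2_eq_square)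
  have "(\<integral>\<^sup>+x. (\<integral>\<^sup>+Y. ennreal (((\<Sum>j\<in>J. mehler d \<rho> x (Y j) * vec_inner d x (Y j)) + real k * \<rho> * vec_inner d x x)\<^sup>2) \<partial>(\<Pi>\<^sub>M j\<in>J. gauss d)) \<partial>gauss d)
    \<le> (\<integral>\<^sup>+x. ennreal (real k) * (\<integral>\<^sup>+y. ennreal ((mehler d \<rho> x y * vec_inner d x y)\<^sup>2) \<partial>gauss d) \<partial>gauss d)"
  proof (rule nn_integral_mono)
    fix x
    have "has_bochner_integral (gauss d) (\<lambda>y. \<Sum>l<d. x l * (mehler d \<rho> x y * y l)) (\<Sum>l<d. x l * (- \<rho> * x l))"
      using has_bochner_integral_mehler(2)[OF r1]
      by (intro has_bochner_integral_sum has_bochner_integral_mult_right) auto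
    moreover have "(\<Sum>l<d. x l * (mehler d \<rho> x y * y l)) = mehler d \<rho> x y * vec_inner d x y" for y
      by (simp add: vec_inner_def sum_distrib_left ac_simps)
    moreover have "(\<Sum>l<d. x l * (- \<rho> * x l)) = - \<rho> * vec_inner d x x"
      by (simp add: vec_inner_def sum_distrib_left sum_negf ac_simps)
    ultimately have "(\<integral>y. mehler d \<rho> x y * vec_inner d x y \<partial>gauss d) = - \<rho> * vec_inner d x x"
      by (simp add: has_bochner_integral_iff)
    from G.nn_integral_PiM_sum_centred_square[OF J(1) _ _ this]
      integrable_mehler_mult_square[OF r1 integrable_gauss_inner_power4, of d x x] J
    show "(\<integral>\<^sup>+Y. ennreal (((\<Sum>j\<in>J. mehler d \<rho> x (Y j) * vec_inner d x (Y j)) + real k * \<rho> * vec_inner d x x)\<^sup>2) \<partial>(\<Pi>\<^sub>M j\<in>J. gauss d))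
      \<le> ennreal (real k) * (\<integral>\<^sup>+y. ennreal ((mehler d \<rho> x y * vec_inner d x y)\<^sup>2) \<partial>gauss d)"
      by (simp add: mult.assoc)
  qed
  also have "\<dots> = ennreal (real k) * (\<integral>\<^sup>+x. (\<integral>\<^sup>+y. ennreal ((mehler d \<rho> x y * vec_inner d x y)\<^sup>2) \<partial>gauss d) \<partial>gauss d)"
    by (simp add: nn_integral_cmult)
  also have "\<dots> \<le> ennreal (real k) * ennreal (14 * d * exp (7 * \<rho>\<^sup>2 * d))"
  proof (intro mult_left_mono)
    have *: "(\<integral>\<^sup>+x. (\<integral>\<^sup>+y. ennreal ((vec_inner d x y)^4) \<partial>gauss d) \<partial>gauss d) \<le> ennreal (27 * (real d)\<^sup>2)"
    proof -
      have "(\<integral>\<^sup>+x. (\<integral>\<^sup>+y. ennreal ((vec_inner d x y)^4) \<partial>gauss d) \<partial>gauss d) \<le> (\<integral>\<^sup>+x. ennreal (9 * (vec_inner d x x)\<^sup>2) \<partial>gauss d)"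
        by (intro nn_integral_mono nn_integral_gauss_inner_power4)
      also have "\<dots> = (\<integral>\<^sup>+x. ennreal 9 * ennreal ((vec_inner d x x)\<^sup>2) \<partial>gauss d)"
        by (simp add: ennreal_mult)
      also have "\<dots> = ennreal 9 * (\<integral>\<^sup>+x. ennreal ((vec_inner d x x)\<^sup>2) \<partial>gauss d)"
        by (rule nn_integral_cmult) measurable
      also have "\<dots> \<le> ennreal 9 * ennreal (3 * (real d)\<^sup>2)"
        by (intro mult_left_mono nn_integral_gauss_norm_power4) simp
      also have "\<dots> = ennreal (27 * (real d)\<^sup>2)" by (subst ennreal_mult[symmetric]) auto
      finally show ?thesis .
    qed
    let ?t = "d / exp (7 * \<rho>\<^sup>2 * d)"
    have "(\<integral>\<^sup>+x. (\<integral>\<^sup>+y. ennreal ((mehler d \<rho> x y * vec_inner d x y)\<^sup>2) \<partial>gauss d) \<partial>gauss d)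
      \<le> ennreal ((?t * exp (14 * \<rho>\<^sup>2 * d) + 27 * (real d)\<^sup>2 / ?t) / 2)"
      using d by (intro nn_integral_mehler_mult_square \<rho> *) auto
    also have "exp (14 * \<rho>\<^sup>2 * d) = exp (7 * \<rho>\<^sup>2 * d) * exp (7 * \<rho>\<^sup>2 * d)" by (simp add: exp_add[symmetric])
    also have "(?t * (exp (7 * \<rho>\<^sup>2 * d) * exp (7 * \<rho>\<^sup>2 * d)) + 27 * (real d)\<^sup>2 / ?t) / 2 = 14 * d * exp (7 * \<rho>\<^sup>2 * d)"
      using d by (simp add: field_simps power2_eq_square)
    finally show "(\<integral>\<^sup>+x. (\<integral>\<^sup>+y. ennreal ((mehler d \<rho> x y * vec_inner d x y)\<^sup>2) \<partial>gauss d) \<partial>gauss d) \<le> ennreal (14 * d * exp (7 * \<rho>\<^sup>2 * d))" .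
  qed auto
  also have "\<dots> = ennreal (14 * real k * d * exp (7 * \<rho>\<^sup>2 * d))"
    by (simp add: ennreal_mult[symmetric] ac_simps)
  finally show ?thesis .
qed

lemma (in prob_space) nn_integral_sum_le:
  fixes f :: "'i \<Rightarrow> 'a \<Rightarrow> real"
  assumes [measurable]: "\<And>i. i \<in> I \<Longrightarrow> f i \<in> borel_measurable M" and nn: "\<And>i x. i \<in> I \<Longrightarrow> 0 \<le> f i x"
    and le: "\<And>i. i \<in> I \<Longrightarrow> (\<integral>\<^sup>+x. ennreal (f i x) \<partial>M) \<le> ennreal (b i)" and b: "\<And>i. i \<in> I \<Longrightarrow> 0 \<le> b i"
  shows "(\<integral>\<^sup>+x. ennreal (\<Sum>i\<in>I. f i x) \<partial>M) \<le> ennreal (\<Sum>i\<in>I. b i)"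
proof -
  have "(\<integral>\<^sup>+x. ennreal (\<Sum>i\<in>I. f i x) \<partial>M) = (\<integral>\<^sup>+x. (\<Sum>i\<in>I. ennreal (f i x)) \<partial>M)"
    using nn by (simp add: sum_ennreal)
  also have "\<dots> = (\<Sum>i\<in>I. \<integral>\<^sup>+x. ennreal (f i x) \<partial>M)" by (rule nn_integral_sum) measurable
  also have "\<dots> \<le> (\<Sum>i\<in>I. ennreal (b i))" by (intro sum_mono le)
  also have "\<dots> = ennreal (\<Sum>i\<in>I. b i)" using b by simp
  finally show ?thesis .
qed

text \<open>One application of Markov's inequality to the sum of the ratios
  \<open>f i x / t i\<close>: where it is at most 1, so is each ratio.\<close>

lemma (in prob_space) prob_simultaneous_markov:
  fixes f :: "'i \<Rightarrow> 'a \<Rightarrow> real"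
  assumes [measurable]: "\<And>i. i \<in> I \<Longrightarrow> f i \<in> borel_measurable M" and nn: "\<And>i x. i \<in> I \<Longrightarrow> 0 \<le> f i x"
    and le: "\<And>i. i \<in> I \<Longrightarrow> (\<integral>\<^sup>+x. ennreal (f i x) \<partial>M) \<le> ennreal (b i)" and b: "\<And>i. i \<in> I \<Longrightarrow> 0 \<le> b i"
    and t: "\<And>i. i \<in> I \<Longrightarrow> 0 < t i" and s: "finite I" "(\<Sum>i\<in>I. b i / t i) \<le> \<delta>"
  shows "1 - \<delta> \<le> measure M {x \<in> space M. \<forall>i\<in>I. f i x \<le> t i}"
proof -
  define g where "g x = (\<Sum>i\<in>I. f i x / t i)" for x
  have [measurable]: "g \<in> borel_measurable M" unfolding g_def[abs_def] by measurable
  have "(\<integral>\<^sup>+x. ennreal (g x) \<partial>M) \<le> ennreal (\<Sum>i\<in>I. b i / t i)"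
    unfolding g_def
  proof (rule nn_integral_sum_le)
    fix i assume i: "i \<in> I"
    have "(\<integral>\<^sup>+x. ennreal (f i x / t i) \<partial>M) = (\<integral>\<^sup>+x. ennreal (1 / t i) * ennreal (f i x) \<partial>M)"
      using t[OF i] nn[OF i] by (simp add: ennreal_mult[symmetric])
    also have "\<dots> = ennreal (1 / t i) * (\<integral>\<^sup>+x. ennreal (f i x) \<partial>M)"
      using i by (intro nn_integral_cmult) measurable
    also have "\<dots> \<le> ennreal (1 / t i) * ennreal (b i)" by (intro mult_left_mono le i) simp
    also have "\<dots> = ennreal (b i / t i)" using t[OF i] b[OF i] by (simp add: ennreal_mult[symmetric])
    finally show "(\<integral>\<^sup>+x. ennreal (f i x / t i) \<partial>M) \<le> ennreal (b i / t i)" .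
  qed (use nn b t in \<open>auto simp: less_imp_le intro!: divide_nonneg_pos\<close>)
  from nn_integral_markov[OF _ this, of 1] have "measure M {x \<in> space M. 1 < g x} \<le> (\<Sum>i\<in>I. b i / t i)"
    using b t by (auto intro!: sum_nonneg divide_nonneg_pos)
  then have "measure M {x \<in> space M. 1 < g x} \<le> \<delta>" using s by simp
  moreover have "measure M {x \<in> space M. 1 < g x} = 1 - measure M {x \<in> space M. g x \<le> 1}"
    using prob_neg[of "\<lambda>x. g x \<le> 1"] by (simp add: not_le)
  moreover have "measure M {x \<in> space M. g x \<le> 1} \<le> measure M {x \<in> space M. \<forall>i\<in>I. f i x \<le> t i}"
  proof (rule finite_measure_mono)
    show "{x \<in> space M. g x \<le> 1} \<subseteq> {x \<in> space M. \<forall>i\<in>I. f i x \<le> t i}"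
    proof safe
      fix x i assume x: "g x \<le> 1" and i: "i \<in> I"
      have "f i x / t i \<le> g x"
        unfolding g_def using nn t s by (intro member_le_sum i) (auto intro!: divide_nonneg_pos)
      then have "f i x / t i \<le> 1" using x by linarith
      then show "f i x \<le> t i" using t[OF i] by (simp add: divide_le_eq)
    qed
    have "{x \<in> space M. \<forall>i\<in>I. f i x \<le> t i} = {x \<in> space M. \<forall>i\<in>I. f i x \<le> t i}" ..
    show "{x \<in> space M. \<forall>i\<in>I. f i x \<le> t i} \<in> events"
      using s by (intro sets.sets_Collect_finite_All) measurable
  qed
  ultimately show ?thesis by linarith
qed

lemma measurable_snd_gauss_component:
  assumes "j \<in> K" "l < d"
  shows "(\<lambda>x. snd x j l) \<in> borel_measurable (N \<Otimes>\<^sub>M (\<Pi>\<^sub>M j\<in>K. gauss d))"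
proof (rule measurable_gauss_component[OF _ assms(2)])
  show "(\<lambda>x. snd x j) \<in> N \<Otimes>\<^sub>M (\<Pi>\<^sub>M j\<in>K. gauss d) \<rightarrow>\<^sub>M gauss d" using assms(1) by measurable
qed

lemma measurable_mehler_row_vector:
  "(\<lambda>q. ennreal (\<Sum>l<d. (\<Sum>j\<in>J. mehler d \<rho> (fst q) (snd q j) * snd q j l)\<^sup>2))
     \<in> borel_measurable (gauss d \<Otimes>\<^sub>M (\<Pi>\<^sub>M j\<in>J. gauss d))"
proof (rule measurable_compose[OF _ measurable_ennreal], intro borel_measurable_sum borel_measurable_power borel_measurable_times)
  fix j l assume jl: "j \<in> J" "l \<in> {..<d}"
  show "(\<lambda>q. snd q j l) \<in> borel_measurable (gauss d \<Otimes>\<^sub>M (\<Pi>\<^sub>M j\<in>J. gauss d))"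
    using jl by (intro measurable_snd_gauss_component) auto
  show "(\<lambda>q. mehler d \<rho> (fst q) (snd q j)) \<in> borel_measurable (gauss d \<Otimes>\<^sub>M (\<Pi>\<^sub>M j\<in>J. gauss d))"
    using jl by measurable
qed

text \<open>The event that all inner products between two independent Gaussian samples are nonnegative is
  far from typical: any configuration in it is far, in Euclidean distance, from the typical set on which
  the Mehler weights favour negatively correlated pairs while having nearly constant row and column sums.\<close>

lemma bipartite_nonneg_bound:
  fixes I :: "'i set" and J :: "'j set" and d :: nat and \<rho> s0 :: real
  defines "\<Omega> \<equiv> (\<Pi>\<^sub>M i\<in>I. gauss d) \<Otimes>\<^sub>M (\<Pi>\<^sub>M j\<in>J. gauss d)"
  assumes I: "finite I" "card I = k" and J: "finite J" "card J = k" and \<rho>: "0 < \<rho>" "\<rho> \<le> 1 / 4" and d: "0 < d"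
    and k: "768 * exp (14 * \<rho>\<^sup>2 * d) \<le> real k" and k2: "3584 * exp (7 * \<rho>\<^sup>2 * d) \<le> real k * (\<rho>\<^sup>2 * d)"
    and s0: "s0 \<le> real k * \<rho> * d / 8"
      "s0 \<le> (real k * \<rho> * d)\<^sup>2 / (4096 * (4 * d * exp (7 * \<rho>\<^sup>2 * d) + 2 * real k * \<rho>\<^sup>2 * d))"
  shows "measure \<Omega> {p \<in> space \<Omega>. \<forall>i\<in>I. \<forall>j\<in>J. 0 \<le> vec_inner d (fst p i) (snd p j)} \<le> 2 * exp (- s0 / 4)"
proof -
  interpret G: prob_space "gauss d" by (rule prob_space_gauss)
  have PX: "prob_space (\<Pi>\<^sub>M i\<in>I. gauss d)" and PY: "prob_space (\<Pi>\<^sub>M j\<in>J. gauss d)"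
    by (auto intro!: prob_space_PiM prob_space_gauss)
  interpret X: prob_space "\<Pi>\<^sub>M i\<in>I. gauss d" by fact
  interpret Y: prob_space "\<Pi>\<^sub>M j\<in>J. gauss d" by fact
  interpret XY: pair_prob_space "\<Pi>\<^sub>M i\<in>I. gauss d" "\<Pi>\<^sub>M j\<in>J. gauss d" by unfold_locales
  interpret O: prob_space \<Omega> unfolding \<Omega>_def by unfold_locales
  have "\<bar>\<rho>\<bar>\<^sup>2 \<le> (1 / 4)\<^sup>2" using \<rho> by (intro power_mono) auto
  then have r1: "\<rho>\<^sup>2 < 1" by (auto simp: power2_eq_square)
  have \<rho>': "\<bar>\<rho>\<bar> \<le> 1 / 4" using \<rho> by simp
  define E where "E = exp (7 * \<rho>\<^sup>2 * d)"
  have E: "1 \<le> E" by (simp add: E_def)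
  have EE: "exp (14 * \<rho>\<^sup>2 * d) = E * E" by (simp add: E_def exp_add[symmetric])
  have EE1: "1 \<le> E * E" using mult_mono[OF E E] E by simp
  have kE: "768 * (E * E) \<le> real k" using k by (simp add: EE)
  have k768: "768 \<le> real k" using EE1 kE by linarith
  have k0: "0 < real k" using k768 by linarith
  define Q where "Q = 4 * real k * d * E + 2 * (real k)\<^sup>2 * \<rho>\<^sup>2 * d"
  have Q: "0 < Q" unfolding Q_def using k0 d E by (intro add_pos_nonneg) auto
  have mX [measurable]: "(\<lambda>p. fst p i) \<in> \<Omega> \<rightarrow>\<^sub>M gauss d" if "i \<in> I" for i
    unfolding \<Omega>_def using that by measurable
  have mY [measurable]: "(\<lambda>p. snd p j) \<in> \<Omega> \<rightarrow>\<^sub>M gauss d" if "j \<in> J" for j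
    unfolding \<Omega>_def using that by measurable
  have [measurable]: "(\<lambda>p. fst p i l) \<in> borel_measurable \<Omega>" if "i \<in> I" "l < d" for i l
    using measurable_gauss_component[OF mX[OF that(1)] that(2)] .
  have [measurable]: "(\<lambda>p. snd p j l) \<in> borel_measurable \<Omega>" if "j \<in> J" "l < d" for j l
    using measurable_gauss_component[OF mY[OF that(1)] that(2)] .
  have [measurable]: "(\<lambda>w. f w j) \<in> M \<rightarrow>\<^sub>M gauss d" if "f \<in> M \<rightarrow>\<^sub>M (\<Pi>\<^sub>M j\<in>K. gauss d)" "j \<in> K" for f M j and K :: "'z set"
    using that by measurable
  define W where "W p i j = mehler d \<rho> (fst p i) (snd p j)" for p :: "('i \<Rightarrow> nat \<Rightarrow> real) \<times> ('j \<Rightarrow> nat \<Rightarrow> real)" and i j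
  have W0: "0 \<le> W p i j" for p i j unfolding W_def by (rule mehler_nonneg[OF r1])
  have [measurable]: "(\<lambda>p. W p i j) \<in> borel_measurable \<Omega>" if "i \<in> I" "j \<in> J" for i j
    unfolding W_def using that by measurable
  \<comment> \<open>The statistics that define the typical set \<open>B\<close>: row and column sums
    of the weights, squared lengths of the weighted row and column vectors, deviation of the
    weighted inner products from their conditional mean, and total squared length of the
    \<open>X i\<close>. Their means are bounded by \<open>b\<close>, and Markov is applied at the
    levels \<open>t\<close>.\<close>
  define f :: "nat \<Rightarrow> ('i \<Rightarrow> nat \<Rightarrow> real) \<times> ('j \<Rightarrow> nat \<Rightarrow> real) \<Rightarrow> real" where
    "f a p =
      (if a = 0 then (\<Sum>i\<in>I. ((\<Sum>j\<in>J. W p i j) - real k)^4)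
       else if a = 1 then (\<Sum>j\<in>J. ((\<Sum>i\<in>I. W p i j) - real k)^4)
       else if a = 2 then (\<Sum>i\<in>I. \<Sum>l<d. (\<Sum>j\<in>J. W p i j * snd p j l)\<^sup>2)
       else if a = 3 then (\<Sum>j\<in>J. \<Sum>l<d. (\<Sum>i\<in>I. W p i j * fst p i l)\<^sup>2)
       else if a = 4 then (\<Sum>i\<in>I. ((\<Sum>j\<in>J. W p i j * vec_inner d (fst p i) (snd p j)) + real k * \<rho> * vec_inner d (fst p i) (fst p i))\<^sup>2)
       else ((\<Sum>i\<in>I. vec_inner d (fst p i) (fst p i)) - real k * d)\<^sup>2)" for a p
  define b :: "nat \<Rightarrow> real" where
    "b a = (if a = 0 \<or> a = 1 then real k * (48 * real k ^ 2 * exp (14 * \<rho>\<^sup>2 * d))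
       else if a = 2 \<or> a = 3 then real k * Q
       else if a = 4 then real k * (14 * real k * d * E) else 3 * real k * (real d)\<^sup>2)" for a
  define t :: "nat \<Rightarrow> real" where
    "t a = (if a = 0 \<or> a = 1 then real k ^ 4 else if a = 2 \<or> a = 3 then 16 * (real k * Q)
       else if a = 4 then 16 * (real k * (14 * real k * d * E)) else (real k * d / 2)\<^sup>2)" for a
  define A where "A = {p \<in> space \<Omega>. \<forall>i\<in>I. \<forall>j\<in>J. 0 \<le> vec_inner d (fst p i) (snd p j)}"
  define B where "B = {p \<in> space \<Omega>. \<forall>a\<in>{..<6::nat}. f a p \<le> t a}"
  have less6: "{..<6::nat} = {0, 1, 2, 3, 4, 5}" by auto
  have fm [measurable]: "f a \<in> borel_measurable \<Omega>" if "a \<in> {..<6}" for a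
    using that unfolding f_def[abs_def] less6 by (elim insertE) (simp_all, measurable)
  have f0: "0 \<le> f a p" if "a \<in> {..<6}" for a p
    using that unfolding f_def less6 by (auto intro!: sum_nonneg)
  have int: "(\<integral>\<^sup>+p. ennreal (f a p) \<partial>\<Omega>) \<le> ennreal (b a)" if a: "a \<in> {..<6}" for a
  proof -
    consider "a = 0" | "a = 1" | "a = 2" | "a = 3" | "a = 4" | "a = 5" using a unfolding less6 by auto
    then show ?thesis
    proof cases
      case 1
      have "(\<integral>\<^sup>+p. ennreal (((\<Sum>j\<in>J. W p i j) - real k)^4) \<partial>\<Omega>) \<le> ennreal (48 * real k ^ 2 * exp (14 * \<rho>\<^sup>2 * d))" if i: "i \<in> I" for i
        using mehler_row_weight[OF J \<rho>'] unfolding W_def \<Omega>_def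
        by (subst nn_integral_pair_fst_component[OF prob_space_gauss PY I(1) i,
              of "\<lambda>q. ennreal (((\<Sum>j\<in>J. mehler d \<rho> (fst q) (snd q j)) - real k)^4)", simplified]) auto
      then have "(\<integral>\<^sup>+p. ennreal (\<Sum>i\<in>I. ((\<Sum>j\<in>J. W p i j) - real k)^4) \<partial>\<Omega>) \<le> ennreal (\<Sum>i\<in>I. 48 * real k ^ 2 * exp (14 * \<rho>\<^sup>2 * d))"
        by (intro O.nn_integral_sum_le) auto
      then show ?thesis using I by (simp add: 1 f_def b_def)
    next
      case 2
      have "(\<integral>\<^sup>+p. ennreal (((\<Sum>i\<in>I. W p i j) - real k)^4) \<partial>\<Omega>) \<le> ennreal (48 * real k ^ 2 * exp (14 * \<rho>\<^sup>2 * d))" if j: "j \<in> J" for j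
        using mehler_row_weight[OF I \<rho>'] unfolding W_def \<Omega>_def mehler_commute[of d \<rho> "fst _ _"]
        by (subst nn_integral_pair_snd_component[OF prob_space_gauss PX J(1) j,
              of "\<lambda>q. ennreal (((\<Sum>i\<in>I. mehler d \<rho> (fst q) (snd q i)) - real k)^4)", simplified]) auto
      then have "(\<integral>\<^sup>+p. ennreal (\<Sum>j\<in>J. ((\<Sum>i\<in>I. W p i j) - real k)^4) \<partial>\<Omega>) \<le> ennreal (\<Sum>j\<in>J. 48 * real k ^ 2 * exp (14 * \<rho>\<^sup>2 * d))"
        by (intro O.nn_integral_sum_le) auto
      then show ?thesis using J by (simp add: 2 f_def b_def)
    next
      case 3
      have "(\<integral>\<^sup>+p. ennreal (\<Sum>l<d. (\<Sum>j\<in>J. W p i j * snd p j l)\<^sup>2) \<partial>\<Omega>) \<le> ennreal Q" if i: "i \<in> I" for i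
      proof -
        let ?F = "\<lambda>q. ennreal (\<Sum>l<d. (\<Sum>j\<in>J. mehler d \<rho> (fst q) (snd q j) * snd q j l)\<^sup>2)"
        have "?F \<in> borel_measurable (gauss d \<Otimes>\<^sub>M (\<Pi>\<^sub>M j\<in>J. gauss d))"
          by (rule measurable_mehler_row_vector)
        from nn_integral_pair_fst_component[OF prob_space_gauss PY I(1) i this] mehler_row_vector[OF J \<rho>' d]
        show ?thesis unfolding W_def \<Omega>_def Q_def E_def by simp
      qed
      then have "(\<integral>\<^sup>+p. ennreal (\<Sum>i\<in>I. \<Sum>l<d. (\<Sum>j\<in>J. W p i j * snd p j l)\<^sup>2) \<partial>\<Omega>) \<le> ennreal (\<Sum>i\<in>I. Q)"
        using Q by (intro O.nn_integral_sum_le) (auto intro!: sum_nonneg)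
      then show ?thesis using I by (simp add: 3 f_def b_def)
    next
      case 4
      have "(\<integral>\<^sup>+p. ennreal (\<Sum>l<d. (\<Sum>i\<in>I. W p i j * fst p i l)\<^sup>2) \<partial>\<Omega>) \<le> ennreal Q" if j: "j \<in> J" for j
      proof -
        let ?F = "\<lambda>q. ennreal (\<Sum>l<d. (\<Sum>i\<in>I. mehler d \<rho> (fst q) (snd q i) * snd q i l)\<^sup>2)"
        have "?F \<in> borel_measurable (gauss d \<Otimes>\<^sub>M (\<Pi>\<^sub>M i\<in>I. gauss d))"
          by (rule measurable_mehler_row_vector)
        from nn_integral_pair_snd_component[OF prob_space_gauss PX J(1) j this] mehler_row_vector[OF I \<rho>' d]
        show ?thesis unfolding W_def \<Omega>_def Q_def E_def mehler_commute[of d \<rho> "fst _ _"] by simp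
      qed
      then have "(\<integral>\<^sup>+p. ennreal (\<Sum>j\<in>J. \<Sum>l<d. (\<Sum>i\<in>I. W p i j * fst p i l)\<^sup>2) \<partial>\<Omega>) \<le> ennreal (\<Sum>j\<in>J. Q)"
        using Q by (intro O.nn_integral_sum_le) (auto intro!: sum_nonneg)
      then show ?thesis using J by (simp add: 4 f_def b_def)
    next
      case 5
      have "(\<integral>\<^sup>+p. ennreal (((\<Sum>j\<in>J. W p i j * vec_inner d (fst p i) (snd p j)) + real k * \<rho> * vec_inner d (fst p i) (fst p i))\<^sup>2) \<partial>\<Omega>)
         \<le> ennreal (14 * real k * d * E)" if i: "i \<in> I" for i
      proof -
        let ?F = "\<lambda>q. ennreal (((\<Sum>j\<in>J. mehler d \<rho> (fst q) (snd q j) * vec_inner d (fst q) (snd q j)) + real k * \<rho> * vec_inner d (fst q) (fst q))\<^sup>2)"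
        have "?F \<in> borel_measurable (gauss d \<Otimes>\<^sub>M (\<Pi>\<^sub>M j\<in>J. gauss d))" by measurable
        from nn_integral_pair_fst_component[OF prob_space_gauss PY I(1) i this] mehler_row_inner[OF J \<rho>' d]
        show ?thesis unfolding W_def \<Omega>_def Q_def E_def by simp
      qed
      then have "(\<integral>\<^sup>+p. ennreal (\<Sum>i\<in>I. ((\<Sum>j\<in>J. W p i j * vec_inner d (fst p i) (snd p j)) + real k * \<rho> * vec_inner d (fst p i) (fst p i))\<^sup>2) \<partial>\<Omega>)
         \<le> ennreal (\<Sum>i\<in>I. 14 * real k * d * E)"
        using E by (intro O.nn_integral_sum_le) auto
      then show ?thesis using I by (simp add: 5 f_def b_def)
    next
      case 6
      have nn: "0 \<le> vec_inner d x x" for x by (auto simp: vec_inner_def intro: sum_nonneg)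
      have i2: "integrable (gauss d) (\<lambda>x. (vec_inner d x x)\<^sup>2)"
        by (rule integrableI_nonneg) (use nn_integral_gauss_norm_power4[of d] in \<open>auto intro: order_le_less_trans\<close>)
      have i1: "integrable (gauss d) (\<lambda>x. vec_inner d x x)"
        using G.integrable_power_mono[of "\<lambda>x. vec_inner d x x" 2 1] i2 by simp
      have mean: "(\<integral>x. vec_inner d x x \<partial>gauss d) = real d"
        using nn_integral_eq_integral[OF i1] nn nn_integral_gauss_norm_square[of d] by simp
      have "(\<integral>\<^sup>+p. ennreal (((\<Sum>i\<in>I. vec_inner d (fst p i) (fst p i)) - real k * d)\<^sup>2) \<partial>\<Omega>)
        = (\<integral>\<^sup>+X. ennreal (((\<Sum>i\<in>I. vec_inner d (X i) (X i)) - real k * d)\<^sup>2) \<partial>(\<Pi>\<^sub>M i\<in>I. gauss d))"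
        unfolding \<Omega>_def by (subst Y.nn_integral_fst[symmetric]) (auto simp: Y.emeasure_space_1)
      also have "\<dots> \<le> ennreal k * (\<integral>\<^sup>+x. ennreal ((vec_inner d x x)\<^sup>2) \<partial>gauss d)"
        using G.nn_integral_PiM_sum_centred_square[OF I(1) _ i2 mean] I by simp
      also have "\<dots> \<le> ennreal k * ennreal (3 * (real d)\<^sup>2)"
        by (intro mult_left_mono nn_integral_gauss_norm_power4) simp
      also have "\<dots> = ennreal (3 * real k * (real d)\<^sup>2)"
        by (subst ennreal_mult[symmetric]) (auto simp: ac_simps)
      finally show ?thesis by (simp add: 6 f_def b_def)
    qed
  qed
  have PB: "1 / 2 \<le> measure \<Omega> B"
  proof -
    have "(\<Sum>a\<in>{..<6::nat}. b a / t a) = 2 * (48 * (E * E) / k) + 2 * (1 / 16) + 1 / 16 + 12 / k"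
      unfolding less6 b_def t_def EE using k0 Q d E
      by (simp add: power2_eq_square power4_eq_xxxx field_simps)
    also have "\<dots> \<le> 1 / 2"
    proof -
      \<comment> \<open>The 768 in the hypothesis is \<open>16 * 48\<close>. The six ratios then add
        up to at most 3/8.\<close>
      have "48 * (E * E) / k \<le> 1 / 16" "12 / real k \<le> 1 / 16" using kE k768 k0 by (simp_all add: field_simps)
      then show ?thesis by simp
    qed
    finally have "1 - 1 / 2 \<le> measure \<Omega> B" unfolding B_def
      using k0 Q d E by (intro O.prob_simultaneous_markov[where b = b] fm f0 int) (auto simp: b_def t_def)
    then show ?thesis by simp
  qed
  have far: "s0 \<le> (\<Sum>i\<in>I. \<Sum>l<d. (fst p i l - fst q i l)\<^sup>2) + (\<Sum>j\<in>J. \<Sum>l<d. (snd p j l - snd q j l)\<^sup>2)" (is "_ \<le> ?S")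
    if p: "p \<in> B" and q: "q \<in> A" for p q
  proof (rule ccontr)
    assume "\<not> s0 \<le> ?S"
    then have S: "?S < s0" by simp
    have S0: "0 \<le> ?S" by (intro add_nonneg_nonneg sum_nonneg) auto
    have fp: "f a p \<le> t a" if "a < 6" for a using p that by (auto simp: B_def)
    have ab: "x \<le> 2 * real k" if "(x - real k)^4 \<le> real k ^ 4" for x :: real
    proof -
      have "\<bar>x - real k\<bar>^4 \<le> real k ^ 4" using that by (simp add: power_even_abs)
      then have "\<bar>x - real k\<bar> \<le> real k" by (subst (asm) power_mono_iff) auto
      then show ?thesis by simp
    qed
    have abs_le: "\<bar>x\<bar> \<le> y" if "x\<^sup>2 \<le> y\<^sup>2" "0 \<le> y" for x y :: real
      using that abs_le_square_iff[of x y] by simp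
    have row: "(\<Sum>j\<in>J. W p i j) \<le> 2 * real k" if "i \<in> I" for i
    proof (rule ab)
      have "((\<Sum>j\<in>J. W p i j) - real k)^4 \<le> f 0 p"
        unfolding f_def using that I by (auto intro!: member_le_sum)
      then show "((\<Sum>j\<in>J. W p i j) - real k)^4 \<le> real k ^ 4" using fp[of 0] by (simp add: t_def)
    qed
    have col: "(\<Sum>i\<in>I. W p i j) \<le> 2 * real k" if "j \<in> J" for j
    proof (rule ab)
      have "((\<Sum>i\<in>I. W p i j) - real k)^4 \<le> f 1 p"
        unfolding f_def using that J member_le_sum[of j J "\<lambda>j. ((\<Sum>i\<in>I. W p i j) - real k)^4"] by auto
      then show "((\<Sum>i\<in>I. W p i j) - real k)^4 \<le> real k ^ 4" using fp[of 1] by (simp add: t_def)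
    qed
    have U: "(\<Sum>i\<in>I. \<Sum>l<d. (\<Sum>j\<in>J. W p i j * snd p j l)\<^sup>2) \<le> 16 * (real k * Q)"
      using fp[of 2] by (simp add: f_def t_def)
    have V: "(\<Sum>j\<in>J. \<Sum>l<d. (\<Sum>i\<in>I. W p i j * fst p i l)\<^sup>2) \<le> 16 * (real k * Q)"
      using fp[of 3] by (simp add: f_def t_def)
    let ?T = "\<Sum>i\<in>I. \<Sum>j\<in>J. W p i j * vec_inner d (fst p i) (snd p j)"
    have T: "- ?T \<le> 2 * sqrt (16 * (real k * Q) * ?S) + real k * ?S"
      using q by (intro weighted_bilinear_bound I J W0 row col U V) (auto simp: A_def)
    have N: "real k * d / 2 \<le> (\<Sum>i\<in>I. vec_inner d (fst p i) (fst p i))"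
    proof -
      have "((\<Sum>i\<in>I. vec_inner d (fst p i) (fst p i)) - real k * d)\<^sup>2 \<le> (real k * d / 2)\<^sup>2"
        using fp[of 5] by (simp add: f_def t_def)
      then have "\<bar>(\<Sum>i\<in>I. vec_inner d (fst p i) (fst p i)) - real k * d\<bar> \<le> real k * d / 2"
        by (rule abs_le) simp
      then show ?thesis unfolding abs_le_iff by linarith
    qed
    let ?g = "\<lambda>i. (\<Sum>j\<in>J. W p i j * vec_inner d (fst p i) (snd p j)) + real k * \<rho> * vec_inner d (fst p i) (fst p i)"
    \<comment> \<open>Cauchy-Schwarz over the \<open>k\<close> rows. The constant 3584 is
      \<open>16 * 16 * 14\<close>: Markov's 16, the 14 of \<open>mehler_row_inner\<close>, and 16
      for the desired quarter, squared.\<close>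
    have "(\<Sum>i\<in>I. ?g i)\<^sup>2 \<le> real k * (\<Sum>i\<in>I. (?g i)\<^sup>2)"
      using Cauchy_Schwarz_ineq_sum[of "\<lambda>_. 1" ?g I] I by simp
    also have "\<dots> \<le> real k * (16 * (real k * (14 * real k * d * E)))"
      using fp[of 4] by (intro mult_left_mono) (auto simp: f_def t_def)
    also have "\<dots> = 3584 * E * ((real k)^3 * d) / 16" by (simp add: power3_eq_cube)
    also have "\<dots> \<le> (real k * (\<rho>\<^sup>2 * d)) * ((real k)^3 * d) / 16"
      using k2 by (intro divide_right_mono mult_right_mono) (auto simp: E_def)
    also have "\<dots> = ((real k)\<^sup>2 * \<rho> * d / 4)\<^sup>2"
      by (simp add: power2_eq_square power3_eq_cube)
    finally have "\<bar>\<Sum>i\<in>I. ?g i\<bar> \<le> (real k)\<^sup>2 * \<rho> * d / 4"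
      using \<rho> by (intro abs_le) auto
    moreover have "(\<Sum>i\<in>I. ?g i) = ?T + real k * \<rho> * (\<Sum>i\<in>I. vec_inner d (fst p i) (fst p i))"
      by (simp add: sum.distrib sum_distrib_left)
    moreover have "real k * \<rho> * (real k * d / 2) \<le> real k * \<rho> * (\<Sum>i\<in>I. vec_inner d (fst p i) (fst p i))"
      using \<rho> by (intro mult_left_mono N) auto
    moreover have "real k * \<rho> * (real k * d / 2) = (real k)\<^sup>2 * \<rho> * d / 2" by (simp add: power2_eq_square)
    \<comment> \<open>By \<open>N\<close> the mean is at most
      \<open>- k\<^sup>2 * \<rho> * d / 2\<close>, and the fluctuation takes back at most half of
      that. The two bounds on \<open>s0\<close> are calibrated so that \<open>T\<close> allows
      strictly less than the remaining quarter: twice 1/16 from the square root and 1/8 from the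
      bilinear term.\<close>
    ultimately have T2: "(real k)\<^sup>2 * \<rho> * d / 4 \<le> - ?T" by linarith
    have "real k * ?S < real k * (real k * \<rho> * d / 8)"
      using S s0(1) k0 by (intro mult_strict_left_mono) auto
    then have a1: "real k * ?S < (real k)\<^sup>2 * \<rho> * d / 8" by (simp add: power2_eq_square)
    \<comment> \<open>Here 4096 is \<open>16 * 16\<^sup>2\<close>, so the square root comes out as
      one sixteenth.\<close>
    have "16 * (real k * Q) * ?S < 16 * (real k * Q) * ((real k * \<rho> * d)\<^sup>2 / (4096 * (Q / real k)))"
    proof (rule mult_strict_left_mono)
      have "Q / real k = 4 * d * E + 2 * real k * \<rho>\<^sup>2 * d"
        using k0 by (simp add: Q_def field_simps power2_eq_square)
      then show "?S < (real k * \<rho> * d)\<^sup>2 / (4096 * (Q / real k))"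
        using S s0(2) by (simp add: E_def)
    qed (use k0 Q in simp)
    also have "\<dots> = ((real k)\<^sup>2 * \<rho> * d / 16)\<^sup>2"
      using k0 Q by (simp add: power2_eq_square field_simps)
    finally have "sqrt (16 * (real k * Q) * ?S) < sqrt (((real k)\<^sup>2 * \<rho> * d / 16)\<^sup>2)" by (rule real_sqrt_less_mono)
    then have "sqrt (16 * (real k * Q) * ?S) < (real k)\<^sup>2 * \<rho> * d / 16" using \<rho> by simp
    with a1 T T2 show False by linarith
  qed
  have Am: "A \<in> sets \<Omega>"
    unfolding A_def using I J by (intro sets.sets_Collect_finite_All) measurable
  have Bm: "B \<in> sets \<Omega>"
    unfolding B_def by (intro sets.sets_Collect_finite_All) measurable
  have tp: "transport_property (gauss d) (\<lambda>x y. \<Sum>l<d. (x l - y l)\<^sup>2 / 4)"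
    by (intro transport_property_PiM transport_property_std_normal std_normal.prob_space_axioms) simp
  have "transport_property \<Omega> (\<lambda>p q. (\<Sum>i\<in>I. \<Sum>l<d. (fst p i l - fst q i l)\<^sup>2 / 4) + (\<Sum>j\<in>J. \<Sum>l<d. (snd p j l - snd q j l)\<^sup>2 / 4))"
    unfolding \<Omega>_def using I J
    by (intro transport_property_pair transport_property_PiM tp prob_space_gauss PX PY) auto
  then have "measure \<Omega> B * measure \<Omega> A \<le> exp (- (s0 / 4))"
  proof (rule transport_property_sets[OF O.prob_space_axioms _ Bm Am])
    fix p q assume "p \<in> B" "q \<in> A"
    from far[OF this] show "s0 / 4 \<le> (\<Sum>i\<in>I. \<Sum>l<d. (fst p i l - fst q i l)\<^sup>2 / 4) + (\<Sum>j\<in>J. \<Sum>l<d. (snd p j l - snd q j l)\<^sup>2 / 4)"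
      by (simp add: sum_divide_distrib[symmetric] add_divide_distrib[symmetric])
  qed
  moreover have "1 / 2 * measure \<Omega> A \<le> measure \<Omega> B * measure \<Omega> A"
    using PB by (intro mult_right_mono) auto
  ultimately show ?thesis unfolding A_def[symmetric] by simp
qed

section \<open>Gaussian vectors and the sphere\<close>

lemma PiM_density:
  fixes M :: "'a measure"
  assumes "sigma_finite_measure M" "\<And>i. sigma_finite_measure (density M (g i))" "finite I"
    and [measurable]: "\<And>i. g i \<in> borel_measurable M"
  shows "(\<Pi>\<^sub>M i\<in>I. density M (g i)) = density (\<Pi>\<^sub>M i\<in>I. M) (\<lambda>x. \<Prod>i\<in>I. g i (x i))"
proof -
  interpret D: product_sigma_finite "\<lambda>i. density M (g i)"
    by (simp add: product_sigma_finite_def assms)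
  interpret P: product_sigma_finite "\<lambda>_. M"
    by (simp add: product_sigma_finite_def assms)
  show ?thesis
  proof (rule D.PiM_eqI[symmetric])
    show "sets (density (\<Pi>\<^sub>M i\<in>I. M) (\<lambda>x. \<Prod>i\<in>I. g i (x i))) = sets (\<Pi>\<^sub>M i\<in>I. density M (g i))"
      by (simp, rule sets_PiM_cong) auto
    fix A assume "\<And>i. i \<in> I \<Longrightarrow> A i \<in> sets (density M (g i))"
    then have A [measurable]: "A i \<in> sets M" if "i \<in> I" for i using that by simp
    have "emeasure (density (\<Pi>\<^sub>M i\<in>I. M) (\<lambda>x. \<Prod>i\<in>I. g i (x i))) (Pi\<^sub>E I A)
       = (\<integral>\<^sup>+x. (\<Prod>i\<in>I. g i (x i)) * indicator (Pi\<^sub>E I A) x \<partial>(\<Pi>\<^sub>M i\<in>I. M))"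
      using assms by (intro emeasure_density) auto
    also have "\<dots> = (\<integral>\<^sup>+x. (\<Prod>i\<in>I. g i (x i) * indicator (A i) (x i)) \<partial>(\<Pi>\<^sub>M i\<in>I. M))"
    proof (rule nn_integral_cong)
      fix x assume x: "x \<in> space (\<Pi>\<^sub>M i\<in>I. M)"
      have "indicator (Pi\<^sub>E I A) x = (\<Prod>i\<in>I. indicator (A i) (x i) :: ennreal)"
        using x \<open>finite I\<close> by (auto simp: indicator_def space_PiM PiE_iff prod_eq_1_iff)
      then show "(\<Prod>i\<in>I. g i (x i)) * indicator (Pi\<^sub>E I A) x = (\<Prod>i\<in>I. g i (x i) * indicator (A i) (x i))"
        by (simp add: prod.distrib)
    qed
    also have "\<dots> = (\<Prod>i\<in>I. \<integral>\<^sup>+x. g i x * indicator (A i) x \<partial>M)"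
      using assms by (intro P.product_nn_integral_prod) auto
    also have "\<dots> = (\<Prod>i\<in>I. emeasure (density M (g i)) (A i))"
      by (intro prod.cong refl emeasure_density[symmetric]) auto
    finally show "emeasure (density (\<Pi>\<^sub>M i\<in>I. M) (\<lambda>x. \<Prod>i\<in>I. g i (x i))) (Pi\<^sub>E I A) = \<dots>" .
  qed (use assms in auto)
qed

abbreviation lebesgue_vec :: "nat \<Rightarrow> (nat \<Rightarrow> real) measure" where
  "lebesgue_vec d \<equiv> (\<Pi>\<^sub>M k\<in>{..<d}. lborel)"

lemma emeasure_lebesgue_vec_scale:
  assumes r: "0 < r" and A [measurable]: "A \<in> sets (lebesgue_vec d)"
  shows "emeasure (lebesgue_vec d) A
    = ennreal (r ^ d) * emeasure (lebesgue_vec d) {x \<in> space (lebesgue_vec d). (\<lambda>k\<in>{..<d}. r * x k) \<in> A}"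
proof -
  interpret product_sigma_finite "\<lambda>_::nat. lborel :: real measure" by unfold_locales
  let ?L = "lebesgue_vec d"
  let ?s = "\<lambda>x. \<lambda>k\<in>{..<d}. r * x k"
  have s [measurable]: "?s \<in> ?L \<rightarrow>\<^sub>M ?L" by measurable
  have "density (distr ?L ?L ?s) (\<lambda>_. ennreal (r ^ d)) = ?L"
  proof (rule PiM_eqI)
    fix B assume B [measurable]: "\<And>i. i \<in> {..<d} \<Longrightarrow> B i \<in> sets (lborel :: real measure)"
    have one: "emeasure lborel C = ennreal r * emeasure lborel ((*) r -` C)" if [measurable]: "C \<in> sets borel" for C
    proof -
      have "emeasure lborel C = emeasure (density (distr lborel borel (\<lambda>x. 0 + r * x)) (\<lambda>_. ennreal \<bar>r\<bar>)) C"
        using lborel_real_affine[of r 0] r by simp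
      also have "\<dots> = ennreal r * emeasure (distr lborel borel (\<lambda>x. 0 + r * x)) C"
        using r by (simp add: emeasure_density_const)
      also have "emeasure (distr lborel borel (\<lambda>x. 0 + r * x)) C = emeasure lborel ((*) r -` C)"
        by (subst emeasure_distr) (auto intro!: arg_cong[where f = "emeasure lborel"])
      finally show ?thesis .
    qed
    have "emeasure (density (distr ?L ?L ?s) (\<lambda>_. ennreal (r ^ d))) (Pi\<^sub>E {..<d} B)
      = ennreal (r ^ d) * emeasure ?L (?s -` Pi\<^sub>E {..<d} B \<inter> space ?L)"
      by (simp add: emeasure_density_const emeasure_distr)
    also have "?s -` Pi\<^sub>E {..<d} B \<inter> space ?L = Pi\<^sub>E {..<d} (\<lambda>k. (*) r -` B k)"
      by (auto simp: space_PiM PiE_iff restrict_def extensional_def)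
    also have "emeasure ?L \<dots> = (\<Prod>k<d. emeasure lborel ((*) r -` B k))"
    proof (rule emeasure_PiM)
      fix k assume "k \<in> {..<d}"
      then have "(*) r -` B k \<inter> space borel \<in> sets borel" using B by (intro measurable_sets[of _ borel borel]) auto
      then show "(*) r -` B k \<in> sets lborel" by simp
    qed simp
    also have "ennreal (r ^ d) * \<dots> = (\<Prod>k<d. ennreal r * emeasure lborel ((*) r -` B k))"
      using r by (simp add: prod.distrib ennreal_power)
    also have "\<dots> = (\<Prod>k<d. emeasure lborel (B k))"
      using B by (intro prod.cong refl one[symmetric]) auto
    finally show "emeasure (density (distr ?L ?L ?s) (\<lambda>_. ennreal (r ^ d))) (Pi\<^sub>E {..<d} B) = \<dots>" .
  qed auto
  then have "emeasure ?L A = emeasure (density (distr ?L ?L ?s) (\<lambda>_. ennreal (r ^ d))) A" by simp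
  also have "\<dots> = ennreal (r ^ d) * emeasure ?L (?s -` A \<inter> space ?L)"
    by (simp add: emeasure_density_const emeasure_distr)
  finally show ?thesis by (simp add: vimage_def Int_def conj_commute)
qed

lemma L2_set_scale:
  assumes "0 \<le> r" shows "L2_set (\<lambda>k\<in>{..<d}. r * x k) {..<d} = r * L2_set x {..<d}"
proof -
  have "L2_set (\<lambda>k\<in>{..<d}. r * x k) {..<d} = L2_set (\<lambda>k. r * x k) {..<d}"
    by (intro L2_set_cong) auto
  also have "\<dots> = r * L2_set x {..<d}" using assms by (rule L2_set_right_distrib[symmetric])
  finally show ?thesis .
qed

lemma vec_normalize_scale:
  assumes "0 < r" shows "vec_normalize d (\<lambda>k\<in>{..<d}. r * x k) = vec_normalize d x"
proof (rule ext)
  fix k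
  show "vec_normalize d (\<lambda>k\<in>{..<d}. r * x k) k = vec_normalize d x k"
    unfolding vec_normalize_def L2_set_scale[OF less_imp_le[OF assms]]
    using assms by (cases "k < d") (simp_all add: restrict_def)
qed

text \<open>Read from right to left, it spreads the Gaussian factor over the radii \<open>r\<close>
  beyond the norm, turning the Gaussian measure into a mixture of measures on balls.\<close>

lemma nn_integral_exp_neg_half_square:
  assumes "0 \<le> a"
  shows "(\<integral>\<^sup>+r. ennreal (r * exp (- r\<^sup>2 / 2)) * indicator {a..} r \<partial>lborel) = ennreal (exp (- a\<^sup>2 / 2))"
proof -
  have lim: "((\<lambda>r::real. - exp (- r\<^sup>2 / 2)) \<longlongrightarrow> 0) at_top"
    by real_asymp
  have "(\<integral>\<^sup>+r. ennreal (r * exp (- r\<^sup>2 / 2)) * indicator {a..} r \<partial>lborel) = ennreal (0 - (- exp (- a\<^sup>2 / 2)))"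
  proof (rule nn_integral_FTC_atLeast)
    fix x :: real assume "a \<le> x"
    then show "0 \<le> x * exp (- x\<^sup>2 / 2)" using assms by simp
    show "((\<lambda>r. - exp (- r\<^sup>2 / 2)) has_real_derivative x * exp (- x\<^sup>2 / 2)) (at x)"
      by (auto intro!: derivative_eq_intros)
  qed (use lim in auto)
  then show ?thesis by simp
qed

lemma gauss_density: "gauss d = density (lebesgue_vec d) (\<lambda>x. ennreal ((1 / sqrt (2 * pi)) ^ d * exp (- (L2_set x {..<d})\<^sup>2 / 2)))"
proof -
  have "gauss d = density (lebesgue_vec d) (\<lambda>x. \<Prod>k<d. ennreal (std_normal_density (x k)))"
    by (rule PiM_density) (auto intro: std_normal.sigma_finite_measure_axioms sigma_finite_lborel)
  also have "\<dots> = density (lebesgue_vec d) (\<lambda>x. ennreal ((1 / sqrt (2 * pi)) ^ d * exp (- (L2_set x {..<d})\<^sup>2 / 2)))"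
  proof (rule arg_cong[where f = "density (lebesgue_vec d)"], rule ext)
    fix x :: "nat \<Rightarrow> real"
    have "(\<Prod>k<d. std_normal_density (x k)) = (1 / sqrt (2 * pi)) ^ d * exp (\<Sum>k<d. - (x k)\<^sup>2 / 2)"
      unfolding std_normal_density_def prod.distrib by (simp add: exp_sum)
    also have "(\<Sum>k<d. - (x k)\<^sup>2 / 2) = - (L2_set x {..<d})\<^sup>2 / 2"
      by (simp add: L2_set_def sum_nonneg sum_divide_distrib[symmetric] sum_negf)
    finally show "(\<Prod>k<d. ennreal (std_normal_density (x k))) = ennreal ((1 / sqrt (2 * pi)) ^ d * exp (- (L2_set x {..<d})\<^sup>2 / 2))"
      by (simp add: prod_ennreal)
  qed
  finally show ?thesis .
qed

text \<open>Integration in polar coordinates: a cone meets the ball of radius \<open>r\<close> in volume proportional to \<open>r ^ d\<close>.\<close>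

lemma emeasure_gauss_cone:
  assumes A [measurable]: "A \<in> sets (\<Pi>\<^sub>M k\<in>{..<d}. borel)"
  defines "C \<equiv> {x \<in> space (lebesgue_vec d). vec_normalize d x \<in> A}"
  shows "emeasure (gauss d) C = (\<integral>\<^sup>+r. ennreal ((1 / sqrt (2 * pi)) ^ d) * ennreal (r * exp (- r\<^sup>2 / 2) * r ^ d) * indicator {0..} r \<partial>lborel)
     * emeasure (lebesgue_vec d) (C \<inter> vec_ball d)"
proof -
  interpret product_sigma_finite "\<lambda>_::nat. lborel :: real measure" by unfold_locales
  let ?L = "lebesgue_vec d"
  interpret L: sigma_finite_measure ?L by (rule sigma_finite) simp
  interpret P: pair_sigma_finite ?L lborel by unfold_locales
  let ?N = "\<lambda>x. L2_set x {..<d}"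
  let ?c = "ennreal ((1 / sqrt (2 * pi)) ^ d)"
  have C [measurable]: "C \<in> sets ?L" unfolding C_def by measurable
  have cone: "emeasure ?L {x \<in> C. ?N x \<le> r} = ennreal (r ^ d) * emeasure ?L (C \<inter> vec_ball d)" if r: "0 < r" for r
  proof -
    have m: "{x \<in> C. ?N x \<le> r} \<in> sets ?L"
    proof -
      have "{x \<in> C. ?N x \<le> r} = C \<inter> {x \<in> space ?L. ?N x \<le> r}" by (auto simp: C_def)
      also have "\<dots> \<in> sets ?L" by measurable
      finally show ?thesis .
    qed
    have "{x \<in> space ?L. (\<lambda>k\<in>{..<d}. r * x k) \<in> {x \<in> C. ?N x \<le> r}} = C \<inter> vec_ball d"
      using r by (auto simp: C_def space_PiM vec_ball_def vec_normalize_scale L2_set_scale less_imp_le[OF r])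
    then show ?thesis using emeasure_lebesgue_vec_scale[OF r m] by simp
  qed
  have Cg: "C \<in> sets (gauss d)" 
    using C sets_PiM_lborel by (simp add: sets_PiM_cong[OF refl, of "{..<d}" "\<lambda>_. std_normal_distribution" "\<lambda>_. lborel"])
  have "emeasure (gauss d) C = (\<integral>\<^sup>+x. ennreal ((1 / sqrt (2 * pi)) ^ d * exp (- (?N x)\<^sup>2 / 2)) * indicator C x \<partial>?L)"
    unfolding gauss_density by (rule emeasure_density) auto
  also have "\<dots> = (\<integral>\<^sup>+x. (\<integral>\<^sup>+r. ?c * (ennreal (r * exp (- r\<^sup>2 / 2)) * indicator {?N x..} r) * indicator C x \<partial>lborel) \<partial>?L)"
  proof (rule nn_integral_cong)
    fix x
    have "(\<integral>\<^sup>+r. ?c * (ennreal (r * exp (- r\<^sup>2 / 2)) * indicator {?N x..} r) * indicator C x \<partial>lborel)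
      = ?c * (\<integral>\<^sup>+r. ennreal (r * exp (- r\<^sup>2 / 2)) * indicator {?N x..} r \<partial>lborel) * indicator C x"
      by (simp add: nn_integral_cmult nn_integral_multc)
    also have "\<dots> = ennreal ((1 / sqrt (2 * pi)) ^ d * exp (- (?N x)\<^sup>2 / 2)) * indicator C x"
      using L2_set_nonneg[of x "{..<d}"] by (subst nn_integral_exp_neg_half_square) (auto simp: ennreal_mult)
    finally show "ennreal ((1 / sqrt (2 * pi)) ^ d * exp (- (?N x)\<^sup>2 / 2)) * indicator C x
      = (\<integral>\<^sup>+r. ?c * (ennreal (r * exp (- r\<^sup>2 / 2)) * indicator {?N x..} r) * indicator C x \<partial>lborel)" by simp
  qed
  also have "\<dots> = (\<integral>\<^sup>+r. (\<integral>\<^sup>+x. ?c * (ennreal (r * exp (- r\<^sup>2 / 2)) * indicator {?N x..} r) * indicator C x \<partial>?L) \<partial>lborel)"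
    by (rule P.Fubini'[symmetric]) (simp add: indicator_def, measurable)
  also have "\<dots> = (\<integral>\<^sup>+r. ?c * ennreal (r * exp (- r\<^sup>2 / 2) * r ^ d) * indicator {0..} r * emeasure ?L (C \<inter> vec_ball d) \<partial>lborel)"
  proof (rule nn_integral_cong)
    fix r :: real
    have eq: "?c * (ennreal (r * exp (- r\<^sup>2 / 2)) * indicator {?N x..} r) * indicator C x
      = ?c * ennreal (r * exp (- r\<^sup>2 / 2)) * indicator {x \<in> C. ?N x \<le> r} x" for x
      by (auto simp: indicator_def)
    have m: "{x \<in> C. ?N x \<le> r} \<in> sets ?L"
    proof -
      have "{x \<in> C. ?N x \<le> r} = C \<inter> {x \<in> space ?L. ?N x \<le> r}" by (auto simp: C_def)
      also have "\<dots> \<in> sets ?L" by measurable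
      finally show ?thesis .
    qed
    have "(\<integral>\<^sup>+x. ?c * (ennreal (r * exp (- r\<^sup>2 / 2)) * indicator {?N x..} r) * indicator C x \<partial>?L)
      = ?c * ennreal (r * exp (- r\<^sup>2 / 2)) * emeasure ?L {x \<in> C. ?N x \<le> r}"
      unfolding eq using m by (subst nn_integral_cmult) auto
    also have "\<dots> = ?c * ennreal (r * exp (- r\<^sup>2 / 2) * r ^ d) * indicator {0..} r * emeasure ?L (C \<inter> vec_ball d)"
    proof (cases "0 < r")
      case True
      then show ?thesis by (simp add: cone ennreal_mult mult.assoc)
    next
      case False
      then have "ennreal (r * exp (- r\<^sup>2 / 2)) = 0" by (simp add: ennreal_neg mult_nonpos_nonneg)
      moreover have "?c * ennreal (r * exp (- r\<^sup>2 / 2) * r ^ d) * indicator {0..} r * emeasure ?L (C \<inter> vec_ball d) = 0"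
      proof (cases "r = 0")
        case False
        with \<open>\<not> 0 < r\<close> have "(indicator {0..} r :: ennreal) = 0" by simp
        then show ?thesis by (simp only: mult_zero_right mult_zero_left)
      qed simp
      ultimately show ?thesis by (simp only: mult_zero_right mult_zero_left)
    qed
    finally show "(\<integral>\<^sup>+x. ?c * (ennreal (r * exp (- r\<^sup>2 / 2)) * indicator {?N x..} r) * indicator C x \<partial>?L)
      = ?c * ennreal (r * exp (- r\<^sup>2 / 2) * r ^ d) * indicator {0..} r * emeasure ?L (C \<inter> vec_ball d)" .
  qed
  also have "\<dots> = (\<integral>\<^sup>+r. ?c * ennreal (r * exp (- r\<^sup>2 / 2) * r ^ d) * indicator {0..} r \<partial>lborel) * emeasure ?L (C \<inter> vec_ball d)"
    by (rule nn_integral_multc) measurable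
  finally show ?thesis .
qed

text \<open>Both measures of \<open>A\<close> are multiples of the volume of the cone over
  \<open>A\<close> inside the ball, with factors independent of \<open>A\<close>. The radial
  integral \<open>K\<close> is never evaluated: the cone over everything has mass 1 on both sides,
  which fixes the factors.\<close>

lemma uniform_sphere_eq_gauss:
  assumes d: "1 \<le> d"
  shows "uniform_sphere d = distr (gauss d) (\<Pi>\<^sub>M k\<in>{..<d}. borel) (vec_normalize d)"
proof (rule measure_eqI)
  show "sets (uniform_sphere d) = sets (distr (gauss d) (\<Pi>\<^sub>M k\<in>{..<d}. borel) (vec_normalize d))"
    by (simp add: sets_uniform_sphere)
  fix A assume "A \<in> sets (uniform_sphere d)"
  then have A [measurable]: "A \<in> sets (\<Pi>\<^sub>M k\<in>{..<d}. borel)" by (simp add: sets_uniform_sphere)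
  let ?L = "lebesgue_vec d"
  interpret G: prob_space "gauss d" by (rule prob_space_gauss)
  interpret U: prob_space "uniform_sphere d" by (rule prob_space_uniform_sphere[OF d])
  have setseq: "sets (gauss d) = sets ?L" by (rule sets_PiM_cong) auto
  have sp: "space (gauss d) = space ?L" by (rule sets_eq_imp_space_eq[OF setseq])
  have nm [measurable]: "vec_normalize d \<in> gauss d \<rightarrow>\<^sub>M (\<Pi>\<^sub>M k\<in>{..<d}. borel)"
    using vec_normalize_measurable[of d] measurable_cong_sets[OF setseq refl] by blast
  define K where "K = (\<integral>\<^sup>+r. ennreal ((1 / sqrt (2 * pi)) ^ d) * ennreal (r * exp (- r\<^sup>2 / 2) * r ^ d) * indicator {0..} r \<partial>lborel)"
  have cone: "emeasure (gauss d) {x \<in> space ?L. vec_normalize d x \<in> B} = K * emeasure ?L ({x \<in> space ?L. vec_normalize d x \<in> B} \<inter> vec_ball d)"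
    if "B \<in> sets (\<Pi>\<^sub>M k\<in>{..<d}. borel)" for B
    unfolding K_def using emeasure_gauss_cone[OF that] .
  have uni: "emeasure (uniform_sphere d) B = emeasure ?L ({x \<in> space ?L. vec_normalize d x \<in> B} \<inter> vec_ball d) / emeasure ?L (vec_ball d)"
    if [measurable]: "B \<in> sets (\<Pi>\<^sub>M k\<in>{..<d}. borel)" for B
  proof -
    have "emeasure (uniform_sphere d) B = emeasure (uniform_measure ?L (vec_ball d)) (vec_normalize d -` B \<inter> space ?L)"
      unfolding uniform_sphere_def by (subst emeasure_distr) auto
    also have "\<dots> = emeasure ?L (vec_ball d \<inter> (vec_normalize d -` B \<inter> space ?L)) / emeasure ?L (vec_ball d)"
      by (subst emeasure_uniform_measure) auto
    also have "vec_ball d \<inter> (vec_normalize d -` B \<inter> space ?L) = {x \<in> space ?L. vec_normalize d x \<in> B} \<inter> vec_ball d" by auto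
    finally show ?thesis .
  qed
  let ?B = "emeasure ?L (vec_ball d)"
  have sp': "{x \<in> space ?L. vec_normalize d x \<in> space (\<Pi>\<^sub>M k\<in>{..<d}. borel)} = space ?L"
    using measurable_space[OF vec_normalize_measurable] by blast
  have vb: "space ?L \<inter> vec_ball d = vec_ball d" by (auto simp: vec_ball_def space_PiM)
  have 1: "K * ?B = 1"
    using cone[of "space (\<Pi>\<^sub>M k\<in>{..<d}. borel)"] G.emeasure_space_1 unfolding sp' vb sp by simp
  have 2: "?B / ?B = 1"
    using uni[of "space (\<Pi>\<^sub>M k\<in>{..<d}. borel)"] U.emeasure_space_1
    unfolding sp' vb by (simp add: space_uniform_sphere space_PiM)
  have B0: "?B \<noteq> 0" "?B \<noteq> \<infinity>" using 1 2 by (auto simp: ennreal_mult_eq_top_iff)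
  have "emeasure (distr (gauss d) (\<Pi>\<^sub>M k\<in>{..<d}. borel) (vec_normalize d)) A = emeasure (gauss d) {x \<in> space ?L. vec_normalize d x \<in> A}"
    by (subst emeasure_distr) (auto simp: sp intro!: arg_cong[where f = "emeasure (gauss d)"])
  also have "\<dots> = K * emeasure ?L ({x \<in> space ?L. vec_normalize d x \<in> A} \<inter> vec_ball d)" by (rule cone) fact
  also have "\<dots> = emeasure (uniform_sphere d) A"
  proof -
    have "emeasure (uniform_sphere d) A = 1 * (emeasure ?L ({x \<in> space ?L. vec_normalize d x \<in> A} \<inter> vec_ball d) / ?B)"
      by (simp add: uni)
    also have "\<dots> = K * (?B * (emeasure ?L ({x \<in> space ?L. vec_normalize d x \<in> A} \<inter> vec_ball d) / ?B))"
      by (simp only: 1[symmetric] mult.assoc)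
    also have "?B * (emeasure ?L ({x \<in> space ?L. vec_normalize d x \<in> A} \<inter> vec_ball d) / ?B) = emeasure ?L ({x \<in> space ?L. vec_normalize d x \<in> A} \<inter> vec_ball d)"
      using ennreal_mult_divide_eq[OF B0(1), of "emeasure ?L ({x \<in> space ?L. vec_normalize d x \<in> A} \<inter> vec_ball d)"] B0(2)
      by (simp add: ennreal_times_divide mult.commute[of ?B])
    finally show ?thesis by simp
  qed
  finally show "emeasure (uniform_sphere d) A = emeasure (distr (gauss d) (\<Pi>\<^sub>M k\<in>{..<d}. borel) (vec_normalize d)) A" by simp
qed

section \<open>Cosines, and the transfer of event and threshold to Gaussian vectors\<close>

lemma L2_set_eq_sqrt_inner: "L2_set x {..<d} = sqrt (vec_inner d x x)"
  by (simp add: L2_set_def vec_inner_def power2_eq_square)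

lemma vec_inner_self_nonneg: "0 \<le> vec_inner d x x"
  by (auto simp: vec_inner_def intro: sum_nonneg)

lemma vec_inner_commute: "vec_inner d x y = vec_inner d y x"
  by (simp add: vec_inner_def mult.commute)

lemma vec_inner_Cauchy_Schwarz: "\<bar>vec_inner d x y\<bar> \<le> sqrt (vec_inner d x x) * sqrt (vec_inner d y y)"
proof -
  have "(vec_inner d x y)\<^sup>2 \<le> vec_inner d x x * vec_inner d y y"
    using Cauchy_Schwarz_ineq_sum[of x y "{..<d}"] by (simp add: vec_inner_def power2_eq_square)
  then have "sqrt ((vec_inner d x y)\<^sup>2) \<le> sqrt (vec_inner d x x * vec_inner d y y)" by (rule real_sqrt_le_mono)
  then show ?thesis by (simp add: real_sqrt_mult)
qed

text \<open>For a zero vector the quotient is 0, and \<open>vec_normalize\<close> yields the zero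
  vector; thus \<open>vec_inner_normalize\<close> holds without exceptions.\<close>

definition vec_cos :: "nat \<Rightarrow> (nat \<Rightarrow> real) \<Rightarrow> (nat \<Rightarrow> real) \<Rightarrow> real" where
  "vec_cos d x y = vec_inner d x y / (sqrt (vec_inner d x x) * sqrt (vec_inner d y y))"

lemma vec_inner_normalize: "vec_inner d (vec_normalize d x) (vec_normalize d y) = vec_cos d x y"
proof -
  have "vec_inner d (vec_normalize d x) (vec_normalize d y) = (\<Sum>k<d. (x k / L2_set x {..<d}) * (y k / L2_set y {..<d}))"
    by (simp add: vec_inner_def vec_normalize_def)
  also have "\<dots> = (\<Sum>k<d. x k * y k) / (L2_set x {..<d} * L2_set y {..<d})"
    by (simp add: sum_divide_distrib)
  finally show ?thesis
    unfolding vec_cos_def L2_set_eq_sqrt_inner[symmetric] by (simp add: vec_inner_def)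
qed

lemma vec_cos_measurable [measurable]:
  "f \<in> M \<rightarrow>\<^sub>M gauss d \<Longrightarrow> g \<in> M \<rightarrow>\<^sub>M gauss d \<Longrightarrow> (\<lambda>w. vec_cos d (f w) (g w)) \<in> borel_measurable M"
  unfolding vec_cos_def by simp

lemma vec_normalize_measurable_gauss [measurable]: "vec_normalize d \<in> gauss d \<rightarrow>\<^sub>M (\<Pi>\<^sub>M k\<in>{..<d}. borel)"
proof -
  have "sets (gauss d) = sets (lebesgue_vec d)" by (rule sets_PiM_cong) auto
  then show ?thesis using vec_normalize_measurable[of d] measurable_cong_sets[OF _ refl] by blast
qed

lemma (in prob_space) distr_PiM_pair_component:
  assumes "finite I" "i \<in> I" "j \<in> I" "i \<noteq> j"
  shows "distr (\<Pi>\<^sub>M i\<in>I. M) (M \<Otimes>\<^sub>M M) (\<lambda>x. (x i, x j)) = M \<Otimes>\<^sub>M M"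
proof (rule pair_measure_eqI[symmetric])
  interpret product_sigma_finite "\<lambda>_. M" by unfold_locales
  have [measurable]: "(\<lambda>x. (x i, x j)) \<in> (\<Pi>\<^sub>M i\<in>I. M) \<rightarrow>\<^sub>M M \<Otimes>\<^sub>M M" using assms by measurable
  fix A B assume A [measurable]: "A \<in> sets M" and B [measurable]: "B \<in> sets M"
  let ?S = "\<lambda>k. if k = i then A else if k = j then B else space M"
  have "emeasure (distr (\<Pi>\<^sub>M i\<in>I. M) (M \<Otimes>\<^sub>M M) (\<lambda>x. (x i, x j))) (A \<times> B)
     = emeasure (\<Pi>\<^sub>M i\<in>I. M) ((\<lambda>x. (x i, x j)) -` (A \<times> B) \<inter> space (\<Pi>\<^sub>M i\<in>I. M))"
    by (rule emeasure_distr) auto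
  also have "(\<lambda>x. (x i, x j)) -` (A \<times> B) \<inter> space (\<Pi>\<^sub>M i\<in>I. M) = Pi\<^sub>E I ?S"
    using assms sets.sets_into_space[OF A] sets.sets_into_space[OF B]
    by (auto simp: space_PiM PiE_iff split: if_splits) (metis subsetD)
  also have "emeasure (\<Pi>\<^sub>M i\<in>I. M) \<dots> = (\<Prod>k\<in>I. emeasure M (?S k))"
    using assms by (intro emeasure_PiM) auto
  also have "\<dots> = (\<Prod>k\<in>I. (if k = i then emeasure M A else 1) * (if k = j then emeasure M B else 1))"
    using assms by (intro prod.cong) (auto simp: emeasure_space_1)
  also have "\<dots> = emeasure M A * emeasure M B"
    using assms by (simp add: prod.distrib)
  finally show "emeasure M A * emeasure M B = emeasure (distr (\<Pi>\<^sub>M i\<in>I. M) (M \<Otimes>\<^sub>M M) (\<lambda>x. (x i, x j))) (A \<times> B)" ..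
qed (auto simp: sigma_finite_measure_axioms)

text \<open>Normalised coordinates of the Gaussian product are independent and uniform on the
  sphere, so \<open>complete_event_prob_iid\<close> applies to them.\<close>

lemma measure_complete_event_gauss:
  assumes d: "1 \<le> d" and n: "1 \<le> n"
  shows "measure (sphere_sample n d) (complete_event n d t) = measure (\<Pi>\<^sub>M i\<in>{1..n}. gauss d)
    {G \<in> space (\<Pi>\<^sub>M i\<in>{1..n}. gauss d). \<forall>i\<in>{1..n}. \<forall>j\<in>{1..n}. i \<noteq> j \<longrightarrow> t \<le> vec_cos d (G i) (G j)}"
proof -
  let ?P = "\<Pi>\<^sub>M i\<in>{1..n}. gauss d"
  interpret G: prob_space "gauss d" by (rule prob_space_gauss)
  interpret P: prob_space ?P by (intro prob_space_PiM prob_space_gauss)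
  interpret PP: product_prob_space "\<lambda>_. gauss d" "{1..n}" by unfold_locales
  let ?X = "\<lambda>i w. vec_normalize d (w i)"
  have us: "uniform_sphere d = distr (gauss d) (uniform_sphere d) (vec_normalize d)"
    by (subst uniform_sphere_eq_gauss[OF d]) (rule distr_cong; simp add: sets_uniform_sphere)
  have nm [measurable]: "vec_normalize d \<in> gauss d \<rightarrow>\<^sub>M uniform_sphere d"
    using vec_normalize_measurable_gauss[of d] measurable_cong_sets[OF refl sets_uniform_sphere[of d]] by blast
  have comp [measurable]: "(\<lambda>w. w i) \<in> ?P \<rightarrow>\<^sub>M gauss d" if "i \<in> {1..n}" for i
    using that by measurable
  have dc: "distr ?P (gauss d) (\<lambda>w. w i) = gauss d" if "i \<in> {1..n}" for i
    using PP.PiM_component[OF that] .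
  have law: "distr ?P (uniform_sphere d) (?X i) = uniform_sphere d" if "i \<in> {1..n}" for i
  proof -
    have "distr ?P (uniform_sphere d) (?X i) = distr (distr ?P (gauss d) (\<lambda>w. w i)) (uniform_sphere d) (vec_normalize d)"
      using that by (subst distr_distr) (auto simp: comp_def)
    then show ?thesis using dc[OF that] us by simp
  qed
  have ind: "P.indep_vars (\<lambda>_. uniform_sphere d) ?X {1..n}"
  proof (rule P.indep_vars_compose2[where X = "\<lambda>i w. w i" and M' = "\<lambda>_. gauss d"])
    show "P.indep_vars (\<lambda>_. gauss d) (\<lambda>i w. w i) {1..n}"
    proof (subst P.indep_vars_iff_distr_eq_PiM')
      have "distr ?P ?P (\<lambda>x. \<lambda>i\<in>{1..n}. x i) = distr ?P ?P (\<lambda>x. x)"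
        by (intro distr_cong) (auto simp: space_PiM PiE_iff extensional_restrict)
      also have "\<dots> = ?P" by (rule distr_id)
      also have "\<dots> = (\<Pi>\<^sub>M i\<in>{1..n}. distr ?P (gauss d) (\<lambda>w. w i))"
        by (intro PiM_cong refl dc[symmetric])
      finally show "distr ?P ?P (\<lambda>x. \<lambda>i\<in>{1..n}. x i) = (\<Pi>\<^sub>M i\<in>{1..n}. distr ?P (gauss d) (\<lambda>w. w i))" .
    qed (use n comp in auto)
  qed measurable
  show ?thesis
    using complete_event_prob_iid[OF P.prob_space_axioms n ind law, of t]
    by (simp add: vec_inner_normalize)
qed

lemma measure_threshold_gauss:
  assumes d: "1 \<le> d"
  shows "is_threshold d p t \<longleftrightarrow>
    measure (gauss d \<Otimes>\<^sub>M gauss d) {q \<in> space (gauss d \<Otimes>\<^sub>M gauss d). t \<le> vec_cos d (fst q) (snd q)} = p"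
proof -
  interpret G: prob_space "gauss d" by (rule prob_space_gauss)
  interpret U: prob_space "uniform_sphere d" by (rule prob_space_uniform_sphere[OF d])
  have us: "uniform_sphere d = distr (gauss d) (uniform_sphere d) (vec_normalize d)"
    by (subst uniform_sphere_eq_gauss[OF d]) (rule distr_cong; simp add: sets_uniform_sphere)
  have nm [measurable]: "vec_normalize d \<in> gauss d \<rightarrow>\<^sub>M uniform_sphere d"
    using vec_normalize_measurable_gauss[of d] measurable_cong_sets[OF refl sets_uniform_sphere[of d]] by blast
  have sf: "sigma_finite_measure (distr (gauss d) (uniform_sphere d) (vec_normalize d))"
    unfolding us[symmetric] by unfold_locales
  have "uniform_sphere d \<Otimes>\<^sub>M uniform_sphere d
     = distr (gauss d) (uniform_sphere d) (vec_normalize d) \<Otimes>\<^sub>M distr (gauss d) (uniform_sphere d) (vec_normalize d)"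
    using us by simp
  also have "\<dots> = distr (gauss d \<Otimes>\<^sub>M gauss d) (uniform_sphere d \<Otimes>\<^sub>M uniform_sphere d) (\<lambda>(x, y). (vec_normalize d x, vec_normalize d y))"
    by (rule pair_measure_distr[OF nm nm sf])
  finally have eq: "uniform_sphere d \<Otimes>\<^sub>M uniform_sphere d
     = distr (gauss d \<Otimes>\<^sub>M gauss d) (uniform_sphere d \<Otimes>\<^sub>M uniform_sphere d) (\<lambda>(x, y). (vec_normalize d x, vec_normalize d y))" .
  let ?S = "{(x, y) \<in> space (uniform_sphere d \<Otimes>\<^sub>M uniform_sphere d). t \<le> vec_inner d x y}"
  have m: "(\<lambda>(x, y). (vec_normalize d x, vec_normalize d y)) \<in> gauss d \<Otimes>\<^sub>M gauss d \<rightarrow>\<^sub>M uniform_sphere d \<Otimes>\<^sub>M uniform_sphere d"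
    by measurable
  have S: "?S \<in> sets (uniform_sphere d \<Otimes>\<^sub>M uniform_sphere d)"
  proof -
    have [measurable]: "(\<lambda>q. vec_inner d (fst q) (snd q)) \<in> borel_measurable (uniform_sphere d \<Otimes>\<^sub>M uniform_sphere d)"
      by (rule vec_inner_measurable) simp_all
    have "?S = {q \<in> space (uniform_sphere d \<Otimes>\<^sub>M uniform_sphere d). t \<le> vec_inner d (fst q) (snd q)}" by auto
    also have "\<dots> \<in> sets (uniform_sphere d \<Otimes>\<^sub>M uniform_sphere d)" by measurable
    finally show ?thesis .
  qed
  have "measure (uniform_sphere d \<Otimes>\<^sub>M uniform_sphere d) ?S
    = measure (gauss d \<Otimes>\<^sub>M gauss d) ((\<lambda>(x, y). (vec_normalize d x, vec_normalize d y)) -` ?S \<inter> space (gauss d \<Otimes>\<^sub>M gauss d))"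
    by (subst eq, rule measure_distr[OF m S])
  also have "(\<lambda>(x, y). (vec_normalize d x, vec_normalize d y)) -` ?S \<inter> space (gauss d \<Otimes>\<^sub>M gauss d)
     = {q \<in> space (gauss d \<Otimes>\<^sub>M gauss d). t \<le> vec_cos d (fst q) (snd q)}"
    using measurable_space[OF m] by (auto simp: vec_inner_normalize[symmetric])
  finally show ?thesis unfolding is_threshold_def by simp
qed

lemma distr_std_normal_uminus: "distr std_normal_distribution std_normal_distribution uminus = std_normal_distribution"
proof (rule measure_eqI)
  fix A assume "A \<in> sets (distr std_normal_distribution std_normal_distribution uminus)"
  then have A [measurable]: "A \<in> sets borel" by simp
  have "emeasure (distr std_normal_distribution std_normal_distribution uminus) A
     = (\<integral>\<^sup>+x. ennreal (std_normal_density x) * indicator (uminus -` A) x \<partial>lborel)"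
  proof -
    have "uminus -` A \<in> sets borel" using measurable_sets_borel[of uminus borel A] by simp
    then show ?thesis by (subst emeasure_distr) (auto simp: emeasure_density)
  qed
  also have "\<dots> = (\<integral>\<^sup>+x. ennreal (std_normal_density (- x)) * indicator A (- x) \<partial>lborel)"
    by (intro nn_integral_cong) (auto simp: std_normal_density_def indicator_def)
  also have "\<dots> = (\<integral>\<^sup>+x. ennreal (std_normal_density x) * indicator A x \<partial>distr lborel borel uminus)"
    by (subst nn_integral_distr) auto
  also have "\<dots> = emeasure std_normal_distribution A"
    by (simp add: lborel_distr_uminus emeasure_density)
  finally show "emeasure (distr std_normal_distribution std_normal_distribution uminus) A = emeasure std_normal_distribution A" .
qed simp

lemma distr_gauss_uminus: "distr (gauss d) (gauss d) (\<lambda>x. \<lambda>k\<in>{..<d}. - x k) = gauss d"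
proof -
  have "distr (gauss d) (gauss d) (compose {..<d} uminus) = (\<Pi>\<^sub>M k\<in>{..<d}. distr std_normal_distribution std_normal_distribution uminus)"
    by (rule distr_PiM_finite_prob_space') (auto intro: std_normal.prob_space_axioms)
  then show ?thesis by (simp add: distr_std_normal_uminus compose_def[abs_def])
qed

lemma nn_integral_gauss_uminus:
  assumes [measurable]: "f \<in> borel_measurable (gauss d)"
  shows "(\<integral>\<^sup>+x. f (\<lambda>k\<in>{..<d}. - x k) \<partial>gauss d) = (\<integral>\<^sup>+x. f x \<partial>gauss d)"
  by (subst (2) distr_gauss_uminus[symmetric], subst nn_integral_distr) auto

lemma vec_inner_uminus: "vec_inner d x (\<lambda>k\<in>{..<d}. - y k) = - vec_inner d x y"
  by (simp add: vec_inner_def sum_negf)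

text \<open>Reflecting the second vector alone preserves the product law and changes the sign of the
  inner product.\<close>

lemma emeasure_gauss_pair_symmetric:
  "emeasure (gauss d \<Otimes>\<^sub>M gauss d) {q \<in> space (gauss d \<Otimes>\<^sub>M gauss d). vec_inner d (fst q) (snd q) < 0}
   = emeasure (gauss d \<Otimes>\<^sub>M gauss d) {q \<in> space (gauss d \<Otimes>\<^sub>M gauss d). 0 < vec_inner d (fst q) (snd q)}"
proof -
  interpret G: prob_space "gauss d" by (rule prob_space_gauss)
  have e: "emeasure (gauss d \<Otimes>\<^sub>M gauss d) {q \<in> space (gauss d \<Otimes>\<^sub>M gauss d). P (vec_inner d (fst q) (snd q))}
     = (\<integral>\<^sup>+x. (\<integral>\<^sup>+y. indicator {z. P z} (vec_inner d x y) \<partial>gauss d) \<partial>gauss d)" if [measurable]: "{z. P z} \<in> sets borel" for P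
  proof -
    have "emeasure (gauss d \<Otimes>\<^sub>M gauss d) {q \<in> space (gauss d \<Otimes>\<^sub>M gauss d). P (vec_inner d (fst q) (snd q))}
      = (\<integral>\<^sup>+q. indicator {z. P z} (vec_inner d (fst q) (snd q)) \<partial>(gauss d \<Otimes>\<^sub>M gauss d))"
    proof -
      have "{q \<in> space (gauss d \<Otimes>\<^sub>M gauss d). P (vec_inner d (fst q) (snd q))}
        = (\<lambda>q. vec_inner d (fst q) (snd q)) -` {z. P z} \<inter> space (gauss d \<Otimes>\<^sub>M gauss d)" by auto
      also have "\<dots> \<in> sets (gauss d \<Otimes>\<^sub>M gauss d)" by measurable
      finally have "emeasure (gauss d \<Otimes>\<^sub>M gauss d) {q \<in> space (gauss d \<Otimes>\<^sub>M gauss d). P (vec_inner d (fst q) (snd q))}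
        = (\<integral>\<^sup>+q. indicator {q \<in> space (gauss d \<Otimes>\<^sub>M gauss d). P (vec_inner d (fst q) (snd q))} q \<partial>(gauss d \<Otimes>\<^sub>M gauss d))"
        by (rule nn_integral_indicator[symmetric])
      also have "\<dots> = (\<integral>\<^sup>+q. indicator {z. P z} (vec_inner d (fst q) (snd q)) \<partial>(gauss d \<Otimes>\<^sub>M gauss d))"
        by (intro nn_integral_cong) (simp only: indicator_def mem_Collect_eq simp_thms)
      finally show ?thesis .
    qed
    also have "\<dots> = (\<integral>\<^sup>+x. (\<integral>\<^sup>+y. indicator {z. P z} (vec_inner d x y) \<partial>gauss d) \<partial>gauss d)"
      by (subst G.nn_integral_fst[symmetric]) auto
    finally show ?thesis .
  qed
  show ?thesis
  proof (subst e, simp, subst e, simp, rule nn_integral_cong)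
    fix x
    have "(\<integral>\<^sup>+y. indicator {z. z < 0} (vec_inner d x y) \<partial>gauss d)
      = (\<integral>\<^sup>+y. indicator {z. z < 0} (vec_inner d x (\<lambda>k\<in>{..<d}. - y k)) \<partial>gauss d)"
      by (rule nn_integral_gauss_uminus[symmetric]) measurable
    then show "(\<integral>\<^sup>+y. indicator {z. z < 0} (vec_inner d x y) \<partial>gauss d) = (\<integral>\<^sup>+y. indicator {z. 0 < z} (vec_inner d x y) \<partial>gauss d)"
      by (simp add: vec_inner_uminus indicator_def)
  qed
qed

section \<open>The upper bound\<close>

lemma vec_cos_nonneg_iff: "0 \<le> vec_cos d x y \<longleftrightarrow> 0 \<le> vec_inner d x y"
proof (cases "sqrt (vec_inner d x x) * sqrt (vec_inner d y y) = 0")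
  case True
  then have "vec_inner d x y = 0" using vec_inner_Cauchy_Schwarz[of d x y] by (auto simp: True)
  then show ?thesis by (simp add: vec_cos_def)
next
  case False
  then have "0 < sqrt (vec_inner d x x) * sqrt (vec_inner d y y)"
    using vec_inner_self_nonneg[of d x] vec_inner_self_nonneg[of d y]
    by (metis less_le mult_nonneg_nonneg real_sqrt_ge_zero)
  then show ?thesis by (simp add: vec_cos_def zero_le_divide_iff)
qed

text \<open>A Paley-Zygmund argument: the inner product has second moment \<open>d\<close> and
  fourth moment at most \<open>27 * d\<^sup>2\<close>, so it is nonzero with probability at least
  1/27, and by symmetry negative with probability at least 1/54. The bound 1/2 is symmetry
  alone.\<close>

lemma prob_gauss_pair_neg:
  assumes d: "1 \<le> d"
  shows "measure (gauss d \<Otimes>\<^sub>M gauss d) {q \<in> space (gauss d \<Otimes>\<^sub>M gauss d). 0 \<le> vec_inner d (fst q) (snd q)} \<le> 53 / 54"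
    and "1 / 2 \<le> measure (gauss d \<Otimes>\<^sub>M gauss d) {q \<in> space (gauss d \<Otimes>\<^sub>M gauss d). 0 \<le> vec_inner d (fst q) (snd q)}"
proof -
  interpret G: prob_space "gauss d" by (rule prob_space_gauss)
  interpret GG: pair_prob_space "gauss d" "gauss d" by unfold_locales
  let ?M = "gauss d \<Otimes>\<^sub>M gauss d"
  let ?Z = "\<lambda>q. vec_inner d (fst q) (snd q)"
  have [measurable]: "?Z \<in> borel_measurable ?M" by measurable
  let ?neg = "measure ?M {q \<in> space ?M. ?Z q < 0}" and ?pos = "measure ?M {q \<in> space ?M. 0 < ?Z q}"
  let ?nn = "measure ?M {q \<in> space ?M. 0 \<le> ?Z q}" and ?nz = "measure ?M {q \<in> space ?M. ?Z q \<noteq> 0}"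
  have sym: "?neg = ?pos" using emeasure_gauss_pair_symmetric[of d] by (simp add: measure_def)
  have nz: "?nz = ?neg + ?pos"
  proof -
    have "{q \<in> space ?M. ?Z q \<noteq> 0} = {q \<in> space ?M. ?Z q < 0} \<union> {q \<in> space ?M. 0 < ?Z q}" by auto
    then show ?thesis by (simp add: GG.finite_measure_Union[symmetric] disjoint_iff)
  qed
  have nn: "?nn = 1 - ?neg"
    using GG.prob_neg[of "\<lambda>q. ?Z q < 0"] by (simp add: not_less)
  have "?pos \<le> ?nn" by (rule GG.finite_measure_mono) auto
  then show "1 / 2 \<le> ?nn" using sym nn by linarith
  have z2: "(\<integral>\<^sup>+q. ennreal ((?Z q)\<^sup>2) \<partial>?M) = ennreal d"
    by (subst G.nn_integral_fst[symmetric]) (auto simp: nn_integral_gauss_inner_square nn_integral_gauss_norm_square)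
  have z4: "(\<integral>\<^sup>+q. ennreal ((?Z q)^4) \<partial>?M) \<le> ennreal (27 * (real d)\<^sup>2)"
  proof -
    have "(\<integral>\<^sup>+q. ennreal ((?Z q)^4) \<partial>?M) = (\<integral>\<^sup>+x. (\<integral>\<^sup>+y. ennreal ((vec_inner d x y)^4) \<partial>gauss d) \<partial>gauss d)"
      by (subst G.nn_integral_fst[symmetric]) auto
    also have "\<dots> \<le> (\<integral>\<^sup>+x. ennreal (9 * (vec_inner d x x)\<^sup>2) \<partial>gauss d)"
      by (intro nn_integral_mono nn_integral_gauss_inner_power4)
    also have "\<dots> = (\<integral>\<^sup>+x. ennreal 9 * ennreal ((vec_inner d x x)\<^sup>2) \<partial>gauss d)"
      by (simp add: ennreal_mult)
    also have "\<dots> = ennreal 9 * (\<integral>\<^sup>+x. ennreal ((vec_inner d x x)\<^sup>2) \<partial>gauss d)"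
      by (rule nn_integral_cmult) measurable
    also have "\<dots> \<le> ennreal 9 * ennreal (3 * (real d)\<^sup>2)"
      by (intro mult_left_mono nn_integral_gauss_norm_power4) simp
    also have "\<dots> = ennreal (27 * (real d)\<^sup>2)" by (subst ennreal_mult[symmetric]) auto
    finally show ?thesis .
  qed
  have "(\<integral>\<^sup>+q. ennreal ((?Z q)\<^sup>2) \<partial>?M)\<^sup>2 = (\<integral>\<^sup>+q. ennreal ((?Z q)\<^sup>2) * indicator {q \<in> space ?M. ?Z q \<noteq> 0} q \<partial>?M)\<^sup>2"
    by (intro arg_cong[where f = "\<lambda>x. x\<^sup>2"] nn_integral_cong) (auto simp: indicator_def)
  also have "\<dots> \<le> (\<integral>\<^sup>+q. (ennreal ((?Z q)\<^sup>2))\<^sup>2 \<partial>?M) * (\<integral>\<^sup>+q. (indicator {q \<in> space ?M. ?Z q \<noteq> 0} q)\<^sup>2 \<partial>?M)"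
    by (rule Cauchy_Schwarz_nn_integral) measurable
  also have "(\<integral>\<^sup>+q. (ennreal ((?Z q)\<^sup>2))\<^sup>2 \<partial>?M) = (\<integral>\<^sup>+q. ennreal ((?Z q)^4) \<partial>?M)"
    by (intro nn_integral_cong) (simp add: ennreal_power power_mult[symmetric])
  also have "(\<integral>\<^sup>+q. (indicator {q \<in> space ?M. ?Z q \<noteq> 0} q)\<^sup>2 \<partial>?M) = (\<integral>\<^sup>+q. indicator {q \<in> space ?M. ?Z q \<noteq> 0} q \<partial>?M)"
    by (intro nn_integral_cong) (auto simp: indicator_def)
  also have "\<dots> = ennreal ?nz" by (simp add: GG.emeasure_eq_measure)
  also have "(\<integral>\<^sup>+q. ennreal ((?Z q)^4) \<partial>?M) * ennreal ?nz \<le> ennreal (27 * (real d)\<^sup>2) * ennreal ?nz"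
    by (intro mult_right_mono z4) simp
  finally have "ennreal ((real d)\<^sup>2) \<le> ennreal (27 * (real d)\<^sup>2 * ?nz)"
    by (simp add: z2 ennreal_mult ennreal_power)
  then have "(real d)\<^sup>2 \<le> (real d)\<^sup>2 * (27 * ?nz)" by (simp add: ac_simps)
  then have "1 \<le> 27 * ?nz" using d by simp
  then show "?nn \<le> 53 / 54" using nz sym nn by linarith
qed

text \<open>For \<open>t \<ge> 0\<close> the events are nested. If \<open>t < 0\<close>, then
  \<open>p \<le> 1 / 2\<close> and the probability at least 1/2 of a nonnegative cosine leave no
  mass to cosines in \<open>[t, 0)\<close>, so the two events differ by a finite union of null
  sets.\<close>

lemma threshold_event_le_nonneg:
  assumes d: "1 \<le> d" and n: "1 \<le> n" and t: "is_threshold d p t" and p: "p \<le> 1 / 2"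
  defines "P \<equiv> (\<Pi>\<^sub>M i\<in>{1..n}. gauss d)"
  shows "measure (sphere_sample n d) (complete_event n d t)
    \<le> measure P {G \<in> space P. \<forall>i\<in>{1..n}. \<forall>j\<in>{1..n}. i \<noteq> j \<longrightarrow> 0 \<le> vec_inner d (G i) (G j)}"
proof -
  interpret G: prob_space "gauss d" by (rule prob_space_gauss)
  interpret GG: pair_prob_space "gauss d" "gauss d" by unfold_locales
  interpret P: prob_space P unfolding P_def by (intro prob_space_PiM prob_space_gauss)
  let ?M = "gauss d \<Otimes>\<^sub>M gauss d"
  have [measurable]: "(\<lambda>G. G i) \<in> P \<rightarrow>\<^sub>M gauss d" if "i \<in> {1..n}" for i unfolding P_def using that by measurable
  have em: "{G \<in> space P. \<forall>i\<in>{1..n}. \<forall>j\<in>{1..n}. i \<noteq> j \<longrightarrow> s \<le> vec_cos d (G i) (G j)} \<in> sets P" for s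
  proof -
    have 1: "{G \<in> space P. i \<noteq> j \<longrightarrow> s \<le> vec_cos d (G i) (G j)} \<in> sets P" if ij: "i \<in> {1..n}" "j \<in> {1..n}" for i j
    proof (cases "i = j")
      case False
      have "{G \<in> space P. s \<le> vec_cos d (G i) (G j)} \<in> sets P" using ij by measurable
      then show ?thesis using False by simp
    qed simp
    show ?thesis
      by (rule sets.sets_Collect_finite_All[OF sets.sets_Collect_finite_All[OF 1]]) auto
  qed
  have eq: "measure (sphere_sample n d) (complete_event n d t)
    = measure P {G \<in> space P. \<forall>i\<in>{1..n}. \<forall>j\<in>{1..n}. i \<noteq> j \<longrightarrow> t \<le> vec_cos d (G i) (G j)}"
    unfolding P_def by (rule measure_complete_event_gauss[OF d n])
  show ?thesis
  proof (cases "0 \<le> t")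
    case True
    show ?thesis unfolding eq vec_cos_nonneg_iff[symmetric]
    proof (rule P.finite_measure_mono[OF _ em])
      show "{G \<in> space P. \<forall>i\<in>{1..n}. \<forall>j\<in>{1..n}. i \<noteq> j \<longrightarrow> t \<le> vec_cos d (G i) (G j)}
        \<subseteq> {G \<in> space P. \<forall>i\<in>{1..n}. \<forall>j\<in>{1..n}. i \<noteq> j \<longrightarrow> 0 \<le> vec_cos d (G i) (G j)}"
        using order_trans[OF True] by blast
    qed
  next
    case False
    have "measure ?M {q \<in> space ?M. 0 \<le> vec_cos d (fst q) (snd q)} \<le> measure ?M {q \<in> space ?M. t \<le> vec_cos d (fst q) (snd q)}"
      using False by (intro GG.finite_measure_mono) auto
    moreover have "measure ?M {q \<in> space ?M. t \<le> vec_cos d (fst q) (snd q)} \<le> 1 / 2"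
      using t p measure_threshold_gauss[OF d] by simp
    moreover have "1 / 2 \<le> measure ?M {q \<in> space ?M. 0 \<le> vec_cos d (fst q) (snd q)}"
      using prob_gauss_pair_neg(2)[OF d] by (simp add: vec_cos_nonneg_iff)
    ultimately have "measure ?M {q \<in> space ?M. t \<le> vec_cos d (fst q) (snd q)} = measure ?M {q \<in> space ?M. 0 \<le> vec_cos d (fst q) (snd q)}"
      by linarith
    then have null: "measure ?M {q \<in> space ?M. t \<le> vec_cos d (fst q) (snd q) \<and> vec_cos d (fst q) (snd q) < 0} = 0"
    proof -
      have "{q \<in> space ?M. t \<le> vec_cos d (fst q) (snd q) \<and> vec_cos d (fst q) (snd q) < 0}
        = {q \<in> space ?M. t \<le> vec_cos d (fst q) (snd q)} - {q \<in> space ?M. 0 \<le> vec_cos d (fst q) (snd q)}" by auto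
      then show ?thesis
        using \<open>measure ?M {q \<in> space ?M. t \<le> _ q} = _\<close> False by (simp add: GG.finite_measure_Diff subset_eq)
    qed
    have nullP: "measure P {G \<in> space P. t \<le> vec_cos d (G i) (G j) \<and> vec_cos d (G i) (G j) < 0} = 0"
      if ij: "i \<in> {1..n}" "j \<in> {1..n}" "i \<noteq> j" for i j
    proof -
      have m: "(\<lambda>G. (G i, G j)) \<in> P \<rightarrow>\<^sub>M ?M" using ij by measurable
      let ?S = "{q \<in> space ?M. t \<le> vec_cos d (fst q) (snd q) \<and> vec_cos d (fst q) (snd q) < 0}"
      have "measure ?M ?S = measure (distr P ?M (\<lambda>G. (G i, G j))) ?S"
        unfolding P_def using G.distr_PiM_pair_component[OF _ ij] by simp
      also have "\<dots> = measure P ((\<lambda>G. (G i, G j)) -` ?S \<inter> space P)"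
        by (rule measure_distr[OF m]) measurable
      also have "(\<lambda>G. (G i, G j)) -` ?S \<inter> space P = {G \<in> space P. t \<le> vec_cos d (G i) (G j) \<and> vec_cos d (G i) (G j) < 0}"
        using measurable_space[OF m] by auto
      finally show ?thesis using null by simp
    qed
    let ?N = "\<lambda>q. {G \<in> space P. t \<le> vec_cos d (G (fst q)) (G (snd q)) \<and> vec_cos d (G (fst q)) (G (snd q)) < 0}"
    let ?I = "{q \<in> {1..n} \<times> {1..n}. fst q \<noteq> snd q}"
    let ?E = "{G \<in> space P. \<forall>i\<in>{1..n}. \<forall>j\<in>{1..n}. i \<noteq> j \<longrightarrow> 0 \<le> vec_cos d (G i) (G j)}"
    have Nm: "?N q \<in> sets P" if "q \<in> ?I" for q
    proof -
      have "fst q \<in> {1..n}" "snd q \<in> {1..n}" using that by auto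
      then show ?thesis by measurable
    qed
    have fin: "finite ?I" by simp
    have Um: "(\<Union>q\<in>?I. ?N q) \<in> sets P" by (rule sets.finite_UN[OF fin Nm])
    have "measure P {G \<in> space P. \<forall>i\<in>{1..n}. \<forall>j\<in>{1..n}. i \<noteq> j \<longrightarrow> t \<le> vec_cos d (G i) (G j)}
      \<le> measure P (?E \<union> (\<Union>q\<in>?I. ?N q))"
    proof (rule P.finite_measure_mono)
      show "{G \<in> space P. \<forall>i\<in>{1..n}. \<forall>j\<in>{1..n}. i \<noteq> j \<longrightarrow> t \<le> vec_cos d (G i) (G j)} \<subseteq> ?E \<union> (\<Union>q\<in>?I. ?N q)"
      proof
        fix G assume G: "G \<in> {G \<in> space P. \<forall>i\<in>{1..n}. \<forall>j\<in>{1..n}. i \<noteq> j \<longrightarrow> t \<le> vec_cos d (G i) (G j)}"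
        show "G \<in> ?E \<union> (\<Union>q\<in>?I. ?N q)"
        proof (cases "G \<in> ?E")
          case False
          then obtain i j where ij: "i \<in> {1..n}" "j \<in> {1..n}" "i \<noteq> j" "vec_cos d (G i) (G j) < 0"
            using G by (auto simp: not_le)
          then have "(i, j) \<in> ?I" "G \<in> ?N (i, j)" using G by simp_all
          then show ?thesis by blast
        qed simp
      qed
      show "?E \<union> (\<Union>q\<in>?I. ?N q) \<in> sets P"
        by (rule sets.Un[OF em Um])
    qed
    also have "\<dots> \<le> measure P ?E + measure P (\<Union>q\<in>?I. ?N q)"
      by (rule measure_Un_le[OF em Um])
    also have "measure P (\<Union>q\<in>?I. ?N q) \<le> (\<Sum>q\<in>?I. measure P (?N q))"
      by (rule measure_UNION_le[OF fin Nm])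
    also have "(\<Sum>q\<in>?I. measure P (?N q)) = 0"
      using nullP by (intro sum.neutral) auto
    finally show ?thesis unfolding eq vec_cos_nonneg_iff[symmetric] by simp
  qed
qed

text \<open>Constraints inside \<open>I\<close> and inside \<open>J\<close> are dropped, and the two
  disjoint blocks of coordinates are independent.\<close>

lemma bipartite_reduction:
  fixes I J K :: "'i set" and d :: nat
  assumes I: "I \<union> J \<subseteq> K" "I \<inter> J = {}" "finite K"
  defines "P \<equiv> (\<Pi>\<^sub>M i\<in>K. gauss d)" and "\<Omega> \<equiv> (\<Pi>\<^sub>M i\<in>I. gauss d) \<Otimes>\<^sub>M (\<Pi>\<^sub>M j\<in>J. gauss d)"
  shows "measure P {G \<in> space P. \<forall>i\<in>K. \<forall>j\<in>K. i \<noteq> j \<longrightarrow> 0 \<le> vec_inner d (G i) (G j)}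
    \<le> measure \<Omega> {p \<in> space \<Omega>. \<forall>i\<in>I. \<forall>j\<in>J. 0 \<le> vec_inner d (fst p i) (snd p j)}"
proof -
  interpret G: prob_space "gauss d" by (rule prob_space_gauss)
  interpret PP: product_prob_space "\<lambda>_. gauss d" K by unfold_locales
  interpret P: prob_space P unfolding P_def by (intro prob_space_PiM prob_space_gauss)
  have fin: "finite I" "finite J" using I finite_subset[of _ K] by auto
  let ?Q = "\<Pi>\<^sub>M i\<in>I \<union> J. gauss d"
  let ?A = "{G \<in> space ?Q. \<forall>i\<in>I. \<forall>j\<in>J. 0 \<le> vec_inner d (G i) (G j)}"
  have A: "?A \<in> sets ?Q"
    using fin by (intro sets.sets_Collect_finite_All) measurable
  have d1: "?Q = distr P ?Q (\<lambda>f. restrict f (I \<union> J))"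
    unfolding P_def by (rule PP.distr_restrict[OF I(1) I(3)])
  have d2: "?Q = distr \<Omega> ?Q (merge I J)"
    unfolding \<Omega>_def by (rule PP.distr_merge[OF I(2) fin, symmetric])
  have m1: "(\<lambda>f. restrict f (I \<union> J)) \<in> P \<rightarrow>\<^sub>M ?Q" unfolding P_def by (rule measurable_restrict_subset[OF I(1)])
  have m2: "merge I J \<in> \<Omega> \<rightarrow>\<^sub>M ?Q" unfolding \<Omega>_def by measurable
  have "measure P {G \<in> space P. \<forall>i\<in>K. \<forall>j\<in>K. i \<noteq> j \<longrightarrow> 0 \<le> vec_inner d (G i) (G j)}
     \<le> measure P ((\<lambda>f. restrict f (I \<union> J)) -` ?A \<inter> space P)"
  proof (rule P.finite_measure_mono)
    show "{G \<in> space P. \<forall>i\<in>K. \<forall>j\<in>K. i \<noteq> j \<longrightarrow> 0 \<le> vec_inner d (G i) (G j)} \<subseteq> (\<lambda>f. restrict f (I \<union> J)) -` ?A \<inter> space P"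
    proof
      fix G assume G: "G \<in> {G \<in> space P. \<forall>i\<in>K. \<forall>j\<in>K. i \<noteq> j \<longrightarrow> 0 \<le> vec_inner d (G i) (G j)}"
      then have "restrict G (I \<union> J) \<in> space ?Q" using measurable_space[OF m1] by simp
      moreover have "0 \<le> vec_inner d (restrict G (I \<union> J) i) (restrict G (I \<union> J) j)" if "i \<in> I" "j \<in> J" for i j
      proof -
        have "i \<in> K" "j \<in> K" "i \<noteq> j" using that I by auto
        then show ?thesis using that G by simp
      qed
      ultimately show "G \<in> (\<lambda>f. restrict f (I \<union> J)) -` ?A \<inter> space P" using G by simp
    qed
    show "(\<lambda>f. restrict f (I \<union> J)) -` ?A \<inter> space P \<in> sets P" by (rule measurable_sets[OF m1 A])
  qed
  also have "\<dots> = measure ?Q ?A"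
    using trans[OF arg_cong[OF d1, of "\<lambda>M. measure M ?A"] measure_distr[OF m1 A]] by (rule sym)
  also have "\<dots> = measure \<Omega> (merge I J -` ?A \<inter> space \<Omega>)"
    by (rule trans[OF arg_cong[OF d2, of "\<lambda>M. measure M ?A"] measure_distr[OF m2 A]])
  also have "merge I J -` ?A \<inter> space \<Omega> = {p \<in> space \<Omega>. \<forall>i\<in>I. \<forall>j\<in>J. 0 \<le> vec_inner d (fst p i) (snd p j)}"
  proof -
    have mg: "merge I J p i = fst p i" "merge I J p j = snd p j" if "i \<in> I" "j \<in> J" for p :: "('i \<Rightarrow> nat \<Rightarrow> real) \<times> ('i \<Rightarrow> nat \<Rightarrow> real)" and i j
      using that I(2) by (cases p; auto simp: merge_def)+
    show ?thesis using measurable_space[OF m2] by (auto simp: mg)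
  qed
  finally show ?thesis .
qed

text \<open>A bijection \<pi> matches the two halves. The constraints on matched pairs involve
  disjoint vectors, hence are independent, and each holds with probability at most 53/54.\<close>

lemma bipartite_matching_bound:
  fixes I :: "'i set" and J :: "'j set" and d :: nat
  defines "\<Omega> \<equiv> (\<Pi>\<^sub>M i\<in>I. gauss d) \<Otimes>\<^sub>M (\<Pi>\<^sub>M j\<in>J. gauss d)"
  assumes fin: "finite I" "finite J" "card I = card J" and d: "1 \<le> d"
  shows "measure \<Omega> {p \<in> space \<Omega>. \<forall>i\<in>I. \<forall>j\<in>J. 0 \<le> vec_inner d (fst p i) (snd p j)} \<le> (53 / 54) ^ card I"
proof -
  interpret G: prob_space "gauss d" by (rule prob_space_gauss)
  interpret GG: pair_prob_space "gauss d" "gauss d" by unfold_locales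
  interpret X: prob_space "\<Pi>\<^sub>M i\<in>I. gauss d" by (intro prob_space_PiM prob_space_gauss)
  interpret Y: prob_space "\<Pi>\<^sub>M j\<in>J. gauss d" by (intro prob_space_PiM prob_space_gauss)
  interpret XY: pair_prob_space "\<Pi>\<^sub>M i\<in>I. gauss d" "\<Pi>\<^sub>M j\<in>J. gauss d" by unfold_locales
  interpret O: prob_space \<Omega> unfolding \<Omega>_def by unfold_locales
  interpret SI: product_sigma_finite "\<lambda>_::'i. gauss d" by unfold_locales
  interpret SJ: product_sigma_finite "\<lambda>_::'j. gauss d" by unfold_locales
  obtain \<pi> where \<pi>: "bij_betw \<pi> J I" using fin finite_same_card_bij by metis
  let ?g = "\<lambda>x y. indicator {z::real. 0 \<le> z} (vec_inner d x y) :: ennreal"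
  have [measurable]: "(\<lambda>w. f w j) \<in> M \<rightarrow>\<^sub>M gauss d" if "f \<in> M \<rightarrow>\<^sub>M (\<Pi>\<^sub>M j\<in>J. gauss d)" "j \<in> J" for f M j
    using that by measurable
  have piI: "\<pi> j \<in> I" if "j \<in> J" for j using \<pi> that by (auto simp: bij_betw_def)
  let ?A = "{p \<in> space \<Omega>. \<forall>i\<in>I. \<forall>j\<in>J. 0 \<le> vec_inner d (fst p i) (snd p j)}"
  have A: "?A \<in> sets \<Omega>"
    unfolding \<Omega>_def using fin by (intro sets.sets_Collect_finite_All) measurable
  have "emeasure \<Omega> ?A = (\<integral>\<^sup>+p. indicator ?A p \<partial>\<Omega>)" using A by simp
  also have "\<dots> \<le> (\<integral>\<^sup>+p. (\<Prod>j\<in>J. ?g (fst p (\<pi> j)) (snd p j)) \<partial>\<Omega>)"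
  proof (rule nn_integral_mono)
    fix p
    show "indicator ?A p \<le> (\<Prod>j\<in>J. ?g (fst p (\<pi> j)) (snd p j))"
    proof (cases "p \<in> ?A")
      case True
      then have "(\<Prod>j\<in>J. ?g (fst p (\<pi> j)) (snd p j)) = 1" using piI by (intro prod.neutral) auto
      then show ?thesis by (simp add: indicator_def)
    qed simp
  qed
  also have "\<dots> = (\<integral>\<^sup>+x. (\<integral>\<^sup>+y. (\<Prod>j\<in>J. ?g (x (\<pi> j)) (y j)) \<partial>(\<Pi>\<^sub>M j\<in>J. gauss d)) \<partial>(\<Pi>\<^sub>M i\<in>I. gauss d))"
  proof -
    have "(\<lambda>p. \<Prod>j\<in>J. ?g (fst p (\<pi> j)) (snd p j)) \<in> borel_measurable ((\<Pi>\<^sub>M i\<in>I. gauss d) \<Otimes>\<^sub>M (\<Pi>\<^sub>M j\<in>J. gauss d))"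
      using piI by (intro borel_measurable_prod_ennreal) measurable
    then show ?thesis unfolding \<Omega>_def by (subst Y.nn_integral_fst[symmetric]) auto
  qed
  also have "\<dots> = (\<integral>\<^sup>+x. (\<Prod>j\<in>J. \<integral>\<^sup>+y. ?g (x (\<pi> j)) y \<partial>gauss d) \<partial>(\<Pi>\<^sub>M i\<in>I. gauss d))"
    using fin by (intro nn_integral_cong SJ.product_nn_integral_prod) measurable
  also have "\<dots> = (\<integral>\<^sup>+x. (\<Prod>i\<in>I. \<integral>\<^sup>+y. ?g (x i) y \<partial>gauss d) \<partial>(\<Pi>\<^sub>M i\<in>I. gauss d))"
    by (intro nn_integral_cong prod.reindex_bij_betw \<pi>)
  also have "\<dots> = (\<Prod>i\<in>I. \<integral>\<^sup>+x. (\<integral>\<^sup>+y. ?g x y \<partial>gauss d) \<partial>gauss d)"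
    using fin by (intro SI.product_nn_integral_prod) measurable
  also have "\<dots> \<le> (\<Prod>i\<in>I. ennreal (53 / 54))"
  proof -
    have "(\<integral>\<^sup>+x. (\<integral>\<^sup>+y. ?g x y \<partial>gauss d) \<partial>gauss d) = (\<integral>\<^sup>+q. ?g (fst q) (snd q) \<partial>(gauss d \<Otimes>\<^sub>M gauss d))"
      by (subst G.nn_integral_fst[symmetric]) auto
    also have "\<dots> = (\<integral>\<^sup>+q. indicator {q \<in> space (gauss d \<Otimes>\<^sub>M gauss d). 0 \<le> vec_inner d (fst q) (snd q)} q \<partial>(gauss d \<Otimes>\<^sub>M gauss d))"
      by (intro nn_integral_cong) (simp only: indicator_def mem_Collect_eq simp_thms)
    also have "\<dots> = emeasure (gauss d \<Otimes>\<^sub>M gauss d) {q \<in> space (gauss d \<Otimes>\<^sub>M gauss d). 0 \<le> vec_inner d (fst q) (snd q)}"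
      by (rule nn_integral_indicator) measurable
    also have "\<dots> \<le> ennreal (53 / 54)"
      unfolding GG.emeasure_eq_measure by (intro ennreal_leI prob_gauss_pair_neg(1)[OF d])
    finally show ?thesis unfolding prod_constant by (intro power_mono) auto
  qed
  finally have "ennreal (measure \<Omega> ?A) \<le> ennreal ((53 / 54) ^ card I)"
    unfolding O.emeasure_eq_measure prod_constant by (simp only: ennreal_power)
  then show ?thesis by (subst (asm) ennreal_le_iff) auto
qed

lemma nonneg_event_bounds:
  fixes n d :: nat
  assumes n: "2 \<le> n" and d: "1 \<le> d"
  defines "P \<equiv> (\<Pi>\<^sub>M i\<in>{1..n}. gauss d)" and "k \<equiv> n div 2"
  defines "p0 \<equiv> measure P {G \<in> space P. \<forall>i\<in>{1..n}. \<forall>j\<in>{1..n}. i \<noteq> j \<longrightarrow> 0 \<le> vec_inner d (G i) (G j)}"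
  shows "p0 \<le> (53 / 54) ^ k"
    and "\<And>(\<rho>::real) (s::real). \<lbrakk>0 < \<rho>; \<rho> \<le> 1 / 4; 768 * exp (14 * \<rho>\<^sup>2 * d) \<le> real k; 3584 * exp (7 * \<rho>\<^sup>2 * d) \<le> real k * (\<rho>\<^sup>2 * d);
      s \<le> real k * \<rho> * d / 8; s \<le> (real k * \<rho> * d)\<^sup>2 / (4096 * (4 * d * exp (7 * \<rho>\<^sup>2 * d) + 2 * real k * \<rho>\<^sup>2 * d))\<rbrakk>
      \<Longrightarrow> p0 \<le> 2 * exp (- s / 4)"
proof -
  let ?I = "{1..k}" and ?J = "{k+1..2*k}"
  let ?O = "(\<Pi>\<^sub>M i\<in>?I. gauss d) \<Otimes>\<^sub>M (\<Pi>\<^sub>M j\<in>?J. gauss d)"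
  have red: "p0 \<le> measure ?O {p \<in> space ?O. \<forall>i\<in>?I. \<forall>j\<in>?J. 0 \<le> vec_inner d (fst p i) (snd p j)}"
    unfolding p0_def P_def by (rule bipartite_reduction) (auto simp: k_def)
  show "p0 \<le> (53 / 54) ^ k"
    using red bipartite_matching_bound[of ?I ?J d] d by simp
  fix \<rho> s :: real
  assume "0 < \<rho>" "\<rho> \<le> 1 / 4" "768 * exp (14 * \<rho>\<^sup>2 * d) \<le> real k" "3584 * exp (7 * \<rho>\<^sup>2 * d) \<le> real k * (\<rho>\<^sup>2 * d)"
      "s \<le> real k * \<rho> * d / 8" "s \<le> (real k * \<rho> * d)\<^sup>2 / (4096 * (4 * d * exp (7 * \<rho>\<^sup>2 * d) + 2 * real k * \<rho>\<^sup>2 * d))"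
  then show "p0 \<le> 2 * exp (- s / 4)"
    using red bipartite_nonneg_bound[of ?I k ?J \<rho> d s] d by simp
qed

section \<open>Parameter regimes of the upper bound\<close>

lemma le_3_mult_half: "2 \<le> n \<Longrightarrow> real n \<le> 3 * real (n div 2)" for n :: nat
proof -
  assume "2 \<le> n"
  then have "n \<le> 3 * (n div 2)" by presburger
  then have "real n \<le> real (3 * (n div 2))" by (simp only: of_nat_le_iff)
  then show "real n \<le> 3 * real (n div 2)" by simp
qed

text \<open>Wherever the minimum in the claim is at most linear in \<open>n\<close>, in particular
  for bounded \<open>n\<close> or bounded \<open>d\<close>, the matching bound is already strong
  enough.\<close>

lemma upper_bound_small:
  fixes p0 K m :: real and n :: nat
  assumes n: "2 \<le> n" and p0: "p0 \<le> (53 / 54) ^ (n div 2)" and m: "m \<le> n * K" and K: "0 < K"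
  shows "p0 \<le> exp (- (ln (54 / 53) / (3 * K)) * m)"
proof -
  have l: "0 < ln (54 / 53 :: real)" by simp
  have k: "real n / 3 \<le> real (n div 2)" using le_3_mult_half[OF n] by simp
  have "(53 / 54) ^ (n div 2) = exp (ln (53 / 54) * real (n div 2))"
    by (metis exp_ln exp_of_nat2_mult zero_less_divide_iff zero_less_numeral)
  also have "ln (53 / 54 :: real) = - ln (54 / 53)" by (simp add: ln_div)
  also have "exp (- ln (54 / 53) * real (n div 2)) \<le> exp (- (ln (54 / 53) / (3 * K)) * m)"
  proof -
    have "ln (54 / 53) / (3 * K) * m \<le> ln (54 / 53) / (3 * K) * (n * K)"
      using m l K by (intro mult_left_mono) auto
    also have "\<dots> = ln (54 / 53) * (real n / 3)" using K by simp
    also have "\<dots> \<le> ln (54 / 53) * real (n div 2)" using k l by (intro mult_left_mono) auto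
    finally show ?thesis by simp
  qed
  finally show ?thesis using p0 by simp
qed

lemma two_exp_absorb: "2 * exp (- s / 4) \<le> exp (- s / 8)" if "8 \<le> s" for s :: real
proof -
  have "2 \<le> exp (1::real)" using exp_ge_add_one_self[of 1] by simp
  also have "\<dots> \<le> exp (s / 8)" using that by simp
  finally have "2 * exp (- s / 4) \<le> exp (s / 8) * exp (- s / 4)" by simp
  also have "\<dots> = exp (- s / 8)" by (simp add: exp_add[symmetric])
  finally show ?thesis .
qed

text \<open>The choice \<open>\<rho> = 1 / sqrt d\<close>.\<close>

lemma upper_bound_critical:
  fixes p0 :: real and n d :: nat
  defines "k \<equiv> n div 2"
  assumes n: "2 \<le> n" and d: "16 \<le> d" and k: "4000 * exp 14 \<le> real k"
    and c1: "c1 = 1 / (4096 * (4 * exp 7 + 2))" and k': "8 / c1 \<le> real k"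
    and p0: "\<And>(\<rho>::real) (s::real). \<lbrakk>0 < \<rho>; \<rho> \<le> 1 / 4; 768 * exp (14 * \<rho>\<^sup>2 * d) \<le> real k; 3584 * exp (7 * \<rho>\<^sup>2 * d) \<le> real k * (\<rho>\<^sup>2 * d);
      s \<le> real k * \<rho> * d / 8; s \<le> (real k * \<rho> * d)\<^sup>2 / (4096 * (4 * d * exp (7 * \<rho>\<^sup>2 * d) + 2 * real k * \<rho>\<^sup>2 * d))\<rbrakk>
      \<Longrightarrow> p0 \<le> 2 * exp (- s / 4)"
    and m: "m \<le> real n ^ 2" "m \<le> real n * sqrt d"
  shows "p0 \<le> exp (- (c1 / 72) * m)"
proof -
  define m' where "m' = min ((real k)\<^sup>2) (real k * sqrt d)"
  have kn: "real n \<le> 3 * real k" unfolding k_def by (rule le_3_mult_half[OF n])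
  have sd: "4 \<le> sqrt d" using d real_sqrt_le_mono[of 16 "real d"] by simp
  have sd2: "sqrt d * sqrt d = real d" by simp
  have e7: "exp 7 \<le> (exp 14 :: real)" by simp
  have k1: "4000 \<le> real k" using k one_le_exp_iff[of "14::real"] by linarith
  have c1p: "0 < c1" by (simp add: c1 add_pos_pos)
  have c18: "c1 \<le> 1 / 8"
  proof -
    have "8 \<le> 4096 * (4 * x + 2)" if "0 < x" for x :: real using that by simp
    then have "8 \<le> 4096 * (4 * exp 7 + 2 :: real)" using exp_gt_zero by blast
    then show ?thesis unfolding c1 by (intro divide_left_mono) (auto intro: add_pos_pos)
  qed
  have m'k: "real k \<le> m'" unfolding m'_def using k1 sd d by (simp add: power2_eq_square)
  define \<rho> where "\<rho> = 1 / sqrt d"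
  have \<rho>2: "\<rho>\<^sup>2 * d = 1" using d by (simp add: \<rho>_def power_divide)
  have \<rho>d: "\<rho> * d = sqrt d" by (simp add: \<rho>_def real_div_sqrt)
  have "p0 \<le> 2 * exp (- (c1 * m') / 4)"
  proof (rule p0)
    show "0 < \<rho>" using d by (simp add: \<rho>_def)
    show "\<rho> \<le> 1 / 4" unfolding \<rho>_def by (rule divide_left_mono) (use sd d in auto)
    show "768 * exp (14 * \<rho>\<^sup>2 * d) \<le> real k" using k by (simp add: mult.assoc \<rho>2)
    show "3584 * exp (7 * \<rho>\<^sup>2 * d) \<le> real k * (\<rho>\<^sup>2 * d)" 
    proof -
      have "3584 * x \<le> z" if "x \<le> y" "4000 * y \<le> z" "0 < x" for x y z :: real using that by linarith
      from this[OF e7 k exp_gt_zero] show ?thesis by (simp add: mult.assoc \<rho>2)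
    qed
    have "c1 * m' \<le> 1 / 8 * (real k * sqrt d)"
      using c18 m'k k1 by (intro mult_mono) (auto simp: m'_def)
    then show "c1 * m' \<le> real k * \<rho> * d / 8" by (simp add: mult.assoc \<rho>d)
    have eq: "(real k * \<rho> * d)\<^sup>2 / (4096 * (4 * d * exp (7 * \<rho>\<^sup>2 * d) + 2 * real k * \<rho>\<^sup>2 * d))
       = (real k)\<^sup>2 * d / (4096 * (4 * d * exp 7 + 2 * real k))"
      by (simp add: mult.assoc \<rho>2 \<rho>d power_mult_distrib)
    have D: "0 < 4096 * (4 * d * exp 7 + 2 * real k)" using k1 d by (intro mult_pos_pos add_pos_pos) auto
    show "c1 * m' \<le> (real k * \<rho> * d)\<^sup>2 / (4096 * (4 * d * exp (7 * \<rho>\<^sup>2 * d) + 2 * real k * \<rho>\<^sup>2 * d))"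
    \<comment> \<open>The larger of \<open>d\<close> and \<open>k\<close> dominates the denominator.
      The quotient is then at least \<open>c1 * k\<^sup>2\<close> or \<open>c1 * k * d\<close>;
      \<open>c1\<close> is the reciprocal of the denominator's coefficient when both variables are
      replaced by the larger one.\<close>
    proof (cases "real k \<le> d")
      case True
      have "(real k)\<^sup>2 * (4096 * (4 * d * exp 7 + 2 * real k)) \<le> (real k)\<^sup>2 * (4096 * (4 * d * exp 7 + 2 * d))"
        using True by (intro mult_left_mono) auto
      also have "\<dots> = (real k)\<^sup>2 * d / c1" by (simp add: c1 algebra_simps)
      finally have "c1 * (real k)\<^sup>2 \<le> (real k)\<^sup>2 * d / (4096 * (4 * d * exp 7 + 2 * real k))"
        using D c1p by (simp add: field_simps)
      moreover have "c1 * m' \<le> c1 * (real k)\<^sup>2" using c1p by (intro mult_left_mono) (auto simp: m'_def)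
      ultimately show ?thesis unfolding eq by linarith
    next
      case False
      have dk: "4096 * (4 * d * exp 7 + 2 * real k) \<le> 4096 * (4 * real k * exp 7 + 2 * real k)"
        using False by (intro mult_left_mono add_mono mult_right_mono) auto
      have "c1 * m' \<le> c1 * (real k * d)"
      proof -
        have "sqrt d * 1 \<le> sqrt d * sqrt d" using sd d by (intro mult_left_mono) auto
        then have "sqrt d \<le> d" by (simp only: sd2 mult_1_right)
        then have "real k * sqrt d \<le> real k * d" by (intro mult_left_mono) auto
        then show ?thesis using c1p by (intro mult_left_mono) (auto simp: m'_def)
      qed
      also have "\<dots> = (real k)\<^sup>2 * d / (4096 * (4 * real k * exp 7 + 2 * real k))"
      proof -
        have "4096 * (4 * real k * exp 7 + 2 * real k) = real k / c1" by (simp add: c1 algebra_simps)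
        then show ?thesis using k1 c1p by (simp add: power2_eq_square)
      qed
      also have "\<dots> \<le> (real k)\<^sup>2 * d / (4096 * (4 * d * exp 7 + 2 * real k))"
      proof (rule divide_left_mono[OF dk])
        have "0 < 4096 * (4 * real k * exp 7 + 2 * real k)" using k1 by (intro mult_pos_pos add_pos_pos) auto
        then show "0 < 4096 * (4 * real k * exp 7 + 2 * real k) * (4096 * (4 * d * exp 7 + 2 * real k))"
          using D by (rule mult_pos_pos)
      qed simp
      finally show ?thesis unfolding eq .
    qed
  qed
  also have "\<dots> \<le> exp (- (c1 * m') / 8)"
  proof (rule two_exp_absorb)
    have "8 = c1 * (8 / c1)" using c1p by simp
    also have "\<dots> \<le> c1 * m'" using k' m'k c1p by (intro mult_left_mono) auto
    finally show "8 \<le> c1 * m'" .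
  qed
  also have "\<dots> \<le> exp (- (c1 / 72) * m)"
  proof -
    \<comment> \<open>The 9 comes from \<open>n \<le> 3 * k\<close> squared; with the 8 from
      absorbing the factor 2 it makes the 72.\<close>
    have "m \<le> 9 * m'"
    proof -
      have "m \<le> 9 * (real k)\<^sup>2"
        using m(1) power_mono[OF kn, of 2] by (simp add: power_mult_distrib)
      moreover have "m \<le> 9 * (real k * sqrt d)"
      proof -
        have "real n * sqrt d \<le> (9 * real k) * sqrt d" using kn by (intro mult_right_mono) auto
        then show ?thesis using m(2) by simp
      qed
      ultimately show ?thesis by (simp add: m'_def)
    qed
    then have "c1 / 72 * m \<le> c1 / 72 * (9 * m')" using c1p by (intro mult_left_mono) auto
    then show ?thesis by simp
  qed
  finally show ?thesis .
qed

text \<open>With \<open>\<rho>\<^sup>2 * d\<close> at most \<open>ln k / 140\<close>, the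
  exponentials with coefficients 14 and 7 are at most \<open>k powr (1/10)\<close> and
  \<open>k powr (1/20)\<close>. The inequalities collect what is then asked of a large
  \<open>k\<close>; \<open>140 \<le> ln k\<close> lets \<open>\<rho>\<close> be at least
  \<open>1 / sqrt d\<close>.\<close>

lemma upper_bound_supercritical_constant:
  "\<exists>N::nat. \<forall>k\<ge>N. 768 * real k powr (1/10) \<le> real k \<and> 3584 * real k powr (1/20) \<le> real k \<and> 140 \<le> ln (real k)
      \<and> 12 * real k powr (1/20) \<le> real k powr (1/3) \<and> 8 * 8192 \<le> real k"
proof -
  have "\<forall>\<^sub>F x::real in at_top. 768 * x powr (1/10) \<le> x \<and> 3584 * x powr (1/20) \<le> x \<and> 140 \<le> ln x
      \<and> 12 * x powr (1/20) \<le> x powr (1/3) \<and> 8 * 8192 \<le> x"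
    by (intro eventually_conj; real_asymp)
  then have "\<forall>\<^sub>F k in sequentially. 768 * real k powr (1/10) \<le> real k \<and> 3584 * real k powr (1/20) \<le> real k \<and> 140 \<le> ln (real k)
      \<and> 12 * real k powr (1/20) \<le> real k powr (1/3) \<and> 8 * 8192 \<le> real k"
    by (rule eventually_compose_filterlim[OF _ filterlim_real_sequentially])
  then show ?thesis unfolding eventually_sequentially .
qed

text \<open>Here \<open>\<rho>\<close> is the smaller of 1/4 and
  \<open>sqrt (ln k / (140 * d))\<close>. Since \<open>d\<close> is at most of order
  \<open>k powr (4/3)\<close>, \<open>k * \<rho>\<close> exceeds the exponential factor, so
  \<open>s\<close> can be of order \<open>k * \<rho> * d\<close>. The two values of
  \<open>\<rho>\<close> produce the terms \<open>n * d\<close> and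
  \<open>n * sqrt (d * ln n)\<close>.\<close>

lemma upper_bound_supercritical:
  fixes p0 :: real and n d :: nat
  defines "k \<equiv> n div 2"
  assumes n: "2 \<le> n" and d: "16 \<le> d"
    and k: "768 * real k powr (1/10) \<le> real k" "3584 * real k powr (1/20) \<le> real k" "140 \<le> ln (real k)"
      "12 * real k powr (1/20) \<le> real k powr (1/3)" "8 * 8192 \<le> real k"
    and nd: "real d powr (3 / 4) \<le> real n"
    and p0: "\<And>(\<rho>::real) (s::real). \<lbrakk>0 < \<rho>; \<rho> \<le> 1 / 4; 768 * exp (14 * \<rho>\<^sup>2 * d) \<le> real k; 3584 * exp (7 * \<rho>\<^sup>2 * d) \<le> real k * (\<rho>\<^sup>2 * d);
      s \<le> real k * \<rho> * d / 8; s \<le> (real k * \<rho> * d)\<^sup>2 / (4096 * (4 * d * exp (7 * \<rho>\<^sup>2 * d) + 2 * real k * \<rho>\<^sup>2 * d))\<rbrakk>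
      \<Longrightarrow> p0 \<le> 2 * exp (- s / 4)"
    and m: "m \<le> real n * real d" "m \<le> real n * sqrt (real d * ln (real n))"
  shows "p0 \<le> exp (- (1 / (60 * 65536)) * m)"
proof -
  have kn: "real n \<le> 3 * real k" unfolding k_def by (rule le_3_mult_half[OF n])
  have k0: "3 \<le> real k" using k(5) by simp
  have sd: "4 \<le> sqrt d" using d real_sqrt_le_mono[of 16 "real d"] by simp
  have sd2: "sqrt d * sqrt d = real d" by simp
  define L where "L = ln (real k) / 140"
  have L: "1 \<le> L" "ln (real k) = 140 * L" using k(3) by (auto simp: L_def)
  define \<rho> where "\<rho> = min (1 / 4) (sqrt (L / d))"
  have \<rho>1: "1 / sqrt d \<le> \<rho>"
  proof -
    have "1 / sqrt d \<le> 1 / 4" by (rule divide_left_mono) (use sd d in auto)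
    moreover have "1 / sqrt d \<le> sqrt (L / d)"
      using L by (simp add: real_sqrt_divide divide_right_mono)
    ultimately show ?thesis by (simp add: \<rho>_def)
  qed
  have \<rho>pos: "0 < \<rho>" using \<rho>1 sd by (smt (verit) divide_pos_pos)
  have \<rho>2: "\<rho>\<^sup>2 * d \<le> L"
  proof -
    have "\<rho>\<^sup>2 \<le> (sqrt (L / d))\<^sup>2" using \<rho>pos by (intro power_mono) (auto simp: \<rho>_def)
    also have "\<dots> = L / d" using L by simp
    finally show ?thesis using d by (simp add: field_simps)
  qed
  have \<rho>2': "1 \<le> \<rho>\<^sup>2 * d"
  proof -
    have "(1 / sqrt d)\<^sup>2 \<le> \<rho>\<^sup>2" using \<rho>1 by (intro power_mono) auto
    then show ?thesis using d by (simp add: power_divide field_simps)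
  qed
  have E: "exp (7 * \<rho>\<^sup>2 * d) \<le> real k powr (1/20)"
  proof -
    have "exp (7 * \<rho>\<^sup>2 * d) \<le> exp (7 * L)" using \<rho>2 by simp
    also have "\<dots> = real k powr (1/20)" using k0 by (simp add: powr_def L_def)
    finally show ?thesis .
  qed
  have E2: "exp (14 * \<rho>\<^sup>2 * d) \<le> real k powr (1/10)"
  proof -
    have "exp (14 * \<rho>\<^sup>2 * d) \<le> exp (14 * L)" using \<rho>2 by simp
    also have "\<dots> = real k powr (1/10)" using k0 by (simp add: powr_def L_def)
    finally show ?thesis .
  qed
  \<comment> \<open>From \<open>d powr (3 / 4) \<le> 3 * k\<close> follows
    \<open>sqrt d \<le> 3 * k powr (2/3)\<close>, so \<open>k / sqrt d\<close> is at least a third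
    of \<open>k powr (1/3)\<close>, which outgrows \<open>k powr (1/20)\<close>.\<close>
  have k\<rho>: "4 * exp (7 * \<rho>\<^sup>2 * d) \<le> real k * \<rho>"
  proof -
    have "real d powr (3 / 4) \<le> 3 * real k" using nd kn by linarith
    then have "(real d powr (3 / 4)) powr (2 / 3) \<le> (3 * real k) powr (2 / 3)" by (intro powr_mono2) auto
    then have "sqrt d \<le> 3 powr (2 / 3) * real k powr (2 / 3)" by (simp add: powr_powr powr_mult powr_half_sqrt)
    moreover have "(3::real) powr (2 / 3) \<le> 3" using powr_mono[of "2/3" 1 "3::real"] by simp
    then have "3 powr (2 / 3) * real k powr (2 / 3) \<le> 3 * real k powr (2 / 3)"
      by (intro mult_right_mono) auto
    ultimately have s: "sqrt d \<le> 3 * real k powr (2 / 3)" by linarith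
    have "real k powr (1/3) * real k powr (2/3) = real k" using k0 by (simp add: powr_add[symmetric])
    then have "real k powr (1/3) * sqrt d \<le> 3 * real k"
      using mult_left_mono[OF s, of "real k powr (1/3)"] by simp
    then have "real k powr (1/3) \<le> 3 * (real k * (1 / sqrt d))" using d by (simp add: pos_le_divide_eq)
    also have "\<dots> \<le> 3 * (real k * \<rho>)" using \<rho>1 by (intro mult_left_mono) auto
    finally have "12 * exp (7 * \<rho>\<^sup>2 * d) \<le> 3 * (real k * \<rho>)" using E k(4) by linarith
    then show ?thesis by linarith
  qed
  \<comment> \<open>Twice 4096: the bracket in the denominator is at most
    \<open>d * (2 * (k * \<rho>))\<close>, and one factor \<open>k * \<rho> * d\<close>
    cancels.\<close>
  define s where "s = real k * \<rho> * d / 8192"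
  have kd: "real k \<le> real k * \<rho> * d"
  proof -
    have "1 \<le> \<rho> * d"
    proof -
      have "sqrt d \<le> \<rho> * d" using mult_right_mono[OF \<rho>1, of d] by (simp add: real_div_sqrt)
      then show ?thesis using sd by linarith
    qed
    then show ?thesis using mult_left_mono[of 1 "\<rho> * d" "real k"] by (simp add: mult.assoc)
  qed
  have "p0 \<le> 2 * exp (- s / 4)"
  proof (rule p0[OF \<rho>pos])
    show "\<rho> \<le> 1 / 4" by (simp add: \<rho>_def)
    show "768 * exp (14 * \<rho>\<^sup>2 * d) \<le> real k" using E2 k(1) by linarith
    have "real k * 1 \<le> real k * (\<rho>\<^sup>2 * d)" using \<rho>2' by (intro mult_left_mono) auto
    then show "3584 * exp (7 * \<rho>\<^sup>2 * d) \<le> real k * (\<rho>\<^sup>2 * d)" using E k(2) by linarith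
    have "0 \<le> real k * \<rho> * d" using \<rho>pos by simp
    then show "s \<le> real k * \<rho> * d / 8" unfolding s_def by linarith
    have "real k * \<rho> * \<rho> \<le> real k * \<rho> * (1 / 4)" using \<rho>pos by (intro mult_left_mono) (auto simp: \<rho>_def)
    then have "4 * exp (7 * \<rho>\<^sup>2 * d) + 2 * real k * \<rho>\<^sup>2 \<le> 2 * (real k * \<rho>)"
    proof -
      have "0 < real k * \<rho>" using \<rho>pos k0 by simp
      moreover have "2 * real k * \<rho>\<^sup>2 = 2 * (real k * \<rho> * \<rho>)" by (simp add: power2_eq_square)
      ultimately show ?thesis
        using k\<rho> \<open>real k * \<rho> * \<rho> \<le> real k * \<rho> * (1 / 4)\<close> by linarith
    qed
    then have le: "d * (4 * exp (7 * \<rho>\<^sup>2 * d) + 2 * real k * \<rho>\<^sup>2) \<le> d * (2 * (real k * \<rho>))" by (intro mult_left_mono) auto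
    have "s = (real k * \<rho> * d)\<^sup>2 / (4096 * (d * (2 * (real k * \<rho>))))"
      using k0 \<rho>pos d by (simp add: s_def power2_eq_square field_simps)
    also have "\<dots> \<le> (real k * \<rho> * d)\<^sup>2 / (4096 * (d * (4 * exp (7 * \<rho>\<^sup>2 * d) + 2 * real k * \<rho>\<^sup>2)))"
    proof (rule divide_left_mono)
      show "0 < 4096 * (real d * (2 * (real k * \<rho>))) * (4096 * (real d * (4 * exp (7 * \<rho>\<^sup>2 * real d) + 2 * real k * \<rho>\<^sup>2)))"
        using k0 \<rho>pos d by (intro mult_pos_pos add_pos_nonneg) auto
      show "4096 * (real d * (4 * exp (7 * \<rho>\<^sup>2 * real d) + 2 * real k * \<rho>\<^sup>2)) \<le> 4096 * (real d * (2 * (real k * \<rho>)))"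
        by (rule mult_left_mono[OF le]) simp
    qed simp
    finally show "s \<le> (real k * \<rho> * d)\<^sup>2 / (4096 * (4 * d * exp (7 * \<rho>\<^sup>2 * d) + 2 * real k * \<rho>\<^sup>2 * d))"
      by (simp add: algebra_simps)
  qed
  also have "\<dots> \<le> exp (- s / 8)"
  proof (rule two_exp_absorb)
    show "8 \<le> s" using order_trans[OF k(5) kd] unfolding s_def by linarith
  qed
  also have "\<dots> \<le> exp (- (1 / (60 * 65536)) * m)"
  proof -
    \<comment> \<open>By \<open>n \<le> 3 * k \<le> k * k\<close> the two logarithms differ by at
      most a factor 2. Below, \<open>17\<^sup>2 = 289\<close> is the next square above 280.\<close>
    have lnn: "ln (real n) \<le> 280 * L"
    proof -
      have "real n \<le> real k * real k" using kn mult_right_mono[OF k0, of "real k"] by simp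
      then have "ln (real n) \<le> ln (real k * real k)" using n by (subst ln_le_cancel_iff) (use k0 in auto)
      also have "\<dots> = 280 * L" using k0 L by (simp add: ln_mult)
      finally show ?thesis .
    qed
    \<comment> \<open>The cases need the constants 12 and \<open>3 * 17 = 51\<close>. The
      denominator 65536 is \<open>8 * 8192\<close>.\<close>
    have "m \<le> 60 * (real k * \<rho> * d)"
    proof (cases "\<rho> = 1 / 4")
      case True
      have "real n * real d \<le> 3 * real k * real d" using kn by (intro mult_right_mono) auto
      moreover have "60 * (real k * \<rho> * d) = 15 * (real k * d)" using True by simp
      moreover have "0 \<le> real k * real d" by simp
      ultimately show ?thesis using m(1) by linarith
    next
      case False
      then have \<rho>: "\<rho> = sqrt (L / d)" by (auto simp: \<rho>_def min_def)
      have "sqrt (real d * ln (real n)) \<le> sqrt (17 ^ 2 * (d * L))"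
      proof (rule real_sqrt_le_mono)
        have "real d * ln (real n) \<le> real d * (280 * L)" using lnn by (intro mult_left_mono) auto
        also have "\<dots> \<le> real d * (289 * L)" using L by (intro mult_left_mono) auto
        finally show "real d * ln (real n) \<le> 17 ^ 2 * (real d * L)" by simp
      qed
      also have "\<dots> = 17 * sqrt (d * L)" by (simp add: real_sqrt_mult)
      also have "sqrt (d * L) = \<rho> * d"
      proof -
        have "\<rho> * d = sqrt L * (d / sqrt d)" by (simp add: \<rho> real_sqrt_divide)
        also have "d / sqrt d = sqrt d" by (rule real_div_sqrt) simp
        finally show ?thesis by (simp add: real_sqrt_mult)
      qed
      finally have sq: "sqrt (real d * ln (real n)) \<le> 17 * (\<rho> * d)" .
      have "real n * sqrt (real d * ln (real n)) \<le> (3 * real k) * (17 * (\<rho> * d))"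
        using kn sq by (intro mult_mono) (use n in auto)
      moreover have "0 \<le> real k * \<rho> * d" using kd by linarith
      ultimately show ?thesis using m(2) by simp
    qed
    then have "m / (60 * 65536) \<le> real k * \<rho> * d / 65536" by simp
    then show ?thesis by (simp add: s_def)
  qed
  finally show ?thesis .
qed

text \<open>If \<open>n\<close> or \<open>d\<close> is bounded, the minimum is linear in
  \<open>n\<close> and the matching bound applies. Otherwise, for \<open>n\<close> below
  \<open>d powr (3 / 4)\<close> the maximum is \<open>exp 1\<close>, the logarithm is 1 and the
  critical choice of \<open>\<rho>\<close> applies. For larger \<open>n\<close> the logarithm is at
  most \<open>ln n\<close>, which the supercritical choice reaches.\<close>

lemma complete_event_upper_bound:
  "\<exists>c>0. \<forall>n\<ge>2. \<forall>d\<ge>2. \<forall>p t. p \<le> 1 / 2 \<longrightarrow> is_threshold d p t \<longrightarrow>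
     measure (sphere_sample n d) (complete_event n d t)
       \<le> exp (- c * Min {real n ^ 2, real n * sqrt (real d * ln (max (real n / real d powr (3 / 4)) (exp 1))), real n * real d})"
proof -
  obtain N :: nat where N: "\<forall>k\<ge>N. 768 * real k powr (1/10) \<le> real k \<and> 3584 * real k powr (1/20) \<le> real k \<and> 140 \<le> ln (real k)
      \<and> 12 * real k powr (1/20) \<le> real k powr (1/3) \<and> 8 * 8192 \<le> real k"
    using upper_bound_supercritical_constant by blast
  define c1 :: real where "c1 = 1 / (4096 * (4 * exp 7 + 2))"
  have c1: "0 < c1" by (simp add: c1_def add_pos_pos)
  obtain N1 :: nat where N1: "max (4000 * exp 14) (8 / c1) \<le> real N1" using real_arch_simple by blast
  define K0 where "K0 = max N N1"
  define K where "K = 3 * real K0 + 16"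
  have K: "0 < K" by (simp add: K_def)
  define c where "c = min (c1 / 72) (min (1 / (60 * 65536)) (ln (54 / 53) / (3 * K)))"
  have c: "0 < c" using c1 K by (simp add: c_def)
  have main: "measure (sphere_sample n d) (complete_event n d t)
       \<le> exp (- c * Min {real n ^ 2, real n * sqrt (real d * ln (max (real n / real d powr (3 / 4)) (exp 1))), real n * real d})"
    if n: "2 \<le> n" and d: "2 \<le> d" and p: "p \<le> 1 / 2" and t: "is_threshold d p t" for n d :: nat and p t
  proof -
    let ?P = "\<Pi>\<^sub>M i\<in>{1..n}. gauss d"
    let ?m = "Min {real n ^ 2, real n * sqrt (real d * ln (max (real n / real d powr (3 / 4)) (exp 1))), real n * real d}"
    define p0 where "p0 = measure ?P {G \<in> space ?P. \<forall>i\<in>{1..n}. \<forall>j\<in>{1..n}. i \<noteq> j \<longrightarrow> 0 \<le> vec_inner d (G i) (G j)}"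
    have le: "measure (sphere_sample n d) (complete_event n d t) \<le> p0"
      unfolding p0_def using threshold_event_le_nonneg[OF _ _ t p] n d by simp
    have d1: "1 \<le> d" using d by simp
    note b = nonneg_event_bounds[OF n d1, folded p0_def]
    have m: "?m \<le> real n ^ 2" "?m \<le> real n * sqrt (real d * ln (max (real n / real d powr (3 / 4)) (exp 1)))" "?m \<le> real n * real d"
      by (auto intro: Min_le)
    have "1 \<le> ln (max (real n / real d powr (3 / 4)) (exp 1))"
    proof (subst ln_ge_iff)
      show "0 < max (real n / real d powr (3 / 4)) (exp 1)" unfolding less_max_iff_disj using exp_gt_zero by blast
    qed simp
    then have m0: "0 \<le> ?m" by (subst Min_ge_iff) auto
    have fin: "p0 \<le> exp (- c * ?m)" if "p0 \<le> exp (- c' * ?m)" "c \<le> c'" for c'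
    proof -
      have "c * ?m \<le> c' * ?m" using that m0 by (intro mult_right_mono) auto
      then show ?thesis using that(1) by (smt (verit) exp_le_cancel_iff minus_mult_left)
    qed
    have kn: "real n \<le> 3 * real (n div 2)" by (rule le_3_mult_half[OF n])
    have "p0 \<le> exp (- c * ?m)"
    proof (cases "K0 \<le> n div 2 \<and> 16 \<le> d")
      case False
      have "?m \<le> real n * K"
      proof (cases "d < 16")
        case True
        then have "real n * real d \<le> real n * K" unfolding K_def by (intro mult_left_mono) auto
        then show ?thesis using m(3) by linarith
      next
        case d16: False
        then have "n div 2 \<le> K0" using False by auto
        then have "real (n div 2) \<le> real K0" by simp
        then have "real n \<le> K" using kn unfolding K_def by linarith
        then have "real n * real n \<le> real n * K" by (intro mult_left_mono) auto
        then show ?thesis using m(1) by (simp add: power2_eq_square)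
      qed
      from upper_bound_small[OF n b(1) this K] show ?thesis
        by (rule fin) (simp add: c_def)
    next
      case True
      then have k: "N \<le> n div 2" "real N1 \<le> real (n div 2)" and d16: "16 \<le> d" by (auto simp: K0_def)
      show ?thesis
      proof (cases "real d powr (3 / 4) \<le> real n")
        case False
        have "real n / real d powr (3 / 4) \<le> 1" using False d by (simp add: divide_le_eq)
        moreover have "1 \<le> exp (1::real)" by simp
        ultimately have "max (real n / real d powr (3 / 4)) (exp 1) = exp 1" by linarith
        then have m2: "?m \<le> real n * sqrt d" using m(2) by simp
        have "4000 * exp 14 \<le> real (n div 2)" "8 / c1 \<le> real (n div 2)" using N1 k(2) by linarith+
        from upper_bound_critical[OF n d16 this(1) c1_def this(2) b(2) m(1) m2]
        show ?thesis by (rule fin) (simp_all add: c_def)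
      next
        case True
        note Nk = N[rule_format, OF k(1)]
        have "1 \<le> real d powr (3 / 4)" using d by (simp add: ge_one_powr_ge_zero)
        then have "real n / real d powr (3 / 4) \<le> real n" by (simp add: divide_le_eq mult_le_cancel_left1)
        \<comment> \<open>Otherwise the maximum, being at least \<open>exp 1\<close>, could exceed
          \<open>n\<close>.\<close>
        moreover have "exp 1 \<le> real n"
        proof -
          have "real (n div 2) \<le> real n" by simp
          then have "3 \<le> real n" using Nk by linarith
          then show ?thesis using exp_le by linarith
        qed
        ultimately have le: "max (real n / real d powr (3 / 4)) (exp 1) \<le> real n" by simp
        have "0 < max (real n / real d powr (3 / 4)) (exp 1)" unfolding less_max_iff_disj using exp_gt_zero by blast
        then have "ln (max (real n / real d powr (3 / 4)) (exp 1)) \<le> ln (real n)"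
          using le by (subst ln_le_cancel_iff) auto
        then have "real n * sqrt (real d * ln (max (real n / real d powr (3 / 4)) (exp 1))) \<le> real n * sqrt (real d * ln (real n))"
          by (intro mult_left_mono real_sqrt_le_mono) auto
        then have m2: "?m \<le> real n * sqrt (real d * ln (real n))" using m(2) by linarith
        have "p0 \<le> exp (- (1 / (60 * 65536)) * ?m)"
          by (rule upper_bound_supercritical[OF n d16 _ _ _ _ _ True b(2) m(3) m2]) (use Nk in auto)
        then show ?thesis by (rule fin) (simp add: c_def)
      qed
    qed
    then show ?thesis using le by linarith
  qed
  show ?thesis using c main by blast
qed

section \<open>Gaussian shifts and slabs\<close>

lemma std_normal_density_shift: "std_normal_density (y - m) = std_normal_density y * exp (m * y - m\<^sup>2 / 2)"
proof -
  have "exp (- (y - m)\<^sup>2 / 2) = exp (- y\<^sup>2 / 2) * exp (m * y - m\<^sup>2 / 2)"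
    unfolding exp_add[symmetric]
    by (intro arg_cong[where f = exp]) (simp add: power2_eq_square field_simps)
  then show ?thesis by (simp only: std_normal_density_def mult.assoc)
qed

lemma nn_integral_std_normal_shift:
  assumes [measurable]: "f \<in> borel_measurable borel"
  shows "(\<integral>\<^sup>+y. f (y + m) \<partial>std_normal_distribution) = (\<integral>\<^sup>+y. ennreal (exp (m * y - m\<^sup>2 / 2)) * f y \<partial>std_normal_distribution)"
proof -
  have "(\<integral>\<^sup>+y. f (y + m) \<partial>std_normal_distribution) = (\<integral>\<^sup>+y. ennreal (std_normal_density y) * f (y + m) \<partial>lborel)"
    by (rule nn_integral_density) auto
  also have "\<dots> = (\<integral>\<^sup>+y. ennreal (std_normal_density (- m + 1 * y)) * f (- m + 1 * y + m) \<partial>lborel)"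
    using nn_integral_real_affine[of "\<lambda>y. ennreal (std_normal_density y) * f (y + m)" 1 "- m"] by simp
  also have "\<dots> = (\<integral>\<^sup>+y. ennreal (std_normal_density y) * (ennreal (exp (m * y - m\<^sup>2 / 2)) * f y) \<partial>lborel)"
  proof (rule nn_integral_cong)
    fix y
    have "ennreal (std_normal_density (- m + 1 * y)) = ennreal (std_normal_density y) * ennreal (exp (m * y - m\<^sup>2 / 2))"
      using std_normal_density_shift[of y m] by (simp add: ennreal_mult[symmetric])
    then show "ennreal (std_normal_density (- m + 1 * y)) * f (- m + 1 * y + m)
       = ennreal (std_normal_density y) * (ennreal (exp (m * y - m\<^sup>2 / 2)) * f y)" by (simp add: mult.assoc)
  qed
  also have "\<dots> = (\<integral>\<^sup>+y. ennreal (exp (m * y - m\<^sup>2 / 2)) * f y \<partial>std_normal_distribution)"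
    by (rule nn_integral_density[symmetric]) auto
  finally show ?thesis .
qed

text \<open>The Cameron-Martin formula, obtained coordinate by coordinate.\<close>

lemma gauss_shift:
  "distr (gauss d) (gauss d) (\<lambda>y. \<lambda>k\<in>{..<d}. y k + m k) = density (gauss d) (\<lambda>y. ennreal (exp (vec_inner d m y - vec_inner d m m / 2)))"
proof -
  let ?g = "\<lambda>k y. ennreal (exp (m k * y - (m k)\<^sup>2 / 2))"
  have pr: "prob_space (density std_normal_distribution (?g k))" for k
  proof (rule prob_spaceI)
    show "emeasure (density std_normal_distribution (?g k)) (space (density std_normal_distribution (?g k))) = 1"
      using nn_integral_std_normal_shift[of "\<lambda>_. 1" "m k"] std_normal.emeasure_space_1
      by (simp add: emeasure_density)
  qed
  then have sf: "sigma_finite_measure (density std_normal_distribution (?g k))" for k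
    using prob_space_imp_sigma_finite by blast
  interpret D: product_sigma_finite "\<lambda>k. density std_normal_distribution (?g k)"
    by (simp add: product_sigma_finite_def sf)
  have "distr (gauss d) (gauss d) (\<lambda>y. \<lambda>k\<in>{..<d}. y k + m k) = (\<Pi>\<^sub>M k\<in>{..<d}. density std_normal_distribution (?g k))"
  proof (rule D.PiM_eqI)
    show "sets (distr (gauss d) (gauss d) (\<lambda>y. \<lambda>k\<in>{..<d}. y k + m k)) = sets (\<Pi>\<^sub>M k\<in>{..<d}. density std_normal_distribution (?g k))"
      by (simp, rule sets_PiM_cong) auto
    fix A assume "\<And>k. k \<in> {..<d} \<Longrightarrow> A k \<in> sets (density std_normal_distribution (?g k))"
    then have A: "A k \<in> sets borel" if "k < d" for k using that by simp
    have Am: "{y. y + m k \<in> A k} \<in> sets borel" if "k < d" for k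
    proof -
      have "(\<lambda>y. y + m k) -` A k \<inter> space borel \<in> sets borel"
        using A[OF that] by (intro measurable_sets[of _ borel borel]) auto
      then show ?thesis by (simp add: vimage_def)
    qed
    have "emeasure (distr (gauss d) (gauss d) (\<lambda>y. \<lambda>k\<in>{..<d}. y k + m k)) (Pi\<^sub>E {..<d} A)
      = emeasure (gauss d) ((\<lambda>y. \<lambda>k\<in>{..<d}. y k + m k) -` Pi\<^sub>E {..<d} A \<inter> space (gauss d))"
      using A by (intro emeasure_distr sets_PiM_I_finite) auto
    also have "(\<lambda>y. \<lambda>k\<in>{..<d}. y k + m k) -` Pi\<^sub>E {..<d} A \<inter> space (gauss d) = Pi\<^sub>E {..<d} (\<lambda>k. {y. y + m k \<in> A k})"
    proof (rule set_eqI)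
      fix x
      have b: "(\<forall>i\<in>{..<d}. (\<lambda>k\<in>{..<d}. x k + m k) i \<in> A i) \<longleftrightarrow> (\<forall>i\<in>{..<d}. x i + m i \<in> A i)"
        by (rule ball_cong) simp_all
      show "x \<in> (\<lambda>y. \<lambda>k\<in>{..<d}. y k + m k) -` Pi\<^sub>E {..<d} A \<inter> space (gauss d) \<longleftrightarrow> x \<in> Pi\<^sub>E {..<d} (\<lambda>k. {y. y + m k \<in> A k})"
        by (simp only: vimage_eq Int_iff PiE_iff space_PiM space_density space_lborel space_borel UNIV_I mem_Collect_eq
            b restrict_extensional ball_triv simp_thms)
    qed
    also have "emeasure (gauss d) \<dots> = (\<Prod>k<d. emeasure std_normal_distribution {y. y + m k \<in> A k})"
      using Am by (intro std_normal_product.emeasure_PiM) auto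
    also have "\<dots> = (\<Prod>k<d. emeasure (density std_normal_distribution (?g k)) (A k))"
    proof (intro prod.cong refl)
      fix k assume "k \<in> {..<d}"
      then have k: "k < d" by simp
      have "emeasure std_normal_distribution {y. y + m k \<in> A k} = (\<integral>\<^sup>+y. indicator {y. y + m k \<in> A k} y \<partial>std_normal_distribution)"
        using Am[OF k] by simp
      also have "\<dots> = (\<integral>\<^sup>+y. indicator (A k) (y + m k) \<partial>std_normal_distribution)"
        by (intro nn_integral_cong) (simp add: indicator_def)
      also have "\<dots> = (\<integral>\<^sup>+y. ?g k y * indicator (A k) y \<partial>std_normal_distribution)"
        using A[OF k] by (intro nn_integral_std_normal_shift) auto
      also have "\<dots> = emeasure (density std_normal_distribution (?g k)) (A k)"
        using A[OF k] by (intro emeasure_density[symmetric]) auto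
      finally show "emeasure std_normal_distribution {y. y + m k \<in> A k} = emeasure (density std_normal_distribution (?g k)) (A k)" .
    qed
    finally show "emeasure (distr (gauss d) (gauss d) (\<lambda>y. \<lambda>k\<in>{..<d}. y k + m k)) (Pi\<^sub>E {..<d} A) = \<dots>" .
  qed auto
  also have "\<dots> = density (gauss d) (\<lambda>y. \<Prod>k<d. ?g k (y k))"
    by (rule PiM_density) (auto simp: sf std_normal.sigma_finite_measure_axioms)
  also have "\<dots> = density (gauss d) (\<lambda>y. ennreal (exp (vec_inner d m y - vec_inner d m m / 2)))"
  proof (rule arg_cong[where f = "density (gauss d)"], rule ext)
    fix y :: "nat \<Rightarrow> real"
    have "(\<Prod>k<d. exp (m k * y k - (m k)\<^sup>2 / 2)) = exp (vec_inner d m y - vec_inner d m m / 2)"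
      by (simp add: exp_sum[symmetric] vec_inner_def sum_subtractf sum_divide_distrib power2_eq_square)
    then show "(\<Prod>k<d. ?g k (y k)) = ennreal (exp (vec_inner d m y - vec_inner d m m / 2))"
      by (simp add: prod_ennreal)
  qed
  finally show ?thesis .
qed

lemma nn_integral_gauss_shift:
  assumes [measurable]: "f \<in> borel_measurable (gauss d)"
  shows "(\<integral>\<^sup>+y. f (\<lambda>k\<in>{..<d}. y k + m k) \<partial>gauss d) = (\<integral>\<^sup>+y. ennreal (exp (vec_inner d m y - vec_inner d m m / 2)) * f y \<partial>gauss d)"
proof -
  have "(\<integral>\<^sup>+y. f (\<lambda>k\<in>{..<d}. y k + m k) \<partial>gauss d) = (\<integral>\<^sup>+y. f y \<partial>distr (gauss d) (gauss d) (\<lambda>y. \<lambda>k\<in>{..<d}. y k + m k))"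
    by (rule nn_integral_distr[symmetric]) measurable
  also have "\<dots> = (\<integral>\<^sup>+y. ennreal (exp (vec_inner d m y - vec_inner d m m / 2)) * f y \<partial>gauss d)"
    unfolding gauss_shift by (rule nn_integral_density) measurable
  finally show ?thesis .
qed

text \<open>The density of the translate by \<open>m\<close> has total mass 1.\<close>

lemma nn_integral_gauss_exp_inner: "(\<integral>\<^sup>+y. ennreal (exp (vec_inner d m y)) \<partial>gauss d) = ennreal (exp (vec_inner d m m / 2))"
proof -
  interpret G: prob_space "gauss d" by (rule prob_space_gauss)
  have "1 = (\<integral>\<^sup>+y. ennreal (exp (vec_inner d m y - vec_inner d m m / 2)) * 1 \<partial>gauss d)"
    using nn_integral_gauss_shift[of "\<lambda>_. 1" d m] by (simp add: G.emeasure_space_1)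
  also have "\<dots> = (\<integral>\<^sup>+y. ennreal (exp (- vec_inner d m m / 2)) * ennreal (exp (vec_inner d m y)) \<partial>gauss d)"
    by (intro nn_integral_cong) (simp add: ennreal_mult[symmetric] exp_add[symmetric])
  also have "\<dots> = ennreal (exp (- vec_inner d m m / 2)) * (\<integral>\<^sup>+y. ennreal (exp (vec_inner d m y)) \<partial>gauss d)"
    by (rule nn_integral_cmult) measurable
  finally have "ennreal (exp (vec_inner d m m / 2)) * 1
     = ennreal (exp (vec_inner d m m / 2)) * ennreal (exp (- vec_inner d m m / 2)) * (\<integral>\<^sup>+y. ennreal (exp (vec_inner d m y)) \<partial>gauss d)"
    by (simp add: mult.assoc)
  then show ?thesis by (simp add: ennreal_mult[symmetric] exp_add[symmetric])
qed

text \<open>Averaging the density of the translate over \<open>y\<close> and \<open>- y\<close> replaces the exponential by a hyperbolic cosine.\<close>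

lemma gauss_symmetric_shift:
  assumes S: "S \<in> sets (gauss d)" and sym: "\<And>y. y \<in> S \<Longrightarrow> (\<lambda>k\<in>{..<d}. - y k) \<in> S"
    and T: "T \<in> sets (gauss d)" and ST: "\<And>y. y \<in> S \<Longrightarrow> (\<lambda>k\<in>{..<d}. y k + m k) \<in> T"
  shows "exp (- vec_inner d m m / 2) * measure (gauss d) S \<le> measure (gauss d) T"
proof -
  interpret G: prob_space "gauss d" by (rule prob_space_gauss)
  note [measurable] = S T
  let ?c = "vec_inner d m m / 2"
  have inv: "(\<lambda>k\<in>{..<d}. - (\<lambda>k\<in>{..<d}. - y k) k) = y" if "y \<in> space (gauss d)" for y
    using that by (auto simp: space_PiM PiE_iff extensional_def fun_eq_iff)
  have sym': "(\<lambda>k\<in>{..<d}. - y k) \<in> S \<longleftrightarrow> y \<in> S" if "y \<in> space (gauss d)" for y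
    using sym[of y] sym[of "\<lambda>k\<in>{..<d}. - y k"] inv[OF that] by auto
  let ?I = "\<integral>\<^sup>+y. ennreal (exp (vec_inner d (\<lambda>k. - m k) y - ?c)) * indicator S y \<partial>gauss d"
  let ?J = "\<integral>\<^sup>+y. ennreal (exp (vec_inner d m y - ?c)) * indicator S y \<partial>gauss d"
  have neg: "vec_inner d (\<lambda>k. - m k) y = - vec_inner d m y" for y by (simp add: vec_inner_def sum_negf)
  have IJ: "?I = ?J"
  proof -
    have "?J = (\<integral>\<^sup>+y. ennreal (exp (vec_inner d m (\<lambda>k\<in>{..<d}. - y k) - ?c)) * indicator S (\<lambda>k\<in>{..<d}. - y k) \<partial>gauss d)"
      by (rule nn_integral_gauss_uminus[symmetric]) measurable
    also have "\<dots> = ?I"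
      by (intro nn_integral_cong) (simp add: vec_inner_uminus neg sym' indicator_def)
    finally show ?thesis ..
  qed
  have "ennreal (2 * exp (- ?c)) * emeasure (gauss d) S = (\<integral>\<^sup>+y. ennreal (2 * exp (- ?c)) * indicator S y \<partial>gauss d)"
    by (simp add: nn_integral_cmult)
  also have "\<dots> \<le> (\<integral>\<^sup>+y. ennreal (exp (vec_inner d (\<lambda>k. - m k) y - ?c)) * indicator S y
      + ennreal (exp (vec_inner d m y - ?c)) * indicator S y \<partial>gauss d)"
  proof (rule nn_integral_mono)
    fix y
    have two: "2 \<le> exp u + exp (- u)" for u :: real
    proof -
      have "0 \<le> (exp (u / 2) - exp (- u / 2))\<^sup>2" by simp
      also have "\<dots> = exp u + exp (- u) - 2"
        by (simp add: power2_diff exp_double[symmetric] mult.assoc exp_add[symmetric] flip: exp_of_nat_mult)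
      finally show ?thesis by simp
    qed
    have "2 * exp (- ?c) \<le> exp (vec_inner d (\<lambda>k. - m k) y - ?c) + exp (vec_inner d m y - ?c)"
    proof -
      have "exp (- c) * (exp u + exp (- u)) = exp (- u - c) + exp (u - c)" for u c :: real
        by (simp add: distrib_left exp_add[symmetric] algebra_simps)
      then show ?thesis
        using mult_left_mono[OF two[of "vec_inner d m y"], of "exp (- ?c)"] by (simp add: neg mult.commute)
    qed
    then show "ennreal (2 * exp (- ?c)) * indicator S y \<le> ennreal (exp (vec_inner d (\<lambda>k. - m k) y - ?c)) * indicator S y
      + ennreal (exp (vec_inner d m y - ?c)) * indicator S y"
      by (simp add: distrib_right[symmetric] ennreal_plus[symmetric] mult_right_mono ennreal_leI del: ennreal_plus)
  qed
  also have "\<dots> = ?I + ?J" by (rule nn_integral_add) measurable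
  also have "\<dots> = 2 * ?I" unfolding IJ by (simp add: mult_2)
  also have "?I = (\<integral>\<^sup>+y. indicator S (\<lambda>k\<in>{..<d}. y k + - m k) \<partial>gauss d)"
    using nn_integral_gauss_shift[of "indicator S" d "\<lambda>k. - m k"] by (simp add: vec_inner_def)
  also have "\<dots> \<le> (\<integral>\<^sup>+y. indicator T y \<partial>gauss d)"
  proof (rule nn_integral_mono)
    fix y assume y: "y \<in> space (gauss d)"
    have "(\<lambda>k\<in>{..<d}. (\<lambda>k\<in>{..<d}. y k + - m k) k + m k) = y"
      using y by (auto simp: space_PiM PiE_iff extensional_def fun_eq_iff)
    then show "indicator S (\<lambda>k\<in>{..<d}. y k + - m k) \<le> (indicator T y :: ennreal)"
      using ST[of "\<lambda>k\<in>{..<d}. y k + - m k"] by (auto simp: indicator_def)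
  qed
  finally have "ennreal (2 * exp (- ?c)) * emeasure (gauss d) S \<le> 2 * emeasure (gauss d) T"
    by (simp add: mult_left_mono)
  then have "ennreal (2 * exp (- ?c) * measure (gauss d) S) \<le> ennreal (2 * measure (gauss d) T)"
    by (simp add: G.emeasure_eq_measure ennreal_mult)
  then have "2 * exp (- ?c) * measure (gauss d) S \<le> 2 * measure (gauss d) T"
    by (subst (asm) ennreal_le_iff) auto
  then show ?thesis by simp
qed

section \<open>Tail bounds and the slab estimate\<close>

lemma gauss_inner_tail:
  assumes V: "vec_inner d v v \<le> V" "0 < V" and a: "0 < a"
  shows "measure (gauss d) {y \<in> space (gauss d). a < \<bar>vec_inner d v y\<bar>} \<le> 2 * exp (- a\<^sup>2 / (2 * V))"
proof -
  interpret G: prob_space "gauss d" by (rule prob_space_gauss)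
  have one: "measure (gauss d) {y \<in> space (gauss d). a < vec_inner d w y} \<le> exp (- a\<^sup>2 / (2 * V))"
    if w: "vec_inner d w w \<le> V" for w
  proof -
    \<comment> \<open>The minimiser of the Chernoff exponent
      \<open>l\<^sup>2 * V / 2 - l * a\<close>.\<close>
    define l where "l = a / V"
    have l: "0 < l" using V a by (simp add: l_def)
    have "measure (gauss d) {y \<in> space (gauss d). a < vec_inner d w y}
      \<le> measure (gauss d) {y \<in> space (gauss d). exp (l * a) < exp (vec_inner d (\<lambda>k. l * w k) y)}"
    proof (rule G.finite_measure_mono)
      show "{y \<in> space (gauss d). a < vec_inner d w y} \<subseteq> {y \<in> space (gauss d). exp (l * a) < exp (vec_inner d (\<lambda>k. l * w k) y)}"
        using l by (auto simp: vec_inner_def sum_distrib_left[symmetric] mult.assoc)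
    qed measurable
    also have "\<dots> \<le> exp (l\<^sup>2 * V / 2) / exp (l * a)"
    proof (rule G.nn_integral_markov)
      have "vec_inner d (\<lambda>k. l * w k) (\<lambda>k. l * w k) = l\<^sup>2 * vec_inner d w w"
        by (simp add: vec_inner_def sum_distrib_left power2_eq_square ac_simps)
      also have "\<dots> \<le> l\<^sup>2 * V" using w by (intro mult_left_mono) auto
      finally show "(\<integral>\<^sup>+y. ennreal (exp (vec_inner d (\<lambda>k. l * w k) y)) \<partial>gauss d) \<le> ennreal (exp (l\<^sup>2 * V / 2))"
        unfolding nn_integral_gauss_exp_inner by (intro ennreal_leI) simp
    qed auto
    also have "\<dots> = exp (l\<^sup>2 * V / 2 - l * a)" by (simp add: exp_diff)
    also have "l\<^sup>2 * V / 2 - l * a = - a\<^sup>2 / (2 * V)" using V by (simp add: l_def power2_eq_square field_simps)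
    finally show ?thesis .
  qed
  have neg: "vec_inner d (\<lambda>k. - v k) y = - vec_inner d v y" for y by (simp add: vec_inner_def sum_negf)
  have neg2: "vec_inner d (\<lambda>k. - v k) (\<lambda>k. - v k) = vec_inner d v v" by (simp add: vec_inner_def)
  have "measure (gauss d) {y \<in> space (gauss d). a < \<bar>vec_inner d v y\<bar>}
    \<le> measure (gauss d) ({y \<in> space (gauss d). a < vec_inner d v y} \<union> {y \<in> space (gauss d). a < vec_inner d (\<lambda>k. - v k) y})"
    by (rule G.finite_measure_mono) (auto simp: neg abs_if split: if_splits)
  also have "\<dots> \<le> measure (gauss d) {y \<in> space (gauss d). a < vec_inner d v y} + measure (gauss d) {y \<in> space (gauss d). a < vec_inner d (\<lambda>k. - v k) y}"
    by (rule measure_Un_le) auto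
  also have "\<dots> \<le> 2 * exp (- a\<^sup>2 / (2 * V))"
    using one[OF V(1)] one[of "\<lambda>k. - v k"] V(1) neg2 by simp
  finally show ?thesis .
qed

text \<open>Chernoff with \<open>exp (- vec_inner d y y)\<close>, whose mean is
  \<open>(1 / sqrt 3) ^ d\<close>. What matters is that \<open>exp 1 < 3\<close>, so the bound
  decays exponentially in \<open>d\<close>.\<close>

lemma gauss_norm_lower_tail:
  "measure (gauss d) {y \<in> space (gauss d). vec_inner d y y < d / 2} \<le> (sqrt (exp 1 / 3)) ^ d"
proof -
  interpret G: prob_space "gauss d" by (rule prob_space_gauss)
  have i: "(\<integral>\<^sup>+y. ennreal (exp (- vec_inner d y y)) \<partial>gauss d) = ennreal ((1 / sqrt 3) ^ d)"
  proof -
    have "(\<integral>\<^sup>+y. ennreal (exp (- vec_inner d y y)) \<partial>gauss d) = (\<integral>\<^sup>+y. (\<Prod>k<d. ennreal (exp (0 * y k - 1 * (y k)\<^sup>2))) \<partial>gauss d)"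
      by (intro nn_integral_cong) (simp add: vec_inner_def prod_ennreal exp_sum[symmetric] sum_negf power2_eq_square)
    also have "\<dots> = (\<Prod>k<d. \<integral>\<^sup>+y. ennreal (exp (0 * y - 1 * y\<^sup>2)) \<partial>std_normal_distribution)"
      by (rule std_normal_product.product_nn_integral_prod) auto
    also have "\<dots> = ennreal ((1 / sqrt 3) ^ d)"
      by (subst nn_integral_std_normal_exp_quadratic) (auto simp: ennreal_power)
    finally show ?thesis .
  qed
  have "measure (gauss d) {y \<in> space (gauss d). vec_inner d y y < d / 2}
    = measure (gauss d) {y \<in> space (gauss d). exp (- (d / 2)) < exp (- vec_inner d y y)}"
    by simp
  also have "\<dots> \<le> (1 / sqrt 3) ^ d / exp (- (d / 2))"
    by (rule G.nn_integral_markov) (auto simp: i)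
  also have "\<dots> = (sqrt (exp 1 / 3)) ^ d"
  proof -
    have "sqrt (exp 1 :: real) = exp (1 / 2)"
      by (rule real_sqrt_unique) (auto simp: power2_eq_square exp_add[symmetric])
    then have "sqrt (exp 1 / 3) ^ d = exp (1 / 2) ^ d * (1 / sqrt 3) ^ d"
      by (simp add: real_sqrt_divide power_divide)
    also have "exp (1 / 2 :: real) ^ d = exp (d / 2)" by (simp add: exp_of_nat_mult[symmetric])
    finally show ?thesis by (simp add: exp_minus field_simps)
  qed
  finally show ?thesis .
qed

text \<open>Rotation of a Gaussian pair by 45 degrees. After substituting
  \<open>z = z' + sqrt 2 * w\<close>, the identity \<open>id\<close> splits off the density of
  \<open>w\<close>, and what remains integrates to 1 over \<open>z'\<close>.\<close>

lemma nn_integral_std_normal_difference: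
  assumes [measurable]: "f \<in> borel_measurable borel"
  shows "(\<integral>\<^sup>+z'. (\<integral>\<^sup>+z. f ((z - z') / sqrt 2) \<partial>std_normal_distribution) \<partial>std_normal_distribution)
    = (\<integral>\<^sup>+w. f w \<partial>std_normal_distribution)"
proof -
  let ?\<phi> = std_normal_density
  have id: "?\<phi> (z' + sqrt 2 * w) * ?\<phi> z' = ?\<phi> w * ?\<phi> (w + sqrt 2 * z')" for w z' :: real
  proof -
    have "(z' + sqrt 2 * w)\<^sup>2 + z'\<^sup>2 = w\<^sup>2 + (w + sqrt 2 * z')\<^sup>2"
      by (simp add: power2_sum power_mult_distrib)
    then have "- (z' + sqrt 2 * w)\<^sup>2 / 2 + - z'\<^sup>2 / 2 = - w\<^sup>2 / 2 + - (w + sqrt 2 * z')\<^sup>2 / 2" by simp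
    then have e: "exp (- (z' + sqrt 2 * w)\<^sup>2 / 2) * exp (- z'\<^sup>2 / 2) = exp (- w\<^sup>2 / 2) * exp (- (w + sqrt 2 * z')\<^sup>2 / 2)"
      unfolding exp_add[symmetric] by (rule arg_cong)
    have "?\<phi> (z' + sqrt 2 * w) * ?\<phi> z' = (1 / sqrt (2 * pi)) * (1 / sqrt (2 * pi)) * (exp (- (z' + sqrt 2 * w)\<^sup>2 / 2) * exp (- z'\<^sup>2 / 2))"
      unfolding std_normal_density_def by (simp only: ac_simps)
    also have "\<dots> = ?\<phi> w * ?\<phi> (w + sqrt 2 * z')"
      unfolding e std_normal_density_def by (simp only: ac_simps)
    finally show ?thesis .
  qed
  have "(\<integral>\<^sup>+z'. (\<integral>\<^sup>+z. f ((z - z') / sqrt 2) \<partial>std_normal_distribution) \<partial>std_normal_distribution)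
     = (\<integral>\<^sup>+z'. ennreal (?\<phi> z') * (\<integral>\<^sup>+z. ennreal (?\<phi> z) * f ((z - z') / sqrt 2) \<partial>lborel) \<partial>lborel)"
    by (subst nn_integral_density, measurable, intro nn_integral_cong arg_cong2[where f = "(*)"] refl nn_integral_density) auto
  also have "\<dots> = (\<integral>\<^sup>+z'. (\<integral>\<^sup>+w. ennreal (sqrt 2) * (ennreal (?\<phi> w) * ennreal (?\<phi> (w + sqrt 2 * z'))) * f w \<partial>lborel) \<partial>lborel)"
  proof (rule nn_integral_cong)
    fix z' :: real
    have "(\<integral>\<^sup>+z. ennreal (?\<phi> z) * f ((z - z') / sqrt 2) \<partial>lborel)
      = ennreal (sqrt 2) * (\<integral>\<^sup>+w. ennreal (?\<phi> (z' + sqrt 2 * w)) * f w \<partial>lborel)"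
      using nn_integral_real_affine[of "\<lambda>z. ennreal (?\<phi> z) * f ((z - z') / sqrt 2)" "sqrt 2" z'] by simp
    then have "ennreal (?\<phi> z') * (\<integral>\<^sup>+z. ennreal (?\<phi> z) * f ((z - z') / sqrt 2) \<partial>lborel)
      = (\<integral>\<^sup>+w. ennreal (sqrt 2) * ennreal (?\<phi> z') * (ennreal (?\<phi> (z' + sqrt 2 * w)) * f w) \<partial>lborel)"
      by (subst nn_integral_cmult) (auto simp: ac_simps)
    also have "\<dots> = (\<integral>\<^sup>+w. ennreal (sqrt 2) * (ennreal (?\<phi> w) * ennreal (?\<phi> (w + sqrt 2 * z'))) * f w \<partial>lborel)"
    proof (rule nn_integral_cong)
      fix w
      have "ennreal (?\<phi> z') * ennreal (?\<phi> (z' + sqrt 2 * w)) = ennreal (?\<phi> w) * ennreal (?\<phi> (w + sqrt 2 * z'))"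
        using id[of z' w] by (simp add: ennreal_mult[symmetric] mult.commute)
      then show "ennreal (sqrt 2) * ennreal (?\<phi> z') * (ennreal (?\<phi> (z' + sqrt 2 * w)) * f w)
        = ennreal (sqrt 2) * (ennreal (?\<phi> w) * ennreal (?\<phi> (w + sqrt 2 * z'))) * f w"
        by (metis mult.assoc)
    qed
    finally show "ennreal (?\<phi> z') * (\<integral>\<^sup>+z. ennreal (?\<phi> z) * f ((z - z') / sqrt 2) \<partial>lborel)
      = (\<integral>\<^sup>+w. ennreal (sqrt 2) * (ennreal (?\<phi> w) * ennreal (?\<phi> (w + sqrt 2 * z'))) * f w \<partial>lborel)" .
  qed
  also have "\<dots> = (\<integral>\<^sup>+w. (\<integral>\<^sup>+z'. ennreal (sqrt 2) * (ennreal (?\<phi> w) * ennreal (?\<phi> (w + sqrt 2 * z'))) * f w \<partial>lborel) \<partial>lborel)"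
    by (rule lborel_pair.Fubini') measurable
  also have "\<dots> = (\<integral>\<^sup>+w. ennreal (?\<phi> w) * f w \<partial>lborel)"
  proof (rule nn_integral_cong)
    fix w :: real
    have one: "ennreal (sqrt 2) * (\<integral>\<^sup>+z'. ennreal (?\<phi> (w + sqrt 2 * z')) \<partial>lborel) = 1"
      using nn_integral_real_affine[of "\<lambda>z. ennreal (?\<phi> z)" "sqrt 2" w] std_normal.emeasure_space_1
      by (simp add: emeasure_density)
    have "(\<integral>\<^sup>+z'. ennreal (sqrt 2) * (ennreal (?\<phi> w) * ennreal (?\<phi> (w + sqrt 2 * z'))) * f w \<partial>lborel)
      = (\<integral>\<^sup>+z'. (ennreal (?\<phi> w) * f w * ennreal (sqrt 2)) * ennreal (?\<phi> (w + sqrt 2 * z')) \<partial>lborel)"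
      by (intro nn_integral_cong) (simp only: ac_simps)
    also have "\<dots> = (ennreal (?\<phi> w) * f w) * (ennreal (sqrt 2) * (\<integral>\<^sup>+z'. ennreal (?\<phi> (w + sqrt 2 * z')) \<partial>lborel))"
      by (subst nn_integral_cmult) (auto simp: mult.assoc)
    finally show "(\<integral>\<^sup>+z'. ennreal (sqrt 2) * (ennreal (?\<phi> w) * ennreal (?\<phi> (w + sqrt 2 * z'))) * f w \<partial>lborel) = ennreal (?\<phi> w) * f w"
      by (simp add: one)
  qed
  also have "\<dots> = (\<integral>\<^sup>+w. f w \<partial>std_normal_distribution)"
    by (rule nn_integral_density[symmetric]) auto
  finally show ?thesis .
qed

definition rotated_difference :: "nat \<Rightarrow> (nat \<Rightarrow> real) \<times> (nat \<Rightarrow> real) \<Rightarrow> nat \<Rightarrow> real" where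
  "rotated_difference d q = (\<lambda>k\<in>{..<d}. (fst q k - snd q k) / sqrt 2)"

lemma measurable_rotated_difference [measurable]:
  "rotated_difference d \<in> gauss d \<Otimes>\<^sub>M gauss d \<rightarrow>\<^sub>M gauss d"
proof -
  have "(\<lambda>q. (fst q k - snd q k) / sqrt 2) \<in> borel_measurable (gauss d \<Otimes>\<^sub>M gauss d)" if "k < d" for k
    using measurable_gauss_component[OF measurable_fst[of "gauss d" "gauss d"] that]
      measurable_gauss_component[OF measurable_snd[of "gauss d" "gauss d"] that] by simp
  then show ?thesis unfolding rotated_difference_def[abs_def] by (intro measurable_restrict) auto
qed

lemma distr_rotated_difference: "distr (gauss d \<Otimes>\<^sub>M gauss d) (gauss d) (rotated_difference d) = gauss d"
proof (rule std_normal_product.PiM_eqI)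
  interpret G: prob_space "gauss d" by (rule prob_space_gauss)
  interpret GG: pair_prob_space "gauss d" "gauss d" by unfold_locales
  fix A assume "\<And>k. k \<in> {..<d} \<Longrightarrow> A k \<in> sets std_normal_distribution"
  then have A [measurable]: "A k \<in> sets borel" if "k < d" for k using that by simp
  have box: "Pi\<^sub>E {..<d} A \<in> sets (gauss d)" using A by (intro sets_PiM_I_finite) auto
  let ?g = "\<lambda>k z z'. indicator (A k) ((z - z') / sqrt 2) :: ennreal"
  have comp: "(\<lambda>q. fst q k) \<in> borel_measurable (gauss d \<Otimes>\<^sub>M gauss d)" "(\<lambda>q. snd q k) \<in> borel_measurable (gauss d \<Otimes>\<^sub>M gauss d)" if "k < d" for k
    using measurable_gauss_component[OF measurable_fst[of "gauss d" "gauss d"] that]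
      measurable_gauss_component[OF measurable_snd[of "gauss d" "gauss d"] that] by auto
  have "emeasure (distr (gauss d \<Otimes>\<^sub>M gauss d) (gauss d) (rotated_difference d)) (Pi\<^sub>E {..<d} A)
    = (\<integral>\<^sup>+q. indicator (Pi\<^sub>E {..<d} A) (rotated_difference d q) \<partial>(gauss d \<Otimes>\<^sub>M gauss d))"
  proof -
    have "emeasure (distr (gauss d \<Otimes>\<^sub>M gauss d) (gauss d) (rotated_difference d)) (Pi\<^sub>E {..<d} A)
      = (\<integral>\<^sup>+x. indicator (Pi\<^sub>E {..<d} A) x \<partial>distr (gauss d \<Otimes>\<^sub>M gauss d) (gauss d) (rotated_difference d))"
      using box by simp
    also have "\<dots> = (\<integral>\<^sup>+q. indicator (Pi\<^sub>E {..<d} A) (rotated_difference d q) \<partial>(gauss d \<Otimes>\<^sub>M gauss d))"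
      using box by (intro nn_integral_distr) auto
    finally show ?thesis .
  qed
  also have "\<dots> = (\<integral>\<^sup>+q. (\<Prod>k<d. ?g k (fst q k) (snd q k)) \<partial>(gauss d \<Otimes>\<^sub>M gauss d))"
  proof (rule nn_integral_cong)
    fix q
    show "indicator (Pi\<^sub>E {..<d} A) (rotated_difference d q) = (\<Prod>k<d. ?g k (fst q k) (snd q k))"
      by (auto simp: indicator_def rotated_difference_def PiE_iff prod_eq_1_iff)
  qed
  also have "\<dots> = (\<integral>\<^sup>+z'. (\<integral>\<^sup>+z. (\<Prod>k<d. ?g k (z k) (z' k)) \<partial>gauss d) \<partial>gauss d)"
  proof -
    have "(\<lambda>q. \<Prod>k<d. ?g k (fst q k) (snd q k)) \<in> borel_measurable (gauss d \<Otimes>\<^sub>M gauss d)"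
    proof (rule borel_measurable_prod_ennreal)
      fix k assume "k \<in> {..<d}"
      then have k: "k < d" by simp
      note [measurable] = comp[OF k] A[OF k]
      show "(\<lambda>q. ?g k (fst q k) (snd q k)) \<in> borel_measurable (gauss d \<Otimes>\<^sub>M gauss d)" by measurable
    qed
    then show ?thesis by (subst GG.nn_integral_snd[symmetric]) auto
  qed
  also have "\<dots> = (\<integral>\<^sup>+z'. (\<Prod>k<d. \<integral>\<^sup>+z. ?g k z (z' k) \<partial>std_normal_distribution) \<partial>gauss d)"
    using A by (intro nn_integral_cong std_normal_product.product_nn_integral_prod) auto
  also have "\<dots> = (\<Prod>k<d. \<integral>\<^sup>+z'. (\<integral>\<^sup>+z. ?g k z z' \<partial>std_normal_distribution) \<partial>std_normal_distribution)"
  proof (rule std_normal_product.product_nn_integral_prod)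
    fix k assume "k \<in> {..<d}"
    then have [measurable]: "A k \<in> sets borel" using A by simp
    show "(\<lambda>z'. \<integral>\<^sup>+z. ?g k z z' \<partial>std_normal_distribution) \<in> borel_measurable std_normal_distribution" by measurable
  qed simp
  also have "\<dots> = (\<Prod>k<d. emeasure std_normal_distribution (A k))"
    using A by (intro prod.cong refl) (simp add: nn_integral_std_normal_difference)
  finally show "emeasure (distr (gauss d \<Otimes>\<^sub>M gauss d) (gauss d) (rotated_difference d)) (Pi\<^sub>E {..<d} A) = \<dots>" .
qed auto

text \<open>On the interval \<open>x\<^sup>2 \<le> 2 * u\<^sup>2 + 1 / 2\<close>, which bounds the
  density from below. The weaker exponent \<open>u\<^sup>2\<close> instead of
  \<open>u\<^sup>2 / 2\<close> makes the bound a clean product over the directions.\<close>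

lemma std_normal_interval_lower:
  "ennreal (exp (- 1 / 4) / sqrt (2 * pi) * exp (- u\<^sup>2)) \<le> emeasure std_normal_distribution {u - 1/2..u + 1/2}"
proof -
  have "ennreal (exp (- 1 / 4) / sqrt (2 * pi) * exp (- u\<^sup>2))
     = (\<integral>\<^sup>+x. ennreal (exp (- 1 / 4) / sqrt (2 * pi) * exp (- u\<^sup>2)) * indicator {u - 1/2..u + 1/2} x \<partial>lborel)"
    by (subst nn_integral_cmult_indicator) auto
  also have "\<dots> \<le> (\<integral>\<^sup>+x. ennreal (std_normal_density x) * indicator {u - 1/2..u + 1/2} x \<partial>lborel)"
  proof (rule nn_integral_mono)
    fix x
    show "ennreal (exp (- 1 / 4) / sqrt (2 * pi) * exp (- u\<^sup>2)) * indicator {u - 1/2..u + 1/2} x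
      \<le> ennreal (std_normal_density x) * indicator {u - 1/2..u + 1/2} x"
    proof (cases "x \<in> {u - 1/2..u + 1/2}")
      case True
      then have "\<bar>x - u\<bar> \<le> 1 / 2" unfolding abs_le_iff by simp
      then have "(x - u)\<^sup>2 \<le> (1 / 2)\<^sup>2" using abs_le_square_iff[of "x - u" "1 / 2"] by simp
      moreover have "x\<^sup>2 \<le> 2 * u\<^sup>2 + 2 * (x - u)\<^sup>2"
        using zero_le_power2[of "x - 2 * u"] by (simp add: power2_eq_square algebra_simps)
      ultimately have "- 1 / 4 + - u\<^sup>2 \<le> - x\<^sup>2 / 2" by (simp add: power2_eq_square)
      then have "exp (- 1 / 4) * exp (- u\<^sup>2) \<le> exp (- x\<^sup>2 / 2)" unfolding exp_add[symmetric] by simp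
      then have "1 / sqrt (2 * pi) * (exp (- 1 / 4) * exp (- u\<^sup>2)) \<le> 1 / sqrt (2 * pi) * exp (- x\<^sup>2 / 2)"
        by (intro mult_left_mono) auto
      then show ?thesis using True by (simp add: std_normal_density_def ennreal_leI)
    qed simp
  qed
  also have "\<dots> = emeasure std_normal_distribution {u - 1/2..u + 1/2}"
    by (simp add: emeasure_density)
  finally show ?thesis .
qed

text \<open>The base is the interval constant times \<open>exp (- 37)\<close>, where 37 covers the
  Markov level \<open>36 * card V + 1\<close>, times the probability 1/4 of a good vector. The
  square is the loss in passing from one vector to two.\<close>

definition slab_const :: real where
  "slab_const = (exp (- 1 / 4) / sqrt (2 * pi) * exp (- 37) / 4)\<^sup>2"

text \<open>Write \<open>y = (z - z') / sqrt 2\<close> with \<open>z\<close>, \<open>z'\<close> independent. If the projections of \<open>z\<close> and of \<open>z'\<close> are within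
  \<open>1/2\<close> of a common random vector \<open>T\<close>, then those of \<open>y\<close> are small. Given \<open>T\<close> the two conditions are independent and
  equally likely, so by Jensen's inequality both hold with at least the square of the probability of one, and
  that probability is found by integrating over \<open>T\<close> first.\<close>

lemma gauss_slab_lower_bound:
  fixes V :: "(nat \<Rightarrow> real) set" and d :: nat
  assumes d: "1 \<le> d" and V: "finite V" "\<And>v. v \<in> V \<Longrightarrow> vec_inner d v v \<le> 9 * d"
  shows "slab_const ^ (card V + 1)
    \<le> measure (gauss d) {y \<in> space (gauss d). vec_inner d y y \<le> 4 * d \<and> (\<forall>v\<in>V. \<bar>vec_inner d v y\<bar> \<le> sqrt d)}"
proof -
  interpret G: prob_space "gauss d" by (rule prob_space_gauss)
  interpret GG: pair_prob_space "gauss d" "gauss d" by unfold_locales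
  let ?\<nu> = "\<Pi>\<^sub>M v\<in>V. std_normal_distribution"
  interpret N: prob_space ?\<nu> by (intro prob_space_PiM std_normal.prob_space_axioms)
  interpret GN: pair_prob_space "gauss d" ?\<nu> by unfold_locales
  interpret GGN: pair_prob_space "gauss d \<Otimes>\<^sub>M gauss d" ?\<nu> by unfold_locales
  interpret PV: product_sigma_finite "\<lambda>_::nat \<Rightarrow> real. std_normal_distribution" by unfold_locales
  let ?n = "card V"
  define u where "u z v = vec_inner d v z / sqrt d" for z v
  define F :: "(nat \<Rightarrow> real) \<Rightarrow> ((nat \<Rightarrow> real) \<Rightarrow> real) \<Rightarrow> ennreal" where
    "F z T = indicator {..2 * real d} (vec_inner d z z) * (\<Prod>v\<in>V. indicator {- 1/2..1/2} (T v - u z v))" for z T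
  define S where "S = {y \<in> space (gauss d). vec_inner d y y \<le> 4 * d \<and> (\<forall>v\<in>V. \<bar>vec_inner d v y\<bar> \<le> sqrt d)}"
  have Sm [measurable]: "S \<in> sets (gauss d)"
  proof -
    have "S = {y \<in> space (gauss d). vec_inner d y y \<le> 4 * d} \<inter> {y \<in> space (gauss d). \<forall>v\<in>V. \<bar>vec_inner d v y\<bar> \<le> sqrt d}"
      by (auto simp: S_def)
    moreover have "{y \<in> space (gauss d). \<forall>v\<in>V. \<bar>vec_inner d v y\<bar> \<le> sqrt d} \<in> sets (gauss d)"
      using V(1) by (intro sets.sets_Collect_finite_All) auto
    ultimately show ?thesis by simp
  qed
  have Tm [measurable]: "(\<lambda>T. T v) \<in> borel_measurable ?\<nu>" if "v \<in> V" for v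
    using measurable_component_singleton[OF that, of "\<lambda>_. std_normal_distribution"] by simp
  have Fm: "(\<lambda>p. F (f p) (g p)) \<in> borel_measurable M" if [measurable]: "f \<in> M \<rightarrow>\<^sub>M gauss d" "g \<in> M \<rightarrow>\<^sub>M ?\<nu>" for f g and M :: "'z measure"
  proof -
    have "(\<lambda>p. g p v) \<in> borel_measurable M" if "v \<in> V" for v
      using measurable_compose[OF \<open>g \<in> M \<rightarrow>\<^sub>M ?\<nu>\<close> Tm[OF that]] .
    then show ?thesis unfolding F_def u_def by measurable
  qed
  have F01: "F z T = 0 \<or> F z T = 1" for z T
    unfolding F_def using V(1)
    by (cases "\<forall>v\<in>V. T v - u z v \<in> {- 1/2..1/2}") (auto simp: indicator_def prod_zero_iff intro!: prod.neutral)
  have Fone: "vec_inner d z z \<le> 2 * d \<and> (\<forall>v\<in>V. \<bar>T v - u z v\<bar> \<le> 1 / 2)" if "F z T \<noteq> 0" for z T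
  proof -
    have "- (1/2) \<le> T v - u z v \<and> T v - u z v \<le> 1/2" if "v \<in> V" for v
      using \<open>F z T \<noteq> 0\<close> V(1) that unfolding F_def by (auto simp: indicator_def prod_zero_iff split: if_splits)
    moreover have "vec_inner d z z \<le> 2 * d"
      using that unfolding F_def by (auto simp: indicator_def split: if_splits)
    ultimately show ?thesis unfolding abs_le_iff atLeastAtMost_iff by (smt (verit))
  qed
  \<comment> \<open>Half the squared length of a difference is at most the sum of the squared
    lengths, which gives \<open>4 * d\<close>. Two projections within 1/2 of the same
    \<open>T v\<close> differ by at most 1, in units of \<open>sqrt d\<close>.\<close>
  have inS: "rotated_difference d q \<in> S" if q: "q \<in> space (gauss d \<Otimes>\<^sub>M gauss d)" and F: "F (fst q) T * F (snd q) T \<noteq> 0" for q T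
  proof -
    have a: "vec_inner d (fst q) (fst q) \<le> 2 * d" "vec_inner d (snd q) (snd q) \<le> 2 * d"
      and b: "\<bar>T v - u (fst q) v\<bar> \<le> 1 / 2" "\<bar>T v - u (snd q) v\<bar> \<le> 1 / 2" if "v \<in> V" for v
      using Fone[of "fst q" T] Fone[of "snd q" T] F that by auto
    have a: "vec_inner d (fst q) (fst q) \<le> 2 * d" "vec_inner d (snd q) (snd q) \<le> 2 * d"
      using Fone[of "fst q" T] Fone[of "snd q" T] F by auto
    have "vec_inner d (rotated_difference d q) (rotated_difference d q)
       = (\<Sum>k<d. ((fst q k - snd q k) * (fst q k - snd q k)) / 2)"
      by (simp add: vec_inner_def rotated_difference_def)
    also have "\<dots> \<le> (\<Sum>k<d. fst q k * fst q k + snd q k * snd q k)"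
    proof (rule sum_mono)
      fix k
      have "0 \<le> (fst q k + snd q k) * (fst q k + snd q k)" by simp
      then show "((fst q k - snd q k) * (fst q k - snd q k)) / 2 \<le> fst q k * fst q k + snd q k * snd q k"
        by (simp add: algebra_simps)
    qed
    also have "\<dots> \<le> 4 * d" using a by (simp add: vec_inner_def sum.distrib)
    finally have 1: "vec_inner d (rotated_difference d q) (rotated_difference d q) \<le> 4 * d" .
    have 2: "\<bar>vec_inner d v (rotated_difference d q)\<bar> \<le> sqrt d" if v: "v \<in> V" for v
    proof -
      have "\<bar>u (fst q) v - u (snd q) v\<bar> \<le> 1"
        using b[OF v] unfolding abs_le_iff by linarith
      have "vec_inner d v (rotated_difference d q) = (\<Sum>k<d. (v k * fst q k - v k * snd q k) / sqrt 2)"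
        by (simp add: vec_inner_def rotated_difference_def right_diff_distrib)
      also have "\<dots> = (vec_inner d v (fst q) - vec_inner d v (snd q)) / sqrt 2"
        by (simp add: vec_inner_def sum_divide_distrib[symmetric] sum_subtractf)
      also have "\<dots> = sqrt d * (u (fst q) v - u (snd q) v) / sqrt 2"
        using d by (simp add: u_def diff_divide_distrib[symmetric])
      finally have "\<bar>vec_inner d v (rotated_difference d q)\<bar> = sqrt d * \<bar>u (fst q) v - u (snd q) v\<bar> / sqrt 2"
        by (simp add: abs_mult)
      also have "\<dots> \<le> sqrt d * 1 / sqrt 2"
        using \<open>\<bar>u (fst q) v - u (snd q) v\<bar> \<le> 1\<close> by (intro divide_right_mono mult_left_mono) auto
      also have "\<dots> \<le> sqrt d" by (simp add: divide_le_eq mult_le_cancel_left1)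
      finally show ?thesis .
    qed
    show ?thesis
      using 1 2 measurable_space[OF measurable_rotated_difference q] by (simp add: S_def)
  qed
  \<comment> \<open>Markov fails with probability at most 1/2 for the norm, and at most 1/4 for the
    projections, whose squares have total mean at most \<open>9 * card V\<close>. The added 1 keeps
    the level positive when \<open>V\<close> is empty.\<close>
  define good where "good = {z \<in> space (gauss d). \<forall>a\<in>{..<2::nat}. (if a = 0 then vec_inner d z z else (\<Sum>v\<in>V. (u z v)\<^sup>2)) \<le> (if a = 0 then 2 * real d else 36 * ?n + 1)}"
  have um [measurable]: "(\<lambda>z. u z v) \<in> borel_measurable (gauss d)" for v unfolding u_def by measurable
  have pgood: "1 - 3 / 4 \<le> measure (gauss d) good"
    unfolding good_def
  proof (rule G.prob_simultaneous_markov[where b = "\<lambda>a. if a = 0 then real d else 9 * ?n"])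
    fix a :: nat assume "a \<in> {..<2}"
    show "(\<lambda>z. if a = 0 then vec_inner d z z else (\<Sum>v\<in>V. (u z v)\<^sup>2)) \<in> borel_measurable (gauss d)" by simp
    show "(\<integral>\<^sup>+z. ennreal (if a = 0 then vec_inner d z z else (\<Sum>v\<in>V. (u z v)\<^sup>2)) \<partial>gauss d) \<le> ennreal (if a = 0 then real d else 9 * ?n)"
    proof (cases "a = 0")
      case False
      have "(\<integral>\<^sup>+z. ennreal (\<Sum>v\<in>V. (u z v)\<^sup>2) \<partial>gauss d) \<le> ennreal (\<Sum>v\<in>V. 9)"
      proof (rule G.nn_integral_sum_le)
        fix v assume v: "v \<in> V"
        have "(\<integral>\<^sup>+z. ennreal ((u z v)\<^sup>2) \<partial>gauss d) = (\<integral>\<^sup>+z. ennreal (1 / d) * ennreal ((vec_inner d v z)\<^sup>2) \<partial>gauss d)"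
          using d by (intro nn_integral_cong) (simp add: u_def power_divide ennreal_mult[symmetric])
        also have "\<dots> = ennreal (1 / d) * ennreal (vec_inner d v v)"
          by (subst nn_integral_cmult) (auto simp: nn_integral_gauss_inner_square)
        also have "\<dots> = ennreal (vec_inner d v v / d)"
          using d vec_inner_self_nonneg[of d v] by (simp add: ennreal_mult[symmetric])
        also have "\<dots> \<le> ennreal 9" using V(2)[OF v] d by (intro ennreal_leI) (simp add: divide_le_eq)
        finally show "(\<integral>\<^sup>+z. ennreal ((u z v)\<^sup>2) \<partial>gauss d) \<le> ennreal 9" .
      qed auto
      then show ?thesis using False by (simp add: mult.commute)
    qed (simp add: nn_integral_gauss_norm_square)
    show "0 \<le> (if a = 0 then vec_inner d z z else (\<Sum>v\<in>V. (u z v)\<^sup>2))" for z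
      by (auto simp: vec_inner_self_nonneg intro: sum_nonneg)
  next
    have "{..<2::nat} = {0, 1}" by auto
    moreover have "9 * real ?n / (36 * real ?n + 1) \<le> 1 / 4" by (simp add: divide_le_eq)
    ultimately show "(\<Sum>a<(2::nat). (if a = 0 then real d else 9 * ?n) / (if a = 0 then 2 * real d else 36 * ?n + 1)) \<le> 3 / 4"
      using d by simp
  qed (use d in auto)
  define c1 where "c1 = exp (- 1 / 4) / sqrt (2 * pi)"
  have c1: "0 < c1" "c1 \<le> 1"
  proof -
    show "0 < c1" by (simp add: c1_def)
    have "1 \<le> sqrt (2 * pi)" using pi_gt3 by (intro real_le_rsqrt) simp
    then show "c1 \<le> 1" using order.trans[of "exp (- 1 / 4)" 1 "sqrt (2 * pi)"] by (simp add: c1_def divide_le_eq_1)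
  qed
  define K where "K = c1 ^ ?n * exp (- (36 * real ?n + 1))"
  have K: "0 \<le> K" using c1 by (simp add: K_def)
  have inner: "ennreal K * indicator good z \<le> (\<integral>\<^sup>+T. F z T \<partial>?\<nu>)" for z
  proof (cases "z \<in> good")
    case True
    then have *: "\<forall>a\<in>{..<2::nat}. (if a = 0 then vec_inner d z z else (\<Sum>v\<in>V. (u z v)\<^sup>2)) \<le> (if a = 0 then 2 * real d else 36 * ?n + 1)"
      unfolding good_def by simp
    have g: "vec_inner d z z \<le> 2 * d" "(\<Sum>v\<in>V. (u z v)\<^sup>2) \<le> 36 * real ?n + 1"
      using bspec[OF *, of 0] bspec[OF *, of 1] by simp_all
    have "K \<le> (\<Prod>v\<in>V. c1 * exp (- (u z v)\<^sup>2))"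
    proof -
      have "(\<Prod>v\<in>V. c1 * exp (- (u z v)\<^sup>2)) = c1 ^ ?n * exp (- (\<Sum>v\<in>V. (u z v)\<^sup>2))"
        using V(1) by (simp add: prod.distrib exp_sum[symmetric] sum_negf)
      moreover have "exp (- (36 * real ?n + 1)) \<le> exp (- (\<Sum>v\<in>V. (u z v)\<^sup>2))" using g(2) by simp
      ultimately show ?thesis unfolding K_def using c1 by (simp add: mult_left_mono)
    qed
    then have "ennreal K \<le> (\<Prod>v\<in>V. ennreal (c1 * exp (- (u z v)\<^sup>2)))"
      using c1 by (subst prod_ennreal) (auto intro: ennreal_leI)
    also have "\<dots> \<le> (\<Prod>v\<in>V. \<integral>\<^sup>+T. indicator {- 1/2..1/2} (T - u z v) \<partial>std_normal_distribution)"
    proof (rule prod_mono_ennreal)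
      fix v assume "v \<in> V"
      have "ennreal (c1 * exp (- (u z v)\<^sup>2)) \<le> emeasure std_normal_distribution {u z v - 1/2..u z v + 1/2}"
        using std_normal_interval_lower[of "u z v"] by (simp add: c1_def)
      also have "\<dots> = (\<integral>\<^sup>+T. indicator {u z v - 1/2..u z v + 1/2} T \<partial>std_normal_distribution)" by simp
      also have "\<dots> = (\<integral>\<^sup>+T. indicator {- 1/2..1/2} (T - u z v) \<partial>std_normal_distribution)"
        by (intro nn_integral_cong) (auto simp: indicator_def)
      finally show "ennreal (c1 * exp (- (u z v)\<^sup>2)) \<le> (\<integral>\<^sup>+T. indicator {- 1/2..1/2} (T - u z v) \<partial>std_normal_distribution)" .
    qed
    also have "\<dots> = (\<integral>\<^sup>+T. (\<Prod>v\<in>V. indicator {- 1/2..1/2} (T v - u z v)) \<partial>?\<nu>)"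
      using V(1) by (intro PV.product_nn_integral_prod[symmetric]) auto
    also have "\<dots> = (\<integral>\<^sup>+T. F z T \<partial>?\<nu>)" using g(1) by (simp add: F_def)
    finally show ?thesis using True by simp
  qed simp
  have goodm: "good \<in> sets (gauss d)"
  proof -
    have e: "{..<2::nat} = {0, 1}" by auto
    have "good = {z \<in> space (gauss d). vec_inner d z z \<le> 2 * d \<and> (\<Sum>v\<in>V. (u z v)\<^sup>2) \<le> 36 * real ?n + 1}"
      unfolding good_def e by auto
    also have "\<dots> \<in> sets (gauss d)" by measurable
    finally show ?thesis .
  qed
  have G1: "(\<lambda>z. F z T) \<in> borel_measurable (gauss d)" if "T \<in> space ?\<nu>" for T
    using Fm[of "\<lambda>z. z" "gauss d" "\<lambda>_. T"] that by simp
  have Fm1: "(\<lambda>(z, T). F z T) \<in> borel_measurable (gauss d \<Otimes>\<^sub>M ?\<nu>)"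
    unfolding case_prod_beta' by (rule Fm) (rule measurable_fst measurable_snd)+
  have Fm2: "(\<lambda>(T, z). F z T) \<in> borel_measurable (?\<nu> \<Otimes>\<^sub>M gauss d)"
    unfolding case_prod_beta' by (rule Fm) (rule measurable_fst measurable_snd)+
  have "ennreal (K * (1 / 4)) \<le> ennreal K * emeasure (gauss d) good"
    using mult_left_mono[OF _ K, of "1 / 4" "G.prob good"] pgood K by (simp only: G.emeasure_eq_measure ennreal_mult[symmetric]) (intro ennreal_leI, auto)
  also have "\<dots> = (\<integral>\<^sup>+z. ennreal K * indicator good z \<partial>gauss d)" using goodm by (simp add: nn_integral_cmult_indicator)
  also have "\<dots> \<le> (\<integral>\<^sup>+z. (\<integral>\<^sup>+T. F z T \<partial>?\<nu>) \<partial>gauss d)" by (intro nn_integral_mono inner)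
  also have "\<dots> = (\<integral>\<^sup>+T. (\<integral>\<^sup>+z. F z T \<partial>gauss d) \<partial>?\<nu>)"
    by (rule GN.Fubini'[symmetric]) (rule Fm1)
  finally have L: "ennreal (K * (1 / 4)) \<le> (\<integral>\<^sup>+T. (\<integral>\<^sup>+z. F z T \<partial>gauss d) \<partial>?\<nu>)" .
  \<comment> \<open>Cauchy-Schwarz against the constant 1 stands for Jensen's inequality; the
    squared inner integral is then read as an integral over two independent vectors with the same
    \<open>T\<close>.\<close>
  have "(ennreal (K * (1 / 4)))\<^sup>2 \<le> (\<integral>\<^sup>+T. (\<integral>\<^sup>+z. F z T \<partial>gauss d) * 1 \<partial>?\<nu>)\<^sup>2"
    unfolding mult_1_right by (rule power_mono[OF L zero_le])
  also have "\<dots> \<le> (\<integral>\<^sup>+T. (\<integral>\<^sup>+z. F z T \<partial>gauss d)\<^sup>2 \<partial>?\<nu>) * (\<integral>\<^sup>+T. 1\<^sup>2 \<partial>?\<nu>)"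
  proof (rule Cauchy_Schwarz_nn_integral)
    show "(\<lambda>T. \<integral>\<^sup>+z. F z T \<partial>gauss d) \<in> borel_measurable ?\<nu>"
      by (rule G.borel_measurable_nn_integral[OF Fm2])
  qed simp
  also have "\<dots> = (\<integral>\<^sup>+T. (\<integral>\<^sup>+z. F z T \<partial>gauss d)\<^sup>2 \<partial>?\<nu>)" by (simp add: N.emeasure_space_1)
  also have "\<dots> = (\<integral>\<^sup>+T. (\<integral>\<^sup>+q. F (fst q) T * F (snd q) T \<partial>(gauss d \<Otimes>\<^sub>M gauss d)) \<partial>?\<nu>)"
  proof (rule nn_integral_cong)
    fix T assume T: "T \<in> space ?\<nu>"
    have m1: "(\<lambda>q. F (fst q) T) \<in> borel_measurable (gauss d \<Otimes>\<^sub>M gauss d)" "(\<lambda>q. F (snd q) T) \<in> borel_measurable (gauss d \<Otimes>\<^sub>M gauss d)"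
      using T Fm[of fst "gauss d \<Otimes>\<^sub>M gauss d" "\<lambda>_. T"] Fm[of snd "gauss d \<Otimes>\<^sub>M gauss d" "\<lambda>_. T"] by auto
    have "(\<integral>\<^sup>+q. F (fst q) T * F (snd q) T \<partial>(gauss d \<Otimes>\<^sub>M gauss d)) = (\<integral>\<^sup>+z. (\<integral>\<^sup>+z'. F z T * F z' T \<partial>gauss d) \<partial>gauss d)"
      using m1 by (subst G.nn_integral_fst[symmetric]) auto
    also have "\<dots> = (\<integral>\<^sup>+z. F z T * (\<integral>\<^sup>+z'. F z' T \<partial>gauss d) \<partial>gauss d)"
      using G1[OF T] by (simp add: nn_integral_cmult)
    also have "\<dots> = (\<integral>\<^sup>+z. F z T \<partial>gauss d)\<^sup>2"
      using G1[OF T] by (simp add: nn_integral_multc power2_eq_square)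
    finally show "(\<integral>\<^sup>+z. F z T \<partial>gauss d)\<^sup>2 = (\<integral>\<^sup>+q. F (fst q) T * F (snd q) T \<partial>(gauss d \<Otimes>\<^sub>M gauss d))" by simp
  qed
  also have "\<dots> = (\<integral>\<^sup>+q. (\<integral>\<^sup>+T. F (fst q) T * F (snd q) T \<partial>?\<nu>) \<partial>(gauss d \<Otimes>\<^sub>M gauss d))"
  proof (rule GGN.Fubini')
    have "(\<lambda>p. F (fst (fst p)) (snd p)) \<in> borel_measurable ((gauss d \<Otimes>\<^sub>M gauss d) \<Otimes>\<^sub>M ?\<nu>)"
      "(\<lambda>p. F (snd (fst p)) (snd p)) \<in> borel_measurable ((gauss d \<Otimes>\<^sub>M gauss d) \<Otimes>\<^sub>M ?\<nu>)"
      by (intro Fm; measurable)+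
    then show "case_prod (\<lambda>q T. F (fst q) T * F (snd q) T) \<in> borel_measurable ((gauss d \<Otimes>\<^sub>M gauss d) \<Otimes>\<^sub>M ?\<nu>)"
      by (simp add: case_prod_beta')
  qed
  also have "\<dots> \<le> (\<integral>\<^sup>+q. indicator S (rotated_difference d q) \<partial>(gauss d \<Otimes>\<^sub>M gauss d))"
  proof (rule nn_integral_mono)
    fix q assume q: "q \<in> space (gauss d \<Otimes>\<^sub>M gauss d)"
    have "(\<integral>\<^sup>+T. F (fst q) T * F (snd q) T \<partial>?\<nu>) \<le> (\<integral>\<^sup>+T. indicator S (rotated_difference d q) \<partial>?\<nu>)"
    proof (rule nn_integral_mono)
      fix T
      show "F (fst q) T * F (snd q) T \<le> indicator S (rotated_difference d q)"
        using inS[OF q, of T] F01[of "fst q" T] F01[of "snd q" T] by (auto simp: indicator_def)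
    qed
    then show "(\<integral>\<^sup>+T. F (fst q) T * F (snd q) T \<partial>?\<nu>) \<le> indicator S (rotated_difference d q)"
      by (simp add: N.emeasure_space_1)
  qed
  also have "\<dots> = (\<integral>\<^sup>+y. indicator S y \<partial>distr (gauss d \<Otimes>\<^sub>M gauss d) (gauss d) (rotated_difference d))"
    by (rule nn_integral_distr[symmetric]) auto
  also have "\<dots> = emeasure (gauss d) S" unfolding distr_rotated_difference by simp
  finally have "ennreal ((K * (1 / 4))\<^sup>2) \<le> ennreal (measure (gauss d) S)"
    using K by (simp add: G.emeasure_eq_measure ennreal_power)
  then have "(K * (1 / 4))\<^sup>2 \<le> measure (gauss d) S" by (subst (asm) ennreal_le_iff) auto
  moreover have "slab_const ^ (card V + 1) \<le> (K * (1 / 4))\<^sup>2"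
  proof -
    have "(c1 * exp (- 37) / 4) ^ (?n + 1) = (c1 * exp (- 37) * (1 / 4)) ^ (?n + 1)" by simp
    also have "\<dots> = c1 ^ (?n + 1) * exp (real (?n + 1) * - 37) * (1 / 4) ^ (?n + 1)"
      by (simp only: power_mult_distrib exp_of_nat_mult)
    also have "\<dots> \<le> c1 ^ ?n * exp (- (36 * real ?n + 1)) * (1 / 4) ^ 1"
    proof (intro mult_mono)
      show "c1 ^ (?n + 1) \<le> c1 ^ ?n" using c1 by (intro power_decreasing) auto
      show "(1 / 4 :: real) ^ (?n + 1) \<le> (1 / 4) ^ 1" by (intro power_decreasing) auto
    qed (use c1 in auto)
    finally have "(c1 * exp (- 37) / 4) ^ (?n + 1) \<le> K * (1 / 4)" by (simp add: K_def)
    then have "((c1 * exp (- 37) / 4) ^ (?n + 1))\<^sup>2 \<le> (K * (1 / 4))\<^sup>2" using c1 by (intro power_mono) auto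
    then show ?thesis unfolding slab_const_def c1_def[symmetric] by (simp only: power_mult[symmetric] mult.commute)
  qed
  ultimately show ?thesis unfolding S_def by linarith
qed

text \<open>Here \<open>H\<close> is a condition on single points, which carries what later steps
  must know about earlier ones, and \<open>R\<close> one on pairs. Integrating out the newest point
  first, each admissible configuration leaves it probability at least \<open>q\<close>, whatever the
  other points are.\<close>

lemma sequential_lower_bound:
  fixes I :: "'i set"
  assumes M: "prob_space M" and I: "finite I" and sym: "\<And>x y. R x y \<longleftrightarrow> R y x"
    and H: "{x \<in> space M. H x} \<in> sets M" and R: "{q \<in> space (M \<Otimes>\<^sub>M M). R (fst q) (snd q)} \<in> sets (M \<Otimes>\<^sub>M M)"
    and step: "\<And>J w. \<lbrakk>J \<subseteq> I; card J < card I; w \<in> space (\<Pi>\<^sub>M i\<in>J. M); \<forall>i\<in>J. H (w i); \<forall>i\<in>J. \<forall>j\<in>J. i \<noteq> j \<longrightarrow> R (w i) (w j)\<rbrakk>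
      \<Longrightarrow> q \<le> measure M {x \<in> space M. H x \<and> (\<forall>i\<in>J. R (w i) x)}"
    and q: "0 \<le> q"
  shows "q ^ card I \<le> measure (\<Pi>\<^sub>M i\<in>I. M) {w \<in> space (\<Pi>\<^sub>M i\<in>I. M). (\<forall>i\<in>I. H (w i)) \<and> (\<forall>i\<in>I. \<forall>j\<in>I. i \<noteq> j \<longrightarrow> R (w i) (w j))}"
proof -
  interpret M: prob_space M by fact
  interpret P: product_sigma_finite "\<lambda>_. M" by unfold_locales
  define E where "E K = {w \<in> space (\<Pi>\<^sub>M i\<in>K. M). (\<forall>i\<in>K. H (w i)) \<and> (\<forall>i\<in>K. \<forall>j\<in>K. i \<noteq> j \<longrightarrow> R (w i) (w j))}" for K :: "'i set"
  have Em: "E K \<in> sets (\<Pi>\<^sub>M i\<in>K. M)" if K: "finite K" for K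
  proof -
    have 1: "{w \<in> space (\<Pi>\<^sub>M i\<in>K. M). H (w i)} \<in> sets (\<Pi>\<^sub>M i\<in>K. M)" if "i \<in> K" for i
    proof -
      have "{w \<in> space (\<Pi>\<^sub>M i\<in>K. M). H (w i)} = (\<lambda>w. w i) -` {x \<in> space M. H x} \<inter> space (\<Pi>\<^sub>M i\<in>K. M)"
        using measurable_space[OF measurable_component_singleton[OF that, of "\<lambda>_. M"]] by blast
      then show ?thesis using measurable_sets[OF measurable_component_singleton[OF that, of "\<lambda>_. M"] H] by simp
    qed
    have 2: "{w \<in> space (\<Pi>\<^sub>M i\<in>K. M). i \<noteq> j \<longrightarrow> R (w i) (w j)} \<in> sets (\<Pi>\<^sub>M i\<in>K. M)" if "i \<in> K" "j \<in> K" for i j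
    proof (cases "i = j")
      case False
      have m: "(\<lambda>w. (w i, w j)) \<in> (\<Pi>\<^sub>M i\<in>K. M) \<rightarrow>\<^sub>M M \<Otimes>\<^sub>M M" using that by measurable
      have "{w \<in> space (\<Pi>\<^sub>M i\<in>K. M). i \<noteq> j \<longrightarrow> R (w i) (w j)} = (\<lambda>w. (w i, w j)) -` {q \<in> space (M \<Otimes>\<^sub>M M). R (fst q) (snd q)} \<inter> space (\<Pi>\<^sub>M i\<in>K. M)"
        using False measurable_space[OF m] by auto
      then show ?thesis using measurable_sets[OF m R] by simp
    qed simp
    have "{w \<in> space (\<Pi>\<^sub>M i\<in>K. M). \<forall>i\<in>K. H (w i)} \<in> sets (\<Pi>\<^sub>M i\<in>K. M)"
      by (rule sets.sets_Collect_finite_All[OF 1 K])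
    moreover have "{w \<in> space (\<Pi>\<^sub>M i\<in>K. M). \<forall>i\<in>K. \<forall>j\<in>K. i \<noteq> j \<longrightarrow> R (w i) (w j)} \<in> sets (\<Pi>\<^sub>M i\<in>K. M)"
      by (rule sets.sets_Collect_finite_All[OF sets.sets_Collect_finite_All[OF 2 K] K])
    ultimately show ?thesis unfolding E_def by (intro sets.sets_Collect_conj)
  qed
  have "K \<subseteq> I \<Longrightarrow> ennreal (q ^ card K) \<le> emeasure (\<Pi>\<^sub>M i\<in>K. M) (E K)" if "finite K" for K
    using that
  proof induction
    case empty
    show ?case by (simp add: space_PiM E_def)
  next
    case (insert i K)
    have K: "finite K" "i \<notin> K" "K \<subseteq> I" "i \<in> I" using insert by auto
    have card: "card K < card I" using K I insert.prems by (intro psubset_card_mono) auto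
    have "ennreal (q ^ card (insert i K)) = ennreal (q ^ card K) * ennreal q"
      using K q by (simp add: ennreal_mult[symmetric] mult.commute)
    also have "\<dots> \<le> emeasure (\<Pi>\<^sub>M i\<in>K. M) (E K) * ennreal q"
      using insert by (intro mult_right_mono) auto
    also have "\<dots> = (\<integral>\<^sup>+w. indicator (E K) w * ennreal q \<partial>(\<Pi>\<^sub>M i\<in>K. M))"
      using Em[OF K(1)] by (subst nn_integral_multc) auto
    also have "\<dots> \<le> (\<integral>\<^sup>+w. (\<integral>\<^sup>+x. indicator (E (insert i K)) (w(i := x)) \<partial>M) \<partial>(\<Pi>\<^sub>M i\<in>K. M))"
    proof (rule nn_integral_mono)
      fix w assume w: "w \<in> space (\<Pi>\<^sub>M i\<in>K. M)"
      show "indicator (E K) w * ennreal q \<le> (\<integral>\<^sup>+x. indicator (E (insert i K)) (w(i := x)) \<partial>M)"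
      proof (cases "w \<in> E K")
        case True
        let ?T = "{x \<in> space M. H x \<and> (\<forall>i\<in>K. R (w i) x)}"
        have upd: "w(i := x) \<in> E (insert i K) \<longleftrightarrow> x \<in> ?T" if "x \<in> space M" for x
        proof -
          have "w(i := x) \<in> space (\<Pi>\<^sub>M i\<in>insert i K. M)"
            using w that by (auto simp: space_PiM PiE_iff extensional_def)
          moreover have "(w(i := x)) j = w j" if "j \<in> K" for j using that K by auto
          ultimately show ?thesis using True that K sym by (auto simp: Ball_def E_def)
        qed
        have "(\<lambda>x. w(i := x)) \<in> M \<rightarrow>\<^sub>M (\<Pi>\<^sub>M i\<in>insert i K. M)"
          using w by measurable
        then have vim: "(\<lambda>x. w(i := x)) -` E (insert i K) \<inter> space M \<in> sets M"
          by (rule measurable_sets) (rule Em, use K(1) in simp)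
        have eq: "(\<lambda>x. w(i := x)) -` E (insert i K) \<inter> space M = ?T" using upd by auto
        have T: "?T \<in> sets M" by (rule subst[where P = "\<lambda>A. A \<in> sets M", OF eq vim])
        have hyps: "\<forall>i\<in>K. H (w i)" "\<forall>i\<in>K. \<forall>j\<in>K. i \<noteq> j \<longrightarrow> R (w i) (w j)"
          using True unfolding E_def mem_Collect_eq by - (elim conjE, assumption)+
        have "ennreal q \<le> emeasure M ?T"
          unfolding M.emeasure_eq_measure by (rule ennreal_leI, rule step[OF K(3) card w hyps])
        also have "\<dots> = (\<integral>\<^sup>+x. indicator ?T x \<partial>M)" by (rule nn_integral_indicator[OF T, symmetric])
        also have "\<dots> = (\<integral>\<^sup>+x. indicator (E (insert i K)) (w(i := x)) \<partial>M)"
          by (intro nn_integral_cong) (simp only: indicator_def upd)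
        finally show ?thesis unfolding indicator_eq_1_iff[THEN iffD2, OF True] mult_1_left .
      qed simp
    qed
    also have "\<dots> = (\<integral>\<^sup>+w. indicator (E (insert i K)) w \<partial>(\<Pi>\<^sub>M i\<in>insert i K. M))"
      using K Em[of "insert i K"] by (intro P.product_nn_integral_insert[symmetric] borel_measurable_indicator) simp_all
    also have "\<dots> = emeasure (\<Pi>\<^sub>M i\<in>insert i K. M) (E (insert i K))"
      using K by (intro nn_integral_indicator Em) simp
    finally show ?case .
  qed
  from this[OF I order_refl] have *: "ennreal (q ^ card I) \<le> emeasure (\<Pi>\<^sub>M i\<in>I. M) (E I)" .
  interpret PI: prob_space "\<Pi>\<^sub>M i\<in>I. M" by (intro prob_space_PiM M)
  show ?thesis using * unfolding PI.emeasure_eq_measure E_def by (subst (asm) ennreal_le_iff) simp_all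
qed

lemma vec_inner_scale: "vec_inner d (\<lambda>k. a * x k) (\<lambda>k. b * y k) = a * b * vec_inner d x y"
  by (simp add: vec_inner_def sum_distrib_left mult_ac)

section \<open>Thresholds\<close>

text \<open>By the shift bound, the translates of the hyperplane by multiples of \<open>w\<close> are disjoint sets of measure bounded below.\<close>

lemma gauss_hyperplane_null:
  assumes w: "0 < vec_inner d w w"
  shows "measure (gauss d) {y \<in> space (gauss d). vec_inner d w y = 0} = 0"
proof (rule ccontr)
  interpret G: prob_space "gauss d" by (rule prob_space_gauss)
  define S where "S = {y \<in> space (gauss d). vec_inner d w y = 0}"
  \<comment> \<open>Distinct positive heights keep the translates disjoint, and multiples of
    \<open>w\<close> by at most 1 keep the cost of each shift bounded uniformly in
    \<open>i\<close>.\<close>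
  define T where "T i = {y \<in> space (gauss d). vec_inner d w y = vec_inner d w w / (real i + 1)}" for i :: nat
  define c where "c = exp (- vec_inner d w w / 2) * measure (gauss d) S"
  assume "measure (gauss d) {y \<in> space (gauss d). vec_inner d w y = 0} \<noteq> 0"
  then have c: "0 < c" using measure_nonneg[of "gauss d" S] unfolding c_def S_def by (simp add: less_le)
  have [measurable]: "S \<in> sets (gauss d)" "T i \<in> sets (gauss d)" for i unfolding S_def T_def by measurable
  have Ti: "c \<le> measure (gauss d) (T i)" for i
  proof -
    let ?r = "1 / (real i + 1)"
    let ?m = "\<lambda>k. ?r * w k"
    have mm: "vec_inner d ?m ?m = ?r\<^sup>2 * vec_inner d w w"
      unfolding vec_inner_scale power2_eq_square ..
    have "?r\<^sup>2 \<le> 1" by (simp add: power_le_one divide_le_eq)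
    then have "?r\<^sup>2 * vec_inner d w w \<le> 1 * vec_inner d w w" using w by (intro mult_right_mono) auto
    then have "c \<le> exp (- vec_inner d ?m ?m / 2) * measure (gauss d) S"
      unfolding c_def mm by (intro mult_right_mono) auto
    also have "\<dots> \<le> measure (gauss d) (T i)"
    proof (rule gauss_symmetric_shift)
      fix y assume y: "y \<in> S"
      then show "(\<lambda>k\<in>{..<d}. - y k) \<in> S" by (auto simp: S_def space_PiM vec_inner_uminus)
      have "vec_inner d w (\<lambda>k\<in>{..<d}. y k + ?m k) = vec_inner d w y + ?r * vec_inner d w w"
        by (simp add: vec_inner_def distrib_left sum.distrib sum_distrib_left algebra_simps)
      then show "(\<lambda>k\<in>{..<d}. y k + ?m k) \<in> T i" using y by (auto simp: S_def T_def space_PiM)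
    qed auto
    finally show ?thesis .
  qed
  obtain N :: nat where N: "1 < real N * c" using reals_Archimedean3[OF c] by blast
  have "disjoint_family_on T {..<N}"
    unfolding disjoint_family_on_def T_def using w by auto
  then have "measure (gauss d) (\<Union>i\<in>{..<N}. T i) = (\<Sum>i<N. measure (gauss d) (T i))"
    by (intro G.finite_measure_finite_Union) auto
  moreover have "(\<Sum>i<N. c) \<le> (\<Sum>i<N. measure (gauss d) (T i))" by (intro sum_mono Ti)
  ultimately have "real N * c \<le> measure (gauss d) (\<Union>i\<in>{..<N}. T i)" by simp
  with N G.prob_le_1[of "\<Union>i\<in>{..<N}. T i"] show False by linarith
qed

text \<open>The equality case of Cauchy-Schwarz: with \<open>a\<close> and \<open>b\<close> the
  norms of \<open>x\<close> and \<open>y\<close>, the squared length of \<open>b x - a y\<close>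
  equals \<open>2 a b\<close> times \<open>a b\<close> minus the inner product, hence is 0.\<close>

lemma vec_cos_ge_1D:
  assumes "1 \<le> vec_cos d x y" "i < d" "j < d"
  shows "x i * y j = x j * y i"
proof -
  let ?a = "sqrt (vec_inner d x x)" and ?b = "sqrt (vec_inner d y y)"
  have a: "0 \<le> ?a" "0 \<le> ?b" using vec_inner_self_nonneg by auto
  have "?a * ?b \<noteq> 0" using assms(1) by (auto simp: vec_cos_def)
  then have ab: "0 < ?a" "0 < ?b" using a by (auto simp: less_le)
  have "?a * ?b \<le> vec_inner d x y" using assms(1) ab by (simp add: vec_cos_def le_divide_eq)
  then have "2 * (?a * ?b) * (?a * ?b) \<le> 2 * (?a * ?b) * vec_inner d x y" using ab by (intro mult_left_mono) auto
  moreover have "(\<Sum>k<d. (b * x k - a * y k)\<^sup>2) = b\<^sup>2 * vec_inner d x x + a\<^sup>2 * vec_inner d y y - 2 * (a * b) * vec_inner d x y" for a b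
    by (simp add: vec_inner_def power2_eq_square algebra_simps sum.distrib sum_subtractf sum_distrib_left)
  moreover have "?a\<^sup>2 = vec_inner d x x" "?b\<^sup>2 = vec_inner d y y" by (simp_all add: vec_inner_self_nonneg)
  ultimately have "(\<Sum>k<d. (?b * x k - ?a * y k)\<^sup>2) \<le> ?b\<^sup>2 * ?a\<^sup>2 + ?a\<^sup>2 * ?b\<^sup>2 - 2 * (?a * ?b) * (?a * ?b)" by simp
  also have "\<dots> = 0" by (simp only: power2_eq_square) (simp add: mult_ac)
  finally have "(\<Sum>k<d. (?b * x k - ?a * y k)\<^sup>2) \<le> 0" .
  then have "(\<Sum>k<d. (?b * x k - ?a * y k)\<^sup>2) = 0" by (intro antisym sum_nonneg) auto
  then have z: "?b * x k = ?a * y k" if "k < d" for k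
    using that by (simp add: sum_nonneg_eq_0_iff)
  have "?b * (x i * y j) = (?b * x i) * y j" by (simp only: mult.assoc)
  also have "\<dots> = (?a * y j) * y i" unfolding z[OF assms(2)] by (simp only: mult_ac)
  also have "\<dots> = ?b * (x j * y i)" unfolding z[OF assms(3), symmetric] by (simp only: mult_ac)
  finally have "?b * (x i * y j) = ?b * (x j * y i)" .
  then show ?thesis using ab by simp
qed

text \<open>For fixed \<open>x\<close>, a parallel \<open>y\<close> lies in the hyperplane given by
  the first two coordinates, which exist because \<open>d \<ge> 2\<close>. That hyperplane is null
  unless \<open>x 0 = 0\<close>, itself a null event.\<close>

lemma prob_gauss_pair_parallel:
  assumes d: "2 \<le> d"
  shows "measure (gauss d \<Otimes>\<^sub>M gauss d) {q \<in> space (gauss d \<Otimes>\<^sub>M gauss d). 1 \<le> vec_cos d (fst q) (snd q)} = 0"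
proof -
  interpret G: prob_space "gauss d" by (rule prob_space_gauss)
  define A where "A = {q \<in> space (gauss d \<Otimes>\<^sub>M gauss d). 1 \<le> vec_cos d (fst q) (snd q)}"
  have Am: "A \<in> sets (gauss d \<Otimes>\<^sub>M gauss d)" unfolding A_def by measurable
  define e where "e k = (if k = 0 then 1 else 0 :: real)" for k :: nat
  have e: "vec_inner d e x = x 0" for x using d by (simp add: vec_inner_def e_def if_distrib[of "\<lambda>z. z * _"] cong: if_cong)
  define Z where "Z = {x \<in> space (gauss d). vec_inner d e x = 0}"
  have Zm: "Z \<in> sets (gauss d)" unfolding Z_def by measurable
  have Z0: "emeasure (gauss d) Z = 0"
    using gauss_hyperplane_null[of d e] by (simp add: Z_def G.emeasure_eq_measure e) (simp add: e_def)
  have "emeasure (gauss d \<Otimes>\<^sub>M gauss d) A = (\<integral>\<^sup>+x. emeasure (gauss d) (Pair x -` A) \<partial>gauss d)"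
    by (rule G.emeasure_pair_measure_alt[OF Am])
  also have "\<dots> \<le> (\<integral>\<^sup>+x. indicator Z x \<partial>gauss d)"
  proof (rule nn_integral_mono)
    fix x assume x: "x \<in> space (gauss d)"
    show "emeasure (gauss d) (Pair x -` A) \<le> indicator Z x"
    proof (cases "x \<in> Z")
      case True
      then show ?thesis by (simp add: G.emeasure_le_1)
    next
      case False
      then have x0: "x 0 \<noteq> 0" using x by (simp add: Z_def e)
      define w where "w k = (if k = 1 then x 0 else if k = 0 then - x 1 else 0)" for k :: nat
      have w: "vec_inner d w y = x 0 * y 1 - x 1 * y 0" for y
      proof -
        have "vec_inner d w y = (\<Sum>k\<in>{0, 1}. w k * y k)"
          unfolding vec_inner_def using d by (intro sum.mono_neutral_right) (auto simp: w_def)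
        then show ?thesis by (simp add: w_def)
      qed
      have "0 < x 0 * x 0" using x0 by (metis not_real_square_gt_zero)
      then have "0 < vec_inner d w w" unfolding w by (simp add: w_def add_pos_nonneg)
      from gauss_hyperplane_null[OF this]
      have "emeasure (gauss d) {y \<in> space (gauss d). vec_inner d w y = 0} = 0" by (simp add: G.emeasure_eq_measure)
      moreover have "emeasure (gauss d) (Pair x -` A) \<le> emeasure (gauss d) {y \<in> space (gauss d). vec_inner d w y = 0}"
      proof (rule emeasure_mono)
        show "Pair x -` A \<subseteq> {y \<in> space (gauss d). vec_inner d w y = 0}"
          using vec_cos_ge_1D[of d x _ 0 1] d by (auto simp: A_def w space_pair_measure)
      qed measurable
      ultimately show ?thesis by simp
    qed
  qed
  also have "\<dots> = 0" using Zm Z0 by simp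
  finally show ?thesis unfolding A_def measure_def by simp
qed

text \<open>The events that the cosine is at least \<open>1 - 1 / (m + 1)\<close> decrease to a null
  event, so for some \<open>m\<close> the probability drops below \<open>p\<close>.\<close>

lemma threshold_less_one:
  assumes d: "2 \<le> d" and p: "0 < p"
  shows "\<exists>\<tau><1. \<forall>t. is_threshold d p t \<longrightarrow> t \<le> \<tau>"
proof -
  interpret G: prob_space "gauss d" by (rule prob_space_gauss)
  interpret GG: pair_prob_space "gauss d" "gauss d" by unfold_locales
  let ?M = "gauss d \<Otimes>\<^sub>M gauss d"
  define A where "A m = {q \<in> space ?M. 1 - 1 / (real m + 1) \<le> vec_cos d (fst q) (snd q)}" for m :: nat
  have Am: "A m \<in> sets ?M" for m unfolding A_def by measurable
  have "decseq A"
  proof (rule decseq_SucI)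
    fix m
    have "1 - 1 / (real m + 1) \<le> 1 - 1 / (real (Suc m) + 1)" by (simp add: frac_le)
    then show "A (Suc m) \<subseteq> A m" unfolding A_def by auto
  qed
  then have "(\<lambda>m. measure ?M (A m)) \<longlonglongrightarrow> measure ?M (\<Inter>m. A m)"
    using Am by (intro GG.finite_Lim_measure_decseq) auto
  moreover have "(\<Inter>m. A m) = {q \<in> space ?M. 1 \<le> vec_cos d (fst q) (snd q)}"
  proof -
    have "1 \<le> c" if h: "\<And>m::nat. 1 - 1 / (real m + 1) \<le> c" for c :: real
    proof (rule ccontr)
      assume "\<not> 1 \<le> c"
      then obtain m where "inverse (real (Suc m)) < 1 - c" using reals_Archimedean[of "1 - c"] by auto
      with h[of m] show False by (simp add: inverse_eq_divide add.commute)
    qed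
    moreover have "1 - 1 / (real m + 1) \<le> c" if "1 \<le> c" for c :: real and m :: nat
    proof -
      have "0 \<le> 1 / (real m + 1)" by simp
      with that show ?thesis by linarith
    qed
    ultimately show ?thesis unfolding A_def by auto
  qed
  ultimately have "(\<lambda>m. measure ?M (A m)) \<longlonglongrightarrow> 0" by (simp only: prob_gauss_pair_parallel[OF d])
  from order_tendstoD(2)[OF this p] obtain m where m: "measure ?M (A m) < p"
    by (auto simp: eventually_sequentially)
  have "t \<le> 1 - 1 / (real m + 1)" if t: "is_threshold d p t" for t
  proof (rule ccontr)
    assume "\<not> t \<le> 1 - 1 / (real m + 1)"
    then have "{q \<in> space ?M. t \<le> vec_cos d (fst q) (snd q)} \<subseteq> A m" unfolding A_def by auto
    from GG.finite_measure_mono[OF this Am] have "p \<le> measure ?M (A m)"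
      using t measure_threshold_gauss[of d p t] d by simp
    with m show False by simp
  qed
  then show ?thesis by (intro exI[of _ "1 - 1 / (real m + 1)"]) simp
qed

text \<open>For a larger threshold, a cosine at least \<open>t\<close> forces one of three events:
  either squared length is below \<open>d / 2\<close>, with probability below \<open>p / 4\<close>
  each for large \<open>d\<close>, or the squared inner product exceeds \<open>2 * d / p\<close>,
  with probability at most \<open>p / 2\<close> by Markov. The 8 is 2 times 4, the 4 from the two
  halved squared lengths.\<close>

lemma threshold_decay:
  assumes p: "0 < p"
  shows "\<exists>D. \<forall>d\<ge>D. \<forall>t. is_threshold d p t \<longrightarrow> t \<le> sqrt (8 / p) / sqrt (real d)"
proof -
  have "sqrt (exp 1 / 3) < (1::real)" using e_less_272 by simp
  then have "(\<lambda>d. (sqrt (exp 1 / 3 :: real)) ^ d) \<longlonglongrightarrow> 0" by (intro LIMSEQ_realpow_zero) auto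
  from order_tendstoD(2)[OF this, of "p / 4"] p obtain D
    where D: "\<And>d. D \<le> d \<Longrightarrow> (sqrt (exp 1 / 3)) ^ d < p / 4" by (auto simp: eventually_sequentially)
  have "t \<le> sqrt (8 / p) / sqrt (real d)" if d: "max 1 D \<le> d" and t: "is_threshold d p t" for d t
  proof (rule ccontr)
    assume "\<not> t \<le> sqrt (8 / p) / sqrt (real d)"
    then have less: "sqrt (8 / p) / sqrt (real d) < t" by (rule not_le_imp_less)
    interpret G: prob_space "gauss d" by (rule prob_space_gauss)
    interpret GG: pair_prob_space "gauss d" "gauss d" by unfold_locales
    let ?M = "gauss d \<Otimes>\<^sub>M gauss d"
    have d1: "1 \<le> d" "D \<le> d" using d by auto
    have t0: "0 < t" using less p d1 by (smt (verit) divide_nonneg_nonneg real_sqrt_ge_zero of_nat_0_le_iff)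
    have tt: "8 / p < t\<^sup>2 * d"
    proof -
      have "sqrt (8 / p) < t * sqrt d" using less d1 pos_divide_less_eq[of "sqrt d" "sqrt (8 / p)" t] by simp
      then have "(sqrt (8 / p))\<^sup>2 < (t * sqrt d)\<^sup>2" using p by (intro power_strict_mono) auto
      then show ?thesis using p by (simp add: power_mult_distrib)
    qed
    define N where "N = {y \<in> space (gauss d). vec_inner d y y < d / 2}"
    have Nm: "N \<in> sets (gauss d)" unfolding N_def by measurable
    have N: "measure (gauss d) N < p / 4"
      using gauss_norm_lower_tail[of d] D[OF d1(2)] unfolding N_def by simp
    define B where "B = {q \<in> space ?M. 2 * d / p < (vec_inner d (fst q) (snd q))\<^sup>2}"
    have Bm: "B \<in> sets ?M" unfolding B_def by measurable
    have B: "measure ?M B \<le> p / 2"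
    proof -
      have "(\<integral>\<^sup>+q. ennreal ((vec_inner d (fst q) (snd q))\<^sup>2) \<partial>?M) = (\<integral>\<^sup>+x. (\<integral>\<^sup>+y. ennreal ((vec_inner d x y)\<^sup>2) \<partial>gauss d) \<partial>gauss d)"
        by (subst G.nn_integral_fst[symmetric]) auto
      also have "\<dots> = ennreal d" by (simp add: nn_integral_gauss_inner_square nn_integral_gauss_norm_square)
      finally have "measure ?M B \<le> d / (2 * d / p)"
        unfolding B_def using p d1 by (intro GG.nn_integral_markov) auto
      then show ?thesis using p d1 by simp
    qed
    have N1: "measure ?M (N \<times> space (gauss d)) = measure (gauss d) N" "measure ?M (space (gauss d) \<times> N) = measure (gauss d) N"
      using Nm by (simp_all add: measure_def G.emeasure_pair_measure_Times G.emeasure_space_1)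
    have "{q \<in> space ?M. t \<le> vec_cos d (fst q) (snd q)} \<subseteq> (N \<times> space (gauss d)) \<union> (space (gauss d) \<times> N) \<union> B"
    proof (rule subsetI, rule ccontr)
      fix q assume q: "q \<in> {q \<in> space ?M. t \<le> vec_cos d (fst q) (snd q)}"
        and nq: "q \<notin> (N \<times> space (gauss d)) \<union> (space (gauss d) \<times> N) \<union> B"
      obtain x y where qxy: "q = (x, y)" by fastforce
      have xy: "x \<in> space (gauss d)" "y \<in> space (gauss d)" and c: "t \<le> vec_cos d x y"
        using q by (auto simp: qxy space_pair_measure)
      have n: "d / 2 \<le> vec_inner d x x" "d / 2 \<le> vec_inner d y y" and nB: "(x, y) \<notin> B"
        using nq xy by (auto simp: qxy N_def)
      have "t * (sqrt (d / 2) * sqrt (d / 2)) \<le> t * (sqrt (vec_inner d x x) * sqrt (vec_inner d y y))"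
        using t0 n by (intro mult_left_mono mult_mono) auto
      also have "\<dots> \<le> vec_inner d x y"
      proof -
        have "0 < sqrt (vec_inner d x x) * sqrt (vec_inner d y y)" using n d1 by simp
        then show ?thesis using c by (simp add: vec_cos_def le_divide_eq)
      qed
      finally have "t * (d / 2) \<le> vec_inner d x y" by simp
      then have "(t * (d / 2))\<^sup>2 \<le> (vec_inner d x y)\<^sup>2" using t0 by (intro power_mono) auto
      moreover have "(8 / p) * (d / 4) < (t\<^sup>2 * d) * (d / 4)" using tt d1 by (intro mult_strict_right_mono) auto
      moreover have "(8 / p) * (d / 4) = 2 * d / p" "(t\<^sup>2 * d) * (d / 4) = (t * (d / 2))\<^sup>2"
        by (simp_all add: power_mult_distrib power2_eq_square)
      ultimately have "2 * d / p < (vec_inner d x y)\<^sup>2" by linarith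
      then show False using nB xy by (auto simp: B_def space_pair_measure)
    qed
    then have "measure ?M {q \<in> space ?M. t \<le> vec_cos d (fst q) (snd q)} \<le> measure ?M ((N \<times> space (gauss d)) \<union> (space (gauss d) \<times> N) \<union> B)"
      using Nm Bm by (intro GG.finite_measure_mono) auto
    also have "\<dots> \<le> measure ?M ((N \<times> space (gauss d)) \<union> (space (gauss d) \<times> N)) + measure ?M B"
      using Nm Bm by (intro measure_Un_le) auto
    also have "\<dots> \<le> measure ?M (N \<times> space (gauss d)) + measure ?M (space (gauss d) \<times> N) + measure ?M B"
      using Nm Bm by (intro add_right_mono measure_Un_le) auto
    also have "\<dots> < p" using N1 N B by simp
    finally show False using t measure_threshold_gauss[of d p t] d1 by simp
  qed
  then show ?thesis by (intro exI[of _ "max 1 D"]) blast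
qed

text \<open>Large dimensions have thresholds at most 1/2 by the decay. The finitely many others each
  have a bound below 1, and the maximum of these is still below 1.\<close>

lemma threshold_uniformly_less_one:
  assumes p: "0 < p"
  shows "\<exists>\<tau><1. 0 \<le> \<tau> \<and> (\<forall>d\<ge>2. \<forall>t. is_threshold d p t \<longrightarrow> t \<le> \<tau>)"
proof -
  obtain D where D: "\<And>d t. D \<le> d \<Longrightarrow> is_threshold d p t \<Longrightarrow> t \<le> sqrt (8 / p) / sqrt (real d)"
    using threshold_decay[OF p] by blast
  obtain D' :: nat where D': "32 / p < real D'" using reals_Archimedean2 by blast
  have large: "t \<le> 1 / 2" if "D \<le> d" "D' \<le> d" "is_threshold d p t" for d t
  proof -
    have "32 / p \<le> d" using D' that(2) by (meson le_less_trans less_imp_le of_nat_le_iff order.strict_trans2)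
    then have "sqrt (8 / p) \<le> sqrt (d / 4)" by (intro real_sqrt_le_mono) simp
    also have "\<dots> = 1 / 2 * sqrt d" by (simp add: real_sqrt_divide)
    finally have "sqrt (8 / p) / sqrt d \<le> 1 / 2" using D' p that(2) by (simp add: divide_le_eq)
    with D[OF that(1,3)] show ?thesis by (rule order.trans)
  qed
  obtain f where f: "\<And>d. 2 \<le> d \<Longrightarrow> f d < 1" "\<And>d t. 2 \<le> d \<Longrightarrow> is_threshold d p t \<Longrightarrow> t \<le> f d"
    using threshold_less_one[OF _ p] by metis
  let ?F = "insert (1 / 2) (f ` {2..D + D'})"
  have fin: "finite ?F" "?F \<noteq> {}" by auto
  have "t \<le> Max ?F" if d: "2 \<le> d" and t: "is_threshold d p t" for d t
  proof (cases "d \<le> D + D'")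
    case True
    then have "f d \<le> Max ?F" using d by (intro Max_ge fin) auto
    then show ?thesis using f(2)[OF d t] by simp
  next
    case False
    then have "t \<le> 1 / 2" using t by (intro large) auto
    also have "\<dots> \<le> Max ?F" by (intro Max_ge fin) auto
    finally show ?thesis .
  qed
  moreover have "Max ?F < 1" using f(1) by (subst Max_less_iff[OF fin]) auto
  moreover have "0 \<le> Max ?F"
  proof -
    have "1 / 2 \<le> Max ?F" by (intro Max_ge fin) auto
    then show ?thesis by simp
  qed
  ultimately show ?thesis by blast
qed

section \<open>The lower bound\<close>

lemma vec_inner_add:
  "vec_inner d (\<lambda>k. a k + b k) (\<lambda>k. e k + f k) = vec_inner d a e + vec_inner d a f + vec_inner d b e + vec_inner d b f"
  by (simp add: vec_inner_def distrib_left distrib_right sum.distrib)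

lemma vec_inner_affine:
  "vec_inner d x (\<lambda>k\<in>{..<d}. y k + m k) = vec_inner d x y + vec_inner d x m"
  by (simp add: vec_inner_def distrib_left sum.distrib)

lemma vec_inner_affine_self:
  "vec_inner d (\<lambda>k\<in>{..<d}. y k + m k) (\<lambda>k\<in>{..<d}. y k + m k) = vec_inner d y y + 2 * vec_inner d m y + vec_inner d m m"
  by (simp add: vec_inner_def distrib_left distrib_right sum.distrib sum_distrib_left mult_ac)

text \<open>Upper bounds on the lengths help only for a positive threshold; otherwise a positive
  inner product suffices.\<close>

lemma le_vec_cos:
  assumes "a \<le> vec_inner d x y" "0 < a" "vec_inner d x x \<le> B" "vec_inner d y y \<le> B" "t * B \<le> a"
  shows "t \<le> vec_cos d x y"
proof (cases "0 < t")
  case True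
  let ?s = "sqrt (vec_inner d x x) * sqrt (vec_inner d y y)"
  have s: "0 < ?s" using assms(1,2) vec_inner_Cauchy_Schwarz[of d x y] by linarith
  have "0 \<le> B" using vec_inner_self_nonneg[of d x] assms(3) by linarith
  have "t * ?s \<le> t * (sqrt B * sqrt B)"
    using True assms(3,4) \<open>0 \<le> B\<close> by (intro mult_left_mono mult_mono) (auto simp: vec_inner_self_nonneg)
  also have "\<dots> = t * B" using \<open>0 \<le> B\<close> by simp
  finally show ?thesis using assms(1,5) s by (simp add: vec_cos_def le_divide_eq)
next
  case False
  have "0 \<le> vec_cos d x y" using assms(1,2) by (simp add: vec_cos_def vec_inner_self_nonneg)
  then show ?thesis using False by simp
qed

lemma complete_event_sequential_lower:
  assumes d: "1 \<le> d" and n: "1 \<le> n" and q: "0 \<le> q"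
    and H: "{x \<in> space (gauss d). H x} \<in> sets (gauss d)"
    and R: "{q \<in> space (gauss d \<Otimes>\<^sub>M gauss d). R (fst q) (snd q)} \<in> sets (gauss d \<Otimes>\<^sub>M gauss d)"
    and sym: "\<And>x y. R x y \<longleftrightarrow> R y x"
    and cos: "\<And>x y. H x \<Longrightarrow> H y \<Longrightarrow> R x y \<Longrightarrow> t \<le> vec_cos d x y"
    and step: "\<And>J w. \<lbrakk>J \<subseteq> {1..n}; finite J; card J < n; \<forall>i\<in>J. H (w i); \<forall>i\<in>J. \<forall>j\<in>J. i \<noteq> j \<longrightarrow> R (w i) (w j)\<rbrakk>
      \<Longrightarrow> q \<le> measure (gauss d) {x \<in> space (gauss d). H x \<and> (\<forall>i\<in>J. R (w i) x)}"
  shows "q ^ n \<le> measure (sphere_sample n d) (complete_event n d t)"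
proof -
  let ?P = "\<Pi>\<^sub>M i\<in>{1..n}. gauss d"
  interpret P: prob_space ?P by (intro prob_space_PiM prob_space_gauss)
  have "q ^ card {1..n} \<le> measure ?P {w \<in> space ?P. (\<forall>i\<in>{1..n}. H (w i)) \<and> (\<forall>i\<in>{1..n}. \<forall>j\<in>{1..n}. i \<noteq> j \<longrightarrow> R (w i) (w j))}"
  proof (rule sequential_lower_bound[OF prob_space_gauss _ sym H R _ q])
    fix J :: "nat set" and w assume J: "J \<subseteq> {1..n}" "card J < card {1..n}" "\<forall>i\<in>J. H (w i)" "\<forall>i\<in>J. \<forall>j\<in>J. i \<noteq> j \<longrightarrow> R (w i) (w j)"
    show "q \<le> measure (gauss d) {x \<in> space (gauss d). H x \<and> (\<forall>i\<in>J. R (w i) x)}"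
      using J finite_subset[OF J(1)] by (intro step) auto
  qed simp
  also have "\<dots> \<le> measure ?P {G \<in> space ?P. \<forall>i\<in>{1..n}. \<forall>j\<in>{1..n}. i \<noteq> j \<longrightarrow> t \<le> vec_cos d (G i) (G j)}"
  proof (rule P.finite_measure_mono)
    show "{w \<in> space ?P. (\<forall>i\<in>{1..n}. H (w i)) \<and> (\<forall>i\<in>{1..n}. \<forall>j\<in>{1..n}. i \<noteq> j \<longrightarrow> R (w i) (w j))}
      \<subseteq> {G \<in> space ?P. \<forall>i\<in>{1..n}. \<forall>j\<in>{1..n}. i \<noteq> j \<longrightarrow> t \<le> vec_cos d (G i) (G j)}"
      by (intro Collect_mono conjI impI ballI) (use cos in blast)+
    show "{G \<in> space ?P. \<forall>i\<in>{1..n}. \<forall>j\<in>{1..n}. i \<noteq> j \<longrightarrow> t \<le> vec_cos d (G i) (G j)} \<in> sets ?P"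
      by measurable
  qed
  finally show ?thesis unfolding measure_complete_event_gauss[OF d n] by simp
qed

lemma prob_gauss_norm_le: "1 \<le> d \<Longrightarrow> 3 / 4 \<le> measure (gauss d) {y \<in> space (gauss d). vec_inner d y y \<le> 4 * d}"
proof -
  assume d: "1 \<le> d"
  interpret G: prob_space "gauss d" by (rule prob_space_gauss)
  have "1 - 1 / 4 \<le> measure (gauss d) {y \<in> space (gauss d). \<forall>i\<in>{0::nat}. vec_inner d y y \<le> 4 * d}"
    using d by (intro G.prob_simultaneous_markov[where b = "\<lambda>_. real d"]) (auto simp: vec_inner_self_nonneg nn_integral_gauss_norm_square)
  then show ?thesis by simp
qed

definition axis :: "real \<Rightarrow> nat \<Rightarrow> real" where "axis s k = (if k = 0 then s else 0)"

lemma vec_inner_axis: "1 \<le> d \<Longrightarrow> vec_inner d (axis s) x = s * x 0"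
  by (simp add: vec_inner_def axis_def if_distrib[of "\<lambda>z. z * _"] cong: if_cong)

text \<open>All points lie in a cap around the first axis, obtained from a shift by a large multiple of \<open>sqrt d\<close>.\<close>

lemma complete_event_lower_cap:
  fixes \<tau> :: real
  assumes \<tau>: "\<tau> < 1"
  shows "\<exists>C>0. \<forall>n\<ge>1. \<forall>d\<ge>1. \<forall>t\<le>\<tau>. exp (- C * (real n * real d)) \<le> measure (sphere_sample n d) (complete_event n d t)"
proof -
  define \<eta> where "\<eta> = min 1 (1 - \<tau>)"
  have \<eta>: "0 < \<eta>" "\<eta> \<le> 1" "\<tau> \<le> 1 - \<eta>" using \<tau> by (auto simp: \<eta>_def)
  \<comment> \<open>In units of \<open>sqrt d\<close>, \<open>k\<close> is the length of the shift
    and 2 bounds that of the noise. Squared lengths are then at most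
    \<open>(k + 2)\<^sup>2 * d\<close> and inner products at least
    \<open>(k\<^sup>2 - 4 * k - 4) * d\<close>; this \<open>k\<close> brings the ratio above
    \<open>1 - \<eta>\<close>.\<close>
  define k where "k = 16 / \<eta>"
  have k: "16 \<le> k" "\<eta> * k = 16" using \<eta> by (auto simp: k_def le_divide_eq)
  have k2: "16 * k \<le> k * k" using k by (intro mult_right_mono) auto
  have kpos: "0 < k\<^sup>2 - 4 * k - 4" using k k2 unfolding power2_eq_square by linarith
  have ktau: "\<tau> * (k + 2)\<^sup>2 \<le> k\<^sup>2 - 4 * k - 4"
  proof -
    have "\<tau> * (k + 2)\<^sup>2 \<le> (1 - \<eta>) * (k + 2)\<^sup>2" using \<eta> by (intro mult_right_mono) auto
    also have "\<dots> = (k + 2)\<^sup>2 - (\<eta> * k) * k - 4 * (\<eta> * k) - 4 * \<eta>" by (simp add: power2_eq_square algebra_simps)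
    also have "\<dots> = (k + 2)\<^sup>2 - 16 * k - 4 * 16 - 4 * \<eta>" by (simp only: k(2))
    also have "\<dots> \<le> k\<^sup>2 - 4 * k - 4" using k(1) \<eta>(1) unfolding power2_sum by simp
    finally show ?thesis .
  qed
  define C where "C = k\<^sup>2 / 2 + 1"
  have "exp (- C * (real n * real d)) \<le> measure (sphere_sample n d) (complete_event n d t)"
    if n: "1 \<le> n" and d: "1 \<le> d" and t: "t \<le> \<tau>" for n d t
  proof -
    interpret G: prob_space "gauss d" by (rule prob_space_gauss)
    define K where "K = k * sqrt d"
    have K0: "0 < K" using k d by (simp add: K_def)
    define m where "m = axis K"
    have mm: "vec_inner d m m = K\<^sup>2" using d by (simp add: m_def vec_inner_axis) (simp add: axis_def power2_eq_square)
    have KK: "K\<^sup>2 = k\<^sup>2 * d" by (simp add: K_def power_mult_distrib)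
    define u where "u x = (\<lambda>k. x k - m k)" for x :: "nat \<Rightarrow> real"
    have inner_m: "\<bar>vec_inner d m v\<bar> \<le> 2 * k * d" if v: "vec_inner d v v \<le> 4 * d" for v
    proof -
      have "sqrt (vec_inner d v v) \<le> sqrt (4 * d)" using v by simp
      then have "K * sqrt (vec_inner d v v) \<le> K * sqrt (4 * d)" using K0 by (intro mult_left_mono) auto
      moreover have "\<bar>vec_inner d m v\<bar> \<le> K * sqrt (vec_inner d v v)"
        using vec_inner_Cauchy_Schwarz[of d m v] K0 unfolding mm by simp
      ultimately have "\<bar>vec_inner d m v\<bar> \<le> K * sqrt (4 * d)" by linarith
      also have "\<dots> = 2 * k * d" by (simp add: K_def real_sqrt_mult)
      finally show ?thesis .
    qed
    define H where "H x \<longleftrightarrow> vec_inner d (u x) (u x) \<le> 4 * d" for x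
    have expand: "vec_inner d x y = K\<^sup>2 + vec_inner d m (u y) + vec_inner d m (u x) + vec_inner d (u x) (u y)" for x y
      using vec_inner_add[of d m "u x" m "u y"] by (simp add: u_def mm vec_inner_commute[of d "\<lambda>k. x k - m k" m])
    have normH: "vec_inner d x x \<le> (k + 2)\<^sup>2 * d" if "H x" for x
      using inner_m[of "u x"] that unfolding H_def expand[of x x] KK by (simp add: power2_eq_square algebra_simps)
    have innerH: "(k\<^sup>2 - 4 * k - 4) * d \<le> vec_inner d x y" if "H x" "H y" for x y
    proof -
      have "sqrt (vec_inner d (u x) (u x)) * sqrt (vec_inner d (u y) (u y)) \<le> sqrt (4 * d) * sqrt (4 * d)"
        using that by (intro mult_mono) (auto simp: H_def vec_inner_self_nonneg)
      then have "\<bar>vec_inner d (u x) (u y)\<bar> \<le> 4 * d" using vec_inner_Cauchy_Schwarz[of d "u x" "u y"] by simp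
      then show ?thesis using inner_m[of "u x"] inner_m[of "u y"] that
        unfolding H_def expand[of x y] KK abs_le_iff by (simp add: algebra_simps)
    qed
    define S where "S = {y \<in> space (gauss d). vec_inner d y y \<le> 4 * d}"
    have Sm: "S \<in> sets (gauss d)" unfolding S_def by measurable
    have uu: "vec_inner d (u x) (u x) = vec_inner d x x - 2 * vec_inner d m x + vec_inner d m m" for x
      by (simp add: u_def vec_inner_def sum_subtractf sum.distrib sum_distrib_left algebra_simps)
    have Hm: "{x \<in> space (gauss d). H x} \<in> sets (gauss d)" unfolding H_def uu by measurable
    define q where "q = exp (- K\<^sup>2 / 2) * (3 / 4)"
    have "q \<le> exp (- vec_inner d m m / 2) * measure (gauss d) S"
      unfolding q_def mm S_def using prob_gauss_norm_le[OF d] by (intro mult_left_mono) auto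
    also have "\<dots> \<le> measure (gauss d) {x \<in> space (gauss d). H x}"
    proof (rule gauss_symmetric_shift[OF Sm _ Hm])
      fix y assume y: "y \<in> S"
      have "vec_inner d (\<lambda>k\<in>{..<d}. - y k) (\<lambda>k\<in>{..<d}. - y k) = vec_inner d y y" by (simp add: vec_inner_def)
      then show "(\<lambda>k\<in>{..<d}. - y k) \<in> S" using y by (auto simp: S_def space_PiM)
      have "vec_inner d (u (\<lambda>k\<in>{..<d}. y k + m k)) (u (\<lambda>k\<in>{..<d}. y k + m k)) = vec_inner d y y"
        by (simp add: vec_inner_def u_def)
      then show "(\<lambda>k\<in>{..<d}. y k + m k) \<in> {x \<in> space (gauss d). H x}" using y by (auto simp: S_def H_def space_PiM)
    qed
    finally have step: "q \<le> measure (gauss d) {x \<in> space (gauss d). H x}" .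
    have "q ^ n \<le> measure (sphere_sample n d) (complete_event n d t)"
    \<comment> \<open>No relation between points is tracked, since membership of both in the cap
      already bounds their cosine.\<close>
    proof (rule complete_event_sequential_lower[where H = H and R = "\<lambda>_ _. True", OF d n _ Hm])
      show "0 \<le> q" by (simp add: q_def)
      show "t \<le> vec_cos d x y" if "H x" "H y" for x y
      proof (rule le_vec_cos[OF innerH[OF that] _ normH[OF that(1)] normH[OF that(2)]])
        have "t * (k + 2)\<^sup>2 \<le> \<tau> * (k + 2)\<^sup>2" using t by (intro mult_right_mono) auto
        then have "(t * (k + 2)\<^sup>2) * d \<le> (k\<^sup>2 - 4 * k - 4) * d" using ktau by (intro mult_right_mono) auto
        then show "t * ((k + 2)\<^sup>2 * d) \<le> (k\<^sup>2 - 4 * k - 4) * d" by (simp add: mult.assoc)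
      qed (use kpos d in simp)
    qed (simp_all add: step)
    moreover have "exp (- C * (real n * real d)) \<le> q ^ n"
    proof -
      have "exp (- real d) \<le> exp (- 1)" using d by simp
      also have "\<dots> \<le> (3 / 4 :: real)" using exp_ge_add_one_self[of "1 :: real"] by (simp add: exp_minus inverse_eq_divide divide_le_eq)
      finally have "exp (- K\<^sup>2 / 2) * exp (- real d) \<le> q" unfolding q_def by (intro mult_left_mono) auto
      moreover have "exp (- K\<^sup>2 / 2) * exp (- real d) = exp (- C * d)"
        unfolding mult_exp_exp KK C_def by (rule arg_cong[of _ _ exp]) (simp add: algebra_simps)
      ultimately have "exp (- C * d) \<le> q" by simp
      then have "exp (- C * d) ^ n \<le> q ^ n" by (intro power_mono) auto
      then show ?thesis by (simp add: exp_of_nat_mult[symmetric] mult_ac)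
    qed
    ultimately show ?thesis by linarith
  qed
  moreover have "0 < C" unfolding C_def by (simp add: add_nonneg_pos)
  ultimately show ?thesis by blast
qed

lemma vec_inner_uminus_self: "vec_inner d (\<lambda>k\<in>{..<d}. - y k) (\<lambda>k\<in>{..<d}. - y k) = vec_inner d y y"
  by (simp add: vec_inner_def)

lemma sets_gauss_slab:
  assumes "finite V"
  shows "{y \<in> space (gauss d). vec_inner d y y \<le> c \<and> (\<forall>v\<in>V. \<bar>vec_inner d v y\<bar> \<le> b)} \<in> sets (gauss d)"
proof (intro sets.sets_Collect_conj)
  show "{y \<in> space (gauss d). \<forall>v\<in>V. \<bar>vec_inner d v y\<bar> \<le> b} \<in> sets (gauss d)"
    using assms by (intro sets.sets_Collect_finite_All) auto
  show "{y \<in> space (gauss d). vec_inner d y y \<le> c} \<in> sets (gauss d)" by measurable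
qed

text \<open>A shift by \<open>s\<close> along the first axis gives every pair an inner product of about \<open>s\<^sup>2\<close>; the set \<open>V\<close> collects the
  previously chosen points, whose inner products with the noise must not spoil this.\<close>

lemma complete_event_lower_tilt:
  fixes s t \<gamma> :: real
  assumes d: "1 \<le> d" and n: "1 \<le> n" and s: "0 < s" "s\<^sup>2 \<le> d" and t: "36 * t * d \<le> s\<^sup>2" and \<gamma>: "0 \<le> \<gamma>"
    and slab: "\<And>V. \<lbrakk>finite V; card V \<le> n; \<forall>v\<in>V. vec_inner d v v \<le> 9 * real d\<rbrakk>
      \<Longrightarrow> \<gamma> \<le> measure (gauss d) {y \<in> space (gauss d). vec_inner d y y \<le> 4 * real d \<and> (\<forall>v\<in>V. \<bar>vec_inner d v y\<bar> \<le> s\<^sup>2 / 4)}"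
  shows "(exp (- s\<^sup>2 / 2) * \<gamma>) ^ n \<le> measure (sphere_sample n d) (complete_event n d t)"
proof -
  define m where "m = axis s"
  have mm: "vec_inner d m m = s\<^sup>2" using d by (simp add: m_def vec_inner_axis) (simp add: axis_def power2_eq_square)
  \<comment> \<open>Noise takes at most \<open>s\<^sup>2 / 4\<close> from the product
    \<open>s\<^sup>2\<close> with the axis, so \<open>s\<^sup>2 / 2\<close> is safe; a second loss
    of \<open>s\<^sup>2 / 4\<close>, against an earlier point, leaves \<open>s\<^sup>2 / 4\<close>
    for the pair. Squared lengths stay within \<open>4 * d + s\<^sup>2 / 2 + s\<^sup>2\<close>,
    below \<open>9 * d\<close>. The 36 in the hypothesis on \<open>t\<close> is
    \<open>4 * 9\<close>.\<close>
  define H where "H x \<longleftrightarrow> vec_inner d x x \<le> 9 * real d \<and> s\<^sup>2 / 2 \<le> vec_inner d m x" for x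
  have Hm: "{x \<in> space (gauss d). H x} \<in> sets (gauss d)" unfolding H_def by measurable
  show ?thesis
  proof (rule complete_event_sequential_lower[where H = H and R = "\<lambda>x y. s\<^sup>2 / 4 \<le> vec_inner d x y", OF d n _ Hm])
    show "0 \<le> exp (- s\<^sup>2 / 2) * \<gamma>" using \<gamma> by simp
    show "{q \<in> space (gauss d \<Otimes>\<^sub>M gauss d). s\<^sup>2 / 4 \<le> vec_inner d (fst q) (snd q)} \<in> sets (gauss d \<Otimes>\<^sub>M gauss d)"
      by measurable
    show "s\<^sup>2 / 4 \<le> vec_inner d x y \<longleftrightarrow> s\<^sup>2 / 4 \<le> vec_inner d y x" for x y by (simp only: vec_inner_commute)
    show "t \<le> vec_cos d x y" if "H x" "H y" "s\<^sup>2 / 4 \<le> vec_inner d x y" for x y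
      using that s t by (intro le_vec_cos[OF that(3), of "9 * real d"]) (auto simp: H_def)
  next
    fix J w assume J: "J \<subseteq> {1..n}" "finite J" "card J < n" and w: "\<forall>i\<in>J. H (w i)"
    \<comment> \<open>The axis is one of the directions in which the noise must be small; since
      \<open>card J < n\<close>, there are still at most \<open>n\<close> of them.\<close>
    define V where "V = insert m (w ` J)"
    have V: "finite V" "\<forall>v\<in>V. vec_inner d v v \<le> 9 * real d"
      using J w s by (auto simp: V_def H_def mm)
    have "card V \<le> Suc (card (w ` J))" unfolding V_def by (rule card_insert_le_m1) auto
    also have "card (w ` J) \<le> card J" using J by (intro card_image_le)
    finally have cV: "card V \<le> n" using J by simp
    define S where "S = {y \<in> space (gauss d). vec_inner d y y \<le> 4 * real d \<and> (\<forall>v\<in>V. \<bar>vec_inner d v y\<bar> \<le> s\<^sup>2 / 4)}"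
    have Sm: "S \<in> sets (gauss d)" unfolding S_def by (rule sets_gauss_slab[OF V(1)])
    have Tm: "{x \<in> space (gauss d). H x \<and> (\<forall>i\<in>J. s\<^sup>2 / 4 \<le> vec_inner d (w i) x)} \<in> sets (gauss d)"
      using J(2) by (intro sets.sets_Collect_conj[OF _ Hm] sets.sets_Collect_finite_All) auto
    have "exp (- s\<^sup>2 / 2) * \<gamma> \<le> exp (- vec_inner d m m / 2) * measure (gauss d) S"
      unfolding mm S_def by (intro mult_left_mono slab[OF V(1) cV V(2)]) auto
    also have "\<dots> \<le> measure (gauss d) {x \<in> space (gauss d). H x \<and> (\<forall>i\<in>J. s\<^sup>2 / 4 \<le> vec_inner d (w i) x)}"
    proof (rule gauss_symmetric_shift[where m = m, OF Sm _ Tm])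
      fix y assume y: "y \<in> S"
      have "(\<lambda>k\<in>{..<d}. - y k) \<in> space (gauss d)" by (simp add: space_PiM)
      with y show "(\<lambda>k\<in>{..<d}. - y k) \<in> S"
        unfolding S_def mem_Collect_eq vec_inner_uminus_self unfolding vec_inner_uminus abs_minus_cancel by blast
      let ?x = "\<lambda>k\<in>{..<d}. y k + m k"
      have ym: "\<bar>vec_inner d m y\<bar> \<le> s\<^sup>2 / 4" and yy: "vec_inner d y y \<le> 4 * real d" using y unfolding S_def V_def by blast+
      have "vec_inner d ?x ?x \<le> 9 * real d"
        unfolding vec_inner_affine_self mm using ym yy s(2) unfolding abs_le_iff by linarith
      moreover have "s\<^sup>2 / 2 \<le> vec_inner d m ?x"
        unfolding vec_inner_affine mm using ym unfolding abs_le_iff by linarith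
      moreover have "s\<^sup>2 / 4 \<le> vec_inner d (w i) ?x" if "i \<in> J" for i
      proof -
        have "\<bar>vec_inner d (w i) y\<bar> \<le> s\<^sup>2 / 4" using y that unfolding S_def V_def by blast
        moreover have "s\<^sup>2 / 2 \<le> vec_inner d (w i) m" using w that unfolding H_def vec_inner_commute[of d "w i" m] by blast
        ultimately show ?thesis unfolding vec_inner_affine abs_le_iff by linarith
      qed
      moreover have "?x \<in> space (gauss d)" by (simp add: space_PiM)
      ultimately show "?x \<in> {x \<in> space (gauss d). H x \<and> (\<forall>i\<in>J. s\<^sup>2 / 4 \<le> vec_inner d (w i) x)}"
        unfolding H_def mem_Collect_eq by blast
    qed
    finally show "exp (- s\<^sup>2 / 2) * \<gamma> \<le> measure (gauss d) {x \<in> space (gauss d). H x \<and> (\<forall>i\<in>J. s\<^sup>2 / 4 \<le> vec_inner d (w i) x)}" .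
  qed
qed

text \<open>A union bound: as \<open>72 = 4 * 2 * 9\<close>, each slab is left with probability at
  most \<open>2 / n ^ 4\<close>, and at most \<open>n\<close> slabs lose 1/4 in total for
  \<open>n \<ge> 2\<close>. The norm bound loses another 1/4.\<close>

lemma gauss_slab_half:
  fixes b :: real
  assumes d: "1 \<le> d" and n: "2 \<le> n" and V: "finite V" "card V \<le> n" "\<forall>v\<in>V. vec_inner d v v \<le> 9 * real d"
    and b: "0 < b" "72 * d * ln n \<le> b\<^sup>2"
  shows "1 / 2 \<le> measure (gauss d) {y \<in> space (gauss d). vec_inner d y y \<le> 4 * real d \<and> (\<forall>v\<in>V. \<bar>vec_inner d v y\<bar> \<le> b)}"
proof -
  interpret G: prob_space "gauss d" by (rule prob_space_gauss)
  define A where "A = {y \<in> space (gauss d). vec_inner d y y \<le> 4 * real d}"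
  define B where "B v = {y \<in> space (gauss d). b < \<bar>vec_inner d v y\<bar>}" for v
  define S where "S = {y \<in> space (gauss d). vec_inner d y y \<le> 4 * real d \<and> (\<forall>v\<in>V. \<bar>vec_inner d v y\<bar> \<le> b)}"
  have Am: "A \<in> sets (gauss d)" and Bm: "B v \<in> sets (gauss d)" for v unfolding A_def B_def by measurable
  have Sm: "S \<in> sets (gauss d)" unfolding S_def by (rule sets_gauss_slab[OF V(1)])
  have Bv: "measure (gauss d) (B v) \<le> 2 / real n ^ 4" if "v \<in> V" for v
  proof -
    have "4 * ln n \<le> b\<^sup>2 / (2 * (9 * real d))" using b d by (simp add: le_divide_eq algebra_simps)
    then have "exp (- b\<^sup>2 / (2 * (9 * real d))) \<le> exp (- (4 * ln n))" by simp
    also have "exp (- (4 * ln n)) = 1 / real n ^ 4"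
    proof -
      have "exp (4 * ln (real n)) = real n ^ 4" using n exp_of_nat_mult[of 4 "ln (real n)"] by simp
      then show ?thesis by (simp add: exp_minus inverse_eq_divide)
    qed
    finally have "2 * exp (- b\<^sup>2 / (2 * (9 * real d))) \<le> 2 / real n ^ 4" by simp
    moreover have "measure (gauss d) (B v) \<le> 2 * exp (- b\<^sup>2 / (2 * (9 * real d)))"
      unfolding B_def using that V(3) d b by (intro gauss_inner_tail) auto
    ultimately show ?thesis by linarith
  qed
  have "measure (gauss d) (\<Union>v\<in>V. B v) \<le> (\<Sum>v\<in>V. measure (gauss d) (B v))"
    using V(1) Bm by (intro G.finite_measure_subadditive_finite) auto
  also have "\<dots> \<le> (\<Sum>v\<in>V. 2 / real n ^ 4)" by (intro sum_mono Bv)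
  also have "\<dots> \<le> real n * (2 / real n ^ 4)" using V(2) by (simp add: mult_right_mono divide_right_mono)
  also have "\<dots> = 2 / real n ^ 3" using n by (simp add: power_numeral_reduce)
  also have "\<dots> \<le> 2 / 2 ^ 3" using n by (intro divide_left_mono power_mono) auto
  finally have U: "measure (gauss d) (\<Union>v\<in>V. B v) \<le> 1 / 4" by simp
  have "A \<subseteq> S \<union> (\<Union>v\<in>V. B v)" unfolding A_def B_def S_def by force
  then have "measure (gauss d) A \<le> measure (gauss d) (S \<union> (\<Union>v\<in>V. B v))"
    using V(1) Sm Bm by (intro G.finite_measure_mono sets.Un sets.finite_UN) auto
  also have "\<dots> \<le> measure (gauss d) S + measure (gauss d) (\<Union>v\<in>V. B v)"
    using V(1) Sm Bm by (intro measure_Un_le sets.finite_UN) auto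
  finally show ?thesis using U prob_gauss_norm_le[OF d] unfolding S_def A_def of_nat_mult by simp
qed

text \<open>The tilt with \<open>s\<^sup>2 = A * sqrt (d * ln n)\<close>, where the union bound
  makes the slabs cost only a factor 1/2. It requires \<open>A\<^sup>2 \<ge> 16 * 72 = 1152\<close>,
  whence 34; \<open>A\<^sup>2 * ln n \<le> d\<close> says \<open>s\<^sup>2 \<le> d\<close>.\<close>

lemma complete_event_lower_log:
  fixes A t :: real
  assumes d: "1 \<le> d" and n: "2 \<le> n" and A: "34 \<le> A" "A\<^sup>2 * ln n \<le> d" and t: "36 * t * d \<le> A * sqrt (d * ln n)"
  shows "(exp (- (A * sqrt (d * ln n)) / 2) * (1 / 2)) ^ n \<le> measure (sphere_sample n d) (complete_event n d t)"
proof -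
  define s where "s = sqrt (A * sqrt (d * ln n))"
  have ln: "0 < ln (real n)" using n by simp
  have A0: "0 < A * sqrt (d * ln n)" using A ln d by simp
  have s: "0 < s" "s\<^sup>2 = A * sqrt (d * ln n)" using A0 by (auto simp: s_def)
  have sd: "s\<^sup>2 \<le> d"
  proof -
    have "(s\<^sup>2)\<^sup>2 = (A\<^sup>2 * ln n) * d" using ln by (simp add: s(2) power_mult_distrib)
    also have "\<dots> \<le> real d * real d" using A by (intro mult_right_mono) auto
    finally show ?thesis unfolding power2_eq_square[of "real d", symmetric] by (rule power2_le_imp_le) simp
  qed
  have "(exp (- s\<^sup>2 / 2) * (1 / 2)) ^ n \<le> measure (sphere_sample n d) (complete_event n d t)"
  proof (rule complete_event_lower_tilt[OF d _ s(1) sd])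
    fix V :: "(nat \<Rightarrow> real) set" assume V: "finite V" "card V \<le> n" "\<forall>v\<in>V. vec_inner d v v \<le> 9 * real d"
    have "1152 \<le> A\<^sup>2" using power_mono[OF A(1), of 2] by simp
    then have "1152 * (d * ln n) \<le> A\<^sup>2 * (d * ln n)" using ln by (intro mult_right_mono) auto
    also have "\<dots> = (s\<^sup>2)\<^sup>2" using ln by (simp add: s(2) power_mult_distrib)
    finally have "72 * d * ln n \<le> (s\<^sup>2 / 4)\<^sup>2" by (simp add: power_divide)
    then show "1 / 2 \<le> measure (gauss d) {y \<in> space (gauss d). vec_inner d y y \<le> 4 * real d \<and> (\<forall>v\<in>V. \<bar>vec_inner d v y\<bar> \<le> s\<^sup>2 / 4)}"
      using s A0 by (intro gauss_slab_half[OF d n V]) auto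
  qed (use n t s in auto)
  then show ?thesis unfolding s(2) .
qed

lemma slab_const: "0 < slab_const" "slab_const \<le> 1"
proof -
  show "0 < slab_const" by (simp add: slab_const_def)
  have "1 \<le> sqrt (2 * pi)" using pi_gt3 by (intro real_le_rsqrt) simp
  moreover have "exp (- 1 / 4) \<le> (1::real)" by simp
  ultimately have "exp (- 1 / 4) \<le> sqrt (2 * pi)" by linarith
  then have "exp (- 1 / 4) / sqrt (2 * pi) \<le> 1" by (simp add: divide_le_eq_1)
  moreover have "exp (- 37) \<le> (1::real)" by simp
  ultimately have "exp (- 1 / 4) / sqrt (2 * pi) * exp (- 37) \<le> 1 * 1" by (intro mult_mono) auto
  moreover define r where "r = exp (- 1 / 4) / sqrt (2 * pi) * exp (- 37)"
  ultimately have "0 \<le> r" "r \<le> 1" by auto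
  then show "slab_const \<le> 1" unfolding slab_const_def r_def[symmetric] by (intro power_le_one) auto
qed

text \<open>The tilt with the smaller \<open>s\<^sup>2 = A * sqrt d\<close>. The slabs then have
  width of order \<open>sqrt d\<close>, and each costs a constant factor, so a point costs
  \<open>exp\<close> of minus the order of \<open>sqrt d + n\<close>. This is of order
  \<open>n\<close> when \<open>n\<close> is at least of order \<open>sqrt d\<close>.\<close>

lemma complete_event_lower_dense:
  fixes A t :: real
  assumes d: "1 \<le> d" and n: "1 \<le> n" and A: "4 \<le> A" "A * sqrt d \<le> d" and t: "36 * t * d \<le> A * sqrt d"
  shows "(exp (- (A * sqrt d) / 2) * slab_const ^ (n + 1)) ^ n \<le> measure (sphere_sample n d) (complete_event n d t)"
proof -
  define s where "s = sqrt (A * sqrt d)"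
  have s: "0 < s" "s\<^sup>2 = A * sqrt d" using A d by (auto simp: s_def)
  have "(exp (- s\<^sup>2 / 2) * slab_const ^ (n + 1)) ^ n \<le> measure (sphere_sample n d) (complete_event n d t)"
  proof (rule complete_event_lower_tilt[OF d n s(1)])
    fix V :: "(nat \<Rightarrow> real) set" assume V: "finite V" "card V \<le> n" "\<forall>v\<in>V. vec_inner d v v \<le> 9 * real d"
    interpret G: prob_space "gauss d" by (rule prob_space_gauss)
    have "slab_const ^ (n + 1) \<le> slab_const ^ (card V + 1)" using V slab_const by (intro power_decreasing) auto
    also have "\<dots> \<le> measure (gauss d) {y \<in> space (gauss d). vec_inner d y y \<le> 4 * real d \<and> (\<forall>v\<in>V. \<bar>vec_inner d v y\<bar> \<le> sqrt d)}"
      using gauss_slab_lower_bound[OF d V(1)] V(3) by simp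
    also have "\<dots> \<le> measure (gauss d) {y \<in> space (gauss d). vec_inner d y y \<le> 4 * real d \<and> (\<forall>v\<in>V. \<bar>vec_inner d v y\<bar> \<le> s\<^sup>2 / 4)}"
    proof (rule G.finite_measure_mono[OF _ sets_gauss_slab[OF V(1)]])
      have "4 * sqrt d \<le> A * sqrt d" using A by (intro mult_right_mono) auto
      then have "sqrt d \<le> s\<^sup>2 / 4" unfolding s(2) by simp
      then show "{y \<in> space (gauss d). vec_inner d y y \<le> 4 * real d \<and> (\<forall>v\<in>V. \<bar>vec_inner d v y\<bar> \<le> sqrt d)}
        \<subseteq> {y \<in> space (gauss d). vec_inner d y y \<le> 4 * real d \<and> (\<forall>v\<in>V. \<bar>vec_inner d v y\<bar> \<le> s\<^sup>2 / 4)}"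
        by (auto intro: order.trans)
    qed
    finally show "slab_const ^ (n + 1) \<le> measure (gauss d) {y \<in> space (gauss d). vec_inner d y y \<le> 4 * real d \<and> (\<forall>v\<in>V. \<bar>vec_inner d v y\<bar> \<le> s\<^sup>2 / 4)}" .
  qed (use A t s slab_const(1) in \<open>auto simp: s(2)\<close>)
  then show ?thesis unfolding s(2) .
qed

lemma vec_inner_sum_scale: "vec_inner d (\<lambda>k. c * (\<Sum>i\<in>J. w i k)) y = c * (\<Sum>i\<in>J. vec_inner d (w i) y)"
proof -
  have "vec_inner d (\<lambda>k. c * (\<Sum>i\<in>J. w i k)) y = (\<Sum>k<d. \<Sum>i\<in>J. c * (w i k * y k))"
    by (simp add: vec_inner_def sum_distrib_left sum_distrib_right mult.assoc)
  also have "\<dots> = (\<Sum>i\<in>J. \<Sum>k<d. c * (w i k * y k))" by (rule sum.swap)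
  finally show ?thesis by (simp add: vec_inner_def sum_distrib_left)
qed

text \<open>Here each point is shifted by a multiple of the sum of the previous ones. The squared length of the shift
  is of order \<open>n\<close>, provided that the inner products chosen so far are also bounded above.\<close>

lemma complete_event_lower_sparse:
  fixes a t A B :: real
  assumes d: "1 \<le> d" and n: "1 \<le> n" and a: "1 \<le> a" and A: "A = 4 * (a + 1)" and B: "B = 2 * (9 * A + 1)"
    and nd: "2 * A * real n \<le> sqrt d" and Bd: "B \<le> sqrt d" and t: "9 * t * sqrt d \<le> a"
    and tail: "(sqrt (exp 1 / 3)) ^ d \<le> slab_const ^ n / 2"
  shows "(exp (- (A * B * real n) / 2) * (slab_const ^ n / 2)) ^ n \<le> measure (sphere_sample n d) (complete_event n d t)"
proof -
  define D where "D = sqrt (real d)"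
  have DD: "D * D = real d" by (simp add: D_def)
  have A8: "8 \<le> A" and B8: "8 \<le> B" using a by (auto simp: A B)
  have D0: "8 \<le> D" "B \<le> D" using Bd B8 by (auto simp: D_def)
  have D8: "8 * D \<le> real d" unfolding DD[symmetric] using D0 by (intro mult_right_mono) auto
  have BD: "B * D \<le> real d" unfolding DD[symmetric] using D0 by (intro mult_right_mono) auto
  \<comment> \<open>The lower bound on the squared length matters: the shift acts on an earlier
    point mainly through that point's own term. The upper bound in \<open>R\<close> keeps the sum of
    all the other terms under control.\<close>
  define H where "H x \<longleftrightarrow> real d / 4 \<le> vec_inner d x x \<and> vec_inner d x x \<le> 9 * real d" for x
  define R where "R x y \<longleftrightarrow> a * D \<le> vec_inner d x y \<and> vec_inner d x y \<le> B * D" for x y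
  have Hm: "{x \<in> space (gauss d). H x} \<in> sets (gauss d)" unfolding H_def by measurable
  have Rm: "{q \<in> space (gauss d \<Otimes>\<^sub>M gauss d). R (fst q) (snd q)} \<in> sets (gauss d \<Otimes>\<^sub>M gauss d)" unfolding R_def by measurable
  show ?thesis
  proof (rule complete_event_sequential_lower[where H = H and R = R, OF d n _ Hm Rm])
    show "0 \<le> exp (- (A * B * real n) / 2) * (slab_const ^ n / 2)" using slab_const by simp
    show "R x y \<longleftrightarrow> R y x" for x y unfolding R_def vec_inner_commute[of d x y] ..
    show "t \<le> vec_cos d x y" if "H x" "H y" "R x y" for x y
    proof (rule le_vec_cos[where B = "9 * real d"])
      have "9 * t * D * D \<le> a * D" using t D0 by (intro mult_right_mono) (auto simp: D_def)
      then show "t * (9 * real d) \<le> a * D" unfolding DD[symmetric] by (simp add: mult_ac)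
      show "0 < a * D" using a D0 by simp
    qed (use that in \<open>auto simp: H_def R_def\<close>)
  next
    fix J w assume J: "J \<subseteq> {1..n}" "finite J" "card J < n" and w: "\<forall>i\<in>J. H (w i)" and r: "\<forall>i\<in>J. \<forall>j\<in>J. i \<noteq> j \<longrightarrow> R (w i) (w j)"
    \<comment> \<open>The own term contributes at least \<open>c * d / 4 = (a + 1) * D\<close>, of
      which noise removes at most \<open>D\<close>. From above, the own term gives
      \<open>9 * A * D\<close>, the others \<open>B / 2 * D\<close> and noise \<open>D\<close>;
      \<open>B\<close> solves \<open>9 * A + B / 2 + 1 = B\<close>, so the bound reproduces
      itself.\<close>
    define c where "c = A / D"
    have cD: "c * D = A" "0 \<le> c" using D0 A8 by (auto simp: c_def)
    have cd: "c * real d = A * D" unfolding DD[symmetric] using cD by simp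
    have Jn: "real (card J) \<le> real n" using J by simp
    define m where "m = (\<lambda>k. c * (\<Sum>i\<in>J. w i k))"
    have my: "vec_inner d m y = c * (\<Sum>i\<in>J. vec_inner d (w i) y)" for y
      unfolding m_def by (rule vec_inner_sum_scale)
    have wm: "A / 4 * D \<le> vec_inner d (w i) m \<and> vec_inner d (w i) m \<le> (9 * A + B / 2) * D" if i: "i \<in> J" for i
    proof -
      have e: "vec_inner d (w i) m = c * (vec_inner d (w i) (w i) + (\<Sum>j\<in>J - {i}. vec_inner d (w j) (w i)))"
        unfolding vec_inner_commute[of d "w i" m] my using J(2) i by (simp add: sum.remove)
      have rj: "0 \<le> vec_inner d (w j) (w i) \<and> vec_inner d (w j) (w i) \<le> B * D" if "j \<in> J - {i}" for j
      proof -
        have "R (w j) (w i)" using r i that by blast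
        moreover have "0 \<le> a * D" using a D0 by simp
        ultimately show ?thesis unfolding R_def by linarith
      qed
      have h: "real d / 4 \<le> vec_inner d (w i) (w i)" "vec_inner d (w i) (w i) \<le> 9 * real d" using w i by (auto simp: H_def)
      have "0 \<le> (\<Sum>j\<in>J - {i}. vec_inner d (w j) (w i))" using rj by (intro sum_nonneg) blast
      then have "c * (real d / 4) \<le> vec_inner d (w i) m" unfolding e using h cD by (intro mult_left_mono) auto
      then have 1: "A / 4 * D \<le> vec_inner d (w i) m" using cd by simp
      have "(\<Sum>j\<in>J - {i}. vec_inner d (w j) (w i)) \<le> (\<Sum>j\<in>J - {i}. B * D)" using rj by (intro sum_mono) blast
      also have "\<dots> = real (card (J - {i})) * (B * D)" by simp
      also have "\<dots> \<le> real n * (B * D)"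
        using card_mono[OF J(2), of "J - {i}"] J(3) B8 D0 by (intro mult_right_mono) auto
      finally have "c * (vec_inner d (w i) (w i) + (\<Sum>j\<in>J - {i}. vec_inner d (w j) (w i))) \<le> c * (9 * real d + real n * (B * D))"
        using h cD by (intro mult_left_mono add_mono) auto
      also have "\<dots> = 9 * (c * real d) + (c * D) * (B * real n)" by (simp add: algebra_simps)
      also have "\<dots> = 9 * A * D + B / 2 * (2 * A * real n)" unfolding cd cD(1) by simp
      also have "\<dots> \<le> 9 * A * D + B / 2 * D" using nd B8 by (intro add_left_mono mult_left_mono) (auto simp: D_def)
      finally show ?thesis using 1 unfolding e by (simp add: algebra_simps)
    qed
    have mm: "0 \<le> vec_inner d m m" "vec_inner d m m \<le> A * B * real n"
    proof -
      show "0 \<le> vec_inner d m m" by (rule vec_inner_self_nonneg)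
      have "(\<Sum>i\<in>J. vec_inner d (w i) m) \<le> (\<Sum>i\<in>J. B * D)"
      proof (rule sum_mono)
        fix i assume "i \<in> J"
        have "(9 * A + B / 2) * D \<le> B * D" using D0 B by (intro mult_right_mono) auto
        with wm[OF \<open>i \<in> J\<close>] show "vec_inner d (w i) m \<le> B * D" by linarith
      qed
      also have "\<dots> = real (card J) * (B * D)" by simp
      also have "\<dots> \<le> real n * (B * D)" using Jn B8 D0 by (intro mult_right_mono) auto
      finally have "vec_inner d m m \<le> c * (real n * (B * D))" unfolding my[of m] using cD by (intro mult_left_mono) auto
      also have "\<dots> = (c * D) * B * real n" by (simp add: mult_ac)
      finally show "vec_inner d m m \<le> A * B * real n" unfolding cD(1) .
    qed
    have mm': "vec_inner d m m \<le> B / 2 * D"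
    proof -
      have "A * B * real n = B / 2 * (2 * A * real n)" by simp
      also have "\<dots> \<le> B / 2 * D" using nd B8 by (intro mult_left_mono) (auto simp: D_def)
      finally show ?thesis using mm by linarith
    qed
    define V where "V = w ` J"
    have V: "finite V" using J by (simp add: V_def)
    have cV: "card V + 1 \<le> n" using card_image_le[OF J(2), of w] J(3) by (simp add: V_def)
    define S0 where "S0 = {y \<in> space (gauss d). vec_inner d y y \<le> 4 * real d \<and> (\<forall>v\<in>V. \<bar>vec_inner d v y\<bar> \<le> D)}"
    define N where "N = {y \<in> space (gauss d). vec_inner d y y < real d / 2}"
    define S where "S = {y \<in> space (gauss d). real d / 2 \<le> vec_inner d y y \<and> vec_inner d y y \<le> 4 * real d \<and> (\<forall>v\<in>V. \<bar>vec_inner d v y\<bar> \<le> D)}"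
    have S0m: "S0 \<in> sets (gauss d)" unfolding S0_def by (rule sets_gauss_slab[OF V])
    have Nm: "N \<in> sets (gauss d)" unfolding N_def by measurable
    have Seq: "S = S0 - N" unfolding S_def S0_def N_def by (auto simp: not_less)
    have Sm: "S \<in> sets (gauss d)" unfolding Seq using S0m Nm by simp
    \<comment> \<open>The slab estimate does not bound the norm from below. Removing the vectors of
      small norm costs at most half, by the hypothesis \<open>tail\<close>.\<close>
    have S_lower: "slab_const ^ n / 2 \<le> measure (gauss d) S"
    proof -
      interpret G: prob_space "gauss d" by (rule prob_space_gauss)
      have "slab_const ^ n \<le> slab_const ^ (card V + 1)" using cV slab_const by (intro power_decreasing) auto
      also have "\<dots> \<le> measure (gauss d) S0"
      proof -
        have "vec_inner d v v \<le> real (9 * d)" if "v \<in> V" for v using w that by (auto simp: V_def H_def)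
        from gauss_slab_lower_bound[OF d V this] show ?thesis unfolding S0_def D_def by simp
      qed
      also have "\<dots> \<le> measure (gauss d) (S \<union> N)" using S0m Nm unfolding Seq by (intro G.finite_measure_mono) auto
      also have "\<dots> \<le> measure (gauss d) S + measure (gauss d) N" using Sm Nm by (rule measure_Un_le)
      also have "measure (gauss d) N \<le> slab_const ^ n / 2"
        using gauss_norm_lower_tail[of d] tail unfolding N_def by linarith
      finally show ?thesis by linarith
    qed
    have Tm: "{x \<in> space (gauss d). H x \<and> (\<forall>i\<in>J. R (w i) x)} \<in> sets (gauss d)"
      using J(2) unfolding R_def by (intro sets.sets_Collect_conj[OF _ Hm] sets.sets_Collect_finite_All) auto
    have "exp (- (A * B * real n) / 2) * (slab_const ^ n / 2) \<le> exp (- vec_inner d m m / 2) * measure (gauss d) S"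
      using mm slab_const by (intro mult_mono S_lower) auto
    also have "\<dots> \<le> measure (gauss d) {x \<in> space (gauss d). H x \<and> (\<forall>i\<in>J. R (w i) x)}"
    proof (rule gauss_symmetric_shift[where m = m, OF Sm _ Tm])
      fix y assume y: "y \<in> S"
      have "(\<lambda>k\<in>{..<d}. - y k) \<in> space (gauss d)" by (simp add: space_PiM)
      with y show "(\<lambda>k\<in>{..<d}. - y k) \<in> S"
        unfolding S_def mem_Collect_eq vec_inner_uminus_self unfolding vec_inner_uminus abs_minus_cancel by blast
      let ?x = "\<lambda>k\<in>{..<d}. y k + m k"
      have x: "?x \<in> space (gauss d)" by (simp add: space_PiM)
      have wy: "- D \<le> vec_inner d (w i) y \<and> vec_inner d (w i) y \<le> D" if "i \<in> J" for i
      proof -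
        have "\<bar>vec_inner d (w i) y\<bar> \<le> D" using y that unfolding S_def V_def by blast
        then show ?thesis unfolding abs_le_iff by linarith
      qed
      have yy: "real d / 2 \<le> vec_inner d y y" "vec_inner d y y \<le> 4 * real d" using y unfolding S_def by blast+
      have my2: "\<bar>vec_inner d m y\<bar> \<le> D / 2"
      proof -
        have "\<bar>\<Sum>i\<in>J. vec_inner d (w i) y\<bar> \<le> (\<Sum>i\<in>J. \<bar>vec_inner d (w i) y\<bar>)" by (rule sum_abs)
        also have "\<dots> \<le> (\<Sum>i\<in>J. D)" by (intro sum_mono abs_leI) (use wy in force)+
        also have "\<dots> = real (card J) * D" by simp
        also have "\<dots> \<le> real n * D" using Jn D0 by (intro mult_right_mono) auto
        finally have "c * \<bar>\<Sum>i\<in>J. vec_inner d (w i) y\<bar> \<le> c * (real n * D)" using cD by (intro mult_left_mono) auto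
        also have "\<dots> = (c * D) * real n" by simp
        also have "\<dots> \<le> D / 2" unfolding cD(1) using nd by (simp add: D_def)
        finally show ?thesis unfolding my abs_mult using cD by simp
      qed
      have xx: "vec_inner d ?x ?x = vec_inner d y y + 2 * vec_inner d m y + vec_inner d m m" by (rule vec_inner_affine_self)
      \<comment> \<open>The cross term is at most \<open>D\<close> in absolute value and
        \<open>D \<le> d / 8\<close>; the shift adds at most \<open>B / 2 * D \<le> d / 2\<close>.
        So the squared length remains between \<open>d / 4\<close> and \<open>9 * d\<close>.\<close>
      have "H ?x" unfolding H_def xx using my2 yy mm mm' D8 BD unfolding abs_le_iff by linarith
      moreover have "R (w i) ?x" if "i \<in> J" for i
      proof -
        have "A / 4 * D = (a + 1) * D" by (simp add: A)
        moreover have "(9 * A + B / 2) * D = (B - 1) * D" by (simp add: B)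
        ultimately show ?thesis using wm[OF that] wy[OF that] unfolding R_def vec_inner_affine by (simp add: algebra_simps)
      qed
      ultimately show "?x \<in> {x \<in> space (gauss d). H x \<and> (\<forall>i\<in>J. R (w i) x)}" using x unfolding mem_Collect_eq by blast
    qed
    finally show "exp (- (A * B * real n) / 2) * (slab_const ^ n / 2) \<le> measure (gauss d) {x \<in> space (gauss d). H x \<and> (\<forall>i\<in>J. R (w i) x)}" .
  qed
qed

text \<open>It suffices to reach each of the three terms up to a constant. The cap always gives
  \<open>n * d\<close>, and for bounded \<open>d\<close> also the others. If \<open>n\<close> is at
  most a small multiple of \<open>sqrt d\<close>, the sparse construction gives
  \<open>n\<^sup>2\<close>, the smaller of the first two terms. Otherwise, while \<open>ln n\<close>
  is at most of order \<open>d\<close>, the dense and the logarithmic tilt give one term each;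
  beyond that \<open>n * d\<close> is dominated by both.\<close>

lemma complete_event_lower_bound:
  fixes p :: real
  assumes p: "0 < p"
  shows "\<exists>C>0. \<forall>n\<ge>2. \<forall>d\<ge>2. \<forall>t. is_threshold d p t \<longrightarrow>
    exp (- C * Min {real n ^ 2, real n * sqrt (real d * ln (real n)), real n * real d})
      \<le> measure (sphere_sample n d) (complete_event n d t)"
proof -
  define T where "T = sqrt (8 / p)"
  have T0: "0 < T" using p by (simp add: T_def)
  obtain D where D: "\<And>d t. D \<le> d \<Longrightarrow> is_threshold d p t \<Longrightarrow> t \<le> T / sqrt (real d)"
    using threshold_decay[OF p] unfolding T_def by blast
  obtain \<tau> where \<tau>: "\<tau> < 1" "\<And>d t. 2 \<le> d \<Longrightarrow> is_threshold d p t \<Longrightarrow> t \<le> \<tau>"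
    using threshold_uniformly_less_one[OF p] by blast
  obtain C1 where C1: "0 < C1" "\<And>n d t. 1 \<le> n \<Longrightarrow> 1 \<le> d \<Longrightarrow> t \<le> \<tau> \<Longrightarrow>
      exp (- C1 * (real n * real d)) \<le> measure (sphere_sample n d) (complete_event n d t)"
    using complete_event_lower_cap[OF \<tau>(1)] by blast
  define A where "A = max 34 (72 * T)"
  have A: "34 \<le> A" "72 * T \<le> A" by (auto simp: A_def)
  define a where "a = max 1 (9 * T)"
  have a: "1 \<le> a" "9 * T \<le> a" by (auto simp: a_def)
  define A' where "A' = 4 * (a + 1)"
  define B where "B = 2 * (9 * A' + 1)"
  have A': "8 \<le> A'" and B: "8 \<le> B" using a by (auto simp: A'_def B_def)
  define l where "l = - ln slab_const"
  have l: "0 \<le> l" "slab_const = exp (- l)" using slab_const by (auto simp: l_def)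
  define \<rho> where "\<rho> = sqrt (exp 1 / 3 :: real)"
  have \<rho>: "0 < \<rho>" "\<rho> < 1" using e_less_272 by (auto simp: \<rho>_def)
  define k where "k = - ln \<rho>"
  have k: "0 < k" "\<rho> = exp (- k)" using \<rho> by (auto simp: k_def)
  \<comment> \<open>Lower bounds asked of \<open>sqrt d\<close>: \<open>A\<close> by the dense tilt,
    \<open>B\<close> by the sparse construction, and \<open>(l + 1) / k\<close> so that the
    small-norm tail lies below the slab probability.\<close>
  define M where "M = A + B + (l + 1) / k"
  have M: "A \<le> M" "B \<le> M" "(l + 1) / k \<le> M" "0 \<le> M"
    using A B l k by (auto simp: M_def)
  obtain D0 :: nat where D0: "M\<^sup>2 < real D0" using reals_Archimedean2 by blast
  define D1 where "D1 = D + D0"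
  define K1 where "K1 = A' * B / 2 + l + 1"
  define K2 where "K2 = A * A' + 2 * l"
  define K3 where "K3 = A / 2 + 1"
  define C where "C = C1 * real D1 + K1 + K2 + K3 + C1 * A + C1 * A\<^sup>2 + C1"
  have nonneg: "0 \<le> C1 * real D1" "0 \<le> K1" "0 \<le> K2" "0 \<le> K3" "0 \<le> C1 * A" "0 \<le> C1 * A\<^sup>2"
    using C1 A A' B l by (auto simp: K1_def K2_def K3_def)
  have C0: "0 < C" using nonneg C1(1) unfolding C_def by linarith
  have "exp (- C * Min {real n ^ 2, real n * sqrt (real d * ln (real n)), real n * real d})
      \<le> measure (sphere_sample n d) (complete_event n d t)"
    if n: "2 \<le> n" and d: "2 \<le> d" and t: "is_threshold d p t" for n d t
  proof -
    define P where "P = measure (sphere_sample n d) (complete_event n d t)"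
    define N where "N = real n"
    define E where "E = real d"
    define L where "L = ln (real n)"
    have N2: "2 \<le> N" and E2: "2 \<le> E" using n d by (auto simp: N_def E_def)
    have L: "2 / 3 \<le> L" "L \<le> N"
    proof -
      have "ln 2 \<le> L" unfolding L_def using n by simp
      then show "2 / 3 \<le> L" using ln2_ge_two_thirds by linarith
      have "0 < real n" using n by simp
      from ln_less_self[OF this] show "L \<le> N" unfolding L_def N_def by (rule less_imp_le)
    qed
    have EL: "1 \<le> sqrt (E * L)"
    proof -
      have "2 * (2 / 3) \<le> E * L" using E2 L by (intro mult_mono) auto
      then show ?thesis by (intro real_le_rsqrt) simp
    qed
    \<comment> \<open>Converts a bound in terms of \<open>Y\<close> into one in terms of
      \<open>X\<close> when the cost \<open>c * Y\<close> is at most \<open>c' * X\<close>;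
      \<open>C\<close> is chosen as a sum so that it exceeds every constant \<open>c'\<close>
      used.\<close>
    have weaken: "exp (- C * X) \<le> P" if "exp (- c * Y) \<le> P" "c * Y \<le> c' * X" "c' \<le> C" "0 \<le> X" for c Y c' X
    proof -
      have "c' * X \<le> C * X" using that by (intro mult_right_mono) auto
      then have "exp (- C * X) \<le> exp (- c * Y)" using that(2) by simp
      then show ?thesis using that(1) by linarith
    qed
    have cap: "exp (- C1 * (N * E)) \<le> P" unfolding P_def N_def E_def
      using n d \<tau>(2)[OF d t] by (intro C1(2)) auto
    have NE: "0 \<le> N * E" "0 \<le> N\<^sup>2" "0 \<le> N * sqrt (E * L)" using N2 E2 L by auto
    have C_ge: "C1 * real D1 \<le> C" "K1 \<le> C" "K2 \<le> C" "K3 \<le> C" "C1 * A \<le> C" "C1 * A\<^sup>2 \<le> C" "C1 \<le> C"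
      using nonneg C1(1) unfolding C_def by linarith+
    have cap3: "exp (- C * (N * E)) \<le> P" using weaken[OF cap order_refl C_ge(7) NE(1)] .
    have main: "exp (- C * N\<^sup>2) \<le> P \<and> exp (- C * (N * sqrt (E * L))) \<le> P"
    proof (cases "d < D1")
      case True
      have "E \<le> real D1" using True by (simp add: E_def)
      then have "N * E \<le> N * real D1" using N2 by (intro mult_left_mono) auto
      then have b: "C1 * (N * E) \<le> C1 * (N * real D1)" by (rule mult_left_mono) (use C1(1) in simp)
      have "C1 * (N * E) \<le> C1 * real D1 * X" if "N \<le> X" for X
        using mult_left_mono[OF that nonneg(1)] b by (simp add: mult_ac)
      moreover have "N \<le> N\<^sup>2" using mult_left_mono[of 1 N N] N2 by (simp add: power2_eq_square)
      moreover have "N \<le> N * sqrt (E * L)" using mult_left_mono[OF EL, of N] N2 by simp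
      ultimately show ?thesis using weaken[OF cap _ C_ge(1)] NE by blast
    next
      case False
      define s where "s = sqrt E"
      have ss: "s * s = E" using E2 by (simp add: s_def)
      have Ms: "M \<le> s"
      proof -
        have "M\<^sup>2 \<le> E" using D0 False by (simp add: D1_def E_def)
        then show ?thesis unfolding s_def by (rule real_le_rsqrt)
      qed
      have s0: "34 \<le> s" using Ms M A by linarith
      have sE: "sqrt (E * L) = s * sqrt L" by (simp add: s_def real_sqrt_mult)
      have sqL: "1 / 2 \<le> sqrt L" using L by (intro real_le_rsqrt) (simp add: power2_eq_square)
      have ts: "t * s \<le> T"
        using D[of d t] t False E2 by (simp add: D1_def s_def E_def le_divide_eq)
      have tE: "36 * t * E \<le> 36 * T * s"
        using mult_right_mono[OF ts, of "36 * s"] s0 unfolding ss[symmetric] by (simp add: mult_ac)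
      show ?thesis
      proof (cases "2 * A' * N \<le> s")
        case True
        \<comment> \<open>The small-norm event has exponent \<open>k * d\<close>, and the slabs cost
          \<open>l * n\<close> with \<open>n \<le> sqrt d\<close> here. The extra 1 pays for the
          factor 1/2 in \<open>tail\<close>.\<close>
        have kd: "l * N + 1 \<le> k * E"
        proof -
          have "N \<le> s" using True mult_right_mono[of 1 "2 * A'" N] A' N2 by linarith
          then have "l * N + 1 \<le> l * s + s" using l s0 by (intro add_mono mult_left_mono) auto
          also have "\<dots> = (l + 1) * s" by (simp add: algebra_simps)
          also have "\<dots> \<le> (k * s) * s"
          proof (rule mult_right_mono)
            have "(l + 1) / k \<le> s" using M Ms by linarith
            then show "l + 1 \<le> k * s" using k by (simp add: divide_le_eq mult.commute)
          qed (use s0 in simp)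
          finally show ?thesis unfolding ss[symmetric] by (simp add: mult_ac)
        qed
        have "\<rho> ^ d = exp (- (k * E))" unfolding k(2) E_def by (simp add: exp_of_nat_mult[symmetric] mult.commute)
        also have "\<dots> \<le> exp (- (l * N) - 1)" using kd by simp
        also have "\<dots> = exp (- (l * N)) * exp (- 1)" by (simp add: exp_diff exp_minus divide_inverse)
        also have "\<dots> \<le> exp (- (l * N)) * (1 / 2)"
          using exp_ge_add_one_self[of "1 :: real"] by (intro mult_left_mono) (auto simp: exp_minus inverse_eq_divide divide_le_eq)
        also have "exp (- (l * N)) = slab_const ^ n" unfolding l(2) N_def by (simp add: exp_of_nat_mult[symmetric] mult.commute)
        finally have tail: "\<rho> ^ d \<le> slab_const ^ n / 2" by simp
        have "(exp (- (A' * B * real n) / 2) * (slab_const ^ n / 2)) ^ n \<le> P"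
          unfolding P_def
        proof (rule complete_event_lower_sparse[OF _ _ a(1) A'_def B_def])
          show "2 * A' * real n \<le> sqrt (real d)" using True by (simp add: s_def N_def E_def)
          show "B \<le> sqrt (real d)" using M Ms by (simp add: s_def E_def)
          show "9 * t * sqrt (real d) \<le> a" using ts a by (simp add: s_def E_def)
          show "sqrt (exp 1 / 3) ^ d \<le> slab_const ^ n / 2" using tail by (simp add: \<rho>_def)
        qed (use n d in auto)
        moreover have "exp (- K1 * N\<^sup>2) \<le> (exp (- (A' * B * real n) / 2) * (slab_const ^ n / 2)) ^ n"
        proof -
          have "1 / 2 \<ge> exp (- 1 :: real)"
            using exp_ge_add_one_self[of "1 :: real"] by (auto simp: exp_minus inverse_eq_divide divide_le_eq)
          also have "exp (- 1) \<ge> exp (- N)" using N2 by simp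
          finally have "slab_const ^ n * exp (- N) \<le> slab_const ^ n * (1 / 2)" using slab_const by (intro mult_left_mono) auto
          then have "exp (- (A' * B * N) / 2) * (exp (- (l * N)) * exp (- N)) \<le> exp (- (A' * B * N) / 2) * (slab_const ^ n / 2)"
            unfolding \<open>exp (- (l * N)) = slab_const ^ n\<close> by (intro mult_left_mono) auto
          moreover have "exp (- (A' * B * N) / 2) * (exp (- (l * N)) * exp (- N)) = exp (- K1 * N)"
            unfolding mult_exp_exp K1_def by (rule arg_cong[of _ _ exp]) (simp add: algebra_simps)
          ultimately have "exp (- K1 * N) \<le> exp (- (A' * B * N) / 2) * (slab_const ^ n / 2)" by (simp only:)
          then have "exp (- K1 * N) ^ n \<le> (exp (- (A' * B * N) / 2) * (slab_const ^ n / 2)) ^ n"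
            by (intro power_mono) auto
          then show ?thesis by (simp add: exp_of_nat_mult[symmetric] N_def power2_eq_square mult_ac)
        qed
        ultimately have P1: "exp (- K1 * N\<^sup>2) \<le> P" by linarith
        \<comment> \<open>In this regime \<open>n\<close> is at most of order \<open>sqrt d\<close>,
          so the quadratic bound just proved covers the second term as well.\<close>
        have "N\<^sup>2 \<le> N * sqrt (E * L)"
        proof -
          have "N * 2 * (1 / 2) \<le> s * sqrt L"
          proof (rule mult_mono[OF _ sqL])
            show "N * 2 \<le> s" using True mult_right_mono[of 2 "2 * A'" N] A' N2 by linarith
          qed (use s0 in auto)
          then show ?thesis unfolding sE power2_eq_square using N2 by (intro mult_left_mono) auto
        qed
        then have "K1 * N\<^sup>2 \<le> K1 * (N * sqrt (E * L))" using nonneg by (intro mult_left_mono) auto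
        then show ?thesis using weaken[OF P1 _ C_ge(2)] NE by blast
      next
        case sN: False
        show ?thesis
        proof (cases "A\<^sup>2 * L \<le> E")
          case True
          have "(exp (- (A * sqrt d) / 2) * slab_const ^ (n + 1)) ^ n \<le> P"
            unfolding P_def
          proof (rule complete_event_lower_dense)
            have "A * s \<le> s * s" using M Ms s0 by (intro mult_right_mono) auto
            then show "A * sqrt d \<le> d" unfolding ss by (simp add: s_def E_def)
            have "36 * T * s \<le> A * s" using A T0 s0 by (intro mult_right_mono) auto
            then show "36 * t * d \<le> A * sqrt d" using tE by (simp add: s_def E_def)
          qed (use n d A in auto)
          moreover have "exp (- K2 * N\<^sup>2) \<le> (exp (- (A * sqrt d) / 2) * slab_const ^ (n + 1)) ^ n"
          proof -
            have "A * s \<le> A * (2 * A' * N)" using sN A by (intro mult_left_mono) auto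
            moreover have "l * (N + 1) \<le> l * (2 * N)" using l N2 by (intro mult_left_mono) auto
            ultimately have "exp (- K2 * N) \<le> exp (- (A * s) / 2 + real (n + 1) * - l)"
              unfolding K2_def by (simp add: N_def algebra_simps)
            also have "\<dots> = exp (- (A * sqrt d) / 2) * slab_const ^ (n + 1)"
              unfolding l(2) exp_add exp_of_nat_mult s_def E_def ..
            finally have "exp (- K2 * N) ^ n \<le> (exp (- (A * sqrt d) / 2) * slab_const ^ (n + 1)) ^ n"
              by (intro power_mono) auto
            then show ?thesis by (simp add: exp_of_nat_mult[symmetric] N_def power2_eq_square mult_ac)
          qed
          ultimately have P2: "exp (- K2 * N\<^sup>2) \<le> P" by linarith
          have "(exp (- (A * sqrt (d * ln n)) / 2) * (1 / 2)) ^ n \<le> P"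
            unfolding P_def
          proof (rule complete_event_lower_log)
            have "36 * T * s \<le> (A * s) * (1 / 2)" using mult_right_mono[OF A(2), of s] s0 by simp
            also have "\<dots> \<le> (A * s) * sqrt L" using sqL A s0 by (intro mult_left_mono) auto
            finally show "36 * t * d \<le> A * sqrt (d * ln n)" using tE sE by (simp add: E_def L_def mult.assoc)
            show "A\<^sup>2 * ln n \<le> d" using True by (simp add: E_def L_def)
          qed (use n d A in auto)
          moreover have "exp (- K3 * (N * sqrt (E * L))) \<le> (exp (- (A * sqrt (d * ln n)) / 2) * (1 / 2)) ^ n"
          proof -
            have "exp (- sqrt (E * L)) \<le> exp (- 1)" using EL by simp
            also have "\<dots> \<le> (1 / 2 :: real)"
              using exp_ge_add_one_self[of "1 :: real"] by (auto simp: exp_minus inverse_eq_divide divide_le_eq)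
            finally have "exp (- (A * sqrt (E * L)) / 2) * exp (- sqrt (E * L)) \<le> exp (- (A * sqrt (E * L)) / 2) * (1 / 2)"
              by (intro mult_left_mono) auto
            moreover have "exp (- (A * sqrt (E * L)) / 2) * exp (- sqrt (E * L)) = exp (- K3 * sqrt (E * L))"
              unfolding mult_exp_exp K3_def by (rule arg_cong[of _ _ exp]) (simp add: algebra_simps)
            ultimately have "exp (- K3 * sqrt (E * L)) \<le> exp (- (A * sqrt (E * L)) / 2) * (1 / 2)" by (simp only:)
            then have "exp (- K3 * sqrt (E * L)) ^ n \<le> (exp (- (A * sqrt (E * L)) / 2) * (1 / 2)) ^ n"
              by (intro power_mono) auto
            moreover have "exp (- K3 * sqrt (E * L)) ^ n = exp (- K3 * (N * sqrt (E * L)))"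
              by (simp add: exp_of_nat_mult[symmetric] N_def mult_ac)
            ultimately show ?thesis by (simp add: E_def L_def)
          qed
          ultimately have P3: "exp (- K3 * (N * sqrt (E * L))) \<le> P" by linarith
          show ?thesis using weaken[OF P2 order_refl C_ge(3) NE(2)] weaken[OF P3 order_refl C_ge(4) NE(3)] by blast
        next
          case False
          \<comment> \<open>Now \<open>d < A\<^sup>2 * ln n\<close>, so \<open>d\<close> is at most
            of order both \<open>n\<close> and \<open>sqrt (d * ln n)\<close>, and the cap alone
            suffices.\<close>
          have "N * E \<le> N * (A\<^sup>2 * N)"
          proof (rule mult_left_mono)
            have "A\<^sup>2 * L \<le> A\<^sup>2 * N" using L by (intro mult_left_mono) auto
            then show "E \<le> A\<^sup>2 * N" using False by linarith
          qed (use N2 in simp)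
          then have "C1 * (N * E) \<le> C1 * (N * (A\<^sup>2 * N))" by (rule mult_left_mono) (use C1(1) in simp)
          then have 1: "C1 * (N * E) \<le> C1 * A\<^sup>2 * N\<^sup>2" by (simp add: power2_eq_square mult_ac)
          have "E \<le> A * sqrt (E * L)"
          proof -
            have "E * E \<le> E * (A\<^sup>2 * L)" using False E2 by (intro mult_left_mono) auto
            then have "sqrt (E * E) \<le> sqrt (A\<^sup>2 * (E * L))" by (intro real_sqrt_le_mono) (simp add: mult_ac)
            then show ?thesis using E2 A unfolding real_sqrt_mult by simp
          qed
          then have "N * E \<le> N * (A * sqrt (E * L))" using N2 by (intro mult_left_mono) auto
          then have "C1 * (N * E) \<le> C1 * (N * (A * sqrt (E * L)))" by (rule mult_left_mono) (use C1(1) in simp)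
          then have 2: "C1 * (N * E) \<le> C1 * A * (N * sqrt (E * L))" by (simp add: mult_ac)
          show ?thesis using weaken[OF cap 1 C_ge(6) NE(2)] weaken[OF cap 2 C_ge(5) NE(3)] by blast
        qed
      qed
    qed
    have "Min {N\<^sup>2, N * sqrt (E * L), N * E} \<in> {N\<^sup>2, N * sqrt (E * L), N * E}" by (rule Min_in) auto
    then have "exp (- C * Min {N\<^sup>2, N * sqrt (E * L), N * E}) \<le> P" using main cap3 by auto
    then show ?thesis unfolding P_def N_def E_def L_def .
  qed
  then show ?thesis using C0 by blast
qed

theorem theorem2p1:
  fixes p :: real
  assumes "0 < p" and "p \<le> 1 / 2"
  shows "(\<exists>C>0. \<forall>n\<ge>2. \<forall>d\<ge>2. \<forall>t. is_threshold d p t \<longrightarrow>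
            measure (sphere_sample n d) (complete_event n d t)
              \<ge> exp (- C * Min {real n ^ 2, real n * sqrt (real d * ln (real n)), real n * real d}))
       \<and> (\<exists>c>0. \<exists>\<epsilon> :: nat \<Rightarrow> real. \<epsilon> \<longlonglongrightarrow> 0 \<and>
            (\<forall>n\<ge>2. \<forall>d\<ge>2. \<forall>t. is_threshold d p t \<longrightarrow>
            measure (sphere_sample n d) (complete_event n d t)
              \<le> exp (- c * Min {real n ^ 2,
                    real n * sqrt (real d * ln (max (real n powr (1 - \<epsilon> n) / real d powr (3 / 4)) (exp 1))),
                    real n * real d})))"
proof (rule conjI)
  show "\<exists>C>0. \<forall>n\<ge>2. \<forall>d\<ge>2. \<forall>t. is_threshold d p t \<longrightarrow>
      measure (sphere_sample n d) (complete_event n d t)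
        \<ge> exp (- C * Min {real n ^ 2, real n * sqrt (real d * ln (real n)), real n * real d})"
    by (rule complete_event_lower_bound[OF assms(1)])
  obtain c where c: "c > 0" "\<And>n d t. 2 \<le> n \<Longrightarrow> 2 \<le> d \<Longrightarrow> is_threshold d p t \<Longrightarrow>
      measure (sphere_sample n d) (complete_event n d t)
        \<le> exp (- c * Min {real n ^ 2, real n * sqrt (real d * ln (max (real n / real d powr (3 / 4)) (exp 1))), real n * real d})"
    using complete_event_upper_bound assms(2) by blast
  show "\<exists>c>0. \<exists>\<epsilon> :: nat \<Rightarrow> real. \<epsilon> \<longlonglongrightarrow> 0 \<and>
      (\<forall>n\<ge>2. \<forall>d\<ge>2. \<forall>t. is_threshold d p t \<longrightarrow>
      measure (sphere_sample n d) (complete_event n d t)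
        \<le> exp (- c * Min {real n ^ 2,
              real n * sqrt (real d * ln (max (real n powr (1 - \<epsilon> n) / real d powr (3 / 4)) (exp 1))),
              real n * real d}))"
    \<comment> \<open>The witness for \<epsilon> is the zero sequence, for which
      \<open>real n powr (1 - 0)\<close> is \<open>real n\<close>.\<close>
    using c by (intro exI[of _ c] conjI exI[of _ "\<lambda>_. 0"]) auto
qed

end
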